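(* Let $K$ be a field, let $\mathcal{C}$ be a small $K$-category and let $\mathcal{I}$ be an idempotent two-sided ideal of $\mathcal{C}$ such that $\mathcal{I}(C,-)$ is projective in $\mathrm{Mod}(\mathcal{C})$ for all $C\in\mathcal{C}$. Put $\mathcal{B}=\mathcal{C}/\mathcal{I}$. Then the canonical projection $\Phi:\mathcal{C}\to\mathcal{B}$ is a homological epimorphism, and there is a long exact sequence $$0\to \mathrm{Hom}_{\mathrm{Mod}(\mathcal{C}^{e})}(\mathcal{C},\mathcal{I})\to H^{0}(\mathcal{C})\to H^{0}(\mathcal{B})\to \mathrm{Ext}^{1}_{\mathrm{Mod}(\mathcal{C}^{e})}(\mathcal{C},\mathcal{I})\to H^{1}(\mathcal{C})\to H^{1}(\mathcal{B})\to \mathrm{Ext}^{2}_{\mathrm{Mod}(\mathcal{C}^{e})}(\mathcal{C},\mathcal{I})\to H^{2}(\mathcal{C})\to H^{2}(\mathcal{B})\to\cdots$$ relating the Hochschild-Mitchell cohomologies of $\mathcal{C}$ and $\mathcal{B}$.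
   Context: A $K$-category is a category whose Hom-sets are $K$-vector spaces with $K$-bilinear composition. $\mathrm{Mod}(\mathcal{C})$ is the abelian category of covariant $K$-linear functors $\mathcal{C}\to\mathrm{Mod}(K)$ ($K$-vector spaces). The tensor product $\mathcal{C}\otimes_K\mathcal{D}$ of $K$-categories has objects the pairs $(C,D)$ and morphism spaces $\mathcal{C}(C,C')\otimes_K\mathcal{D}(D,D')$. The enveloping category is $\mathcal{C}^{e}=\mathcal{C}^{op}\otimes_K\mathcal{C}$; the Hom bifunctor $\mathcal{C}(-,-)$ is regarded as an object $\mathcal{C}$ of $\mathrm{Mod}(\mathcal{C}^{e})$. The Hochschild-Mitchell cohomology is $H^{n}(\mathcal{C}):=\mathrm{Ext}^{n}_{\mathrm{Mod}(\mathcal{C}^{e})}(\mathcal{C},\mathcal{C})$. A two-sided ideal $\mathcal{I}$ of $\mathcal{C}$ is a $K$-subfunctor of $\mathcal{C}(-,-)$ (closed under composition with arbitrary morphisms on both sides); thus $\mathcal{I}\in\mathrm{Mod}(\mathcal{C}^e)$ and $\mathcal{I}(C,-)\in\mathrm{Mod}(\mathcal{C})$. It is idempotent if $\mathcal{I}^2=\mathcal{I}$, where $\mathcal{I}^2(X,Y)$ consists of finite sums of compositions $gf$ with $f\in\mathcal{I}(X,Z)$, $g\in\mathcal{I}(Z,Y)$. The quotient category $\mathcal{C}/\mathcal{I}$ has the same objects as $\mathcal{C}$ and morphisms $\mathcal{C}(X,Y)/\mathcal{I}(X,Y)$; the canonical projection $\Phi:\mathcal{C}\to\mathcal{C}/\mathcal{I}$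 is the identity on objects, and $\Phi_*:\mathrm{Mod}(\mathcal{C}/\mathcal{I})\to\mathrm{Mod}(\mathcal{C})$, $F\mapsto F\circ\Phi$, is exact. The ideal $\mathcal{I}$ is strongly idempotent if the canonical maps $\mathrm{Ext}^{i}_{\mathrm{Mod}(\mathcal{C}/\mathcal{I})}(F,F')\to\mathrm{Ext}^{i}_{\mathrm{Mod}(\mathcal{C})}(F\circ\Phi,F'\circ\Phi)$ induced by $\Phi_*$ are isomorphisms for all $F,F'\in\mathrm{Mod}(\mathcal{C}/\mathcal{I})$ and all $i\ge 0$. The projection $\Phi$ is a homological epimorphism if $\mathcal{I}$ is strongly idempotent. *)

theory Defs
  imports "HOL-Algebra.Module" "HOL-Algebra.AbelCoset" "HOL-Library.FSet"
begin

text \<open>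
  Vector spaces over a field \<open>K\<close> are the modules of \<^theory>\<open>HOL-Algebra.Module\<close>. The record
  type \<^typ>\<open>('k, 'v) module\<close> extends the ring records, so it has fields \<open>mult\<close> and \<open>one\<close>;
  these play no role for modules and are left undefined below.
\<close>

section \<open>Linear algebra\<close>

definition lin_maps ::
    "'k ring \<Rightarrow> ('k, 'v) module \<Rightarrow> ('k, 'w) module \<Rightarrow> ('v \<Rightarrow> 'w) set" where
  "lin_maps K V W =
     {T \<in> carrier V \<rightarrow> carrier W.
        (\<forall>x\<in>carrier V. \<forall>y\<in>carrier V. T (x \<oplus>\<^bsub>V\<^esub> y) = T x \<oplus>\<^bsub>W\<^esub> T y) \<and>
        (\<forall>a\<in>carrier K. \<forall>x\<in>carrier V. T (a \<odot>\<^bsub>V\<^esub> x) = a \<odot>\<^bsub>W\<^esub> T x)}"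

definition lin_isos ::
    "'k ring \<Rightarrow> ('k, 'v) module \<Rightarrow> ('k, 'w) module \<Rightarrow> ('v \<Rightarrow> 'w) set" where
  "lin_isos K V W = {T \<in> lin_maps K V W. bij_betw T (carrier V) (carrier W)}"

definition exact_at ::
    "('k, 'u) module \<Rightarrow> ('u \<Rightarrow> 'v) \<Rightarrow> ('k, 'v) module \<Rightarrow> ('v \<Rightarrow> 'w) \<Rightarrow> ('k, 'w) module \<Rightarrow> bool" where
  "exact_at U f V g W \<longleftrightarrow> f ` carrier U = a_kernel V W g"

definition quot_mod :: "('k, 'v) module \<Rightarrow> 'v set \<Rightarrow> ('k, 'v set) module" where
  "quot_mod V W =
     \<lparr>carrier = a_rcosets\<^bsub>V\<^esub> W, mult = undefined, one = undefined,
      zero = W, add = set_add V, smult = (\<lambda>a A. \<Union>x\<in>A. W +>\<^bsub>V\<^esub> (a \<odot>\<^bsub>V\<^esub> x))\<rparr>"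

definition lin_span :: "'k ring \<Rightarrow> ('k, 'v) module \<Rightarrow> 'v set \<Rightarrow> 'v set" where
  "lin_span K V S = \<Inter>{H. submodule H K V \<and> S \<subseteq> H}"

text \<open>The vector space with basis \<open>B\<close>: finitely supported functions on \<open>B\<close>, extended by zero.\<close>

definition free_mod :: "'k ring \<Rightarrow> 'b set \<Rightarrow> ('k, 'b \<Rightarrow> 'k) module" where
  "free_mod K B =
     \<lparr>carrier = {p. (\<forall>b. p b \<in> carrier K) \<and> finite {b. p b \<noteq> \<zero>\<^bsub>K\<^esub>} \<and> {b. p b \<noteq> \<zero>\<^bsub>K\<^esub>} \<subseteq> B},
      mult = undefined, one = undefined,
      zero = (\<lambda>b. \<zero>\<^bsub>K\<^esub>), add = (\<lambda>p q b. p b \<oplus>\<^bsub>K\<^esub> q b), smult = (\<lambda>a p b. a \<otimes>\<^bsub>K\<^esub> p b)\<rparr>"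

definition basis_vec :: "'k ring \<Rightarrow> 'b \<Rightarrow> 'b \<Rightarrow> 'k" where
  "basis_vec K b = (\<lambda>c. if c = b then \<one>\<^bsub>K\<^esub> else \<zero>\<^bsub>K\<^esub>)"

definition lin_ext :: "'k ring \<Rightarrow> ('k, 'v) module \<Rightarrow> ('b \<Rightarrow> 'v) \<Rightarrow> ('b \<Rightarrow> 'k) \<Rightarrow> 'v" where
  "lin_ext K V \<beta> p = (\<Oplus>\<^bsub>V\<^esub> b \<in> {b. p b \<noteq> \<zero>\<^bsub>K\<^esub>}. p b \<odot>\<^bsub>V\<^esub> \<beta> b)"

abbreviation tensor_free ::
    "'k ring \<Rightarrow> ('k, 'v) module \<Rightarrow> ('k, 'w) module \<Rightarrow> ('k, 'v \<times> 'w \<Rightarrow> 'k) module" where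
  "tensor_free K V W \<equiv> free_mod K (carrier V \<times> carrier W)"

definition tensor_rels ::
    "'k ring \<Rightarrow> ('k, 'v) module \<Rightarrow> ('k, 'w) module \<Rightarrow> ('v \<times> 'w \<Rightarrow> 'k) set" where
  "tensor_rels K V W = lin_span K (tensor_free K V W)
     ({basis_vec K (v \<oplus>\<^bsub>V\<^esub> v', w) \<ominus>\<^bsub>tensor_free K V W\<^esub>
         (basis_vec K (v, w) \<oplus>\<^bsub>tensor_free K V W\<^esub> basis_vec K (v', w))
        |v v' w. v \<in> carrier V \<and> v' \<in> carrier V \<and> w \<in> carrier W} \<union>
      {basis_vec K (v, w \<oplus>\<^bsub>W\<^esub> w') \<ominus>\<^bsub>tensor_free K V W\<^esub>
         (basis_vec K (v, w) \<oplus>\<^bsub>tensor_free K V W\<^esub> basis_vec K (v, w'))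
        |v w w'. v \<in> carrier V \<and> w \<in> carrier W \<and> w' \<in> carrier W} \<union>
      {basis_vec K (a \<odot>\<^bsub>V\<^esub> v, w) \<ominus>\<^bsub>tensor_free K V W\<^esub>
         (a \<odot>\<^bsub>tensor_free K V W\<^esub> basis_vec K (v, w))
        |a v w. a \<in> carrier K \<and> v \<in> carrier V \<and> w \<in> carrier W} \<union>
      {basis_vec K (v, a \<odot>\<^bsub>W\<^esub> w) \<ominus>\<^bsub>tensor_free K V W\<^esub>
         (a \<odot>\<^bsub>tensor_free K V W\<^esub> basis_vec K (v, w))
        |a v w. a \<in> carrier K \<and> v \<in> carrier V \<and> w \<in> carrier W})"

definition tensor_mod ::
    "'k ring \<Rightarrow> ('k, 'v) module \<Rightarrow> ('k, 'w) module \<Rightarrow> ('k, ('v \<times> 'w \<Rightarrow> 'k) set) module" where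
  "tensor_mod K V W = quot_mod (tensor_free K V W) (tensor_rels K V W)"


section \<open>\<open>K\<close>-categories\<close>

text \<open>\<open>Comp C X Y Z g f\<close> is the composite \<open>g f\<close> of \<open>f : X \<rightarrow> Y\<close> and \<open>g : Y \<rightarrow> Z\<close>. Hom-sets for
  different pairs of objects are allowed to overlap.\<close>

record ('k, 'o, 'm) kcat =
  Obj :: "'o set"
  Hom :: "'o \<Rightarrow> 'o \<Rightarrow> ('k, 'm) module"
  Comp :: "'o \<Rightarrow> 'o \<Rightarrow> 'o \<Rightarrow> 'm \<Rightarrow> 'm \<Rightarrow> 'm"
  Id :: "'o \<Rightarrow> 'm"

locale k_category =
  fixes K :: "'k ring" and C :: "('k, 'o, 'm) kcat"
  assumes hom_module: "\<lbrakk>X \<in> Obj C; Y \<in> Obj C\<rbrakk> \<Longrightarrow> module K (Hom C X Y)"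
    and id_closed: "X \<in> Obj C \<Longrightarrow> Id C X \<in> carrier (Hom C X X)"
    and comp_linear_left:
      "\<lbrakk>X \<in> Obj C; Y \<in> Obj C; Z \<in> Obj C; f \<in> carrier (Hom C X Y)\<rbrakk> \<Longrightarrow>
       (\<lambda>g. Comp C X Y Z g f) \<in> lin_maps K (Hom C Y Z) (Hom C X Z)"
    and comp_linear_right:
      "\<lbrakk>X \<in> Obj C; Y \<in> Obj C; Z \<in> Obj C; g \<in> carrier (Hom C Y Z)\<rbrakk> \<Longrightarrow>
       (\<lambda>f. Comp C X Y Z g f) \<in> lin_maps K (Hom C X Y) (Hom C X Z)"
    and comp_id_left:
      "\<lbrakk>X \<in> Obj C; Y \<in> Obj C; f \<in> carrier (Hom C X Y)\<rbrakk> \<Longrightarrow> Comp C X Y Y (Id C Y) f = f"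
    and comp_id_right:
      "\<lbrakk>X \<in> Obj C; Y \<in> Obj C; f \<in> carrier (Hom C X Y)\<rbrakk> \<Longrightarrow> Comp C X X Y f (Id C X) = f"
    and comp_assoc:
      "\<lbrakk>W \<in> Obj C; X \<in> Obj C; Y \<in> Obj C; Z \<in> Obj C;
        f \<in> carrier (Hom C W X); g \<in> carrier (Hom C X Y); h \<in> carrier (Hom C Y Z)\<rbrakk> \<Longrightarrow>
       Comp C W Y Z h (Comp C W X Y g f) = Comp C W X Z (Comp C X Y Z h g) f"

definition op_cat :: "('k, 'o, 'm) kcat \<Rightarrow> ('k, 'o, 'm) kcat" where
  "op_cat C = \<lparr>Obj = Obj C, Hom = (\<lambda>X Y. Hom C Y X),
               Comp = (\<lambda>X Y Z g f. Comp C Z Y X f g), Id = Id C\<rparr>"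

text \<open>Composition in the tensor product is the bilinear extension of
  \<open>(g \<otimes> h) (g' \<otimes> h') = g g' \<otimes> h h'\<close>, computed on all representatives of the two classes.\<close>

definition tensor_cat ::
    "'k ring \<Rightarrow> ('k, 'o, 'm) kcat \<Rightarrow> ('k, 'p, 'n) kcat \<Rightarrow>
     ('k, 'o \<times> 'p, ('m \<times> 'n \<Rightarrow> 'k) set) kcat" where
  "tensor_cat K C D =
     \<lparr>Obj = Obj C \<times> Obj D,
      Hom = (\<lambda>(X, Y) (X', Y'). tensor_mod K (Hom C X X') (Hom D Y Y')),
      Comp = (\<lambda>(X, Y) (X', Y') (X'', Y'') A A'.
         let V = Hom C X X''; W = Hom D Y Y''; F = tensor_free K V W
         in \<Union>p\<in>A. \<Union>p'\<in>A'. tensor_rels K V W +>\<^bsub>F\<^esub>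
              lin_ext K F (\<lambda>(g, h).
                lin_ext K F (\<lambda>(g', h').
                  basis_vec K (Comp C X X' X'' g g', Comp D Y Y' Y'' h h')) p') p),
      Id = (\<lambda>(X, Y). tensor_rels K (Hom C X X) (Hom D Y Y)
              +>\<^bsub>tensor_free K (Hom C X X) (Hom D Y Y)\<^esub> basis_vec K (Id C X, Id D Y))\<rparr>"

definition env_cat ::
    "'k ring \<Rightarrow> ('k, 'o, 'm) kcat \<Rightarrow> ('k, 'o \<times> 'o, ('m \<times> 'm \<Rightarrow> 'k) set) kcat" where
  "env_cat K C = tensor_cat K (op_cat C) C"


section \<open>Ideals and quotient categories\<close>

locale two_sided_ideal =
  fixes K :: "'k ring" and C :: "('k, 'o, 'm) kcat" and I :: "'o \<Rightarrow> 'o \<Rightarrow> 'm set"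
  assumes ideal_submodule:
      "\<lbrakk>X \<in> Obj C; Y \<in> Obj C\<rbrakk> \<Longrightarrow> submodule (I X Y) K (Hom C X Y)"
    and ideal_comp_left:
      "\<lbrakk>X \<in> Obj C; Y \<in> Obj C; Z \<in> Obj C; f \<in> I X Y; g \<in> carrier (Hom C Y Z)\<rbrakk> \<Longrightarrow>
       Comp C X Y Z g f \<in> I X Z"
    and ideal_comp_right:
      "\<lbrakk>X \<in> Obj C; Y \<in> Obj C; Z \<in> Obj C; f \<in> carrier (Hom C X Y); g \<in> I Y Z\<rbrakk> \<Longrightarrow>
       Comp C X Y Z g f \<in> I X Z"

text \<open>Finite sums of composites \<open>g f\<close>; the intermediate object may vary with the summand.\<close>

definition ideal_square ::
    "('k, 'o, 'm) kcat \<Rightarrow> ('o \<Rightarrow> 'o \<Rightarrow> 'm set) \<Rightarrow> 'o \<Rightarrow> 'o \<Rightarrow> 'm set" where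
  "ideal_square C I X Y =
     {(\<Oplus>\<^bsub>Hom C X Y\<^esub> i \<in> {..<n}. Comp C X (Z i) Y (g i) (f i)) |(n::nat) Z g f.
        \<forall>i<n. Z i \<in> Obj C \<and> f i \<in> I X (Z i) \<and> g i \<in> I (Z i) Y}"

definition idempotent_ideal :: "('k, 'o, 'm) kcat \<Rightarrow> ('o \<Rightarrow> 'o \<Rightarrow> 'm set) \<Rightarrow> bool" where
  "idempotent_ideal C I \<longleftrightarrow> (\<forall>X\<in>Obj C. \<forall>Y\<in>Obj C. ideal_square C I X Y = I X Y)"

definition quot_cat ::
    "('k, 'o, 'm) kcat \<Rightarrow> ('o \<Rightarrow> 'o \<Rightarrow> 'm set) \<Rightarrow> ('k, 'o, 'm set) kcat" where
  "quot_cat C I =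
     \<lparr>Obj = Obj C,
      Hom = (\<lambda>X Y. quot_mod (Hom C X Y) (I X Y)),
      Comp = (\<lambda>X Y Z G F. \<Union>g\<in>G. \<Union>f\<in>F. I X Z +>\<^bsub>Hom C X Z\<^esub> Comp C X Y Z g f),
      Id = (\<lambda>X. I X X +>\<^bsub>Hom C X X\<^esub> Id C X)\<rparr>"


section \<open>The category of modules over a \<open>K\<close>-category\<close>

text \<open>\<open>Act M X Y f : M(X) \<rightarrow> M(Y)\<close> is the value of the functor \<open>M\<close> at \<open>f : X \<rightarrow> Y\<close>.\<close>

record ('k, 'o, 'm, 'v) cmod =
  On :: "'o \<Rightarrow> ('k, 'v) module"
  Act :: "'o \<Rightarrow> 'o \<Rightarrow> 'm \<Rightarrow> 'v \<Rightarrow> 'v"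

locale c_module =
  fixes K :: "'k ring" and C :: "('k, 'o, 'm) kcat" and M :: "('k, 'o, 'm, 'v) cmod"
  assumes on_module: "X \<in> Obj C \<Longrightarrow> module K (On M X)"
    and act_linear:
      "\<lbrakk>X \<in> Obj C; Y \<in> Obj C; f \<in> carrier (Hom C X Y)\<rbrakk> \<Longrightarrow>
       Act M X Y f \<in> lin_maps K (On M X) (On M Y)"
    and act_linear_hom:
      "\<lbrakk>X \<in> Obj C; Y \<in> Obj C; x \<in> carrier (On M X)\<rbrakk> \<Longrightarrow>
       (\<lambda>f. Act M X Y f x) \<in> lin_maps K (Hom C X Y) (On M Y)"
    and act_id: "\<lbrakk>X \<in> Obj C; x \<in> carrier (On M X)\<rbrakk> \<Longrightarrow> Act M X X (Id C X) x = x"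
    and act_comp:
      "\<lbrakk>X \<in> Obj C; Y \<in> Obj C; Z \<in> Obj C; f \<in> carrier (Hom C X Y); g \<in> carrier (Hom C Y Z);
        x \<in> carrier (On M X)\<rbrakk> \<Longrightarrow>
       Act M X Z (Comp C X Y Z g f) x = Act M Y Z g (Act M X Y f x)"

text \<open>Natural transformations are made extensional (undefined off the objects of \<open>C\<close> and off the
  carriers), so that HOL equality is equality of morphisms in \<open>Mod(C)\<close>.\<close>

definition nat_trans ::
    "'k ring \<Rightarrow> ('k, 'o, 'm) kcat \<Rightarrow> ('k, 'o, 'm, 'v) cmod \<Rightarrow> ('k, 'o, 'm, 'w) cmod \<Rightarrow>
     ('o \<Rightarrow> 'v \<Rightarrow> 'w) set" where
  "nat_trans K C M N =
     {\<eta> \<in> (\<Pi>\<^sub>E X\<in>Obj C. carrier (On M X) \<rightarrow>\<^sub>E carrier (On N X)).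
        (\<forall>X\<in>Obj C. \<eta> X \<in> lin_maps K (On M X) (On N X)) \<and>
        (\<forall>X\<in>Obj C. \<forall>Y\<in>Obj C. \<forall>f\<in>carrier (Hom C X Y). \<forall>x\<in>carrier (On M X).
           \<eta> Y (Act M X Y f x) = Act N X Y f (\<eta> X x))}"

definition nt_comp ::
    "('k, 'o, 'm) kcat \<Rightarrow> ('k, 'o, 'm, 'u) cmod \<Rightarrow> ('o \<Rightarrow> 'v \<Rightarrow> 'w) \<Rightarrow> ('o \<Rightarrow> 'u \<Rightarrow> 'v) \<Rightarrow>
     ('o \<Rightarrow> 'u \<Rightarrow> 'w)" where
  "nt_comp C M \<psi> \<phi> = (\<lambda>X\<in>Obj C. compose (carrier (On M X)) (\<psi> X) (\<phi> X))"

definition Hom_Mod ::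
    "'k ring \<Rightarrow> ('k, 'o, 'm) kcat \<Rightarrow> ('k, 'o, 'm, 'v) cmod \<Rightarrow> ('k, 'o, 'm, 'w) cmod \<Rightarrow>
     ('k, 'o \<Rightarrow> 'v \<Rightarrow> 'w) module" where
  "Hom_Mod K C M N =
     \<lparr>carrier = nat_trans K C M N, mult = undefined, one = undefined,
      zero = (\<lambda>X\<in>Obj C. \<lambda>x\<in>carrier (On M X). \<zero>\<^bsub>On N X\<^esub>),
      add = (\<lambda>\<eta> \<theta>. \<lambda>X\<in>Obj C. \<lambda>x\<in>carrier (On M X). \<eta> X x \<oplus>\<^bsub>On N X\<^esub> \<theta> X x),
      smult = (\<lambda>a \<eta>. \<lambda>X\<in>Obj C. \<lambda>x\<in>carrier (On M X). a \<odot>\<^bsub>On N X\<^esub> \<eta> X x)\<rparr>"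

definition submod :: "('k, 'o, 'm, 'v) cmod \<Rightarrow> ('o \<Rightarrow> 'v set) \<Rightarrow> ('k, 'o, 'm, 'v) cmod" where
  "submod M S = \<lparr>On = (\<lambda>X. (On M X)\<lparr>carrier := S X\<rparr>), Act = Act M\<rparr>"

definition representable :: "('k, 'o, 'm) kcat \<Rightarrow> 'o \<Rightarrow> ('k, 'o, 'm, 'm) cmod" where
  "representable C X = \<lparr>On = (\<lambda>Y. Hom C X Y), Act = (\<lambda>Y Z g h. Comp C X Y Z g h)\<rparr>"

definition ideal_at ::
    "('k, 'o, 'm) kcat \<Rightarrow> ('o \<Rightarrow> 'o \<Rightarrow> 'm set) \<Rightarrow> 'o \<Rightarrow> ('k, 'o, 'm, 'm) cmod" where
  "ideal_at C I X = submod (representable C X) (I X)"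

text \<open>\<open>C\<close> and \<open>I\<close> in \<open>Mod(C\<^sup>e)\<close>. The class of \<open>\<Sum> a\<^sub>i (f\<^sub>i \<otimes> g\<^sub>i)\<close>, where \<open>f\<^sub>i : X' \<rightarrow> X\<close> and
  \<open>g\<^sub>i : Y \<rightarrow> Y'\<close> in \<open>C\<close>, acts by \<open>h \<mapsto> \<Sum> a\<^sub>i (g\<^sub>i h f\<^sub>i)\<close>; the set of which \<open>the_elem\<close> is taken is
  a singleton because that sum does not depend on the representative.\<close>

definition hom_bimod ::
    "'k ring \<Rightarrow> ('k, 'o, 'm) kcat \<Rightarrow> ('k, 'o \<times> 'o, ('m \<times> 'm \<Rightarrow> 'k) set, 'm) cmod" where
  "hom_bimod K C =
     \<lparr>On = (\<lambda>(X, Y). Hom C X Y),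
      Act = (\<lambda>(X, Y) (X', Y') A h.
         the_elem (lin_ext K (Hom C X' Y')
            (\<lambda>(f, g). Comp C X' Y Y' g (Comp C X' X Y h f)) ` A))\<rparr>"

definition ideal_bimod ::
    "'k ring \<Rightarrow> ('k, 'o, 'm) kcat \<Rightarrow> ('o \<Rightarrow> 'o \<Rightarrow> 'm set) \<Rightarrow>
     ('k, 'o \<times> 'o, ('m \<times> 'm \<Rightarrow> 'k) set, 'm) cmod" where
  "ideal_bimod K C I = submod (hom_bimod K C) (\<lambda>(X, Y). I X Y)"


section \<open>Projective resolutions and \<open>Ext\<close>\<close>

text \<open>
  HOL cannot quantify over types inside a definition, so the modules occurring in the definitions
  of projectivity and of \<open>Ext\<close> take their elements in a type that depends on the given module
  \<open>M\<close> (with elements of type \<open>'v\<close>). It contains \<open>'v\<close> and is closed under forming finitely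
  supported families, given by their graphs, of morphisms indexed by pairs of an object and an
  element. The free module on the elements of \<open>M\<close>, whose value at \<open>X\<close> is the direct sum of
  copies of \<open>C(D,X)\<close> over all objects \<open>D\<close> and all \<open>x \<in> M(D)\<close>, consists of such families; hence it, its submodules, and the whole standard free resolution of
  \<open>M\<close> can be formed with elements in this type. In particular every module has a projective
  resolution there, and lifting against epimorphisms between modules over this type (which include
  the free cover of a copy of \<open>M\<close>) is equivalent to lifting against all epimorphisms.
\<close>

datatype ('o, 'm, 'v) elt = Elt 'v | Fam "(('o \<times> ('o, 'm, 'v) elt) \<times> 'm) fset"

text \<open>The epimorphisms of \<open>Mod(C)\<close> are the pointwise surjective transformations.\<close>

definition epi ::
    "('k, 'o, 'm) kcat \<Rightarrow> ('k, 'o, 'm, 'v) cmod \<Rightarrow> ('k, 'o, 'm, 'w) cmod \<Rightarrow> ('o \<Rightarrow> 'v \<Rightarrow> 'w) \<Rightarrow> bool"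
  where
  "epi C M N e \<longleftrightarrow> (\<forall>X\<in>Obj C. e X ` carrier (On M X) = carrier (On N X))"

definition projective :: "'k ring \<Rightarrow> ('k, 'o, 'm) kcat \<Rightarrow> ('k, 'o, 'm, 'v) cmod \<Rightarrow> bool" where
  "projective K C P \<longleftrightarrow> c_module K C P \<and>
     (\<forall>(A :: ('k, 'o, 'm, ('o, 'm, 'v) elt) cmod) (B :: ('k, 'o, 'm, ('o, 'm, 'v) elt) cmod) e f.
        c_module K C A \<longrightarrow> c_module K C B \<longrightarrow> e \<in> nat_trans K C A B \<longrightarrow> epi C A B e \<longrightarrow>
        f \<in> nat_trans K C P B \<longrightarrow>
        (\<exists>g \<in> nat_trans K C P A. nt_comp C P e g = f))"

definition proj_resolution ::
    "'k ring \<Rightarrow> ('k, 'o, 'm) kcat \<Rightarrow> ('k, 'o, 'm, 'v) cmod \<Rightarrow>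
     (nat \<Rightarrow> ('k, 'o, 'm, 'p) cmod) \<Rightarrow> (nat \<Rightarrow> 'o \<Rightarrow> 'p \<Rightarrow> 'p) \<Rightarrow> ('o \<Rightarrow> 'p \<Rightarrow> 'v) \<Rightarrow> bool" where
  "proj_resolution K C M P d \<epsilon> \<longleftrightarrow>
     (\<forall>n. projective K C (P n)) \<and>
     (\<forall>n. d n \<in> nat_trans K C (P (Suc n)) (P n)) \<and>
     \<epsilon> \<in> nat_trans K C (P 0) M \<and>
     epi C (P 0) M \<epsilon> \<and>
     (\<forall>X\<in>Obj C. exact_at (On (P 1) X) (d 0 X) (On (P 0) X) (\<epsilon> X) (On M X)) \<and>
     (\<forall>n. \<forall>X\<in>Obj C.
        exact_at (On (P (Suc (Suc n))) X) (d (Suc n) X) (On (P (Suc n)) X) (d n X) (On (P n) X))"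

definition chosen_resolution ::
    "'k ring \<Rightarrow> ('k, 'o, 'm) kcat \<Rightarrow> ('k, 'o, 'm, 'v) cmod \<Rightarrow>
     (nat \<Rightarrow> ('k, 'o, 'm, ('o, 'm, 'v) elt) cmod) \<times>
     (nat \<Rightarrow> 'o \<Rightarrow> ('o, 'm, 'v) elt \<Rightarrow> ('o, 'm, 'v) elt) \<times>
     ('o \<Rightarrow> ('o, 'm, 'v) elt \<Rightarrow> 'v)" where
  "chosen_resolution K C M = (SOME (P, d, \<epsilon>). proj_resolution K C M P d \<epsilon>)"

definition cocycles ::
    "'k ring \<Rightarrow> ('k, 'o, 'm) kcat \<Rightarrow> (nat \<Rightarrow> ('k, 'o, 'm, 'p) cmod) \<Rightarrow> (nat \<Rightarrow> 'o \<Rightarrow> 'p \<Rightarrow> 'p) \<Rightarrow>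
     ('k, 'o, 'm, 'w) cmod \<Rightarrow> nat \<Rightarrow> ('o \<Rightarrow> 'p \<Rightarrow> 'w) set" where
  "cocycles K C P d N n =
     a_kernel (Hom_Mod K C (P n) N) (Hom_Mod K C (P (Suc n)) N) (\<lambda>\<phi>. nt_comp C (P (Suc n)) \<phi> (d n))"

definition coboundaries ::
    "'k ring \<Rightarrow> ('k, 'o, 'm) kcat \<Rightarrow> (nat \<Rightarrow> ('k, 'o, 'm, 'p) cmod) \<Rightarrow> (nat \<Rightarrow> 'o \<Rightarrow> 'p \<Rightarrow> 'p) \<Rightarrow>
     ('k, 'o, 'm, 'w) cmod \<Rightarrow> nat \<Rightarrow> ('o \<Rightarrow> 'p \<Rightarrow> 'w) set" where
  "coboundaries K C P d N n =
     (case n of 0 \<Rightarrow> {\<zero>\<^bsub>Hom_Mod K C (P 0) N\<^esub>}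
      | Suc m \<Rightarrow> (\<lambda>\<phi>. nt_comp C (P (Suc m)) \<phi> (d m)) ` nat_trans K C (P m) N)"

definition cohomology ::
    "'k ring \<Rightarrow> ('k, 'o, 'm) kcat \<Rightarrow> (nat \<Rightarrow> ('k, 'o, 'm, 'p) cmod) \<Rightarrow> (nat \<Rightarrow> 'o \<Rightarrow> 'p \<Rightarrow> 'p) \<Rightarrow>
     ('k, 'o, 'm, 'w) cmod \<Rightarrow> nat \<Rightarrow> ('k, ('o \<Rightarrow> 'p \<Rightarrow> 'w) set) module" where
  "cohomology K C P d N n =
     quot_mod ((Hom_Mod K C (P n) N)\<lparr>carrier := cocycles K C P d N n\<rparr>) (coboundaries K C P d N n)"

definition Ext ::
    "'k ring \<Rightarrow> ('k, 'o, 'm) kcat \<Rightarrow> nat \<Rightarrow> ('k, 'o, 'm, 'v) cmod \<Rightarrow> ('k, 'o, 'm, 'w) cmod \<Rightarrow>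
     ('k, ('o \<Rightarrow> ('o, 'm, 'v) elt \<Rightarrow> 'w) set) module" where
  "Ext K C n M N = (case chosen_resolution K C M of (P, d, \<epsilon>) \<Rightarrow> cohomology K C P d N n)"

definition Hochschild_Mitchell ::
    "'k ring \<Rightarrow> ('k, 'o, 'm) kcat \<Rightarrow> nat \<Rightarrow>
     ('k, ('o \<times> 'o \<Rightarrow> ('o \<times> 'o, ('m \<times> 'm \<Rightarrow> 'k) set, 'm) elt \<Rightarrow> 'm) set) module" where
  "Hochschild_Mitchell K C n = Ext K (env_cat K C) n (hom_bimod K C) (hom_bimod K C)"


section \<open>Strongly idempotent ideals and homological epimorphisms\<close>

text \<open>\<open>\<Phi>\<^sub>* F = F \<circ> \<Phi>\<close> for the projection \<open>\<Phi> : C \<rightarrow> C/I\<close>, which is the identity on objects. On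
  morphisms \<open>\<Phi>\<^sub>*\<close> is the identity, since a natural transformation of modules over \<open>C/I\<close> is given by
  the same components over \<open>C\<close>.\<close>

definition restrict_mod ::
    "('k, 'o, 'm) kcat \<Rightarrow> ('o \<Rightarrow> 'o \<Rightarrow> 'm set) \<Rightarrow> ('k, 'o, 'm set, 'v) cmod \<Rightarrow>
     ('k, 'o, 'm, 'v) cmod" where
  "restrict_mod C I F = \<lparr>On = On F, Act = (\<lambda>X Y f. Act F X Y (I X Y +>\<^bsub>Hom C X Y\<^esub> f))\<rparr>"

text \<open>A chain map between augmented complexes over the identity of the augmentation target.\<close>

definition chain_lift ::
    "'k ring \<Rightarrow> ('k, 'o, 'm) kcat \<Rightarrow>
     (nat \<Rightarrow> ('k, 'o, 'm, 'q) cmod) \<Rightarrow> (nat \<Rightarrow> 'o \<Rightarrow> 'q \<Rightarrow> 'q) \<Rightarrow> ('o \<Rightarrow> 'q \<Rightarrow> 'v) \<Rightarrow>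
     (nat \<Rightarrow> ('k, 'o, 'm, 'p) cmod) \<Rightarrow> (nat \<Rightarrow> 'o \<Rightarrow> 'p \<Rightarrow> 'p) \<Rightarrow> ('o \<Rightarrow> 'p \<Rightarrow> 'v) \<Rightarrow>
     (nat \<Rightarrow> 'o \<Rightarrow> 'q \<Rightarrow> 'p) \<Rightarrow> bool" where
  "chain_lift K C Q dQ \<epsilon>Q P dP \<epsilon>P \<tau> \<longleftrightarrow>
     (\<forall>n. \<tau> n \<in> nat_trans K C (Q n) (P n)) \<and>
     nt_comp C (Q 0) \<epsilon>P (\<tau> 0) = \<epsilon>Q \<and>
     (\<forall>n. nt_comp C (Q (Suc n)) (dP n) (\<tau> (Suc n)) = nt_comp C (Q (Suc n)) (\<tau> n) (dQ n))"

text \<open>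
  The map induced by the exact functor \<open>\<Phi>\<^sub>*\<close> on \<open>Ext\<close>: if \<open>P\<^sub>\<bullet> \<rightarrow> F\<close> is the resolution over \<open>C/I\<close>
  and \<open>Q\<^sub>\<bullet> \<rightarrow> \<Phi>\<^sub>* F\<close> the one over \<open>C\<close>, then \<open>\<Phi>\<^sub>* P\<^sub>\<bullet> \<rightarrow> \<Phi>\<^sub>* F\<close> is still a resolution, the identity
  lifts to a chain map \<open>\<tau> : Q\<^sub>\<bullet> \<rightarrow> \<Phi>\<^sub>* P\<^sub>\<bullet>\<close>, unique up to homotopy, and the class of \<open>\<phi>\<close> is sent to
  the class of \<open>\<phi> \<tau>\<^sub>n\<close>.
\<close>

definition ext_canonical_map ::
    "'k ring \<Rightarrow> ('k, 'o, 'm) kcat \<Rightarrow> ('o \<Rightarrow> 'o \<Rightarrow> 'm set) \<Rightarrow> nat \<Rightarrow>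
     ('k, 'o, 'm set, 'v) cmod \<Rightarrow> ('k, 'o, 'm set, 'w) cmod \<Rightarrow>
     ('o \<Rightarrow> ('o, 'm set, 'v) elt \<Rightarrow> 'w) set \<Rightarrow> ('o \<Rightarrow> ('o, 'm, 'v) elt \<Rightarrow> 'w) set" where
  "ext_canonical_map K C I n F F' =
     (case chosen_resolution K (quot_cat C I) F of (P, dP, \<epsilon>P) \<Rightarrow>
      case chosen_resolution K C (restrict_mod C I F) of (Q, dQ, \<epsilon>Q) \<Rightarrow>
      let \<tau> = (SOME \<tau>. chain_lift K C Q dQ \<epsilon>Q (\<lambda>n. restrict_mod C I (P n)) dP \<epsilon>P \<tau>)
      in (\<lambda>A. \<Union>\<phi>\<in>A. coboundaries K C Q dQ (restrict_mod C I F') n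
                 +>\<^bsub>Hom_Mod K C (Q n) (restrict_mod C I F')\<^esub> nt_comp C (Q n) \<phi> (\<tau> n)))"

text \<open>The two type arguments are the types of the elements of \<open>F\<close> and \<open>F'\<close>.\<close>

definition strongly_idempotent ::
    "'v itself \<Rightarrow> 'w itself \<Rightarrow> 'k ring \<Rightarrow> ('k, 'o, 'm) kcat \<Rightarrow> ('o \<Rightarrow> 'o \<Rightarrow> 'm set) \<Rightarrow> bool" where
  "strongly_idempotent _ _ K C I \<longleftrightarrow>
     (\<forall>(F :: ('k, 'o, 'm set, 'v) cmod) (F' :: ('k, 'o, 'm set, 'w) cmod) i.
        c_module K (quot_cat C I) F \<longrightarrow> c_module K (quot_cat C I) F' \<longrightarrow>
        ext_canonical_map K C I i F F'
          \<in> lin_isos K (Ext K (quot_cat C I) i F F')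
              (Ext K C i (restrict_mod C I F) (restrict_mod C I F')))"

definition projection_homological_epi ::
    "'v itself \<Rightarrow> 'w itself \<Rightarrow> 'k ring \<Rightarrow> ('k, 'o, 'm) kcat \<Rightarrow> ('o \<Rightarrow> 'o \<Rightarrow> 'm set) \<Rightarrow> bool" where
  "projection_homological_epi \<V> \<W> K C I \<longleftrightarrow> strongly_idempotent \<V> \<W> K C I"

end

theory Submission
 imports Defs
begin

text \<open>
  Let \<open>Q\<close> be a projective resolution of a \<open>C\<close>-module annihilated by \<open>I\<close>. Since the \<open>I(C,-)\<close> are
  projective, so is every \<open>I Q\<^sub>n\<close>; together with \<open>I\<^sup>2 = I\<close> this lets one split off the cycles of \<open>I Q\<close>
  inductively, and \<open>Q / I Q\<close> turns out to be exact. It is therefore a projective resolution over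
  \<open>B = C/I\<close>, and \<open>Hom\<^sub>C(Q, F') = Hom\<^sub>B(Q / I Q, F')\<close> for every \<open>B\<close>-module \<open>F'\<close>, so that \<open>I\<close> is strongly
  idempotent.

  Now let \<open>P \<rightarrow> C\<close> be a projective resolution over \<open>C\<^sup>e\<close>. For fixed \<open>Y\<close> it resolves the representable
  \<open>C(-,Y)\<close>, hence is contractible and stays exact modulo the left action of \<open>I\<close>. For fixed \<open>X\<close> the
  resulting complex is a projective resolution of \<open>B(X,-)\<close>, which is annihilated by \<open>I\<close>, and the first
  paragraph applies. Thus reducing \<open>P\<close> on both sides yields a projective resolution of \<open>B\<close> over \<open>B\<^sup>e\<close>,
  \<open>H\<^sup>n(B) = H\<^sup>n(Hom(P, B))\<close>, and the sequence is the long exact cohomology sequence of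
  \<open>0 \<rightarrow> Hom(P, I) \<rightarrow> Hom(P, C) \<rightarrow> Hom(P, B) \<rightarrow> 0\<close>.
\<close>

text \<open>The hypothesis concerns \<open>I(C,-)\<close> and says nothing about
  \<open>I(-,C)\<close>, so the two sides of a bimodule resolution \<open>P\<close> are treated
  differently: contractibility handles the left side, and the inductive splitting handles the right
  side of what remains. The splitting needs projective modules, whereas \<open>P\<close> is
  projective only over \<open>C^e\<close>. The passage from \<open>P\<close> to
  \<open>P(X,-)\<close> modulo the left action of \<open>I\<close> has the right adjoint
  \<open>N \<mapsto> Hom(C(X,-)/I(X,-), N)\<close>, with \<open>Hom\<close> over \<open>K\<close>;
  it preserves epimorphisms because \<open>K\<close> is a field, so the passage preserves
  projectivity. The encoding adds two obstacles. \<open>projective\<close> tests lifting only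
  against modules with elements in \<open>elt\<close>; this is lifted to all element types by
  exhibiting a projective module as a retract of its free cover. \<open>Ext\<close> is computed from
  one chosen resolution; hence \<open>H^n(B)\<close> enters the sequence only after transport along
  a comparison isomorphism, and strong idempotence has to be shown for the particular chain lift
  inside \<open>ext_canonical_map\<close>.\<close>

abbreviation add_at ("(_ +[_] _)" [65, 0, 66] 65) where "x +[G] y \<equiv> add G x y"
abbreviation minus_at ("(_ -[_] _)" [65, 0, 66] 65) where "x -[G] y \<equiv> a_minus G x y"
abbreviation uminus_at ("(-[_] _)" [0, 81] 80) where "-[G] x \<equiv> a_inv G x"
abbreviation smult_at ("(_ *[_] _)" [70, 0, 71] 70) where "a *[V] x \<equiv> smult V a x"
abbreviation zero_at ("0[_]") where "0[G] \<equiv> zero G"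
abbreviation coset_at ("(_ +>[_] _)" [60, 0, 61] 60) where "W +>[G] x \<equiv> a_r_coset G W x"
abbreviation El where "El M X \<equiv> carrier (On M X)"
abbreviation Mor where "Mor C X Y \<equiv> carrier (Hom C X Y)"

section \<open>Linear maps and quotient spaces\<close>

lemma lin_mapsI:
 assumes "\<And>x. x \<in> carrier V ==> T x \<in> carrier W"
  and "\<And>x y. x \<in> carrier V ==> y \<in> carrier V ==> T (x +[V] y) = T x +[W] T y"
  and "\<And>a x. a \<in> carrier K ==> x \<in> carrier V ==> T (a *[V] x) = a *[W] T x"
 shows "T \<in> lin_maps K V W"
 using assms by (auto simp: lin_maps_def)

lemma lin_closed: "T \<in> lin_maps K V W ==> x \<in> carrier V ==> T x \<in> carrier W"
 by (auto simp: lin_maps_def)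

lemma lin_add: "T \<in> lin_maps K V W ==> x \<in> carrier V ==> y \<in> carrier V ==>
  T (x +[V] y) = T x +[W] T y"
 by (auto simp: lin_maps_def)

lemma lin_smult: "T \<in> lin_maps K V W ==> a \<in> carrier K ==> x \<in> carrier V ==>
  T (a *[V] x) = a *[W] T x"
 by (auto simp: lin_maps_def)

lemma module_abelian_group: "module K V ==> abelian_group V"
 by (simp add: module_def)

lemma additive_zero:
 assumes "abelian_group V" "abelian_group W"
  and T: "\<And>x. x \<in> carrier V ==> T x \<in> carrier W"
  and add: "\<And>x y. x \<in> carrier V ==> y \<in> carrier V ==> T (x +[V] y) = T x +[W] T y"
 shows "T 0[V] = 0[W]"
proof -
 interpret V: abelian_group V by fact
 interpret W: abelian_group W by fact
 have "T 0[V] +[W] T 0[V] = T 0[V]" using add[of "0[V]" "0[V]"] by simp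
 then show ?thesis using T[of "0[V]"] by (metis V.zero_closed W.add.r_cancel_one')
qed

lemma lin_zero:
 assumes "T \<in> lin_maps K V W" "module K V" "module K W"
 shows "T 0[V] = 0[W]"
 by (rule additive_zero) (use assms in "auto intro: lin_closed lin_add module_abelian_group")

lemma lin_uminus:
 assumes "T \<in> lin_maps K V W" "module K V" "module K W" "x \<in> carrier V"
 shows "T (-[V] x) = -[W] T x"
proof -
 interpret V: module K V by fact
 interpret W: module K W by fact
 have "T (-[V] x) +[W] T x = T 0[V]"
  using lin_add[OF assms(1), of "-[V] x" x] assms(4) by (simp add: V.M.l_neg)
 then show ?thesis
  using lin_closed[OF assms(1)] assms(4) lin_zero[OF assms(1-3)]
  by (metis V.M.a_inv_closed W.M.minus_equality)
qed

lemma lin_minus: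
 assumes "T \<in> lin_maps K V W" "module K V" "module K W" "x \<in> carrier V" "y \<in> carrier V"
 shows "T (x -[V] y) = T x -[W] T y"
proof -
 interpret V: module K V by fact
 show ?thesis using assms by (simp add: a_minus_def lin_add lin_uminus)
qed

lemma lin_finsum:
 assumes "T \<in> lin_maps K V W" "module K V" "module K W" "f \<in> A \<rightarrow> carrier V"
 shows "T (\<Oplus>\<^bsub>V\<^esub> i\<in>A. f i) = (\<Oplus>\<^bsub>W\<^esub> i\<in>A. T (f i))"
proof -
 interpret V: module K V by fact
 interpret W: module K W by fact
 show ?thesis using assms(4)
 proof (induction A rule: infinite_finite_induct)
  case (insert a A)
  then have "(\<lambda>i. T (f i)) \<in> A \<rightarrow> carrier W" "T (f a) \<in> carrier W"
   using lin_closed[OF assms(1)] by auto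
  with insert show ?case
   by (simp add: V.M.finsum_insert W.M.finsum_insert lin_add[OF assms(1)] Pi_def)
 qed (simp_all add: lin_zero[OF assms(1-3)] V.M.finsum_infinite W.M.finsum_infinite)
qed

lemma lin_comp: "T \<in> lin_maps K U V ==> S \<in> lin_maps K V W ==> (\<lambda>x. S (T x)) \<in> lin_maps K U W"
 by (auto simp: lin_maps_def Pi_iff)

lemma lin_diff:
 assumes "S \<in> lin_maps K V W" "T \<in> lin_maps K V W" "module K V" "module K W"
 shows "(\<lambda>x. S x -[W] T x) \<in> lin_maps K V W"
proof -
 interpret W: module K W by fact
 show ?thesis
 proof (rule lin_mapsI, goal_cases)
  case (2 x y)
  then show ?case using lin_closed[OF assms(1)] lin_closed[OF assms(2)]
   by (simp add: lin_add[OF assms(1)] lin_add[OF assms(2)] W.M.minus_eq W.M.minus_add W.M.a_ac)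
 next
  case (3 a x)
  then show ?case using lin_closed[OF assms(1)] lin_closed[OF assms(2)]
   by (simp add: lin_smult[OF assms(1)] lin_smult[OF assms(2)] W.M.minus_eq
     W.smult_r_distr W.smult_r_minus)
 qed (use lin_closed[OF assms(1)] lin_closed[OF assms(2)] in auto)
qed

lemma lin_plus:
 assumes "S \<in> lin_maps K V W" "T \<in> lin_maps K V W" "module K W"
 shows "(\<lambda>x. S x +[W] T x) \<in> lin_maps K V W"
proof -
 interpret W: module K W by fact
 show ?thesis
  by (rule lin_mapsI) (use lin_closed[OF assms(1)] lin_closed[OF assms(2)] in
   "auto simp: lin_add[OF assms(1)] lin_add[OF assms(2)] lin_smult[OF assms(1)]
    lin_smult[OF assms(2)] W.M.a_ac W.smult_r_distr")
qed

lemma (in abelian_group) minus_eq_zero_iff: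
 "x \<in> carrier G ==> y \<in> carrier G ==> x \<ominus> y = \<zero> \<longleftrightarrow> x = y"
 by (metis add.inv_closed minus_eq minus_equality minus_minus r_neg)

lemma (in abelian_group) minus_add_cancel:
 "x \<in> carrier G ==> y \<in> carrier G ==> (x \<ominus> y) \<oplus> y = x"
 by (simp add: minus_eq a_assoc l_neg)

lemma (in abelian_group) add_minus_cancel:
 "x \<in> carrier G ==> y \<in> carrier G ==> (x \<oplus> y) \<ominus> y = x"
 by (simp add: minus_eq a_assoc r_neg)

lemma (in abelian_group) minus_zero_right [simp]: "x \<in> carrier G ==> x \<ominus> \<zero> = x"
 by (simp add: minus_eq)

lemma (in abelian_group) minus_minus_cancel: "x \<in> carrier G ==> a \<in> carrier G ==> x \<ominus> (x \<ominus> a) = a"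
 by (simp add: minus_eq minus_add minus_minus r_neg1 r_neg2)

lemma (in module) mod_ops_closed:
 "x \<in> carrier M ==> y \<in> carrier M ==> x +[M] y \<in> carrier M" "a \<in> carrier R ==> x \<in> carrier M ==> a *[M] x \<in> carrier M"
 by simp_all

text \<open>Negation is multiplication by \<open>\<ominus> \<one>\<close>; this yields the closure
  under inverses that the locale \<open>submodule\<close> demands.\<close>

lemma (in module) submoduleI':
 assumes "S \<subseteq> carrier M" "0[M] \<in> S"
  and "\<And>x y. x \<in> S ==> y \<in> S ==> x +[M] y \<in> S"
  and "\<And>a x. a \<in> carrier R ==> x \<in> S ==> a *[M] x \<in> S"
 shows "submodule S R M"
proof (rule submoduleI)
 fix a assume "a \<in> S"
 then have "-[M] a = (\<ominus> \<one>) *[M] a" using assms(1) by (auto simp: smult_l_minus)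
 then show "-[M] a \<in> S" using assms(4)[of "\<ominus> \<one>" a] \<open>a \<in> S\<close> by simp
qed (use assms in auto)

lemma (in module) submodule_props:
 assumes "submodule S R M"
 shows "S \<subseteq> carrier M" "0[M] \<in> S"
  "\<And>x y. x \<in> S ==> y \<in> S ==> x +[M] y \<in> S"
  "\<And>x y. x \<in> S ==> y \<in> S ==> x -[M] y \<in> S"
  "\<And>x. x \<in> S ==> -[M] x \<in> S"
  "\<And>a x. a \<in> carrier R ==> x \<in> S ==> a *[M] x \<in> S"
proof -
 note E = submoduleE[OF assms]
 show "S \<subseteq> carrier M" "\<And>x y. x \<in> S ==> y \<in> S ==> x +[M] y \<in> S"
  "\<And>x. x \<in> S ==> -[M] x \<in> S" "\<And>a x. a \<in> carrier R ==> x \<in> S ==> a *[M] x \<in> S"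
  using E by auto
 show "\<And>x y. x \<in> S ==> y \<in> S ==> x -[M] y \<in> S"
  using E by (simp add: a_minus_def)
 show "0[M] \<in> S" using subgroup.one_closed[OF submodule.axioms(1)[OF assms]] by simp
qed

lemma (in module) submodule_finsum:
 assumes "submodule S R M" "f \<in> A \<rightarrow> S"
 shows "(\<Oplus>\<^bsub>M\<^esub> i\<in>A. f i) \<in> S"
 using assms(2)
proof (induction A rule: infinite_finite_induct)
 case (insert a A)
 then have "f \<in> A \<rightarrow> carrier M" "f a \<in> carrier M" using submodule_props(1)[OF assms(1)] by auto
 with insert show ?case
  by (simp add: finsum_insert Pi_def submodule_props[OF assms(1)])
qed (simp_all add: submodule_props[OF assms(1)] finsum_infinite)

text \<open>A coset depends on the addition only. Cocycles enter as \<open>A n\<close> with a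
  smaller carrier, and this rule lets their cosets be computed in \<open>A n\<close> itself.\<close>

lemma coset_carrier_update [simp]: "W +>[V\<lparr>carrier := S\<rparr>] x = W +>[V] x"
 by (simp add: a_r_coset_def r_coset_def)

locale kmod = module K M for K :: "'k ring" and M :: "('k, 'v) module"

context kmod
begin

lemma coset_mem_iff: "y \<in> W +>[M] x \<longleftrightarrow> (\<exists>w\<in>W. y = w +[M] x)"
 by (auto simp: a_r_coset_def')

lemma coset_self: "submodule W K M ==> x \<in> carrier M ==> x \<in> W +>[M] x"
 unfolding coset_mem_iff by (rule bexI[of _ "0[M]"]) (auto simp: submodule_props)

lemma coset_eq_iff:
 assumes "submodule W K M" "x \<in> carrier M" "y \<in> carrier M"
 shows "W +>[M] x = W +>[M] y \<longleftrightarrow> x -[M] y \<in> W"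
proof
 assume "W +>[M] x = W +>[M] y"
 then obtain w where "w \<in> W" "x = w +[M] y"
  using coset_self[OF assms(1,2)] coset_mem_iff by metis
 then show "x -[M] y \<in> W"
  using submodule_props(1)[OF assms(1)] assms(3) by (simp add: subset_iff add_minus_cancel)
next
 assume d: "x -[M] y \<in> W"
 have "x = (x -[M] y) +[M] y" using assms by (simp add: minus_add_cancel)
 then have "x \<in> W +>[M] y" using d coset_mem_iff by blast
 then have "W +>[M] y = W +>[M] x"
  by (rule a_repr_independence[OF _ assms(3) submodule.axioms(1)[OF assms(1)]])
 then show "W +>[M] x = W +>[M] y" by simp
qed

lemma coset_zero: "submodule W K M ==> W +>[M] 0[M] = W"
 by (rule a_coset_add_zero) (simp add: submodule_props)

lemma coset_eq_self_iff:
 assumes "submodule W K M" "x \<in> carrier M"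
 shows "W +>[M] x = W \<longleftrightarrow> x \<in> W"
 using coset_eq_iff[OF assms, of "0[M]"] coset_zero[OF assms(1)] assms(2)
 by simp

lemma quot_carrier: "carrier (quot_mod M W) = (\<lambda>x. W +>[M] x) ` carrier M"
 by (auto simp: quot_mod_def A_RCOSETS_def')

lemma quot_zero: "0[quot_mod M W] = W"
 by (simp add: quot_mod_def)

lemma coset_carrier_subset:
 assumes "submodule W K M" "x \<in> carrier M" "y \<in> W +>[M] x" shows "y \<in> carrier M"
 using assms submodule_props(1)[OF assms(1)] by (auto simp: coset_mem_iff)

lemma coset_eq_mem:
 assumes "submodule W K M" "x \<in> carrier M" "y \<in> W +>[M] x" shows "W +>[M] y = W +>[M] x"
 using a_repr_independence[OF assms(3,2) submodule.axioms(1)[OF assms(1)]] by simp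

lemma quot_add:
 assumes "submodule W K M" "x \<in> carrier M" "y \<in> carrier M"
 shows "(W +>[M] x) +[quot_mod M W] (W +>[M] y) = W +>[M] (x +[M] y)"
proof -
 interpret W: abelian_subgroup W M
  by (rule abelian_subgroupI3[OF additive_subgroupI[OF submodule.axioms(1)[OF assms(1)]]])
   (rule abelian_group_axioms)
 show ?thesis using W.a_rcos_sum assms(2,3) by (simp add: quot_mod_def)
qed

text \<open>Operations on quotients are defined as unions over all representatives. When
  \<open>F\<close> is constant on the coset, the union collapses to one value, so well-definedness
  of such an operation reduces to this.\<close>

lemma UN_coset_eq:
 assumes "submodule W K M" "x \<in> carrier M" "\<And>w. w \<in> W ==> F (w +[M] x) = F x"
 shows "(\<Union>y\<in>W +>[M] x. F y) = F x"
proof -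
 have "F y = F x" if "y \<in> W +>[M] x" for y
  using that assms(3) unfolding coset_mem_iff by blast
 then show ?thesis using coset_self[OF assms(1,2)] by blast
qed

lemma quot_smult:
 assumes "submodule W K M" "a \<in> carrier K" "x \<in> carrier M"
 shows "a *[quot_mod M W] (W +>[M] x) = W +>[M] (a *[M] x)"
proof -
 have "(\<Union>y\<in>W +>[M] x. W +>[M] (a *[M] y)) = W +>[M] (a *[M] x)"
 proof (rule UN_coset_eq[OF assms(1,3)])
  fix w assume w: "w \<in> W"
  then have "w \<in> carrier M" using submodule_props(1)[OF assms(1)] by auto
  then have "a *[M] (w +[M] x) -[M] a *[M] x = a *[M] w"
   using assms by (simp add: smult_r_distr add_minus_cancel)
  then show "W +>[M] a *[M] (w +[M] x) = W +>[M] a *[M] x"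
   using w assms \<open>w \<in> carrier M\<close> by (simp add: coset_eq_iff submodule_props)
 qed
 then show ?thesis by (simp add: quot_mod_def)
qed

lemma quot_module:
 assumes W: "submodule W K M" shows "module K (quot_mod M W)"
proof (rule moduleI)
 note q = quot_carrier quot_add[OF W] quot_smult[OF W] quot_zero
 have zero: "W = W +>[M] 0[M]" using coset_zero[OF W] by simp
 show "cring K" ..
 show "abelian_group (quot_mod M W)"
 proof (rule abelian_groupI, goal_cases)
  case 2 then show ?case unfolding q(4) q(1) by (subst zero) auto
 next
  case (5 x)
  then obtain y where "x = W +>[M] y" "y \<in> carrier M" by (auto simp: q)
  then show ?case using q(2)[of "0[M]" y] coset_zero[OF W] by (simp add: q(4))
 next
  case (6 x)
  then obtain y where "x = W +>[M] y" "y \<in> carrier M" by (auto simp: q)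
  then show ?case using q(2)[of "-[M] y" y] coset_zero[OF W]
   by (auto simp: q(4) q(1) l_neg intro!: bexI[of _ "W +>[M] (-[M] y)"])
 qed (auto simp: q a_ac)
qed (auto simp: quot_carrier quot_add[OF W] quot_smult[OF W] smult_l_distr smult_r_distr
  smult_assoc1)

lemma proj_lin: "submodule W K M ==> (\<lambda>x. W +>[M] x) \<in> lin_maps K M (quot_mod M W)"
 by (rule lin_mapsI) (auto simp: quot_carrier quot_add quot_smult)

text \<open>The other encoding of an induced map: once \<open>T\<close> kills \<open>W\<close> it is
  constant on cosets, so the image of a coset is a singleton.\<close>

lemma the_elem_coset:
 assumes "submodule W K M" "T \<in> lin_maps K M U" "module K U"
  "\<And>w. w \<in> W ==> T w = 0[U]" "x \<in> carrier M"
 shows "the_elem (T ` (W +>[M] x)) = T x"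
proof -
 interpret U: module K U by fact
 have "T y = T x" if "y \<in> W +>[M] x" for y
 proof -
  obtain w where w: "w \<in> W" "y = w +[M] x" using \<open>y \<in> _\<close> coset_mem_iff by auto
  then have "w \<in> carrier M" using submodule_props(1)[OF assms(1)] by auto
  then show ?thesis using w assms lin_closed[OF assms(2,5)] by (simp add: lin_add[OF assms(2)])
 qed
 then have "\<And>z. z \<in> T ` (W +>[M] x) \<longleftrightarrow> z = T x" using coset_self[OF assms(1,5)] by blast
 then have "T ` (W +>[M] x) = {T x}" by blast
 then show ?thesis by simp
qed

lemma the_elem_lin:
 assumes "submodule W K M" "T \<in> lin_maps K M U" "module K U"
  "\<And>w. w \<in> W ==> T w = 0[U]"
 shows "(\<lambda>A. the_elem (T ` A)) \<in> lin_maps K (quot_mod M W) U"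
proof (rule lin_mapsI)
 note e = the_elem_coset[OF assms]
 show "\<And>x. x \<in> carrier (quot_mod M W) ==> the_elem (T ` x) \<in> carrier U"
  using lin_closed[OF assms(2)] by (auto simp: quot_carrier e)
 show "\<And>x y. x \<in> carrier (quot_mod M W) ==> y \<in> carrier (quot_mod M W) ==>
   the_elem (T ` (x +[quot_mod M W] y)) = the_elem (T ` x) +[U] the_elem (T ` y)"
  by (auto simp: quot_carrier e quot_add assms(1) lin_add[OF assms(2)])
 show "\<And>a x. a \<in> carrier K ==> x \<in> carrier (quot_mod M W) ==>
   the_elem (T ` (a *[quot_mod M W] x)) = a *[U] the_elem (T ` x)"
  by (auto simp: quot_carrier e quot_smult assms(1) lin_smult[OF assms(2)])
qed

end

section \<open>Kernels, images and linear sections\<close>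

lemma kernel_submodule:
 assumes "module K V" "module K W" "T \<in> lin_maps K V W"
 shows "submodule {x \<in> carrier V. T x = 0[W]} K V"
proof -
 interpret V: module K V by fact
 interpret W: module K W by fact
 show ?thesis
  by (rule V.submoduleI')
   (auto simp: lin_add[OF assms(3)] lin_smult[OF assms(3)] lin_zero[OF assms(3,1,2)])
qed

lemma image_submodule:
 assumes "module K V" "module K W" "T \<in> lin_maps K V W"
 shows "submodule (T ` carrier V) K W"
proof -
 interpret V: module K V by fact
 interpret W: module K W by fact
 show ?thesis
 proof (rule W.submoduleI')
  show "0[W] \<in> T ` carrier V" using lin_zero[OF assms(3,1,2)] by (metis V.M.zero_closed image_eqI)
  show "x +[W] y \<in> T ` carrier V" if "x \<in> T ` carrier V" "y \<in> T ` carrier V" for x y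
   using that lin_add[OF assms(3)] by (smt (verit) V.M.a_closed image_iff)
  show "a *[W] x \<in> T ` carrier V" if "a \<in> carrier K" "x \<in> T ` carrier V" for a x
   using that lin_smult[OF assms(3)] by (smt (verit) V.smult_closed image_iff)
 qed (auto simp: lin_closed[OF assms(3)])
qed

lemma zero_submodule: "module K V ==> submodule {0[V]} K V"
proof -
 assume "module K V"
 then interpret module K V .
 show ?thesis by (rule submoduleI') auto
qed

text \<open>Zorn's lemma yields a maximal subspace meeting the kernel trivially; over a field such a
  subspace is a complement of the kernel.\<close>

lemma linear_section:
 assumes "field K" and V: "module K V" and W: "module K W" and T: "T \<in> lin_maps K V W"
  and surj: "T ` carrier V = carrier W"
 shows "\<exists>s \<in> lin_maps K W V. \<forall>w\<in>carrier W. T (s w) = w"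
proof -
 interpret K: field K by fact
 interpret V: module K V by fact
 interpret W: module K W by fact
 note Tz = lin_zero[OF T V W]
 define \<A> where "\<A> = {S. submodule S K V \<and> (\<forall>x\<in>S. T x = 0[W] \<longrightarrow> x = 0[V])}"
 have "\<exists>S\<in>\<A>. \<forall>X\<in>\<A>. S \<subseteq> X \<longrightarrow> X = S"
 proof (rule subset_Zorn_nonempty)
  show "\<A> \<noteq> {}" using zero_submodule[OF V] by (auto simp: \<A>_def)
  fix \<C> assume ne: "\<C> \<noteq> {}" and ch: "subset.chain \<A> \<C>"
  then have sub: "\<And>S. S \<in> \<C> ==> submodule S K V" and tot: "\<And>S S'. S \<in> \<C> ==> S' \<in> \<C> ==> S \<subseteq> S' \<or> S' \<subseteq> S"
   unfolding subset.chain_def \<A>_def by blast+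
  have "submodule (\<Union>\<C>) K V"
  proof (rule V.submoduleI')
   show "\<Union>\<C> \<subseteq> carrier V" using V.submodule_props(1)[OF sub] by blast
   show "0[V] \<in> \<Union>\<C>" using V.submodule_props(2)[OF sub] ne by blast
   show "a *[V] x \<in> \<Union>\<C>" if "a \<in> carrier K" "x \<in> \<Union>\<C>" for a x
    using that V.submodule_props(6)[OF sub] by blast
   fix x y assume "x \<in> \<Union>\<C>" "y \<in> \<Union>\<C>"
   then obtain S S' where S: "S \<in> \<C>" "S' \<in> \<C>" "x \<in> S" "y \<in> S'" by blast
   with tot[of S S'] V.submodule_props(3)[OF sub] show "x +[V] y \<in> \<Union>\<C>" by blast
  qed
  then show "\<Union>\<C> \<in> \<A>" using ch by (auto simp: subset.chain_def \<A>_def)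
 qed
 then obtain S where S: "S \<in> \<A>" and max: "\<And>X. X \<in> \<A> ==> S \<subseteq> X ==> X = S" by blast
 then have sub: "submodule S K V" and triv: "\<And>x. x \<in> S ==> T x = 0[W] ==> x = 0[V]"
  by (auto simp: \<A>_def)
 note p = V.submodule_props[OF sub]
 have Sc: "x \<in> S ==> x \<in> carrier V" for x using p(1) by blast
 have onto: "\<exists>x\<in>S. T x = w" if w: "w \<in> carrier W" for w
 proof (rule ccontr)
  assume no: "\<not> (\<exists>x\<in>S. T x = w)"
  obtain v where v: "v \<in> carrier V" "T v = w" using w unfolding surj[symmetric] by blast
  define X where "X = {x +[V] a *[V] v |x a. x \<in> S \<and> a \<in> carrier K}"
  have XI: "x \<in> S ==> a \<in> carrier K ==> x +[V] a *[V] v \<in> X" for x a by (auto simp: X_def)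
  have "submodule X K V"
  proof (rule V.submoduleI')
   show "X \<subseteq> carrier V" using Sc v by (auto simp: X_def)
   show "0[V] \<in> X" using XI[of "0[V]" "0[K]"] p(2) v by simp
   fix x y assume "x \<in> X" "y \<in> X"
   then obtain x' a y' b where xy: "x = x' +[V] a *[V] v" "y = y' +[V] b *[V] v"
    "x' \<in> S" "y' \<in> S" "a \<in> carrier K" "b \<in> carrier K" by (auto simp: X_def)
   then have "x +[V] y = (x' +[V] y') +[V] (a +[K] b) *[V] v"
    using v Sc by (simp add: V.smult_l_distr V.M.a_ac)
   then show "x +[V] y \<in> X" using xy XI p(3) by simp
  next
   fix b x assume "b \<in> carrier K" "x \<in> X"
   then obtain x' a where xy: "x = x' +[V] a *[V] v" "x' \<in> S" "a \<in> carrier K" by (auto simp: X_def)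
   then have "b *[V] x = b *[V] x' +[V] (b \<otimes>\<^bsub>K\<^esub> a) *[V] v"
    using v Sc \<open>b \<in> carrier K\<close> by (simp add: V.smult_r_distr V.smult_assoc1)
   then show "b *[V] x \<in> X" using xy XI p(6) \<open>b \<in> carrier K\<close> by simp
  qed
  moreover have "y = 0[V]" if "y \<in> X" "T y = 0[W]" for y
  proof -
   obtain x a where y: "y = x +[V] a *[V] v" "x \<in> S" "a \<in> carrier K" using \<open>y \<in> X\<close> by (auto simp: X_def)
   have Ty: "T x +[W] a *[W] w = 0[W]"
    using \<open>T y = 0[W]\<close> y v Sc by (simp add: lin_add[OF T] lin_smult[OF T])
   \<comment> \<open>An invertible \<open>a\<close> would turn the relation \<open>Ty\<close> into a
     preimage of \<open>w\<close> inside \<open>S\<close>. This is the point where \<open>K\<close>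
     has to be a field.\<close>
   have "a = 0[K]"
   proof (rule ccontr)
    assume "a \<noteq> 0[K]"
    then have u: "a \<in> Units K" using K.field_Units y by blast
    define b where "b = inv\<^bsub>K\<^esub> a"
    have b: "b \<in> carrier K" "b \<otimes>\<^bsub>K\<^esub> a = \<one>\<^bsub>K\<^esub>" using u by (auto simp: b_def)
    have "-[W] (T x) = a *[W] w" using Ty y w lin_closed[OF T] Sc
     by (metis W.M.add.inv_equality W.M.minus_minus W.smult_closed W.M.a_inv_closed)
    then have "b *[W] -[W] (T x) = w" using b y w by (simp flip: W.smult_assoc1)
    then have "T (b *[V] -[V] x) = w"
     using b y Sc by (simp add: lin_smult[OF T] lin_uminus[OF T V W])
    then show False using no p(5,6) b y by blast
   qed
   then show ?thesis using y v Sc Ty triv lin_closed[OF T] w by simp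
  qed
  ultimately have "X \<in> \<A>" by (auto simp: \<A>_def)
  moreover have "S \<subseteq> X"
  proof
   fix x assume "x \<in> S"
   then show "x \<in> X" using XI[of x "0[K]"] v Sc by simp
  qed
  ultimately have "X = S" by (rule max)
  then have "v \<in> S" using XI[of "0[V]" "\<one>\<^bsub>K\<^esub>"] v p(2) by simp
  then show False using no v by blast
 qed
 define s where "s w = (SOME x. x \<in> S \<and> T x = w)" for w
 have s: "s w \<in> S" "T (s w) = w" if "w \<in> carrier W" for w
  using someI_ex[of "\<lambda>x. x \<in> S \<and> T x = w"] onto[OF that] unfolding s_def by blast+
 \<comment> \<open>\<open>T\<close> is injective on the complement \<open>S\<close>; linearity of
   \<open>s\<close> follows from the uniqueness of preimages there.\<close>
 have uniq: "x = y" if "x \<in> S" "y \<in> S" "T x = T y" for x y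
 proof -
  have "T (x -[V] y) = 0[W]" using that Sc lin_closed[OF T]
   by (simp add: lin_minus[OF T V W] W.M.minus_eq_zero_iff)
  then have "x -[V] y = 0[V]" using triv p(4) that by blast
  then show ?thesis using that Sc by (simp add: V.M.minus_eq_zero_iff)
 qed
 have "s \<in> lin_maps K W V"
 proof (rule lin_mapsI)
  show "\<And>x. x \<in> carrier W ==> s x \<in> carrier V" using s Sc by blast
  show "\<And>x y. x \<in> carrier W ==> y \<in> carrier W ==> s (x +[W] y) = s x +[V] s y"
   by (rule uniq) (auto simp: s p Sc lin_add[OF T])
  show "\<And>a x. a \<in> carrier K ==> x \<in> carrier W ==> s (a *[W] x) = a *[V] s x"
   by (rule uniq) (auto simp: s p Sc lin_smult[OF T])
 qed
 with s show ?thesis by blast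
qed

section \<open>Cohomology of cochain complexes\<close>

definition cocyc :: "(nat \<Rightarrow> ('k, 'a) module) \<Rightarrow> (nat \<Rightarrow> 'a \<Rightarrow> 'a) \<Rightarrow> nat \<Rightarrow> 'a set" where
 "cocyc A d n = {x \<in> carrier (A n). d n x = 0[A (Suc n)]}"

definition cobd :: "(nat \<Rightarrow> ('k, 'a) module) \<Rightarrow> (nat \<Rightarrow> 'a \<Rightarrow> 'a) \<Rightarrow> nat \<Rightarrow> 'a set" where
 "cobd A d n = (case n of 0 \<Rightarrow> {0[A 0]} | Suc m \<Rightarrow> d m ` carrier (A m))"

text \<open>The construction of \<open>cohomology\<close> for an arbitrary cochain complex;
  \<open>cohomology_H_mod\<close> identifies the two. The abstract form serves the connecting map
  and the comparison of complexes of different origin.\<close>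

definition H_mod :: "(nat \<Rightarrow> ('k, 'a) module) \<Rightarrow> (nat \<Rightarrow> 'a \<Rightarrow> 'a) \<Rightarrow> nat \<Rightarrow> ('k, 'a set) module" where
 "H_mod A d n = quot_mod ((A n)\<lparr>carrier := cocyc A d n\<rparr>) (cobd A d n)"

text \<open>Here \<open>A\<close>, \<open>d\<close> is the target complex. The union over
  representatives copies the form of \<open>ext_canonical_map\<close>, so that the latter unfolds to
  an instance.\<close>

definition H_map :: "(nat \<Rightarrow> ('k, 'a) module) \<Rightarrow> (nat \<Rightarrow> 'a \<Rightarrow> 'a) \<Rightarrow> nat \<Rightarrow> ('b \<Rightarrow> 'a) \<Rightarrow> 'b set \<Rightarrow> 'a set" where
 "H_map A d n f = (\<lambda>X. \<Union>x\<in>X. cobd A d n +>[A n] f x)"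

locale cocomplex =
 fixes K :: "'k ring" and A :: "nat \<Rightarrow> ('k, 'a) module" and d :: "nat \<Rightarrow> 'a \<Rightarrow> 'a"
 assumes mod: "module K (A n)"
  and lin: "d n \<in> lin_maps K (A n) (A (Suc n))"
  and dd: "x \<in> carrier (A n) ==> d (Suc n) (d n x) = 0[A (Suc (Suc n))]"
begin

abbreviation "cls n x \<equiv> cobd A d n +>[A n] x"

lemma kmod: "kmod K (A n)"
 unfolding kmod_def by (rule mod)

lemma cocyc_sub: "submodule (cocyc A d n) K (A n)"
 unfolding cocyc_def by (rule kernel_submodule[OF mod mod lin])

lemma cobd_sub: "submodule (cobd A d n) K (A n)"
 by (cases n) (auto simp: cobd_def intro: zero_submodule[OF mod] image_submodule[OF mod mod lin])

lemma cobd_cocyc: "x \<in> cobd A d n ==> x \<in> cocyc A d n"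
proof -
 interpret A: kmod K "A 0" by (rule kmod)
 assume "x \<in> cobd A d n"
 then show ?thesis
  by (cases n) (auto simp: cobd_def cocyc_def lin_zero[OF lin mod mod] lin_closed[OF lin] dd)
qed

lemma cocyc_carrier: "x \<in> cocyc A d n ==> x \<in> carrier (A n)"
 by (simp add: cocyc_def)

lemma cocyc_module: "module K ((A n)\<lparr>carrier := cocyc A d n\<rparr>)"
 by (rule submodule.submodule_is_module[OF cocyc_sub mod])

lemma cobd_sub_cocyc: "submodule (cobd A d n) K ((A n)\<lparr>carrier := cocyc A d n\<rparr>)"
proof -
 interpret A: kmod K "A n" by (rule kmod)
 interpret Z: kmod K "(A n)\<lparr>carrier := cocyc A d n\<rparr>" unfolding kmod_def by (rule cocyc_module)
 show ?thesis
  by (rule Z.submoduleI') (auto simp: A.submodule_props[OF cobd_sub] cobd_cocyc)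
qed

lemma H_module: "module K (H_mod A d n)"
proof -
 interpret Z: kmod K "(A n)\<lparr>carrier := cocyc A d n\<rparr>" unfolding kmod_def by (rule cocyc_module)
 show ?thesis unfolding H_mod_def by (rule Z.quot_module[OF cobd_sub_cocyc])
qed

lemma H_carrier: "carrier (H_mod A d n) = cls n ` cocyc A d n"
proof -
 interpret Z: kmod K "(A n)\<lparr>carrier := cocyc A d n\<rparr>" unfolding kmod_def by (rule cocyc_module)
 show ?thesis unfolding H_mod_def Z.quot_carrier by simp
qed

lemma H_zero: "0[H_mod A d n] = cobd A d n"
 by (simp add: H_mod_def quot_mod_def)

lemma cls_lin: "cls n \<in> lin_maps K ((A n)\<lparr>carrier := cocyc A d n\<rparr>) (H_mod A d n)"
proof -
 interpret Z: kmod K "(A n)\<lparr>carrier := cocyc A d n\<rparr>" unfolding kmod_def by (rule cocyc_module)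
 show ?thesis unfolding H_mod_def using Z.proj_lin[OF cobd_sub_cocyc] by simp
qed

lemma cls_add: "x \<in> cocyc A d n ==> y \<in> cocyc A d n ==>
  cls n x +[H_mod A d n] cls n y = cls n (x +[A n] y)"
 using lin_add[OF cls_lin] by simp

lemma cls_smult: "a \<in> carrier K ==> x \<in> cocyc A d n ==>
  a *[H_mod A d n] cls n x = cls n (a *[A n] x)"
 using lin_smult[OF cls_lin] by simp

lemma cls_eq_iff: "x \<in> cocyc A d n ==> y \<in> cocyc A d n ==>
  cls n x = cls n y \<longleftrightarrow> x -[A n] y \<in> cobd A d n"
 by (rule kmod.coset_eq_iff[OF kmod cobd_sub]) (auto intro: cocyc_carrier)

lemma cls_zero_iff: "x \<in> cocyc A d n ==> cls n x = 0[H_mod A d n] \<longleftrightarrow> x \<in> cobd A d n"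
 unfolding H_zero by (rule kmod.coset_eq_self_iff[OF kmod cobd_sub]) (auto intro: cocyc_carrier)

lemma H_cases:
 assumes "X \<in> carrier (H_mod A d n)"
 obtains x where "x \<in> cocyc A d n" "X = cls n x"
 using assms unfolding H_carrier by blast

lemma cocycI: "x \<in> carrier (A n) ==> d n x = 0[A (Suc n)] ==> x \<in> cocyc A d n"
 by (simp add: cocyc_def)

lemma cocyc_d: "x \<in> cocyc A d n ==> d n x = 0[A (Suc n)]"
 by (simp add: cocyc_def)

end

locale cochain_map = A: cocomplex K A d + B: cocomplex K B e
 for K :: "'k ring" and A :: "nat \<Rightarrow> ('k, 'a) module" and d and B :: "nat \<Rightarrow> ('k, 'b) module" and e +
 fixes f :: "nat \<Rightarrow> 'a \<Rightarrow> 'b"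
 assumes f_lin: "f n \<in> lin_maps K (A n) (B n)"
  and f_comm: "x \<in> carrier (A n) ==> f (Suc n) (d n x) = e n (f n x)"
begin

lemma f_cocyc: "x \<in> cocyc A d n ==> f n x \<in> cocyc B e n"
 using f_comm lin_zero[OF f_lin A.mod B.mod] lin_closed[OF f_lin] by (auto simp: cocyc_def simp flip: f_comm)

lemma f_cobd: "x \<in> cobd A d n ==> f n x \<in> cobd B e n"
 using lin_zero[OF f_lin A.mod B.mod] lin_closed[OF f_lin]
 by (cases n) (auto simp: cobd_def f_comm)

abbreviation "f_star n \<equiv> H_map B e n (f n)"

text \<open>Adding a coboundary to \<open>x\<close> changes \<open>f n x\<close> by a coboundary, so
  the union in \<open>H_map\<close> runs over a constant family.\<close>

lemma H_map_cls:
 assumes x: "x \<in> cocyc A d n" shows "f_star n (A.cls n x) = B.cls n (f n x)"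
proof -
 interpret An: kmod K "A n" by (rule A.kmod)
 interpret Bn: kmod K "B n" by (rule B.kmod)
 have xc: "x \<in> carrier (A n)" using x by (rule A.cocyc_carrier)
 show ?thesis unfolding H_map_def
 proof (rule An.UN_coset_eq[OF A.cobd_sub xc])
  fix w assume w: "w \<in> cobd A d n"
  then have wc: "w \<in> carrier (A n)" using An.submodule_props(1)[OF A.cobd_sub] by blast
  have c: "f n w \<in> carrier (B n)" "f n x \<in> carrier (B n)" using lin_closed[OF f_lin] wc xc by auto
  then have "f n (w +[A n] x) -[B n] f n x = f n w"
   using wc xc by (simp add: lin_add[OF f_lin] Bn.add_minus_cancel)
  then show "B.cls n (f n (w +[A n] x)) = B.cls n (f n x)"
   using f_cobd[OF w] c wc xc lin_closed[OF f_lin] by (simp add: Bn.coset_eq_iff[OF B.cobd_sub])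
 qed
qed

lemma H_map_lin: "f_star n \<in> lin_maps K (H_mod A d n) (H_mod B e n)"
proof (rule lin_mapsI)
 interpret An: kmod K "A n" by (rule A.kmod)
 note p = An.submodule_props[OF A.cocyc_sub]
 fix X assume X: "X \<in> carrier (H_mod A d n)"
 then obtain x where x: "x \<in> cocyc A d n" "X = A.cls n x" by (rule A.H_cases)
 then show "f_star n X \<in> carrier (H_mod B e n)" by (auto simp: H_map_cls B.H_carrier f_cocyc)
 { fix Y assume "Y \<in> carrier (H_mod A d n)"
  then obtain y where y: "y \<in> cocyc A d n" "Y = A.cls n y" by (rule A.H_cases)
  then show "f_star n (X +[H_mod A d n] Y) = f_star n X +[H_mod B e n] f_star n Y"
   using x by (simp add: A.cls_add H_map_cls p(3) B.cls_add f_cocyc lin_add[OF f_lin] A.cocyc_carrier) }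
 { fix a assume a: "a \<in> carrier K"
  then show "f_star n (a *[H_mod A d n] X) = a *[H_mod B e n] f_star n X"
   using x by (simp add: A.cls_smult H_map_cls p(6) B.cls_smult f_cocyc lin_smult[OF f_lin] A.cocyc_carrier) }
qed

text \<open>Bijectivity on classes, checked on cochains: every cocycle is hit up to a coboundary,
  and coboundaries are reflected. This is the form in which chain homotopies supply it.\<close>

lemma H_map_iso:
 assumes surj: "\<And>y. y \<in> cocyc B e n ==> \<exists>x\<in>cocyc A d n. y -[B n] f n x \<in> cobd B e n"
  and inj: "\<And>x. x \<in> cocyc A d n ==> f n x \<in> cobd B e n ==> x \<in> cobd A d n"
 shows "f_star n \<in> lin_isos K (H_mod A d n) (H_mod B e n)"
proof -
 interpret An: kmod K "A n" by (rule A.kmod)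
 interpret Bn: kmod K "B n" by (rule B.kmod)
 note p = An.submodule_props[OF A.cocyc_sub]
 have "inj_on (f_star n) (carrier (H_mod A d n))"
 proof (rule inj_onI)
  fix X Y assume "X \<in> carrier (H_mod A d n)" "Y \<in> carrier (H_mod A d n)" and eq: "f_star n X = f_star n Y"
  then obtain x y where x: "x \<in> cocyc A d n" "X = A.cls n x" and y: "y \<in> cocyc A d n" "Y = A.cls n y"
   by (metis A.H_cases)
  then have "f n x -[B n] f n y \<in> cobd B e n"
   using eq by (simp add: H_map_cls B.cls_eq_iff f_cocyc)
  then have "f n (x -[A n] y) \<in> cobd B e n"
   using x y by (simp add: lin_minus[OF f_lin A.mod B.mod] A.cocyc_carrier)
  then show "X = Y" using inj x y p(4) by (simp add: A.cls_eq_iff)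
 qed
 moreover have "f_star n ` carrier (H_mod A d n) = carrier (H_mod B e n)"
 proof
  show "f_star n ` carrier (H_mod A d n) \<subseteq> carrier (H_mod B e n)"
   using lin_closed[OF H_map_lin] by blast
  show "carrier (H_mod B e n) \<subseteq> f_star n ` carrier (H_mod A d n)"
  proof
   fix Y assume "Y \<in> carrier (H_mod B e n)"
   then obtain y where y: "y \<in> cocyc B e n" "Y = B.cls n y" by (rule B.H_cases)
   with surj obtain x where x: "x \<in> cocyc A d n" "y -[B n] f n x \<in> cobd B e n" by blast
   then have "Y = f_star n (A.cls n x)" using y by (simp add: H_map_cls B.cls_eq_iff f_cocyc)
   then show "Y \<in> f_star n ` carrier (H_mod A d n)" using x by (auto simp: A.H_carrier)
  qed
 qed
 ultimately show ?thesis using H_map_lin by (simp add: lin_isos_def bij_betw_def)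
qed

end

section \<open>The long exact cohomology sequence of a short exact sequence of complexes\<close>

lemma exact_at_iff:
 "exact_at U f V g W \<longleftrightarrow> f ` carrier U = {x \<in> carrier V. g x = 0[W]}"
 by (simp add: exact_at_def a_kernel_def kernel_def)

lemma exact_atI:
 assumes "\<And>u. u \<in> carrier U ==> f u \<in> carrier V" "\<And>u. u \<in> carrier U ==> g (f u) = 0[W]"
  and "\<And>v. v \<in> carrier V ==> g v = 0[W] ==> \<exists>u\<in>carrier U. v = f u"
 shows "exact_at U f V g W"
 unfolding exact_at_iff using assms by blast

locale short_exact = F: cochain_map K A dA B dB f + G: cochain_map K B dB C dC g
 for K :: "'k ring" and A :: "nat \<Rightarrow> ('k, 'a) module" and dA and B :: "nat \<Rightarrow> ('k, 'b) module" and dB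
  and C :: "nat \<Rightarrow> ('k, 'c) module" and dC and f g +
 assumes f_inj: "x \<in> carrier (A n) ==> f n x = 0[B n] ==> x = 0[A n]"
  and g_surj: "z \<in> carrier (C n) ==> \<exists>y\<in>carrier (B n). g n y = z"
  and gf: "x \<in> carrier (A n) ==> g n (f n x) = 0[C n]"
  and ker_g: "y \<in> carrier (B n) ==> g n y = 0[C n] ==> \<exists>x\<in>carrier (A n). f n x = y"
begin

lemma f_injD:
 assumes "x \<in> carrier (A n)" "y \<in> carrier (A n)" "f n x = f n y" shows "x = y"
proof -
 interpret An: kmod K "A n" by (rule F.A.kmod)
 interpret Bn: kmod K "B n" by (rule F.B.kmod)
 have "f n (x -[A n] y) = 0[B n]"
  using assms lin_closed[OF F.f_lin] by (simp add: lin_minus[OF F.f_lin F.A.mod F.B.mod] Bn.minus_eq_zero_iff)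
 then have "x -[A n] y = 0[A n]" using f_inj assms by simp
 then show ?thesis using assms by (simp add: An.minus_eq_zero_iff)
qed

text \<open>By surjectivity of \<open>g\<close> one degree lower, the cochain bounding
  \<open>z\<close> can be lifted first and differentiated afterwards. In degree 0 there is only the
  zero coboundary.\<close>

lemma g_cobd: "z \<in> cobd C dC n ==> \<exists>y\<in>cobd B dB n. g n y = z"
proof (cases n)
 case (Suc m)
 assume "z \<in> cobd C dC n"
 then obtain c where c: "c \<in> carrier (C m)" "z = dC m c" by (auto simp: cobd_def Suc)
 with g_surj obtain b where "b \<in> carrier (B m)" "g m b = c" by blast
 then show ?thesis using c G.f_comm[of b m] by (intro bexI[of _ "dB m b"]) (simp_all add: cobd_def Suc)
qed (auto simp: cobd_def lin_zero[OF G.f_lin F.B.mod G.B.mod])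

text \<open>The zig-zag of the snake lemma as a relation: \<open>b\<close> lifts a cocycle of
  \<open>C\<close>, and \<open>a\<close> is the pullback of its differential along \<open>f\<close>.
  Working with the relation postpones all choices to \<open>conn\<close>.\<close>

definition conn_rel :: "nat \<Rightarrow> 'b \<Rightarrow> 'a \<Rightarrow> bool" where
 "conn_rel n b a \<longleftrightarrow> b \<in> carrier (B n) \<and> g n b \<in> cocyc C dC n \<and> a \<in> carrier (A (Suc n)) \<and>
   f (Suc n) a = dB n b"

lemma conn_rel_cocyc: assumes "conn_rel n b a" shows "a \<in> cocyc A dA (Suc n)"
proof (rule F.A.cocycI)
 have a: "a \<in> carrier (A (Suc n))" "b \<in> carrier (B n)" "f (Suc n) a = dB n b"
  using assms by (auto simp: conn_rel_def)
 then show "a \<in> carrier (A (Suc n))" by simp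
 show "dA (Suc n) a = 0[A (Suc (Suc n))]"
  by (rule f_inj) (use a lin_closed[OF F.A.lin] in "auto simp: F.f_comm F.B.dd")
qed

lemma conn_rel_ex: assumes "c \<in> cocyc C dC n" shows "\<exists>b a. conn_rel n b a \<and> g n b = c"
proof -
 obtain b where b: "b \<in> carrier (B n)" "g n b = c" using g_surj G.B.cocyc_carrier[OF assms] by blast
 then have "g (Suc n) (dB n b) = 0[C (Suc n)]" using assms by (simp add: G.f_comm G.B.cocyc_d)
 then obtain a where "a \<in> carrier (A (Suc n))" "f (Suc n) a = dB n b"
  using ker_g lin_closed[OF F.B.lin b(1)] by blast
 then show ?thesis using b assms by (auto simp: conn_rel_def)
qed

text \<open>For two zig-zags over the same class, the lifts \<open>b\<close> and \<open>b'\<close>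
  differ, up to a cocycle \<open>\<beta>\<close>, by an element \<open>f n x\<close>; then
  \<open>a - a'\<close> is the differential of \<open>x\<close>.\<close>

lemma conn_rel_unique:
 assumes "conn_rel n b a" "conn_rel n b' a'" "G.B.cls n (g n b) = G.B.cls n (g n b')"
 shows "F.A.cls (Suc n) a = F.A.cls (Suc n) a'"
proof -
 interpret An: kmod K "A n" by (rule F.A.kmod)
 interpret ASn: kmod K "A (Suc n)" by (rule F.A.kmod)
 interpret Bn: kmod K "B n" by (rule F.B.kmod)
 interpret BSn: kmod K "B (Suc n)" by (rule F.B.kmod)
 interpret Cn: kmod K "C n" by (rule G.B.kmod)
 have r: "b \<in> carrier (B n)" "b' \<in> carrier (B n)" "a \<in> carrier (A (Suc n))" "a' \<in> carrier (A (Suc n))"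
  "f (Suc n) a = dB n b" "f (Suc n) a' = dB n b'" "g n b \<in> cocyc C dC n" "g n b' \<in> cocyc C dC n"
  using assms by (auto simp: conn_rel_def)
 then have "g n b -[C n] g n b' \<in> cobd C dC n" using assms(3) by (simp add: G.B.cls_eq_iff)
 then obtain \<beta> where \<beta>: "\<beta> \<in> cobd B dB n" "g n \<beta> = g n b -[C n] g n b'" using g_cobd by blast
 have \<beta>c: "\<beta> \<in> carrier (B n)" "dB n \<beta> = 0[B (Suc n)]"
  using F.B.cobd_cocyc[OF \<beta>(1)] by (auto simp: cocyc_def)
 let ?y = "(b -[B n] b') -[B n] \<beta>"
 have "g n ?y = 0[C n]" using r \<beta> \<beta>c lin_closed[OF G.f_lin]
  by (simp add: lin_minus[OF G.f_lin F.B.mod G.B.mod] Cn.minus_eq_zero_iff)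
 then obtain x where x: "x \<in> carrier (A n)" "f n x = ?y" using ker_g r \<beta>c by (metis Bn.minus_closed)
 have "f (Suc n) (a -[A (Suc n)] a') = f (Suc n) (dA n x)"
  using r \<beta>c x lin_closed[OF F.B.lin, of _ n]
  by (simp add: lin_minus[OF F.f_lin F.A.mod F.B.mod] lin_minus[OF F.B.lin F.B.mod F.B.mod] F.f_comm)
 then have "a -[A (Suc n)] a' = dA n x"
  using f_injD r x lin_closed[OF F.A.lin] by (metis ASn.minus_closed)
 then have "a -[A (Suc n)] a' \<in> cobd A dA (Suc n)" using x by (simp add: cobd_def)
 then show ?thesis using F.A.cls_eq_iff conn_rel_cocyc assms by blast
qed

definition conn :: "nat \<Rightarrow> 'c set \<Rightarrow> 'a set" where
 "conn n X = (SOME Y. \<exists>b a. conn_rel n b a \<and> X = G.B.cls n (g n b) \<and> Y = F.A.cls (Suc n) a)"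

lemma conn_eq: assumes "conn_rel n b a" shows "conn n (G.B.cls n (g n b)) = F.A.cls (Suc n) a"
 unfolding conn_def
proof (rule some_equality)
 fix Y assume "\<exists>b' a'. conn_rel n b' a' \<and> G.B.cls n (g n b) = G.B.cls n (g n b') \<and> Y = F.A.cls (Suc n) a'"
 then show "Y = F.A.cls (Suc n) a" using conn_rel_unique assms by metis
qed (use assms in blast)

lemma conn_cases:
 assumes "X \<in> carrier (H_mod C dC n)"
 obtains b a where "conn_rel n b a" "X = G.B.cls n (g n b)" "conn n X = F.A.cls (Suc n) a"
 using assms conn_rel_ex conn_eq by (metis G.B.H_cases)

lemma conn_rel_add: "conn_rel n b a ==> conn_rel n b' a' ==> conn_rel n (b +[B n] b') (a +[A (Suc n)] a')"
proof -
 interpret ASn: kmod K "A (Suc n)" by (rule F.A.kmod)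
 interpret Bn: kmod K "B n" by (rule F.B.kmod)
 interpret Cn: kmod K "C n" by (rule G.B.kmod)
 show "conn_rel n b a ==> conn_rel n b' a' ==> conn_rel n (b +[B n] b') (a +[A (Suc n)] a')"
  by (simp add: conn_rel_def lin_add[OF G.f_lin] lin_add[OF F.f_lin] lin_add[OF F.B.lin]
    Cn.submodule_props[OF G.B.cocyc_sub])
qed

lemma conn_rel_smult: "conn_rel n b a ==> k \<in> carrier K ==> conn_rel n (k *[B n] b) (k *[A (Suc n)] a)"
proof -
 interpret ASn: kmod K "A (Suc n)" by (rule F.A.kmod)
 interpret Bn: kmod K "B n" by (rule F.B.kmod)
 interpret Cn: kmod K "C n" by (rule G.B.kmod)
 show "conn_rel n b a ==> k \<in> carrier K ==> conn_rel n (k *[B n] b) (k *[A (Suc n)] a)"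
  by (simp add: conn_rel_def lin_smult[OF G.f_lin] lin_smult[OF F.f_lin] lin_smult[OF F.B.lin]
    Cn.submodule_props[OF G.B.cocyc_sub])
qed

lemma conn_relD: "conn_rel n b a ==> b \<in> carrier (B n)" "conn_rel n b a ==> g n b \<in> cocyc C dC n"
 "conn_rel n b a ==> a \<in> carrier (A (Suc n))" "conn_rel n b a ==> f (Suc n) a = dB n b"
 by (auto simp: conn_rel_def)

lemma conn_lin: "conn n \<in> lin_maps K (H_mod C dC n) (H_mod A dA (Suc n))"
proof (rule lin_mapsI)
 fix X assume "X \<in> carrier (H_mod C dC n)"
 then obtain b a where ba: "conn_rel n b a" "X = G.B.cls n (g n b)" "conn n X = F.A.cls (Suc n) a"
  by (rule conn_cases)
 then show "conn n X \<in> carrier (H_mod A dA (Suc n))"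
  using conn_rel_cocyc by (auto simp: F.A.H_carrier)
 { fix Y assume "Y \<in> carrier (H_mod C dC n)"
  then obtain b' a' where ba': "conn_rel n b' a'" "Y = G.B.cls n (g n b')" "conn n Y = F.A.cls (Suc n) a'"
   by (rule conn_cases)
  have "X +[H_mod C dC n] Y = G.B.cls n (g n (b +[B n] b'))"
   using ba ba' conn_relD[OF ba(1)] conn_relD[OF ba'(1)] by (simp add: G.B.cls_add lin_add[OF G.f_lin])
  then show "conn n (X +[H_mod C dC n] Y) = conn n X +[H_mod A dA (Suc n)] conn n Y"
   using conn_eq[OF conn_rel_add[OF ba(1) ba'(1)]] ba ba'
   by (simp add: F.A.cls_add conn_rel_cocyc) }
 { fix k assume k: "k \<in> carrier K"
  have "k *[H_mod C dC n] X = G.B.cls n (g n (k *[B n] b))"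
   using ba k conn_relD[OF ba(1)] by (simp add: G.B.cls_smult lin_smult[OF G.f_lin])
  then show "conn n (k *[H_mod C dC n] X) = k *[H_mod A dA (Suc n)] conn n X"
   using conn_eq[OF conn_rel_smult[OF ba(1) k]] ba k
   by (simp add: F.A.cls_smult conn_rel_cocyc) }
qed

text \<open>If \<open>g y\<close> is a coboundary, it lifts to a coboundary \<open>\<beta>\<close>.
  The representative \<open>y - \<beta>\<close> of the same class is killed by \<open>g\<close>, so
  it comes from \<open>A\<close>, and from a cocycle there because \<open>f\<close> is
  injective.\<close>

lemma exact_middle: "exact_at (H_mod A dA n) (F.f_star n) (H_mod B dB n) (G.f_star n) (H_mod C dC n)"
proof (rule exact_atI)
 interpret Bn: kmod K "B n" by (rule F.B.kmod)
 interpret Cn: kmod K "C n" by (rule G.B.kmod)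
 fix X assume "X \<in> carrier (H_mod A dA n)"
 then show "F.f_star n X \<in> carrier (H_mod B dB n)" by (rule lin_closed[OF F.H_map_lin])
 from \<open>X \<in> _\<close> obtain x where x: "x \<in> cocyc A dA n" "X = F.A.cls n x" by (rule F.A.H_cases)
 then have "G.f_star n (F.f_star n X) = G.B.cls n 0[C n]"
  by (simp add: F.H_map_cls G.H_map_cls F.f_cocyc gf F.A.cocyc_carrier)
 then show "G.f_star n (F.f_star n X) = 0[H_mod C dC n]"
  by (simp add: G.B.H_zero Cn.coset_zero[OF G.B.cobd_sub])
next
 interpret Bn: kmod K "B n" by (rule F.B.kmod)
 interpret BSn: kmod K "B (Suc n)" by (rule F.B.kmod)
 interpret Cn: kmod K "C n" by (rule G.B.kmod)
 fix Y assume "Y \<in> carrier (H_mod B dB n)" and z: "G.f_star n Y = 0[H_mod C dC n]"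
 then obtain y where y: "y \<in> cocyc B dB n" "Y = F.B.cls n y" by (metis F.B.H_cases)
 then have "g n y \<in> cobd C dC n" using z by (simp add: G.H_map_cls G.B.cls_zero_iff G.f_cocyc)
 then obtain \<beta> where \<beta>: "\<beta> \<in> cobd B dB n" "g n \<beta> = g n y" using g_cobd by blast
 have \<beta>c: "\<beta> \<in> cocyc B dB n" using F.B.cobd_cocyc[OF \<beta>(1)] .
 have yc: "y \<in> carrier (B n)" and bc: "\<beta> \<in> carrier (B n)" using y \<beta>c F.B.cocyc_carrier by auto
 have "g n (y -[B n] \<beta>) = 0[C n]" using yc bc lin_closed[OF G.f_lin] \<beta>
  by (simp add: lin_minus[OF G.f_lin F.B.mod G.B.mod] Cn.minus_eq_zero_iff)
 then obtain x where x: "x \<in> carrier (A n)" "f n x = y -[B n] \<beta>" using ker_g yc bc by (metis Bn.minus_closed)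
 have "f (Suc n) (dA n x) = 0[B (Suc n)]"
  using x yc bc y \<beta>c by (simp add: F.f_comm lin_minus[OF F.B.lin F.B.mod F.B.mod] F.B.cocyc_d)
 then have xz: "x \<in> cocyc A dA n" using x f_inj lin_closed[OF F.A.lin] by (auto simp: cocyc_def)
 have "y -[B n] f n x = \<beta>"
  using x yc bc by (simp add: Bn.minus_eq Bn.minus_add Bn.r_neg2)
 then have "F.f_star n (F.A.cls n x) = Y" using y xz \<beta> F.B.cls_eq_iff[OF y(1) F.f_cocyc[OF xz]]
  by (simp add: F.H_map_cls)
 then show "\<exists>X\<in>carrier (H_mod A dA n). Y = F.f_star n X" using xz by (auto simp: F.A.H_carrier)
qed

text \<open>A cocycle \<open>y\<close> of \<open>B\<close> has differential zero, so
  \<open>0\<close> is a partner of \<open>y\<close> in \<open>conn_rel\<close>. Conversely, if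
  \<open>a = dA a'\<close>, then \<open>b - f a'\<close> is a cocycle with the same image under
  \<open>g\<close> as \<open>b\<close>.\<close>

lemma exact_right: "exact_at (H_mod B dB n) (G.f_star n) (H_mod C dC n) (conn n) (H_mod A dA (Suc n))"
proof (rule exact_atI)
 fix Y assume "Y \<in> carrier (H_mod B dB n)"
 then show "G.f_star n Y \<in> carrier (H_mod C dC n)" by (rule lin_closed[OF G.H_map_lin])
 interpret ASn: kmod K "A (Suc n)" by (rule F.A.kmod)
 from \<open>Y \<in> _\<close> obtain y where y: "y \<in> cocyc B dB n" "Y = F.B.cls n y" by (rule F.B.H_cases)
 then have "conn_rel n y 0[A (Suc n)]"
  by (simp add: conn_rel_def F.B.cocyc_carrier G.f_cocyc F.B.cocyc_d lin_zero[OF F.f_lin F.A.mod F.B.mod])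
 from conn_eq[OF this] show "conn n (G.f_star n Y) = 0[H_mod A dA (Suc n)]"
  using y by (simp add: G.H_map_cls F.A.H_zero ASn.coset_zero[OF F.A.cobd_sub])
next
 interpret Bn: kmod K "B n" by (rule F.B.kmod)
 interpret BSn: kmod K "B (Suc n)" by (rule F.B.kmod)
 interpret Cn: kmod K "C n" by (rule G.B.kmod)
 fix X assume "X \<in> carrier (H_mod C dC n)" and z: "conn n X = 0[H_mod A dA (Suc n)]"
 then obtain b a where ba: "conn_rel n b a" "X = G.B.cls n (g n b)" "conn n X = F.A.cls (Suc n) a"
  by (metis conn_cases)
 note r = conn_relD[OF ba(1)]
 have "a \<in> cobd A dA (Suc n)" using ba z conn_rel_cocyc by (simp add: F.A.cls_zero_iff)
 then obtain a' where a': "a' \<in> carrier (A n)" "a = dA n a'" by (auto simp: cobd_def)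
 let ?b = "b -[B n] f n a'"
 have c: "f n a' \<in> carrier (B n)" using lin_closed[OF F.f_lin] a' by blast
 have "dB n ?b = 0[B (Suc n)]" using r a' c lin_closed[OF F.B.lin, of _ n]
  by (simp add: lin_minus[OF F.B.lin F.B.mod F.B.mod] F.f_comm BSn.minus_eq_zero_iff flip: r(4))
 then have bz: "?b \<in> cocyc B dB n" using r c by (simp add: cocyc_def)
 have "g n ?b = g n b" using r c a' lin_closed[OF G.f_lin]
  by (simp add: lin_minus[OF G.f_lin F.B.mod G.B.mod] gf)
 then have "G.f_star n (F.B.cls n ?b) = X" using ba bz by (simp add: G.H_map_cls)
 then show "\<exists>Y\<in>carrier (H_mod B dB n). X = G.f_star n Y" using bz by (auto simp: F.B.H_carrier)
qed

text \<open>An equation \<open>f a = dB b\<close> says at once that the image of \<open>a\<close>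
  bounds and, after applying \<open>g\<close>, that \<open>g b\<close> is a cocycle whose connecting
  image is the class of \<open>a\<close>.\<close>

lemma exact_left: "exact_at (H_mod C dC n) (conn n) (H_mod A dA (Suc n)) (F.f_star (Suc n)) (H_mod B dB (Suc n))"
proof (rule exact_atI)
 fix X assume "X \<in> carrier (H_mod C dC n)"
 then show "conn n X \<in> carrier (H_mod A dA (Suc n))" by (rule lin_closed[OF conn_lin])
 from \<open>X \<in> _\<close> obtain b a where ba: "conn_rel n b a" "X = G.B.cls n (g n b)" "conn n X = F.A.cls (Suc n) a"
  by (rule conn_cases)
 note r = conn_relD[OF ba(1)]
 have "f (Suc n) a \<in> cobd B dB (Suc n)" using r by (simp add: cobd_def)
 then show "F.f_star (Suc n) (conn n X) = 0[H_mod B dB (Suc n)]"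
  using ba conn_rel_cocyc[OF ba(1)] by (simp add: F.H_map_cls F.B.cls_zero_iff F.f_cocyc)
next
 fix Y assume "Y \<in> carrier (H_mod A dA (Suc n))" and z: "F.f_star (Suc n) Y = 0[H_mod B dB (Suc n)]"
 then obtain a where a: "a \<in> cocyc A dA (Suc n)" "Y = F.A.cls (Suc n) a" by (metis F.A.H_cases)
 then have "f (Suc n) a \<in> cobd B dB (Suc n)" using z by (simp add: F.H_map_cls F.B.cls_zero_iff F.f_cocyc)
 then obtain b where b: "b \<in> carrier (B n)" "f (Suc n) a = dB n b" by (auto simp: cobd_def)
 have "dC n (g n b) = 0[C (Suc n)]"
  using b a gf[of a "Suc n"] by (simp add: F.A.cocyc_carrier flip: G.f_comm)
 then have gb: "g n b \<in> cocyc C dC n" using b lin_closed[OF G.f_lin] by (simp add: cocyc_def)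
 then have "conn_rel n b a" using a b by (simp add: conn_rel_def F.A.cocyc_carrier)
 from conn_eq[OF this] show "\<exists>X\<in>carrier (H_mod C dC n). Y = conn n X"
  using gb a by (auto simp: G.B.H_carrier)
qed

end

section \<open>Isomorphisms of spaces and of complexes\<close>

lemma lin_isos_comp:
 assumes "f \<in> lin_isos K U V" "g \<in> lin_isos K V W" shows "(\<lambda>x. g (f x)) \<in> lin_isos K U W"
 using assms bij_betw_trans[of f "carrier U" "carrier V" g "carrier W"] lin_comp[of f K U V g W]
 by (simp add: lin_isos_def comp_def)

lemma lin_isos_cong:
 assumes S: "S \<in> lin_isos K V W" and V: "module K V" and e: "\<And>x. x \<in> carrier V ==> T x = S x"
 shows "T \<in> lin_isos K V W"
 using S module.mod_ops_closed[OF V] e bij_betw_cong[of "carrier V" T S "carrier W"] by (auto simp: lin_isos_def lin_maps_def)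

text \<open>The inverse of a degreewise bijective chain map is automatically compatible with the
  differentials, so preimages of cocycles and of coboundaries are again of the same kind.\<close>

lemma (in cochain_map) H_map_bij:
 assumes bij: "\<And>n. bij_betw (f n) (carrier (A n)) (carrier (B n))"
 shows "f_star n \<in> lin_isos K (H_mod A d n) (H_mod B e n)"
proof (rule H_map_iso)
 have inj: "x = y" if "f n x = f n y" "x \<in> carrier (A n)" "y \<in> carrier (A n)" for x y n
  using bij_betw_imp_inj_on[OF bij, THEN inj_onD, OF that] .
 have sur: "\<exists>x\<in>carrier (A n). f n x = y" if "y \<in> carrier (B n)" for y n
  using that unfolding bij_betw_imp_surj_on[OF bij, of n, symmetric] by (auto simp: image_iff)
 have f0: "f n 0[A n] = 0[B n]" for n by (rule lin_zero[OF f_lin A.mod B.mod])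
 have zc: "0[A n] \<in> carrier (A n)" for n by (rule abelian_monoid.zero_closed[OF abelian_group.axioms(1)[OF module_abelian_group[OF A.mod]]])
 {
  fix y assume y: "y \<in> cocyc B e n"
  obtain x where x: "x \<in> carrier (A n)" "f n x = y" using sur[OF B.cocyc_carrier[OF y]] by blast
  have "f (Suc n) (d n x) = f (Suc n) 0[A (Suc n)]" using f_comm[OF x(1)] x(2) B.cocyc_d[OF y] f0 by simp
  then have "d n x = 0[A (Suc n)]" by (rule inj[OF _ lin_closed[OF A.lin x(1)] zc])
  then have xc: "x \<in> cocyc A d n" by (rule A.cocycI[OF x(1)])
  interpret BK: kmod K "B n" by (rule B.kmod)
  have "y -[B n] f n x \<in> cobd B e n"
   using BK.submodule_props(2)[OF B.cobd_sub] BK.minus_eq_zero_iff[OF B.cocyc_carrier[OF y] B.cocyc_carrier[OF y]] x(2) by simp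
  then show "\<exists>x\<in>cocyc A d n. y -[B n] f n x \<in> cobd B e n" using xc by blast
 }
 fix x assume x: "x \<in> cocyc A d n" and fx: "f n x \<in> cobd B e n"
 note xc = A.cocyc_carrier[OF x]
 show "x \<in> cobd A d n"
 proof (cases n)
  case 0
  then have "f n x = f n 0[A n]" using fx f0[of n] by (simp add: cobd_def)
  then show ?thesis using inj[OF _ xc zc] 0 by (simp add: cobd_def)
 next
  case (Suc m)
  then obtain y where y: "y \<in> carrier (B m)" "f n x = e m y" using fx by (auto simp: cobd_def)
  obtain x' where x': "x' \<in> carrier (A m)" "f m x' = y" using sur[OF y(1)] by blast
  have "f n x = f n (d m x')" using y(2) x'(2) f_comm[OF x'(1)] Suc by simp
  then have "x = d m x'" using inj[OF _ xc] lin_closed[OF A.lin x'(1)] Suc by simp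
  then show ?thesis using x'(1) Suc by (auto simp: cobd_def)
 qed
qed

section \<open>Modules over a \<open>K\<close>-category\<close>

text \<open>\<open>k_category\<close> shows that \<open>K\<close> is a commutative ring only through
  its Hom-modules, hence only if there is an object. The locale asks for it outright.\<close>

locale kcat = k_category K C + K: cring K for K :: "'k ring" and C :: "('k, 'o, 'm) kcat"

text \<open>Morphisms of modules without the extensionality built into \<open>nat_trans\<close>, so
  that plain lambda terms qualify and compose by substitution. \<open>ext_hom\<close> leads back to
  \<open>nat_trans\<close> where equality of morphisms matters.\<close>

definition mod_hom ::
  "'k ring \<Rightarrow> ('k, 'o, 'm) kcat \<Rightarrow> ('k, 'o, 'm, 'v) cmod \<Rightarrow> ('k, 'o, 'm, 'w) cmod \<Rightarrow>
   ('o \<Rightarrow> 'v \<Rightarrow> 'w) \<Rightarrow> bool" where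
 "mod_hom K C M N \<eta> \<longleftrightarrow>
   (\<forall>X\<in>Obj C. \<eta> X \<in> lin_maps K (On M X) (On N X)) \<and>
   (\<forall>X\<in>Obj C. \<forall>Y\<in>Obj C. \<forall>f\<in>Mor C X Y. \<forall>x\<in>El M X.
    \<eta> Y (Act M X Y f x) = Act N X Y f (\<eta> X x))"

definition ext_hom :: "('k, 'o, 'm) kcat \<Rightarrow> ('k, 'o, 'm, 'v) cmod \<Rightarrow> ('o \<Rightarrow> 'v \<Rightarrow> 'w) \<Rightarrow> 'o \<Rightarrow> 'v \<Rightarrow> 'w" where
 "ext_hom C M \<eta> = (\<lambda>X\<in>Obj C. \<lambda>x\<in>El M X. \<eta> X x)"

lemma hom_lin: "mod_hom K C M N \<eta> ==> X \<in> Obj C ==> \<eta> X \<in> lin_maps K (On M X) (On N X)"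
 by (simp add: mod_hom_def)

lemma hom_closed: "mod_hom K C M N \<eta> ==> X \<in> Obj C ==> x \<in> El M X ==> \<eta> X x \<in> El N X"
 by (meson hom_lin lin_closed)

lemma hom_add: "mod_hom K C M N \<eta> ==> X \<in> Obj C ==> x \<in> El M X ==> y \<in> El M X ==>
  \<eta> X (x +[On M X] y) = \<eta> X x +[On N X] \<eta> X y"
 by (meson hom_lin lin_add)

lemma hom_smult: "mod_hom K C M N \<eta> ==> X \<in> Obj C ==> a \<in> carrier K ==> x \<in> El M X ==>
  \<eta> X (a *[On M X] x) = a *[On N X] \<eta> X x"
 by (meson hom_lin lin_smult)

lemma hom_nat: "mod_hom K C M N \<eta> ==> X \<in> Obj C ==> Y \<in> Obj C ==> f \<in> Mor C X Y ==>
  x \<in> El M X ==> \<eta> Y (Act M X Y f x) = Act N X Y f (\<eta> X x)"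
 by (simp add: mod_hom_def)

lemma hom_zero: "mod_hom K C M N \<eta> ==> c_module K C M ==> c_module K C N ==> X \<in> Obj C ==>
  \<eta> X 0[On M X] = 0[On N X]"
 by (meson hom_lin lin_zero c_module.on_module)

lemma hom_minus: "mod_hom K C M N \<eta> ==> c_module K C M ==> c_module K C N ==> X \<in> Obj C ==>
  x \<in> El M X ==> y \<in> El M X ==>
  \<eta> X (x -[On M X] y) = \<eta> X x -[On N X] \<eta> X y"
 by (meson hom_lin lin_minus c_module.on_module)

lemma hom_comp: "mod_hom K C L M \<eta> ==> mod_hom K C M N \<theta> ==> mod_hom K C L N (\<lambda>X x. \<theta> X (\<eta> X x))"
 unfolding mod_hom_def[of K C L N]
 by (intro conjI ballI) (blast intro: lin_comp hom_lin, simp add: hom_nat hom_closed)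

lemma hom_id: "mod_hom K C M M (\<lambda>X x. x)"
 by (auto simp: mod_hom_def lin_maps_def)

lemma on_kmod: "c_module K C M ==> X \<in> Obj C ==> kmod K (On M X)"
 unfolding kmod_def by (rule c_module.on_module)

lemma mod_closed:
 assumes "module K V"
 shows "0[V] \<in> carrier V"
  and "x \<in> carrier V ==> y \<in> carrier V ==> x +[V] y \<in> carrier V"
  and "x \<in> carrier V ==> y \<in> carrier V ==> x -[V] y \<in> carrier V"
  and "a \<in> carrier K ==> x \<in> carrier V ==> a *[V] x \<in> carrier V"
proof -
 interpret module K V by fact
 show "0[V] \<in> carrier V"
  and "x \<in> carrier V ==> y \<in> carrier V ==> x +[V] y \<in> carrier V"
  and "x \<in> carrier V ==> y \<in> carrier V ==> x -[V] y \<in> carrier V"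
  and "a \<in> carrier K ==> x \<in> carrier V ==> a *[V] x \<in> carrier V" by auto
qed

lemmas on_closed = mod_closed[OF c_module.on_module]

lemma act_closed: "c_module K C M ==> X \<in> Obj C ==> Y \<in> Obj C ==> f \<in> Mor C X Y ==>
  x \<in> El M X ==> Act M X Y f x \<in> El M Y"
 by (meson c_module.act_linear lin_closed)

lemma act_add: "c_module K C M ==> X \<in> Obj C ==> Y \<in> Obj C ==> f \<in> Mor C X Y ==>
  x \<in> El M X ==> y \<in> El M X ==>
  Act M X Y f (x +[On M X] y) = Act M X Y f x +[On M Y] Act M X Y f y"
 by (meson c_module.act_linear lin_add)

lemma act_smult: "c_module K C M ==> X \<in> Obj C ==> Y \<in> Obj C ==> f \<in> Mor C X Y ==>
  a \<in> carrier K ==> x \<in> El M X ==>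
  Act M X Y f (a *[On M X] x) = a *[On M Y] Act M X Y f x"
 by (meson c_module.act_linear lin_smult)

lemma act_zero: "c_module K C M ==> X \<in> Obj C ==> Y \<in> Obj C ==> f \<in> Mor C X Y ==>
  Act M X Y f 0[On M X] = 0[On M Y]"
 by (meson c_module.act_linear lin_zero c_module.on_module)

lemma act_hom_add: "c_module K C M ==> X \<in> Obj C ==> Y \<in> Obj C ==> f \<in> Mor C X Y ==>
  g \<in> Mor C X Y ==> x \<in> El M X ==>
  Act M X Y (f +[Hom C X Y] g) x = Act M X Y f x +[On M Y] Act M X Y g x"
 using lin_add[OF c_module.act_linear_hom] by fastforce

lemma act_hom_smult: "c_module K C M ==> X \<in> Obj C ==> Y \<in> Obj C ==> f \<in> Mor C X Y ==>
  a \<in> carrier K ==> x \<in> El M X ==>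
  Act M X Y (a *[Hom C X Y] f) x = a *[On M Y] Act M X Y f x"
 using lin_smult[OF c_module.act_linear_hom] by fastforce

lemmas act_id = c_module.act_id
lemmas act_comp = c_module.act_comp

lemma c_moduleI:
 assumes "\<And>X. X \<in> Obj C ==> module K (On M X)"
  and "\<And>X Y f x. X \<in> Obj C ==> Y \<in> Obj C ==> f \<in> Mor C X Y ==> x \<in> El M X ==>
   Act M X Y f x \<in> El M Y"
  and "\<And>X Y f x y. X \<in> Obj C ==> Y \<in> Obj C ==> f \<in> Mor C X Y ==> x \<in> El M X ==>
   y \<in> El M X ==> Act M X Y f (x +[On M X] y) = Act M X Y f x +[On M Y] Act M X Y f y"
  and "\<And>X Y f a x. X \<in> Obj C ==> Y \<in> Obj C ==> f \<in> Mor C X Y ==> a \<in> carrier K ==>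
   x \<in> El M X ==> Act M X Y f (a *[On M X] x) = a *[On M Y] Act M X Y f x"
  and "\<And>X Y f g x. X \<in> Obj C ==> Y \<in> Obj C ==> f \<in> Mor C X Y ==> g \<in> Mor C X Y ==>
   x \<in> El M X ==> Act M X Y (f +[Hom C X Y] g) x = Act M X Y f x +[On M Y] Act M X Y g x"
  and "\<And>X Y f a x. X \<in> Obj C ==> Y \<in> Obj C ==> f \<in> Mor C X Y ==> a \<in> carrier K ==>
   x \<in> El M X ==> Act M X Y (a *[Hom C X Y] f) x = a *[On M Y] Act M X Y f x"
  and "\<And>X x. X \<in> Obj C ==> x \<in> El M X ==> Act M X X (Id C X) x = x"
  and "\<And>X Y Z f g x. X \<in> Obj C ==> Y \<in> Obj C ==> Z \<in> Obj C ==> f \<in> Mor C X Y ==>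
   g \<in> Mor C Y Z ==> x \<in> El M X ==>
   Act M X Z (Comp C X Y Z g f) x = Act M Y Z g (Act M X Y f x)"
 shows "c_module K C M"
 by (rule c_module.intro) (auto intro!: lin_mapsI assms)

lemma epiI: "mod_hom K C M N e ==> (\<And>X y. X \<in> Obj C ==> y \<in> El N X ==>
  \<exists>x\<in>El M X. e X x = y) ==> epi C M N e"
 unfolding epi_def using hom_closed by fastforce

lemma epiD: "epi C M N e ==> X \<in> Obj C ==> y \<in> El N X ==> \<exists>x\<in>El M X. e X x = y"
 unfolding epi_def by (metis imageE)

lemma nat_trans_hom: "\<eta> \<in> nat_trans K C M N ==> mod_hom K C M N \<eta>"
 by (simp add: nat_trans_def mod_hom_def)

lemma ext_hom_apply: "X \<in> Obj C ==> x \<in> El M X ==> ext_hom C M \<eta> X x = \<eta> X x"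
 by (simp add: ext_hom_def)

lemma epi_ext_hom [simp]: "epi C M N (ext_hom C M e) \<longleftrightarrow> epi C M N e"
 unfolding epi_def by (simp add: ext_hom_apply cong: image_cong)

text \<open>The targets may differ because extensionality refers to the source only.\<close>

lemma nat_trans_eqI:
 assumes "\<eta> \<in> nat_trans K C M N" "\<theta> \<in> nat_trans K C M N'"
  "\<And>X x. X \<in> Obj C ==> x \<in> El M X ==> \<eta> X x = \<theta> X x"
 shows "\<eta> = \<theta>"
proof
 fix X
 have *: "\<eta> \<in> extensional (Obj C)" "\<theta> \<in> extensional (Obj C)"
  "X \<in> Obj C ==> \<eta> X \<in> extensional (El M X)" "X \<in> Obj C ==> \<theta> X \<in> extensional (El M X)"
  using assms(1,2) by (auto simp: nat_trans_def PiE_def Pi_def)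
 show "\<eta> X = \<theta> X"
 proof (cases "X \<in> Obj C")
  case True
  then show ?thesis using assms(3) * by (intro extensionalityI[where A = "El M X"]) auto
 next
  case False
  then show ?thesis using * by (simp add: extensional_def)
 qed
qed

context kcat
begin

lemma comp_closed: "X \<in> Obj C ==> Y \<in> Obj C ==> Z \<in> Obj C ==> f \<in> Mor C X Y ==>
  g \<in> Mor C Y Z ==> Comp C X Y Z g f \<in> Mor C X Z"
 using lin_closed[OF comp_linear_right] by simp

lemma comp_add_right: "X \<in> Obj C ==> Y \<in> Obj C ==> Z \<in> Obj C ==> f \<in> Mor C X Y ==>
  f' \<in> Mor C X Y ==> g \<in> Mor C Y Z ==>
  Comp C X Y Z g (f +[Hom C X Y] f') = Comp C X Y Z g f +[Hom C X Z] Comp C X Y Z g f'"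
 using lin_add[OF comp_linear_right] by simp

lemma comp_add_left: "X \<in> Obj C ==> Y \<in> Obj C ==> Z \<in> Obj C ==> f \<in> Mor C X Y ==>
  g \<in> Mor C Y Z ==> g' \<in> Mor C Y Z ==>
  Comp C X Y Z (g +[Hom C Y Z] g') f = Comp C X Y Z g f +[Hom C X Z] Comp C X Y Z g' f"
 using lin_add[OF comp_linear_left] by simp

lemma comp_smult_right: "X \<in> Obj C ==> Y \<in> Obj C ==> Z \<in> Obj C ==> f \<in> Mor C X Y ==>
  a \<in> carrier K ==> g \<in> Mor C Y Z ==>
  Comp C X Y Z g (a *[Hom C X Y] f) = a *[Hom C X Z] Comp C X Y Z g f"
 using lin_smult[OF comp_linear_right] by simp

lemma comp_smult_left: "X \<in> Obj C ==> Y \<in> Obj C ==> Z \<in> Obj C ==> f \<in> Mor C X Y ==>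
  a \<in> carrier K ==> g \<in> Mor C Y Z ==>
  Comp C X Y Z (a *[Hom C Y Z] g) f = a *[Hom C X Z] Comp C X Y Z g f"
 using lin_smult[OF comp_linear_left] by simp

lemma hom_kmod: "X \<in> Obj C ==> Y \<in> Obj C ==> kmod K (Hom C X Y)"
 unfolding kmod_def by (rule hom_module)

lemma act_hom_zero: "c_module K C M ==> X \<in> Obj C ==> Y \<in> Obj C ==> x \<in> El M X ==>
  Act M X Y 0[Hom C X Y] x = 0[On M Y]"
 using lin_zero[OF c_module.act_linear_hom hom_module c_module.on_module] by fastforce

text \<open>Scalars act through multiples of the identity, so additive natural maps are linear.\<close>

lemma mod_homI:
 assumes M: "c_module K C M" and N: "c_module K C N"
  and cl: "\<And>X x. X \<in> Obj C ==> x \<in> El M X ==> \<eta> X x \<in> El N X"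
  and add: "\<And>X x y. X \<in> Obj C ==> x \<in> El M X ==> y \<in> El M X ==>
   \<eta> X (x +[On M X] y) = \<eta> X x +[On N X] \<eta> X y"
  and nat: "\<And>X Y f x. X \<in> Obj C ==> Y \<in> Obj C ==> f \<in> Mor C X Y ==> x \<in> El M X ==>
   \<eta> Y (Act M X Y f x) = Act N X Y f (\<eta> X x)"
 shows "mod_hom K C M N \<eta>"
 unfolding mod_hom_def
proof (intro conjI ballI lin_mapsI nat)
 fix X a x assume X: "X \<in> Obj C" and a: "a \<in> carrier K" and x: "x \<in> El M X"
 interpret H: kmod K "Hom C X X" by (rule hom_kmod[OF X X])
 have s: "Act M X X (a *[Hom C X X] Id C X) x = a *[On M X] x"
  "Act N X X (a *[Hom C X X] Id C X) (\<eta> X x) = a *[On N X] \<eta> X x"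
  using X a x cl by (simp_all add: act_hom_smult[OF M] act_hom_smult[OF N] id_closed act_id[OF M] act_id[OF N])
 show "\<eta> X (a *[On M X] x) = a *[On N X] \<eta> X x"
  using nat[OF X X, of "a *[Hom C X X] Id C X" x] X a x s by (simp add: id_closed)
qed (use cl add in auto)

lemma ext_hom_nat_trans:
 assumes M: "c_module K C M" and h: "mod_hom K C M N \<eta>"
 shows "ext_hom C M \<eta> \<in> nat_trans K C M N"
proof -
 have "ext_hom C M \<eta> X \<in> lin_maps K (On M X) (On N X)" if X: "X \<in> Obj C" for X
 proof -
  interpret MX: kmod K "On M X" by (rule on_kmod[OF M X])
  show ?thesis
   by (rule lin_mapsI) (use X in "auto simp: ext_hom_apply hom_closed[OF h] hom_add[OF h] hom_smult[OF h]")
 qed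
 then show ?thesis unfolding nat_trans_def
  by (auto simp: hom_closed[OF h] ext_hom_apply hom_nat[OF h] act_closed[OF M])
    (auto simp: ext_hom_def hom_closed[OF h])
qed

lemma nt_comp_apply: "X \<in> Obj C ==> x \<in> El M X ==> nt_comp C M \<psi> \<phi> X x = \<psi> X (\<phi> X x)"
 by (simp add: nt_comp_def compose_def)

lemma nt_comp_nat_trans:
 assumes L: "c_module K C L" and "mod_hom K C L M \<eta>" "mod_hom K C M N \<theta>"
 shows "nt_comp C L \<theta> \<eta> \<in> nat_trans K C L N"
proof -
 have "nt_comp C L \<theta> \<eta> = ext_hom C L (\<lambda>X x. \<theta> X (\<eta> X x))"
  unfolding nt_comp_def ext_hom_def compose_def by simp
 then show ?thesis using ext_hom_nat_trans[OF L hom_comp[OF assms(2,3)]] by simp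
qed

lemma hom_diff:
 assumes M: "c_module K C M" and N: "c_module K C N" and h: "mod_hom K C M N \<eta>" "mod_hom K C M N \<theta>"
 shows "mod_hom K C M N (\<lambda>X x. \<eta> X x -[On N X] \<theta> X x)"
 unfolding mod_hom_def
proof (intro conjI ballI)
 fix X assume X: "X \<in> Obj C"
 show "(\<lambda>x. \<eta> X x -[On N X] \<theta> X x) \<in> lin_maps K (On M X) (On N X)"
  using lin_diff hom_lin[OF h(1) X] hom_lin[OF h(2) X] c_module.on_module[OF M X] c_module.on_module[OF N X] by blast
 fix Y f x assume Y: "Y \<in> Obj C" and f: "f \<in> Mor C X Y" and x: "x \<in> El M X"
 have "Act N X Y f (\<eta> X x -[On N X] \<theta> X x) = Act N X Y f (\<eta> X x) -[On N Y] Act N X Y f (\<theta> X x)"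
  by (rule lin_minus[OF c_module.act_linear[OF N X Y f]])
   (use X Y x in "auto simp: c_module.on_module[OF N] hom_closed[OF h(1)] hom_closed[OF h(2)]")
 then show "\<eta> Y (Act M X Y f x) -[On N Y] \<theta> Y (Act M X Y f x) = Act N X Y f (\<eta> X x -[On N X] \<theta> X x)"
  using X Y f x by (simp add: hom_nat[OF h(1)] hom_nat[OF h(2)])
qed

lemma hom_plus:
 assumes M: "c_module K C M" and N: "c_module K C N" and h: "mod_hom K C M N \<eta>" "mod_hom K C M N \<theta>"
 shows "mod_hom K C M N (\<lambda>X x. \<eta> X x +[On N X] \<theta> X x)"
 unfolding mod_hom_def
proof (intro conjI ballI)
 fix X assume X: "X \<in> Obj C"
 show "(\<lambda>x. \<eta> X x +[On N X] \<theta> X x) \<in> lin_maps K (On M X) (On N X)"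
  using lin_plus hom_lin[OF h(1) X] hom_lin[OF h(2) X] c_module.on_module[OF N X] by blast
qed (use h N in "simp add: hom_nat[OF h(1)] hom_nat[OF h(2)] act_add hom_closed[OF h(1)] hom_closed[OF h(2)]")

lemma hom_zero_map:
 assumes M: "c_module K C M" and N: "c_module K C N"
 shows "mod_hom K C M N (\<lambda>X x. 0[On N X])"
proof (rule mod_homI[OF M N], goal_cases)
 case (1 X x) then interpret NX: kmod K "On N X" by (intro on_kmod[OF N])
 show ?case by simp
next
 case (2 X x) then interpret NX: kmod K "On N X" by (intro on_kmod[OF N])
 show ?case by simp
qed (simp add: act_zero[OF N])

subsection \<open>Submodules and quotients\<close>

lemma submod_On [simp]: "On (submod M S) X = (On M X)\<lparr>carrier := S X\<rparr>"
 and submod_Act [simp]: "Act (submod M S) = Act M"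
 by (simp_all add: submod_def)

definition subfunctor :: "('k, 'o, 'm, 'v) cmod \<Rightarrow> ('o \<Rightarrow> 'v set) \<Rightarrow> bool" where
 "subfunctor M S \<longleftrightarrow> (\<forall>X\<in>Obj C. submodule (S X) K (On M X)) \<and>
   (\<forall>X\<in>Obj C. \<forall>Y\<in>Obj C. \<forall>f\<in>Mor C X Y. \<forall>x\<in>S X. Act M X Y f x \<in> S Y)"

lemma subfunctor_carrier:
 assumes "c_module K C M" "subfunctor M S" "X \<in> Obj C" "x \<in> S X" shows "x \<in> El M X"
 using assms kmod.axioms[OF on_kmod[OF assms(1,3)]] module.submodule_props(1) unfolding subfunctor_def by blast

lemma submod_c_module:
 assumes M: "c_module K C M" and S: "subfunctor M S"
 shows "c_module K C (submod M S)"
proof (rule c_moduleI)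
 fix X assume "X \<in> Obj C"
 then show "module K (On (submod M S) X)"
  using S submodule.submodule_is_module c_module.on_module[OF M] by (fastforce simp: subfunctor_def)
qed (use S in "auto simp: subfunctor_carrier[OF M S] act_add[OF M] act_smult[OF M] act_hom_add[OF M]
   act_hom_smult[OF M] act_id[OF M] act_comp[OF M] subfunctor_def")

lemma submod_incl: "c_module K C M ==> subfunctor M S ==> mod_hom K C (submod M S) M (\<lambda>X x. x)"
 unfolding mod_hom_def by (auto simp: lin_maps_def subfunctor_carrier)

lemma hom_into_submod:
 assumes "mod_hom K C L M \<eta>" "\<And>X x. X \<in> Obj C ==> x \<in> El L X ==> \<eta> X x \<in> S X"
 shows "mod_hom K C L (submod M S) \<eta>"
 using assms unfolding mod_hom_def by (auto simp: lin_maps_def)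

lemma hom_from_submod: "c_module K C M ==> subfunctor M S ==> mod_hom K C M N \<eta> ==> mod_hom K C (submod M S) N \<eta>"
 using hom_comp[OF submod_incl] by fastforce

definition kern :: "('k, 'o, 'm, 'v) cmod \<Rightarrow> ('k, 'o, 'm, 'w) cmod \<Rightarrow> ('o \<Rightarrow> 'v \<Rightarrow> 'w) \<Rightarrow> 'o \<Rightarrow> 'v set" where
 "kern M N \<eta> X = {x \<in> El M X. \<eta> X x = 0[On N X]}"

lemma kern_subfunctor:
 assumes "c_module K C M" "c_module K C N" "mod_hom K C M N \<eta>"
 shows "subfunctor M (kern M N \<eta>)"
 unfolding subfunctor_def kern_def
 using assms by (auto intro!: kernel_submodule hom_lin c_module.on_module act_closed simp: hom_nat act_zero)

lemma kern_c_module: "c_module K C M ==> c_module K C N ==> mod_hom K C M N \<eta> ==>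
  c_module K C (submod M (kern M N \<eta>))"
 by (intro submod_c_module kern_subfunctor)

definition quotm :: "('k, 'o, 'm, 'v) cmod \<Rightarrow> ('o \<Rightarrow> 'v set) \<Rightarrow> ('k, 'o, 'm, 'v set) cmod" where
 "quotm M S = \<lparr>On = (\<lambda>X. quot_mod (On M X) (S X)),
   Act = (\<lambda>X Y f A. \<Union>x\<in>A. S Y +>[On M Y] Act M X Y f x)\<rparr>"

lemma quotm_On [simp]: "On (quotm M S) X = quot_mod (On M X) (S X)"
 by (simp add: quotm_def)

lemma quotm_Act:
 assumes M: "c_module K C M" and S: "subfunctor M S"
  and "X \<in> Obj C" "Y \<in> Obj C" "f \<in> Mor C X Y" "x \<in> El M X"
 shows "Act (quotm M S) X Y f (S X +>[On M X] x) = S Y +>[On M Y] Act M X Y f x"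
proof -
 interpret X: kmod K "On M X" by (rule on_kmod) fact+
 interpret Y: kmod K "On M Y" by (rule on_kmod) fact+
 have "(\<Union>x\<in>S X +>[On M X] x. S Y +>[On M Y] Act M X Y f x) = S Y +>[On M Y] Act M X Y f x"
 proof (rule X.UN_coset_eq)
  show "submodule (S X) K (On M X)" using S assms by (simp add: subfunctor_def)
  fix w assume w: "w \<in> S X"
  then have wc: "w \<in> El M X" using assms by (simp add: subfunctor_carrier)
  have "Act M X Y f (w +[On M X] x) -[On M Y] Act M X Y f x = Act M X Y f w"
   using assms wc by (simp add: act_add[OF M] act_closed[OF M] Y.add_minus_cancel)
  then show "S Y +>[On M Y] Act M X Y f (w +[On M X] x) = S Y +>[On M Y] Act M X Y f x"
   using S assms w wc by (subst Y.coset_eq_iff) (auto simp: subfunctor_def act_closed[OF M])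
 qed fact
 then show ?thesis by (simp add: quotm_def)
qed

lemma quotm_c_module:
 assumes M: "c_module K C M" and S: "subfunctor M S"
 shows "c_module K C (quotm M S)"
proof -
 have sm: "X \<in> Obj C ==> submodule (S X) K (On M X)" for X using S by (simp add: subfunctor_def)
 note k = on_kmod[OF M] and A = quotm_Act[OF M S]
 have c: "X \<in> Obj C ==> x \<in> carrier (quot_mod (On M X) (S X)) \<longleftrightarrow> (\<exists>y\<in>El M X. x = S X +>[On M X] y)"
  for X x using kmod.quot_carrier[OF k] by auto
 have add: "X \<in> Obj C ==> x \<in> El M X ==> y \<in> El M X ==>
   (S X +>[On M X] x) +[quot_mod (On M X) (S X)] (S X +>[On M X] y) = S X +>[On M X] (x +[On M X] y)" for X x y
  by (rule kmod.quot_add[OF k sm])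
 have smult: "X \<in> Obj C ==> a \<in> carrier K ==> x \<in> El M X ==>
   a *[quot_mod (On M X) (S X)] (S X +>[On M X] x) = S X +>[On M X] (a *[On M X] x)" for X a x
  by (rule kmod.quot_smult[OF k sm])
 have mc: "X \<in> Obj C ==> x \<in> El M X ==> y \<in> El M X ==> x +[On M X] y \<in> El M X"
   "X \<in> Obj C ==> a \<in> carrier K ==> x \<in> El M X ==> a *[On M X] x \<in> El M X" for X a x y
  by (simp_all add: on_closed[OF M])
 have hc: "X \<in> Obj C ==> Y \<in> Obj C ==> x \<in> Mor C X Y ==> y \<in> Mor C X Y ==> x +[Hom C X Y] y \<in> Mor C X Y"
   "X \<in> Obj C ==> Y \<in> Obj C ==> a \<in> carrier K ==> x \<in> Mor C X Y ==> a *[Hom C X Y] x \<in> Mor C X Y" for X Y a x y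
  by (simp_all add: mod_closed[OF hom_module])
 show ?thesis
 proof (rule c_moduleI)
  fix X assume "X \<in> Obj C"
  then show "module K (On (quotm M S) X)" using kmod.quot_module[OF k sm] by simp
 qed (auto simp: c A add smult mc hc act_closed[OF M] act_add[OF M] act_smult[OF M] act_hom_add[OF M]
   act_hom_smult[OF M] act_id[OF M] act_comp[OF M] id_closed comp_closed)
qed

lemma quotm_proj:
 assumes M: "c_module K C M" and S: "subfunctor M S"
 shows "mod_hom K C M (quotm M S) (\<lambda>X x. S X +>[On M X] x)"
 unfolding mod_hom_def
 using kmod.proj_lin[OF on_kmod[OF M]] S by (auto simp: quotm_Act[OF M S] subfunctor_def)

lemma quotm_factor:
 assumes M: "c_module K C M" and S: "subfunctor M S" and N: "c_module K C N" and h: "mod_hom K C M N \<eta>"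
  and z: "\<And>X x. X \<in> Obj C ==> x \<in> S X ==> \<eta> X x = 0[On N X]"
 shows "\<exists>\<theta>. mod_hom K C (quotm M S) N \<theta> \<and> (\<forall>X\<in>Obj C. \<forall>x\<in>El M X. \<theta> X (S X +>[On M X] x) = \<eta> X x)"
proof (intro exI conjI ballI)
 have sm: "X \<in> Obj C ==> submodule (S X) K (On M X)" for X using S by (simp add: subfunctor_def)
 let ?\<theta> = "\<lambda>X A. the_elem (\<eta> X ` A)"
 show e: "?\<theta> X (S X +>[On M X] x) = \<eta> X x" if "X \<in> Obj C" "x \<in> El M X" for X x
  using that kmod.the_elem_coset[OF on_kmod[OF M] sm hom_lin[OF h] c_module.on_module[OF N] z] by blast
 show "mod_hom K C (quotm M S) N ?\<theta>"
  unfolding mod_hom_def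
 proof (intro conjI ballI)
  fix X assume X: "X \<in> Obj C"
  show "?\<theta> X \<in> lin_maps K (On (quotm M S) X) (On N X)"
   using X kmod.the_elem_lin[OF on_kmod[OF M] sm hom_lin[OF h] c_module.on_module[OF N] z] by simp
  fix Y f A assume Y: "Y \<in> Obj C" and f: "f \<in> Mor C X Y" and A: "A \<in> El (quotm M S) X"
  then obtain x where x: "x \<in> El M X" "A = S X +>[On M X] x"
   using kmod.quot_carrier[OF on_kmod[OF M X]] by auto
  show "?\<theta> Y (Act (quotm M S) X Y f A) = Act N X Y f (?\<theta> X A)"
   using X Y f x by (simp add: quotm_Act[OF M S] e act_closed[OF M] hom_nat[OF h])
 qed
qed

end

subsection \<open>Direct sums and free modules\<close>

text \<open>The module laws as plain implications. They can be instantiated for families such as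
  \<open>On (N g) X\<close>, where interpreting a locale for each member is not practicable.\<close>

lemma mod_laws:
 assumes "module K V"
 shows "x \<in> carrier V ==> y \<in> carrier V ==> z \<in> carrier V ==> (x +[V] y) +[V] z = x +[V] (y +[V] z)"
  and "x \<in> carrier V ==> y \<in> carrier V ==> x +[V] y = y +[V] x"
  and "x \<in> carrier V ==> 0[V] +[V] x = x" and "x \<in> carrier V ==> x +[V] 0[V] = x"
  and "x \<in> carrier V ==> (-[V] x) +[V] x = 0[V]"
  and "a \<in> carrier K ==> b \<in> carrier K ==> x \<in> carrier V ==> (a +[K] b) *[V] x = a *[V] x +[V] b *[V] x"
  and "a \<in> carrier K ==> x \<in> carrier V ==> y \<in> carrier V ==> a *[V] (x +[V] y) = a *[V] x +[V] a *[V] y"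
  and "a \<in> carrier K ==> b \<in> carrier K ==> x \<in> carrier V ==> (a \<otimes>\<^bsub>K\<^esub> b) *[V] x = a *[V] (b *[V] x)"
  and "x \<in> carrier V ==> \<one>\<^bsub>K\<^esub> *[V] x = x"
  and "a \<in> carrier K ==> a *[V] 0[V] = 0[V]"
  and "x \<in> carrier V ==> -[V] x \<in> carrier V"
  and "-[V] 0[V] = 0[V]"
proof -
 interpret module K V by fact
 show "x \<in> carrier V ==> y \<in> carrier V ==> z \<in> carrier V ==> (x +[V] y) +[V] z = x +[V] (y +[V] z)"
  and "x \<in> carrier V ==> y \<in> carrier V ==> x +[V] y = y +[V] x"
  and "x \<in> carrier V ==> 0[V] +[V] x = x" and "x \<in> carrier V ==> x +[V] 0[V] = x"
  and "x \<in> carrier V ==> (-[V] x) +[V] x = 0[V]"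
  and "a \<in> carrier K ==> b \<in> carrier K ==> x \<in> carrier V ==> (a +[K] b) *[V] x = a *[V] x +[V] b *[V] x"
  and "a \<in> carrier K ==> x \<in> carrier V ==> y \<in> carrier V ==> a *[V] (x +[V] y) = a *[V] x +[V] a *[V] y"
  and "a \<in> carrier K ==> b \<in> carrier K ==> x \<in> carrier V ==> (a \<otimes>\<^bsub>K\<^esub> b) *[V] x = a *[V] (b *[V] x)"
  and "x \<in> carrier V ==> \<one>\<^bsub>K\<^esub> *[V] x = x"
  and "a \<in> carrier K ==> a *[V] 0[V] = 0[V]"
  and "x \<in> carrier V ==> -[V] x \<in> carrier V"
  and "-[V] 0[V] = 0[V]"
  by (simp_all add: M.a_ac M.r_neg smult_l_distr smult_r_distr smult_assoc1)
qed

lemmas on_laws = mod_laws[OF c_module.on_module]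

definition supp :: "'s set \<Rightarrow> ('s \<Rightarrow> ('k, 'o, 'm, 'v) cmod) \<Rightarrow> 'o \<Rightarrow> ('s \<Rightarrow> 'v) \<Rightarrow> 's set" where
 "supp S N X p = {g \<in> S. p g \<noteq> 0[On (N g) X]}"

definition dsum :: "'s set \<Rightarrow> ('s \<Rightarrow> ('k, 'o, 'm, 'v) cmod) \<Rightarrow> ('k, 'o, 'm, 's \<Rightarrow> 'v) cmod" where
 "dsum S N = \<lparr>On = (\<lambda>X.
    \<lparr>carrier = {p \<in> (\<Pi>\<^sub>E g\<in>S. El (N g) X). finite (supp S N X p)},
    mult = undefined, one = undefined,
    zero = (\<lambda>g\<in>S. 0[On (N g) X]), add = (\<lambda>p q. \<lambda>g\<in>S. p g +[On (N g) X] q g),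
    smult = (\<lambda>a p. \<lambda>g\<in>S. a *[On (N g) X] p g)\<rparr>),
   Act = (\<lambda>X Y f p. \<lambda>g\<in>S. Act (N g) X Y f (p g))\<rparr>"

lemma dsum_simps:
 "p \<in> El (dsum S N) X \<longleftrightarrow>
   p \<in> extensional S \<and> (\<forall>g\<in>S. p g \<in> El (N g) X) \<and> finite (supp S N X p)"
 "0[On (dsum S N) X] = (\<lambda>g\<in>S. 0[On (N g) X])"
 "p +[On (dsum S N) X] q = (\<lambda>g\<in>S. p g +[On (N g) X] q g)"
 "a *[On (dsum S N) X] p = (\<lambda>g\<in>S. a *[On (N g) X] p g)"
 "Act (dsum S N) X Y f p = (\<lambda>g\<in>S. Act (N g) X Y f (p g))"
 by (auto simp: dsum_def PiE_def Pi_def)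

lemma dsumD: "p \<in> El (dsum S N) X ==> g \<in> S ==> p g \<in> El (N g) X"
 by (simp add: dsum_simps)

lemma supp_zero [simp]: "supp S N X (\<lambda>g\<in>S. 0[On (N g) X]) = {}"
 by (auto simp: supp_def)

lemma supp_subset: "supp S N X p \<subseteq> S"
 by (auto simp: supp_def)

lemma restrict_eq_ext: "p \<in> extensional S ==> (\<And>g. g \<in> S ==> F g = p g) ==> (\<lambda>g\<in>S. F g) = p"
 by (auto simp: fun_eq_iff extensional_def)

definition dsum_inj :: "'s set \<Rightarrow> ('s \<Rightarrow> ('k, 'o, 'm, 'v) cmod) \<Rightarrow> 's \<Rightarrow> 'o \<Rightarrow> 'v \<Rightarrow> 's \<Rightarrow> 'v" where
 "dsum_inj S N g X x = (\<lambda>h\<in>S. if h = g then x else 0[On (N h) X])"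

definition dsum_map :: "'s set \<Rightarrow> ('s \<Rightarrow> ('k, 'o, 'm, 'v) cmod) \<Rightarrow> ('k, 'o, 'm, 'w) cmod \<Rightarrow>
  ('s \<Rightarrow> 'o \<Rightarrow> 'v \<Rightarrow> 'w) \<Rightarrow> 'o \<Rightarrow> ('s \<Rightarrow> 'v) \<Rightarrow> 'w" where
 "dsum_map S N M h X p = (\<Oplus>\<^bsub>On M X\<^esub> g\<in>supp S N X p. h g X (p g))"

text \<open>The lifting property against one epimorphism, with independent element types for
  \<open>P\<close>, \<open>A\<close> and \<open>B\<close>. The quantification over types that
  \<open>projective\<close> cannot contain is thereby moved to the level of theorems.\<close>

definition lifts :: "'k ring \<Rightarrow> ('k, 'o, 'm) kcat \<Rightarrow> ('k, 'o, 'm, 'v) cmod \<Rightarrow> ('k, 'o, 'm, 'a) cmod \<Rightarrow>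
  ('k, 'o, 'm, 'b) cmod \<Rightarrow> ('o \<Rightarrow> 'a \<Rightarrow> 'b) \<Rightarrow> bool" where
 "lifts K C P A B e \<longleftrightarrow> (\<forall>f. mod_hom K C P B f \<longrightarrow>
   (\<exists>g. mod_hom K C P A g \<and> (\<forall>X\<in>Obj C. \<forall>x\<in>El P X. e X (g X x) = f X x)))"

lemma liftsD:
 assumes "lifts K C P A B e" "mod_hom K C P B f"
 obtains g where "mod_hom K C P A g" "\<And>X x. X \<in> Obj C ==> x \<in> El P X ==> e X (g X x) = f X x"
 using assms unfolding lifts_def by blast

lemma lifts_retract:
 assumes i: "mod_hom K C P L i" and r: "mod_hom K C L P r"
  and ri: "\<And>X x. X \<in> Obj C ==> x \<in> El P X ==> r X (i X x) = x"
  and L: "lifts K C L A B e"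
 shows "lifts K C P A B e"
 unfolding lifts_def
proof (intro allI impI)
 fix f assume f: "mod_hom K C P B f"
 obtain g where g: "mod_hom K C L A g" "\<And>X x. X \<in> Obj C ==> x \<in> El L X ==> e X (g X x) = f X (r X x)"
  using liftsD[OF L hom_comp[OF r f]] by metis
 show "\<exists>g. mod_hom K C P A g \<and> (\<forall>X\<in>Obj C. \<forall>x\<in>El P X. e X (g X x) = f X x)"
  using hom_comp[OF i g(1)] g(2) ri hom_closed[OF i]
  by (intro exI[of _ "\<lambda>X x. g X (i X x)"]) simp
qed

context kcat
begin

context
 fixes S :: "'s set" and N :: "'s \<Rightarrow> ('k, 'o, 'm, 'v) cmod"
 assumes N: "\<And>g. g \<in> S ==> c_module K C (N g)"
begin

lemma supp_finite_sub: "finite (supp S N X p) ==> (\<And>g. g \<in> S ==> p g = 0[On (N g) X] ==> q g = 0[On (N g) Y]) ==>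
  finite (supp S N Y q)"
 by (rule finite_subset[of _ "supp S N X p"]) (auto simp: supp_def)

lemma supp_finite_add: "X \<in> Obj C ==> finite (supp S N X p) ==> finite (supp S N X q) ==>
  finite (supp S N X (\<lambda>g\<in>S. p g +[On (N g) X] q g))"
 by (rule finite_subset[of _ "supp S N X p \<union> supp S N X q"])
  (auto simp: supp_def on_laws(3,4)[OF N] on_closed[OF N])

lemma dsum_c_module: "c_module K C (dsum S N)"
proof (rule c_moduleI)
 fix X assume X: "X \<in> Obj C"
 show "module K (On (dsum S N) X)"
 proof (rule moduleI)
  show "cring K" ..
  show "abelian_group (On (dsum S N) X)"
  proof (rule abelian_groupI)
   fix x assume x: "x \<in> El (dsum S N) X"
   show "\<exists>y\<in>El (dsum S N) X. y +[On (dsum S N) X] x = 0[On (dsum S N) X]"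
   proof (rule bexI[of _ "\<lambda>g\<in>S. -[On (N g) X] x g"])
    have "finite (supp S N X (\<lambda>g\<in>S. -[On (N g) X] x g))"
     by (rule supp_finite_sub[of X x]) (use x X in "auto simp: dsum_simps on_laws[OF N]")
    then show "(\<lambda>g\<in>S. -[On (N g) X] x g) \<in> El (dsum S N) X"
     using x X by (auto simp: dsum_simps on_laws[OF N])
   qed (use x X in "auto simp: dsum_simps on_laws(5)[OF N] intro!: restrict_ext")
  next
   fix x y assume "x \<in> El (dsum S N) X" "y \<in> El (dsum S N) X"
   then show "x +[On (dsum S N) X] y = y +[On (dsum S N) X] x"
    using X by (auto simp: dsum_simps intro!: restrict_ext on_laws(2)[OF N])
  qed (use X in "auto simp: dsum_simps on_laws(1,3)[OF N] on_closed[OF N] supp_finite_add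
     intro!: restrict_ext restrict_eq_ext")
  fix a x assume a: "a \<in> carrier K" and x: "x \<in> El (dsum S N) X"
  have "finite (supp S N X (\<lambda>g\<in>S. a *[On (N g) X] x g))"
   by (rule supp_finite_sub[of X x]) (use x X a in "auto simp: dsum_simps on_laws[OF N]")
  then show "a *[On (dsum S N) X] x \<in> El (dsum S N) X"
   using x X a by (auto simp: dsum_simps on_closed[OF N])
 qed (use X in "auto simp: dsum_simps on_laws(6-9)[OF N] on_closed[OF N] intro!: restrict_ext restrict_eq_ext")
next
 fix X Y f x assume *: "X \<in> Obj C" "Y \<in> Obj C" "f \<in> Mor C X Y" "x \<in> El (dsum S N) X"
 have "finite (supp S N Y (\<lambda>g\<in>S. Act (N g) X Y f (x g)))"
  by (rule supp_finite_sub[of X x]) (use * in "auto simp: dsum_simps act_zero[OF N]")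
 then show "Act (dsum S N) X Y f x \<in> El (dsum S N) Y"
  using * by (auto simp: dsum_simps act_closed[OF N])
qed (auto simp: dsum_simps act_add[OF N] act_smult[OF N] act_hom_add[OF N] act_hom_smult[OF N]
  act_id[OF N] act_comp[OF N] intro!: restrict_ext restrict_eq_ext)

lemma dsum_inj_carrier: "g \<in> S ==> X \<in> Obj C ==> x \<in> El (N g) X ==>
  dsum_inj S N g X x \<in> El (dsum S N) X"
proof -
 assume *: "g \<in> S" "X \<in> Obj C" "x \<in> El (N g) X"
 have "finite (supp S N X (dsum_inj S N g X x))"
  by (rule finite_subset[of _ "{g}"]) (auto simp: supp_def dsum_inj_def)
 then show ?thesis using * by (auto simp: dsum_simps on_closed[OF N]) (auto simp: dsum_inj_def on_closed[OF N])
qed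

lemma dsum_inj_hom: "g \<in> S ==> mod_hom K C (N g) (dsum S N) (dsum_inj S N g)"
 by (rule mod_homI[OF N dsum_c_module])
  (auto simp: dsum_inj_carrier, auto simp: dsum_simps dsum_inj_def act_zero[OF N] on_laws[OF N] on_closed[OF N]
   intro!: restrict_ext)

lemma dsum_eval_lin: "g \<in> S ==> X \<in> Obj C ==> (\<lambda>p. p g) \<in> lin_maps K (On (dsum S N) X) (On (N g) X)"
 by (rule lin_mapsI) (auto simp: dsum_simps)

lemma dsum_decomp:
 assumes X: "X \<in> Obj C" and p: "p \<in> El (dsum S N) X"
 shows "p = (\<Oplus>\<^bsub>On (dsum S N) X\<^esub> g\<in>supp S N X p. dsum_inj S N g X (p g))"
proof -
 interpret D: kmod K "On (dsum S N) X" by (rule on_kmod[OF dsum_c_module X])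
 have pc: "p \<in> extensional S" "\<And>g. g \<in> S ==> p g \<in> El (N g) X" "finite (supp S N X p)"
  using p by (auto simp: dsum_simps)
 have ic: "(\<lambda>g. dsum_inj S N g X (p g)) \<in> supp S N X p \<rightarrow> El (dsum S N) X"
 proof
  fix g assume "g \<in> supp S N X p"
  then have "g \<in> S" using supp_subset[of S N X p] by auto
  then show "dsum_inj S N g X (p g) \<in> El (dsum S N) X" using pc(2) X by (intro dsum_inj_carrier)
 qed
 then have "(\<Oplus>\<^bsub>On (dsum S N) X\<^esub> g\<in>supp S N X p. dsum_inj S N g X (p g)) \<in> El (dsum S N) X"
  by (rule D.finsum_closed)
 then have ext: "(\<Oplus>\<^bsub>On (dsum S N) X\<^esub> g\<in>supp S N X p. dsum_inj S N g X (p g)) \<in> extensional S"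
  by (simp add: dsum_simps)
 show ?thesis
 proof (rule extensionalityI[OF pc(1) ext])
  \<comment> \<open>Compare coordinates: evaluation at \<open>g\<close> is linear and moves into the
    finite sum, where only the summand with index \<open>g\<close> survives.\<close>
  fix g assume g: "g \<in> S"
  interpret Ng: kmod K "On (N g) X" by (rule on_kmod[OF N[OF g] X])
  have "(\<Oplus>\<^bsub>On (dsum S N) X\<^esub> g\<in>supp S N X p. dsum_inj S N g X (p g)) g
   = (\<Oplus>\<^bsub>On (N g) X\<^esub> h\<in>supp S N X p. dsum_inj S N h X (p h) g)"
   by (rule lin_finsum[OF dsum_eval_lin[OF g X] D.module_axioms Ng.module_axioms ic])
  also have "\<dots> = (\<Oplus>\<^bsub>On (N g) X\<^esub> h\<in>supp S N X p. if g = h then p h else 0[On (N g) X])"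
   by (rule Ng.finsum_cong') (use g pc in "auto simp: dsum_inj_def")
  also have "\<dots> = p g"
  proof (cases "g \<in> supp S N X p")
   case True
   have "(\<Oplus>\<^bsub>On (N g) X\<^esub> h\<in>supp S N X p. if g = h then p h else 0[On (N g) X])
    = (\<Oplus>\<^bsub>On (N g) X\<^esub> h\<in>supp S N X p. if g = h then p g else 0[On (N g) X])"
    by (rule Ng.finsum_cong') (use g pc in auto)
   also have "\<dots> = p g"
    by (rule Ng.finsum_singleton) (use True pc g in auto)
   finally show ?thesis .
  next
   case False
   then have "(\<Oplus>\<^bsub>On (N g) X\<^esub> h\<in>supp S N X p. if g = h then p h else 0[On (N g) X])
    = (\<Oplus>\<^bsub>On (N g) X\<^esub> h\<in>supp S N X p. 0[On (N g) X])"
    by (intro Ng.finsum_cong') auto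
   also have "\<dots> = p g" using False g by (simp add: supp_def)
   finally show ?thesis .
  qed
  finally show "p g = (\<Oplus>\<^bsub>On (dsum S N) X\<^esub> g\<in>supp S N X p. dsum_inj S N g X (p g)) g" by simp
 qed
qed

lemma dsum_hom_decomp:
 assumes M: "c_module K C M" and h: "mod_hom K C (dsum S N) M \<eta>"
  and X: "X \<in> Obj C" and p: "p \<in> El (dsum S N) X"
 shows "\<eta> X p = (\<Oplus>\<^bsub>On M X\<^esub> g\<in>supp S N X p. \<eta> X (dsum_inj S N g X (p g)))"
proof -
 have ic: "(\<lambda>g. dsum_inj S N g X (p g)) \<in> supp S N X p \<rightarrow> El (dsum S N) X"
 proof
  fix g assume "g \<in> supp S N X p"
  then have "g \<in> S" using supp_subset[of S N X p] by auto
  then show "dsum_inj S N g X (p g) \<in> El (dsum S N) X" using dsumD[OF p] X by (intro dsum_inj_carrier)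
 qed
 show ?thesis
  by (subst dsum_decomp[OF X p]) (rule lin_finsum[OF hom_lin[OF h X] c_module.on_module[OF dsum_c_module X]
    c_module.on_module[OF M X] ic])
qed

context
 fixes M :: "('k, 'o, 'm, 'w) cmod" and h
 assumes M: "c_module K C M" and h: "\<And>g. g \<in> S ==> mod_hom K C (N g) M (h g)"
begin

text \<open>\<open>dsum_map\<close> sums over the support of its argument. To compare the values at
  \<open>p\<close>, \<open>q\<close> and their sum, or at \<open>p\<close> and its translate, all of
  them are summed over one finite superset of the supports.\<close>

lemma dsum_map_over:
 assumes X: "X \<in> Obj C" and p: "p \<in> El (dsum S N) X" and T: "finite T" "T \<subseteq> S" "supp S N X p \<subseteq> T"
 shows "dsum_map S N M h X p = (\<Oplus>\<^bsub>On M X\<^esub> g\<in>T. h g X (p g))"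
proof -
 interpret MX: kmod K "On M X" by (rule on_kmod[OF M X])
 show ?thesis unfolding dsum_map_def
  by (rule MX.add.finprod_mono_neutral_cong_left)
   (use T X p in "auto simp: supp_def dsum_simps hom_zero[OF h N M] hom_closed[OF h] subset_iff")
qed

lemma dsum_map_hom: "mod_hom K C (dsum S N) M (dsum_map S N M h)"
proof (rule mod_homI[OF dsum_c_module M])
 fix X p assume X: "X \<in> Obj C" and p: "p \<in> El (dsum S N) X"
 interpret MX: kmod K "On M X" by (rule on_kmod[OF M X])
 show "dsum_map S N M h X p \<in> El M X" unfolding dsum_map_def
  by (rule MX.finsum_closed) (use X p in "auto simp: supp_def dsum_simps hom_closed[OF h]")
 { fix q assume q: "q \<in> El (dsum S N) X"
  let ?T = "supp S N X p \<union> supp S N X q"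
  have T: "finite ?T" "?T \<subseteq> S" using p q by (auto simp: dsum_simps supp_def)
  have pq: "p +[On (dsum S N) X] q \<in> El (dsum S N) X"
   by (rule on_closed(2)[OF dsum_c_module X p q])
  have s: "supp S N X (p +[On (dsum S N) X] q) \<subseteq> ?T"
   using X by (auto simp: dsum_simps supp_def on_laws(3,4)[OF N] on_closed[OF N])
  have "dsum_map S N M h X (p +[On (dsum S N) X] q) = (\<Oplus>\<^bsub>On M X\<^esub> g\<in>?T. h g X (p g) +[On M X] h g X (q g))"
   unfolding dsum_map_over[OF X pq T s]
   by (rule MX.finsum_cong') (use X p q T in "auto simp: dsum_simps hom_add[OF h] hom_closed[OF h] subset_iff")
  also have "\<dots> = (\<Oplus>\<^bsub>On M X\<^esub> g\<in>?T. h g X (p g)) +[On M X] (\<Oplus>\<^bsub>On M X\<^esub> g\<in>?T. h g X (q g))"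
   by (rule MX.finsum_addf) (use X p q T in "auto simp: dsum_simps hom_closed[OF h] subset_iff")
  finally show "dsum_map S N M h X (p +[On (dsum S N) X] q) = dsum_map S N M h X p +[On M X] dsum_map S N M h X q"
   by (simp add: dsum_map_over[OF X p T] dsum_map_over[OF X q T]) }
 { fix Y f assume Y: "Y \<in> Obj C" and f: "f \<in> Mor C X Y"
  interpret MY: kmod K "On M Y" by (rule on_kmod[OF M Y])
  let ?T = "supp S N X p"
  have T: "finite ?T" "?T \<subseteq> S" using p by (auto simp: dsum_simps supp_def)
  have fp: "Act (dsum S N) X Y f p \<in> El (dsum S N) Y"
   by (rule act_closed[OF dsum_c_module X Y f p])
  have s: "supp S N Y (Act (dsum S N) X Y f p) \<subseteq> ?T"
   using X Y f by (auto simp: dsum_simps supp_def act_zero[OF N])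
  have "dsum_map S N M h Y (Act (dsum S N) X Y f p) = (\<Oplus>\<^bsub>On M Y\<^esub> g\<in>?T. Act M X Y f (h g X (p g)))"
   unfolding dsum_map_over[OF Y fp T s]
   by (rule MY.finsum_cong') (use X Y f p T in "auto simp: dsum_simps hom_nat[OF h] hom_closed[OF h] subset_iff act_closed[OF M]")
  also have "\<dots> = Act M X Y f (\<Oplus>\<^bsub>On M X\<^esub> g\<in>?T. h g X (p g))"
   by (rule lin_finsum[OF c_module.act_linear[OF M X Y f] MX.module_axioms MY.module_axioms, symmetric])
    (use X p T in "auto simp: dsum_simps hom_closed[OF h] subset_iff")
  finally show "dsum_map S N M h Y (Act (dsum S N) X Y f p) = Act M X Y f (dsum_map S N M h X p)"
   by (simp add: dsum_map_def) }
qed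

lemma dsum_map_inj:
 assumes "g \<in> S" "X \<in> Obj C" "x \<in> El (N g) X"
 shows "dsum_map S N M h X (dsum_inj S N g X x) = h g X x"
proof -
 interpret MX: kmod K "On M X" by (rule on_kmod[OF M]) fact
 have "dsum_map S N M h X (dsum_inj S N g X x) = (\<Oplus>\<^bsub>On M X\<^esub> g'\<in>{g}. h g' X (dsum_inj S N g X x g'))"
  by (rule dsum_map_over[OF assms(2) dsum_inj_carrier[OF assms]])
   (use assms in "auto simp: supp_def dsum_inj_def split: if_splits")
 also have "\<dots> = h g X x" using assms by (simp add: dsum_inj_def hom_closed[OF h] MX.finsum_insert)
 finally show ?thesis .
qed

end

lemma lifts_dsum:
 assumes A: "c_module K C A" and B: "c_module K C B" and e: "mod_hom K C A B e"
  and L: "\<And>g. g \<in> S ==> lifts K C (N g) A B e"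
 shows "lifts K C (dsum S N) A B e"
 unfolding lifts_def
proof (intro allI impI)
 fix f assume f: "mod_hom K C (dsum S N) B f"
 have "\<exists>h. mod_hom K C (N g) A h \<and> (\<forall>X\<in>Obj C. \<forall>x\<in>El (N g) X. e X (h X x) = f X (dsum_inj S N g X x))"
  if "g \<in> S" for g
  using L[OF that] hom_comp[OF dsum_inj_hom[OF that] f] unfolding lifts_def by blast
 then obtain h where h: "\<And>g. g \<in> S ==> mod_hom K C (N g) A (h g)"
  "\<And>g X x. g \<in> S ==> X \<in> Obj C ==> x \<in> El (N g) X ==> e X (h g X x) = f X (dsum_inj S N g X x)"
  by metis
 show "\<exists>g. mod_hom K C (dsum S N) A g \<and> (\<forall>X\<in>Obj C. \<forall>x\<in>El (dsum S N) X. e X (g X x) = f X x)"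
 proof (intro exI conjI ballI)
  show "mod_hom K C (dsum S N) A (dsum_map S N A h)" by (rule dsum_map_hom[OF A h(1)])
  fix X p assume X: "X \<in> Obj C" and p: "p \<in> El (dsum S N) X"
  interpret BX: kmod K "On B X" by (rule on_kmod[OF B X])
  have "e X (dsum_map S N A h X p) = (\<Oplus>\<^bsub>On B X\<^esub> g\<in>supp S N X p. e X (h g X (p g)))"
   unfolding dsum_map_def
   by (rule lin_finsum[OF hom_lin[OF e X] c_module.on_module[OF A X] BX.module_axioms])
    (use X p in "auto simp: supp_def dsum_simps hom_closed[OF h(1)]")
  also have "\<dots> = (\<Oplus>\<^bsub>On B X\<^esub> g\<in>supp S N X p. f X (dsum_inj S N g X (p g)))"
   by (rule BX.finsum_cong') (use X dsumD[OF p] in "auto simp: supp_def h(2) intro!: hom_closed[OF f] dsum_inj_carrier")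
  also have "\<dots> = f X p" using dsum_hom_decomp[OF B f X p] by simp
  finally show "e X (dsum_map S N A h X p) = f X p" .
 qed
qed

end

section \<open>Representable modules and free covers\<close>

lemma representable_simps [simp]:
 "On (representable C D) X = Hom C D X" "Act (representable C D) X Y g f = Comp C D X Y g f"
 by (simp_all add: representable_def)

lemma representable_c_module: "D \<in> Obj C ==> c_module K C (representable C D)"
 by (rule c_moduleI) (auto simp: hom_module comp_closed comp_add_left comp_add_right comp_smult_left
   comp_smult_right comp_id_left comp_assoc)

lemma yoneda_hom: "c_module K C M ==> D \<in> Obj C ==> a \<in> El M D ==>
  mod_hom K C (representable C D) M (\<lambda>X f. Act M D X f a)"
 by (rule mod_homI) (auto simp: representable_c_module act_closed act_hom_add act_comp)

text \<open>Yoneda: a map out of a representable is the choice of one element, and a preimage under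
  \<open>e\<close> of that element gives the lift.\<close>

lemma lifts_representable:
 assumes D: "D \<in> Obj C" and A: "c_module K C A" and e: "mod_hom K C A B e" "epi C A B e"
 shows "lifts K C (representable C D) A B e"
 unfolding lifts_def
proof (intro allI impI)
 fix f assume f: "mod_hom K C (representable C D) B f"
 have "f D (Id C D) \<in> El B D" using hom_closed[OF f D] id_closed[OF D] by simp
 then obtain a where a: "a \<in> El A D" "e D a = f D (Id C D)" using epiD[OF e(2) D] by blast
 show "\<exists>g. mod_hom K C (representable C D) A g \<and> (\<forall>X\<in>Obj C. \<forall>x\<in>El (representable C D) X. e X (g X x) = f X x)"
 proof (intro exI conjI ballI)
  show "mod_hom K C (representable C D) A (\<lambda>X f. Act A D X f a)" by (rule yoneda_hom[OF A D a(1)])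
  fix X x assume X: "X \<in> Obj C" and x: "x \<in> El (representable C D) X"
  have "f X (Act (representable C D) D X x (Id C D)) = Act B D X x (f D (Id C D))"
   by (rule hom_nat[OF f D X]) (use x id_closed[OF D] in simp_all)
  then show "e X (Act A D X x a) = f X x"
   using X x D a by (simp add: hom_nat[OF e(1)] comp_id_right)
 qed
qed

definition gens :: "('k, 'o, 'm, 'v) cmod \<Rightarrow> ('o \<times> 'v) set" where
 "gens M = {(D, x). D \<in> Obj C \<and> x \<in> El M D}"

definition fcov :: "('k, 'o, 'm, 'v) cmod \<Rightarrow> ('k, 'o, 'm, 'o \<times> 'v \<Rightarrow> 'm) cmod" where
 "fcov M = dsum (gens M) (\<lambda>g. representable C (fst g))"

definition fcov_map :: "('k, 'o, 'm, 'v) cmod \<Rightarrow> 'o \<Rightarrow> ('o \<times> 'v \<Rightarrow> 'm) \<Rightarrow> 'v" where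
 "fcov_map M = dsum_map (gens M) (\<lambda>g. representable C (fst g)) M (\<lambda>g X f. Act M (fst g) X f (snd g))"

lemma gens_rep: "g \<in> gens M ==> c_module K C (representable C (fst g))"
 by (auto simp: gens_def representable_c_module)

lemma gens_yoneda: "c_module K C M ==> g \<in> gens M ==>
  mod_hom K C (representable C (fst g)) M (\<lambda>X f. Act M (fst g) X f (snd g))"
 by (auto simp: gens_def intro: yoneda_hom)

lemma fcov_c_module: "c_module K C (fcov M)"
 unfolding fcov_def by (rule dsum_c_module[OF gens_rep])

lemma fcov_map_hom: "c_module K C M ==> mod_hom K C (fcov M) M (fcov_map M)"
 unfolding fcov_def fcov_map_def by (rule dsum_map_hom[OF gens_rep _ gens_yoneda])

lemma fcov_map_epi:
 assumes M: "c_module K C M" shows "epi C (fcov M) M (fcov_map M)"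
proof (rule epiI[OF fcov_map_hom[OF M]])
 fix X x assume X: "X \<in> Obj C" and x: "x \<in> El M X"
 let ?p = "dsum_inj (gens M) (\<lambda>g. representable C (fst g)) (X, x) X (Id C X)"
 have g: "(X, x) \<in> gens M" using X x by (simp add: gens_def)
 have "?p \<in> El (fcov M) X" unfolding fcov_def
  by (rule dsum_inj_carrier[OF gens_rep g X]) (use X id_closed in simp_all)
 moreover have "fcov_map M X ?p = x" unfolding fcov_map_def
  by (subst dsum_map_inj[OF gens_rep M gens_yoneda[OF M] g X]) (use X x id_closed act_id[OF M] in simp_all)
 ultimately show "\<exists>p\<in>El (fcov M) X. fcov_map M X p = x" by blast
qed

text \<open>The Yoneda argument and direct sums leave the element types of \<open>A\<close> and
  \<open>B\<close> free. This is what makes free covers the bridge from the test type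
  \<open>elt\<close> to all types.\<close>

lemma fcov_lifts: "c_module K C A ==> c_module K C B ==> mod_hom K C A B e ==> epi C A B e ==> lifts K C (fcov M) A B e"
 unfolding fcov_def by (rule lifts_dsum[OF gens_rep]) (auto simp: gens_def intro: lifts_representable)

end

subsection \<open>Transport along injections\<close>

text \<open>Transport of structure along the injections \<open>j X\<close>. It moves modules into
  \<open>elt\<close>, the type over which \<open>projective\<close> and
  \<open>chosen_resolution\<close> quantify.\<close>

definition transp :: "('k, 'o, 'm, 'v) cmod \<Rightarrow> ('o \<Rightarrow> 'v \<Rightarrow> 'w) \<Rightarrow> ('k, 'o, 'm, 'w) cmod" where
 "transp M j = (let i = (\<lambda>X. the_inv_into (El M X) (j X)) in
   \<lparr>On = (\<lambda>X. \<lparr>carrier = j X ` El M X, mult = undefined, one = undefined,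
     zero = j X 0[On M X], add = (\<lambda>a b. j X (i X a +[On M X] i X b)),
     smult = (\<lambda>a b. j X (a *[On M X] i X b))\<rparr>),
   Act = (\<lambda>X Y f a. j Y (Act M X Y f (i X a)))\<rparr>)"

context kcat
begin

context
 fixes M :: "('k, 'o, 'm, 'v) cmod" and j :: "'o \<Rightarrow> 'v \<Rightarrow> 'w"
 assumes M: "c_module K C M" and j: "\<And>X. X \<in> Obj C ==> inj_on (j X) (El M X)"
begin

lemma transp_simps:
 "El (transp M j) X = j X ` El M X"
 "0[On (transp M j) X] = j X 0[On M X]"
 "X \<in> Obj C ==> x \<in> El M X ==> y \<in> El M X ==>
   j X x +[On (transp M j) X] j X y = j X (x +[On M X] y)"
 "X \<in> Obj C ==> x \<in> El M X ==> a *[On (transp M j) X] j X x = j X (a *[On M X] x)"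
 "X \<in> Obj C ==> x \<in> El M X ==> Act (transp M j) X Y f (j X x) = j Y (Act M X Y f x)"
 by (simp_all add: transp_def Let_def the_inv_into_f_f[OF j])

lemma transp_c_module: "c_module K C (transp M j)"
proof (rule c_moduleI)
 fix X assume X: "X \<in> Obj C"
 interpret MX: kmod K "On M X" by (rule on_kmod[OF M X])
 note s = transp_simps(1,2) transp_simps(3-5)[OF X]
 show "module K (On (transp M j) X)"
 proof (rule moduleI)
  show "cring K" ..
  show "abelian_group (On (transp M j) X)"
  proof (rule abelian_groupI)
   fix x assume "x \<in> El (transp M j) X"
   then obtain y where y: "y \<in> El M X" "x = j X y" by (auto simp: s)
   then show "\<exists>y\<in>El (transp M j) X. y +[On (transp M j) X] x = 0[On (transp M j) X]"
    by (intro bexI[of _ "j X (-[On M X] y)"]) (auto simp: s MX.l_neg)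
  qed (auto simp: s MX.a_ac)
 qed (auto simp: s MX.smult_l_distr MX.smult_r_distr MX.smult_assoc1)
qed (auto simp: transp_simps act_closed[OF M] act_add[OF M] act_smult[OF M] on_closed[OF M] act_hom_add[OF M]
  act_hom_smult[OF M] act_id[OF M] act_comp[OF M])

lemma transp_hom: "mod_hom K C M (transp M j) j"
 by (rule mod_homI[OF M transp_c_module]) (auto simp: transp_simps)

lemma transp_inv_hom: "mod_hom K C (transp M j) M (\<lambda>X. the_inv_into (El M X) (j X))"
 by (rule mod_homI[OF transp_c_module M])
  (auto simp: transp_simps the_inv_into_f_f[OF j] on_closed[OF M] act_closed[OF M])

end

subsection \<open>Projective modules\<close>

text \<open>An element of the free cover is stored as the finite graph of its restriction to its
  support. The map \<open>lab\<close> turns the elements of \<open>M\<close> that occur in the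
  indices into elements of \<open>elt\<close>.\<close>

definition enc :: "('s \<Rightarrow> ('o, 'm, 'v) elt) \<Rightarrow> ('o \<times> 's) set \<Rightarrow> 'o \<Rightarrow> ('o \<times> 's \<Rightarrow> 'm) \<Rightarrow> ('o, 'm, 'v) elt" where
 "enc lab S X p = Fam (Abs_fset ((\<lambda>g. ((fst g, lab (snd g)), p g)) ` {g \<in> S. p g \<noteq> 0[Hom C (fst g) X]}))"

text \<open>On the support the value is read off from the graph, because \<open>lab\<close> is
  injective and the index can be recovered; off the support the value is zero.\<close>

lemma enc_inj:
 assumes "inj lab" shows "inj_on (enc lab (gens M) X) (El (fcov M) X)"
proof (rule inj_onI)
 fix p q assume pq: "p \<in> El (fcov M) X" "q \<in> El (fcov M) X"
  and eq: "enc lab (gens M) X p = enc lab (gens M) X q"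
 let ?s = "\<lambda>p. {g \<in> gens M. p g \<noteq> 0[Hom C (fst g) X]}" and ?l = "\<lambda>p g. ((fst g, lab (snd g)), p g)"
 have fin: "finite (?s p)" "finite (?s q)" and ext: "p \<in> extensional (gens M)" "q \<in> extensional (gens M)"
  using pq by (auto simp: fcov_def dsum_simps supp_def)
 have im: "?l p ` ?s p = ?l q ` ?s q"
  using eq fin unfolding enc_def by (simp add: Abs_fset_inject)
 have one: "p' g = q' g" if "?l p' ` ?s p' \<subseteq> ?l q' ` ?s q'" "g \<in> ?s p'" for p' q' g
 proof -
  have "?l p' g \<in> ?l q' ` ?s q'" using that by blast
  then obtain g' where "fst g = fst g'" "lab (snd g) = lab (snd g')" "p' g = q' g'" by auto
  then show ?thesis using assms by (metis injD prod_eqI)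
 qed
 show "p = q"
 proof (rule extensionalityI[OF ext])
  fix g assume g: "g \<in> gens M"
  show "p g = q g"
  proof (cases "g \<in> ?s p \<or> g \<in> ?s q")
   case True
   have "?l p ` ?s p \<subseteq> ?l q ` ?s q" "?l q ` ?s q \<subseteq> ?l p ` ?s p" using im by simp_all
   from True show ?thesis
   proof
    assume "g \<in> ?s p" then show ?thesis by (rule one[rotated]) fact
   next
    assume "g \<in> ?s q" then show ?thesis by (rule one[symmetric, rotated]) fact
   qed
  qed (use g in auto)
 qed
qed

lemma projective_lifts_elt:
 assumes P: "projective K C (P :: ('k, 'o, 'm, 'v) cmod)"
  and A: "c_module K C (A :: ('k, 'o, 'm, ('o, 'm, 'v) elt) cmod)"
  and B: "c_module K C (B :: ('k, 'o, 'm, ('o, 'm, 'v) elt) cmod)"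
  and e: "mod_hom K C A B e" "epi C A B e"
 shows "lifts K C P A B e"
 unfolding lifts_def
proof (intro allI impI)
 fix f assume f: "mod_hom K C P B f"
 have Pm: "c_module K C P" using P by (simp add: projective_def)
 have "\<exists>g\<in>nat_trans K C P A. nt_comp C P (ext_hom C A e) g = ext_hom C P f"
  using P A B ext_hom_nat_trans[OF A e(1)] ext_hom_nat_trans[OF Pm f] e(2)
  unfolding projective_def by (metis epi_ext_hom)
 then obtain g where g: "g \<in> nat_trans K C P A" "nt_comp C P (ext_hom C A e) g = ext_hom C P f" by blast
 have gh: "mod_hom K C P A g" by (rule nat_trans_hom[OF g(1)])
 have "e X (g X x) = f X x" if "X \<in> Obj C" "x \<in> El P X" for X x
  using fun_cong[OF fun_cong[OF g(2)], of X x] that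
  by (simp add: nt_comp_apply ext_hom_apply hom_closed[OF gh])
 with gh show "\<exists>g. mod_hom K C P A g \<and> (\<forall>X\<in>Obj C. \<forall>x\<in>El P X. e X (g X x) = f X x)" by blast
qed

lemma projectiveI:
 assumes P: "c_module K C (P :: ('k, 'o, 'm, 'v) cmod)"
  and L: "\<And>(A :: ('k, 'o, 'm, ('o, 'm, 'v) elt) cmod) (B :: ('k, 'o, 'm, ('o, 'm, 'v) elt) cmod) e.
   c_module K C A ==> c_module K C B ==> mod_hom K C A B e ==> epi C A B e ==> lifts K C P A B e"
 shows "projective K C P"
 unfolding projective_def
proof (intro conjI allI impI P)
 fix A B :: "('k, 'o, 'm, ('o, 'm, 'v) elt) cmod" and e f
 assume *: "c_module K C A" "c_module K C B" "e \<in> nat_trans K C A B" "epi C A B e" and f: "f \<in> nat_trans K C P B"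
 obtain g where g: "mod_hom K C P A g" "\<And>X x. X \<in> Obj C ==> x \<in> El P X ==> e X (g X x) = f X x"
  using liftsD[OF L[OF *(1,2) nat_trans_hom[OF *(3)] *(4)] nat_trans_hom[OF f]] by metis
 have "nt_comp C P e (ext_hom C P g) = f"
 proof (rule nat_trans_eqI[OF _ f])
  show "nt_comp C P e (ext_hom C P g) \<in> nat_trans K C P B"
   by (rule nt_comp_nat_trans[OF P nat_trans_hom[OF ext_hom_nat_trans[OF P g(1)]] nat_trans_hom[OF *(3)]])
 qed (simp add: nt_comp_apply ext_hom_apply g(2))
 then show "\<exists>g\<in>nat_trans K C P A. nt_comp C P e g = f" using ext_hom_nat_trans[OF P g(1)] by blast
qed

text \<open>A projective module is a retract of its free cover, which lifts against epimorphisms of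
  modules over arbitrary element types.\<close>

lemma projective_section:
 assumes P: "projective K C P"
 shows "\<exists>s. mod_hom K C P (fcov P) s \<and> (\<forall>X\<in>Obj C. \<forall>x\<in>El P X. fcov_map P X (s X x) = x)"
proof -
 have Pm: "c_module K C P" using P by (simp add: projective_def)
 \<comment> \<open>Both \<open>P\<close> and its free cover are copied into \<open>elt\<close>.
   There the definition of \<open>projective\<close> applies to the copied cover map, and the copy
   of the identity of \<open>P\<close> lifts.\<close>
 let ?e = "enc Elt (gens P)" and ?P = "transp P (\<lambda>_. Elt)"
 let ?L = "transp (fcov P) ?e"
 let ?i = "\<lambda>X. the_inv_into (El (fcov P) X) (?e X)"
 let ?j = "\<lambda>X. the_inv_into (El P X) Elt"
 have je: "inj_on (?e X) (El (fcov P) X)" for X by (rule enc_inj) (auto simp: inj_def)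
 have jE: "inj_on Elt (El P X)" for X by (auto simp: inj_on_def)
 have L: "c_module K C ?L" by (rule transp_c_module[OF fcov_c_module je])
 have PE: "c_module K C ?P" by (rule transp_c_module[OF Pm jE])
 have iL: "mod_hom K C ?L (fcov P) ?i" by (rule transp_inv_hom[OF fcov_c_module je])
 have hE: "mod_hom K C P ?P (\<lambda>_. Elt)" by (rule transp_hom[OF Pm jE])
 have p: "mod_hom K C ?L ?P (\<lambda>X x. Elt (fcov_map P X (?i X x)))"
  by (rule hom_comp[OF hom_comp[OF iL fcov_map_hom[OF Pm]] hE])
 have ep: "epi C ?L ?P (\<lambda>X x. Elt (fcov_map P X (?i X x)))"
 proof (rule epiI[OF p])
  fix X y assume X: "X \<in> Obj C" and "y \<in> carrier (On ?P X)"
  then obtain x where x: "x \<in> El P X" "y = Elt x" by (auto simp: transp_simps[OF Pm jE])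
  then obtain q where "q \<in> El (fcov P) X" "fcov_map P X q = x" using epiD[OF fcov_map_epi[OF Pm] X] by blast
  then show "\<exists>x\<in>carrier (On ?L X). Elt (fcov_map P X (?i X x)) = y"
   using x by (intro bexI[of _ "?e X q"]) (auto simp: transp_simps(1)[OF fcov_c_module je] the_inv_into_f_f[OF je])
 qed
 have "\<exists>g. mod_hom K C P ?L g \<and> (\<forall>X\<in>Obj C. \<forall>x\<in>El P X. Elt (fcov_map P X (?i X (g X x))) = Elt x)"
  using projective_lifts_elt[OF P L PE p ep] hE unfolding lifts_def by blast
 then obtain g where g: "mod_hom K C P ?L g"
  "\<forall>X\<in>Obj C. \<forall>x\<in>El P X. Elt (fcov_map P X (?i X (g X x))) = Elt x"
  by (elim exE conjE)
 show ?thesis using hom_comp[OF g(1) iL] g(2) by (intro exI[of _ "\<lambda>X x. ?i X (g X x)"]) simp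
qed

lemma projective_c_module: "projective K C P ==> c_module K C P"
 by (simp add: projective_def)

lemma projective_lifts:
 assumes P: "projective K C P" and "c_module K C A" "c_module K C B" "mod_hom K C A B e" "epi C A B e"
 shows "lifts K C P A B e"
 using projective_section[OF P] lifts_retract[OF _ fcov_map_hom[OF projective_c_module[OF P]] _ fcov_lifts[OF assms(2-5)]]
 by blast

text \<open>Lifting along a map that is only exact in the middle: \<open>d\<close> is an epimorphism
  onto the kernel of \<open>g\<close>, and \<open>f\<close> lands in that kernel. Chain lifts and
  homotopies are both built with this.\<close>

lemma projective_lift_exact:
 assumes P: "projective K C P" and A: "c_module K C A" and B: "c_module K C B" and D: "c_module K C D"
  and d: "mod_hom K C A B d" and g: "mod_hom K C B D g"
  and ex: "\<And>X y. X \<in> Obj C ==> y \<in> El B X ==> g X y = 0[On D X] ==> \<exists>x\<in>El A X. d X x = y"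
  and gd: "\<And>X x. X \<in> Obj C ==> x \<in> El A X ==> g X (d X x) = 0[On D X]"
  and f: "mod_hom K C P B f" and gf: "\<And>X x. X \<in> Obj C ==> x \<in> El P X ==> g X (f X x) = 0[On D X]"
 obtains h where "mod_hom K C P A h" "\<And>X x. X \<in> Obj C ==> x \<in> El P X ==> d X (h X x) = f X x"
proof -
 let ?Z = "submod B (kern B D g)"
 have Z: "c_module K C ?Z" by (rule kern_c_module[OF B D g])
 have d': "mod_hom K C A ?Z d" by (rule hom_into_submod[OF d]) (auto simp: kern_def gd hom_closed[OF d])
 have f': "mod_hom K C P ?Z f" by (rule hom_into_submod[OF f]) (auto simp: kern_def gf hom_closed[OF f])
 have "epi C A ?Z d" by (rule epiI[OF d']) (auto simp: kern_def ex)
 from liftsD[OF projective_lifts[OF P A Z d' this] f'] that show ?thesis by blast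
qed

text \<open>One equation \<open>r i = id\<close> is asked for, so the lemma covers retracts as well
  as isomorphic copies.\<close>

lemma projective_iso:
 assumes P: "projective K C P" and Q: "c_module K C Q" and i: "mod_hom K C Q P i" and r: "mod_hom K C P Q r"
  and ri: "\<And>X x. X \<in> Obj C ==> x \<in> El Q X ==> r X (i X x) = x"
 shows "projective K C Q"
 by (rule projectiveI[OF Q]) (rule lifts_retract[OF i r ri projective_lifts[OF P]])

lemma fcov_projective: "projective K C (fcov M)"
 by (rule projectiveI[OF fcov_c_module]) (rule fcov_lifts)

lemma transp_projective:
 assumes M: "projective K C M" and j: "\<And>X. X \<in> Obj C ==> inj_on (j X) (El M X)"
 shows "projective K C (transp M j)"
proof (rule projective_iso[OF M])
 have Mm: "c_module K C M" using M by (rule projective_c_module)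
 show "c_module K C (transp M j)" by (rule transp_c_module[OF Mm j])
 show "mod_hom K C (transp M j) M (\<lambda>X. the_inv_into (El M X) (j X))" by (rule transp_inv_hom[OF Mm j])
 show "mod_hom K C M (transp M j) j" by (rule transp_hom[OF Mm j])
qed (auto simp: transp_simps[OF projective_c_module[OF M] j] the_inv_into_f_f[OF j])

end

subsection \<open>Resolutions\<close>

text \<open>An exact augmented complex whose terms need not be projective. Restrictions of
  resolutions along \<open>C -> C/I\<close> are of this kind, and for slices and quotients
  projectivity is established separately.\<close>

locale resolution = kcat K C for K :: "'k ring" and C :: "('k, 'o, 'm) kcat" +
 fixes M :: "('k, 'o, 'm, 'v) cmod" and P :: "nat \<Rightarrow> ('k, 'o, 'm, 'p) cmod" and d \<epsilon>
 assumes M: "c_module K C M" and P: "c_module K C (P n)"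
  and d: "mod_hom K C (P (Suc n)) (P n) (d n)" and eps: "mod_hom K C (P 0) M \<epsilon>"
  and eps_onto: "X \<in> Obj C ==> y \<in> El M X ==> \<exists>x\<in>El (P 0) X. \<epsilon> X x = y"
  and eps_d: "X \<in> Obj C ==> x \<in> El (P (Suc 0)) X ==> \<epsilon> X (d 0 X x) = 0[On M X]"
  and d_d: "X \<in> Obj C ==> z \<in> El (P (Suc (Suc n))) X ==> d n X (d (Suc n) X z) = 0[On (P n) X]"
  and exact0: "X \<in> Obj C ==> x \<in> El (P 0) X ==> \<epsilon> X x = 0[On M X] ==>
   \<exists>y\<in>El (P (Suc 0)) X. d 0 X y = x"
  and exact: "X \<in> Obj C ==> z' \<in> El (P (Suc n)) X ==> d n X z' = 0[On (P n) X] ==>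
   \<exists>y\<in>El (P (Suc (Suc n))) X. d (Suc n) X y = z'"

context kcat
begin

lemmas resolutionI = resolution.intro[OF kcat_axioms, OF resolution_axioms.intro]

lemma proj_resolution_resolution:
 assumes M: "c_module K C M" and R: "proj_resolution K C M P d \<epsilon>"
 shows "resolution K C M P d \<epsilon>" and "\<And>n. projective K C (P n)"
proof -
 show pr: "\<And>n. projective K C (P n)" using R by (simp add: proj_resolution_def)
 have e: "epi C (P 0) M \<epsilon>" using R by (simp add: proj_resolution_def)
 have h: "mod_hom K C (P 0) M \<epsilon>" "\<And>n. mod_hom K C (P (Suc n)) (P n) (d n)"
  using R by (auto simp: proj_resolution_def intro: nat_trans_hom)
 have x0: "X \<in> Obj C ==> d 0 X ` El (P (Suc 0)) X = {x \<in> El (P 0) X. \<epsilon> X x = 0[On M X]}" for X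
  using R by (simp add: proj_resolution_def exact_at_iff)
 have x1: "X \<in> Obj C ==> d (Suc n) X ` El (P (Suc (Suc n))) X = {x \<in> El (P (Suc n)) X. d n X x = 0[On (P n) X]}" for X n
  using R by (simp add: proj_resolution_def exact_at_iff)
 show "resolution K C M P d \<epsilon>"
 proof (rule resolutionI)
  fix X assume X: "X \<in> Obj C"
  { fix y assume "y \<in> El M X" then show "\<exists>x\<in>El (P 0) X. \<epsilon> X x = y" using epiD[OF e X] by blast }
  { fix x assume "x \<in> El (P (Suc 0)) X" then show "\<epsilon> X (d 0 X x) = 0[On M X]" using x0[OF X] by blast }
  { fix x n assume "x \<in> El (P (Suc (Suc n))) X" then show "d n X (d (Suc n) X x) = 0[On (P n) X]" using x1[OF X] by blast }
  { fix x assume "x \<in> El (P 0) X" "\<epsilon> X x = 0[On M X]"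
   then have "x \<in> d 0 X ` El (P (Suc 0)) X" unfolding x0[OF X] by simp
   then show "\<exists>y\<in>El (P (Suc 0)) X. d 0 X y = x" by blast }
  { fix x n assume "x \<in> El (P (Suc n)) X" "d n X x = 0[On (P n) X]"
   then have "x \<in> d (Suc n) X ` El (P (Suc (Suc n))) X" unfolding x1[OF X] by simp
   then show "\<exists>y\<in>El (P (Suc (Suc n))) X. d (Suc n) X y = x" by blast }
 qed (use M pr h projective_c_module in auto)
qed

lemma resolution_proj_resolution:
 assumes R: "resolution K C M P d \<epsilon>" and pr: "\<And>n. projective K C (P n)"
 shows "proj_resolution K C M P (\<lambda>n. ext_hom C (P (Suc n)) (d n)) (ext_hom C (P 0) \<epsilon>)"
proof -
 interpret R: resolution K C M P d \<epsilon> by fact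
 have "epi C (P 0) M \<epsilon>" by (rule epiI[OF R.eps]) (rule R.eps_onto)
 moreover have "d 0 X ` El (P (Suc 0)) X = {x \<in> El (P 0) X. \<epsilon> X x = 0[On M X]}" if X: "X \<in> Obj C" for X
  using R.eps_d[OF X] R.exact0[OF X] hom_closed[OF R.d X] by (fastforce simp: image_iff)
 moreover have "d (Suc n) X ` El (P (Suc (Suc n))) X = {x \<in> El (P (Suc n)) X. d n X x = 0[On (P n) X]}" if X: "X \<in> Obj C" for X n
  using R.d_d[OF X] R.exact[OF X] hom_closed[OF R.d X] by (fastforce simp: image_iff)
 ultimately show ?thesis
  using pr by (auto simp: proj_resolution_def exact_at_iff ext_hom_nat_trans R.P R.d R.eps ext_hom_apply
    cong: image_cong conj_cong)
qed

text \<open>The free cover of a module whose elements lie in \<open>elt\<close>, again with elements in \<open>elt\<close>.\<close>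

definition ecov :: "('s \<Rightarrow> ('o, 'm, 'v) elt) \<Rightarrow> ('k, 'o, 'm, 's) cmod \<Rightarrow> ('k, 'o, 'm, ('o, 'm, 'v) elt) cmod" where
 "ecov lab M = transp (fcov M) (enc lab (gens M))"

definition ecov_map :: "('s \<Rightarrow> ('o, 'm, 'v) elt) \<Rightarrow> ('k, 'o, 'm, 's) cmod \<Rightarrow> 'o \<Rightarrow> ('o, 'm, 'v) elt \<Rightarrow> 's" where
 "ecov_map lab M X x = fcov_map M X (the_inv_into (El (fcov M) X) (enc lab (gens M) X) x)"

lemma ecov_props:
 assumes M: "c_module K C M" and "inj lab"
 shows "projective K C (ecov lab M)" "mod_hom K C (ecov lab M) M (ecov_map lab M)"
  "epi C (ecov lab M) M (ecov_map lab M)"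
proof -
 note e = enc_inj[OF assms(2)]
 show "projective K C (ecov lab M)" unfolding ecov_def by (rule transp_projective[OF fcov_projective e])
 show h: "mod_hom K C (ecov lab M) M (ecov_map lab M)" unfolding ecov_def ecov_map_def
  by (rule hom_comp[OF transp_inv_hom[OF fcov_c_module e] fcov_map_hom[OF M]])
 show "epi C (ecov lab M) M (ecov_map lab M)"
 proof (rule epiI[OF h])
  fix X y assume X: "X \<in> Obj C" and "y \<in> El M X"
  then obtain q where "q \<in> El (fcov M) X" "fcov_map M X q = y" using epiD[OF fcov_map_epi[OF M] X] by blast
  then show "\<exists>x\<in>El (ecov lab M) X. ecov_map lab M X x = y" unfolding ecov_def ecov_map_def
   by (intro bexI[of _ "enc lab (gens M) X q"]) (auto simp: transp_simps(1)[OF fcov_c_module e] the_inv_into_f_f[OF e])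
 qed
qed

lemma proj_resolution_exists:
 assumes M: "c_module K C (M :: ('k, 'o, 'm, 'v) cmod)"
 shows "\<exists>(P :: nat \<Rightarrow> ('k, 'o, 'm, ('o, 'm, 'v) elt) cmod) d \<epsilon>. proj_resolution K C M P d \<epsilon>"
proof -
 \<comment> \<open>After the first cover all elements already lie in \<open>elt\<close> and serve as
   their own labels; only the cover of \<open>M\<close> itself uses \<open>Elt\<close>.\<close>
 let ?cov = "ecov (\<lambda>x. x :: ('o, 'm, 'v) elt)" and ?map = "ecov_map (\<lambda>x. x :: ('o, 'm, 'v) elt)"
 have id: "inj (\<lambda>x. x :: ('o, 'm, 'v) elt)" and El: "inj (Elt :: 'v \<Rightarrow> ('o, 'm, 'v) elt)" by (auto simp: inj_def)
 let ?P0 = "ecov (Elt :: 'v \<Rightarrow> ('o, 'm, 'v) elt) M" and ?\<epsilon> = "ecov_map (Elt :: 'v \<Rightarrow> ('o, 'm, 'v) elt) M"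
 let ?ker = "\<lambda>N :: ('k, 'o, 'm, ('o, 'm, 'v) elt) cmod. submod (?cov N) (kern (?cov N) N (?map N))"
 \<comment> \<open>\<open>Z n\<close> is the kernel inside \<open>P n\<close>. The recursion runs
   over these syzygies, and \<open>P\<close> is read off as the sequence of their covers.\<close>
 define Z where "Z = rec_nat (submod ?P0 (kern ?P0 M ?\<epsilon>)) (\<lambda>n. ?ker)"
 define P where "P n = (case n of 0 \<Rightarrow> ?P0 | Suc m \<Rightarrow> ?cov (Z m))" for n
 have Z0: "Z 0 = submod ?P0 (kern ?P0 M ?\<epsilon>)" and ZS: "Z (Suc n) = ?ker (Z n)" for n by (simp_all add: Z_def)
 note e = ecov_props[OF M El]
 have P0: "c_module K C ?P0" using e(1) by (rule projective_c_module)
 have Zm: "c_module K C (Z n)" for n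
 proof (induction n)
  case 0 show ?case unfolding Z0 by (rule kern_c_module[OF P0 M e(2)])
 next
  case (Suc n)
  show ?case unfolding ZS by (rule kern_c_module[OF projective_c_module[OF ecov_props(1)[OF Suc id]] Suc ecov_props(2)[OF Suc id]])
 qed
 note c = ecov_props[OF Zm id]
 have PS: "P (Suc n) = ?cov (Z n)" and PZ: "P 0 = ?P0" for n by (simp_all add: P_def)
 have pr: "projective K C (P n)" for n by (cases n) (simp_all add: P_def e(1) c(1))
 note Pm = projective_c_module[OF pr]
 \<comment> \<open>The condition that cuts \<open>Z n\<close> out of \<open>P n\<close>. The case
   distinction is needed because the target of the augmentation has elements of another type than
   the targets of the later covers.\<close>
 define T where "T n X x \<longleftrightarrow> (case n of 0 \<Rightarrow> ?\<epsilon> X x = 0[On M X] | Suc m \<Rightarrow> ?map (Z m) X x = 0[On (Z m) X])" for n X x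
 have ZP: "Z n = submod (P n) (\<lambda>X. {x \<in> El (P n) X. T n X x})" for n
  by (cases n) (simp_all add: Z0 ZS P_def T_def kern_def [abs_def])
 have sub: "subfunctor (P n) (\<lambda>X. {x \<in> El (P n) X. T n X x})" for n
 proof (cases n)
  case 0 then show ?thesis using kern_subfunctor[OF P0 M e(2)] by (simp add: P_def T_def kern_def [abs_def])
 next
  case (Suc m) then show ?thesis
   using kern_subfunctor[OF projective_c_module[OF c(1)] Zm c(2)] by (simp add: P_def T_def kern_def [abs_def])
 qed
 have Zc: "x \<in> El (Z n) X \<longleftrightarrow> x \<in> El (P n) X \<and> T n X x" for x n X by (subst ZP) simp
 have Zz: "0[On (Z n) X] = 0[On (P n) X]" for n X by (subst ZP) simp
 have "resolution K C M P (\<lambda>n. ?map (Z n)) ?\<epsilon>"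
 proof (rule resolutionI)
  fix n show "mod_hom K C (P (Suc n)) (P n) (?map (Z n))"
   unfolding PS by (rule hom_comp[OF c(2)]) (subst ZP, rule submod_incl[OF Pm sub])
 next
  fix X z n assume X: "X \<in> Obj C" and z: "z \<in> El (P (Suc n)) X" "?map (Z n) X z = 0[On (P n) X]"
  then have "z \<in> El (Z (Suc n)) X" by (simp add: Zc T_def Zz)
  then show "\<exists>y\<in>El (P (Suc (Suc n))) X. ?map (Z (Suc n)) X y = z" unfolding PS using epiD[OF c(3) X] by blast
 next
  fix X z assume X: "X \<in> Obj C" and z: "z \<in> El (P 0) X" "?\<epsilon> X z = 0[On M X]"
  then have "z \<in> El (Z 0) X" by (simp add: Zc T_def)
  then show "\<exists>y\<in>El (P (Suc 0)) X. ?map (Z 0) X y = z" unfolding PS using epiD[OF c(3) X] by blast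
 next
  fix X x assume X: "X \<in> Obj C" and "x \<in> El (P (Suc 0)) X"
  then have "?map (Z 0) X x \<in> El (Z 0) X" unfolding PS by (metis hom_closed[OF c(2)])
  then show "?\<epsilon> X (?map (Z 0) X x) = 0[On M X]" by (simp add: Zc T_def)
 next
  fix X x n assume X: "X \<in> Obj C" and "x \<in> El (P (Suc (Suc n))) X"
  then have "?map (Z (Suc n)) X x \<in> El (Z (Suc n)) X" unfolding PS by (metis hom_closed[OF c(2)])
  then show "?map (Z n) X (?map (Z (Suc n)) X x) = 0[On (P n) X]" by (simp add: Zc T_def Zz)
 qed (use M Pm PZ e(2) epiD[OF e(3)] in auto)
 from resolution_proj_resolution[OF this pr] show ?thesis by blast
qed

lemma chosen_resolution:
 assumes "c_module K C M" and "chosen_resolution K C M = (P, d, \<epsilon>)"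
 shows "proj_resolution K C M P d \<epsilon>"
proof -
 have "case chosen_resolution K C M of (P, d, \<epsilon>) \<Rightarrow> proj_resolution K C M P d \<epsilon>"
  unfolding chosen_resolution_def
  by (rule someI_ex) (use proj_resolution_exists[OF assms(1)] in auto)
 then show ?thesis using assms(2) by simp
qed

section \<open>Lifting chain maps and constructing homotopies\<close>

lemma chain_lift_exists:
 assumes Q: "resolution K C F Q dQ \<epsilon>Q" and prQ: "\<And>n. projective K C (Q n)"
  and P: "resolution K C G P dP \<epsilon>P" and f: "mod_hom K C F G f"
 obtains \<tau> where "\<And>n. mod_hom K C (Q n) (P n) (\<tau> n)"
  "\<And>X x. X \<in> Obj C ==> x \<in> El (Q 0) X ==> \<epsilon>P X (\<tau> 0 X x) = f X (\<epsilon>Q X x)"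
  "\<And>n X x. X \<in> Obj C ==> x \<in> El (Q (Suc n)) X ==> dP n X (\<tau> (Suc n) X x) = \<tau> n X (dQ n X x)"
proof -
 interpret Q: resolution K C F Q dQ \<epsilon>Q by fact
 interpret P: resolution K C G P dP \<epsilon>P by fact
 define step where "step n t t' \<longleftrightarrow> mod_hom K C (Q (Suc n)) (P (Suc n)) t' \<and>
   (\<forall>X\<in>Obj C. \<forall>x\<in>El (Q (Suc n)) X. dP n X (t' X x) = t X (dQ n X x))" for n t t'
 \<comment> \<open>The invariant for dependent choice carries exactly what makes the next lifting
   problem solvable: the composite to be lifted is killed by the following map of \<open>P\<close>.
   In degree 0 that map is the augmentation.\<close>
 let ?ok = "\<lambda>n t. mod_hom K C (Q n) (P n) t \<and>
  (case n of 0 \<Rightarrow> \<forall>X\<in>Obj C. \<forall>x\<in>El (Q 0) X. \<epsilon>P X (t X x) = f X (\<epsilon>Q X x)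
   | Suc m \<Rightarrow> \<forall>X\<in>Obj C. \<forall>x\<in>El (Q (Suc n)) X. dP m X (t X (dQ n X x)) = 0[On (P m) X])"
 have "\<exists>\<tau>. \<forall>n. ?ok n (\<tau> n) \<and> step n (\<tau> n) (\<tau> (Suc n))"
 proof (rule dependent_nat_choice)
  have "epi C (P 0) G \<epsilon>P" by (rule epiI[OF P.eps]) (rule P.eps_onto)
  from projective_lifts[OF prQ P.P P.M P.eps this, of 0] hom_comp[OF Q.eps f]
  show "\<exists>t. ?ok 0 t" unfolding lifts_def by fastforce
  fix n t assume t: "?ok n t"
  have h: "mod_hom K C (Q (Suc n)) (P n) (\<lambda>X x. t X (dQ n X x))" by (rule hom_comp[OF Q.d]) (use t in blast)
  obtain t' where t': "mod_hom K C (Q (Suc n)) (P (Suc n)) t'"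
   "\<And>X x. X \<in> Obj C ==> x \<in> El (Q (Suc n)) X ==> dP n X (t' X x) = t X (dQ n X x)"
  proof (cases n)
   case 0
   show ?thesis
   proof (rule projective_lift_exact[OF prQ[of "Suc n"] P.P P.P P.M P.d[of n] _ _ _ h])
    show "mod_hom K C (P n) G \<epsilon>P" using P.eps 0 by simp
    show "\<epsilon>P X (t X (dQ n X x)) = 0[On G X]" if "X \<in> Obj C" "x \<in> El (Q (Suc n)) X" for X x
     using t that hom_closed[OF Q.d that] by (simp add: 0 Q.eps_d hom_zero[OF f Q.M P.M])
   qed (use that P.exact0 P.eps_d 0 in auto)
  next
   case (Suc m)
   show ?thesis
   proof (rule projective_lift_exact[OF prQ[of "Suc n"] P.P P.P P.P P.d[of n] _ _ _ h])
    show "mod_hom K C (P n) (P m) (dP m)" using P.d Suc by simp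
    show "dP m X (t X (dQ n X x)) = 0[On (P m) X]" if "X \<in> Obj C" "x \<in> El (Q (Suc n)) X" for X x
     using t that by (simp add: Suc)
   qed (use that P.exact P.d_d Suc in auto)
  qed
  have tm: "mod_hom K C (Q n) (P n) t" using t by blast
  have "dP n X (t' X (dQ (Suc n) X x)) = 0[On (P n) X]" if "X \<in> Obj C" "x \<in> El (Q (Suc (Suc n))) X" for X x
   using t'(2)[OF that(1) hom_closed[OF Q.d that]] that by (simp add: Q.d_d hom_zero[OF tm Q.P P.P])
  then show "\<exists>t'. ?ok (Suc n) t' \<and> step n t t'" using t' by (auto simp: step_def)
 qed
 then obtain \<tau> where \<tau>: "\<And>n. ?ok n (\<tau> n)" "\<And>n. step n (\<tau> n) (\<tau> (Suc n))" by blast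
 show ?thesis
 proof (rule that)
  show "mod_hom K C (Q n) (P n) (\<tau> n)" for n using \<tau>(1) by blast
  show "\<epsilon>P X (\<tau> 0 X x) = f X (\<epsilon>Q X x)" if "X \<in> Obj C" "x \<in> El (Q 0) X" for X x
   using \<tau>(1)[of 0] that by simp
  show "dP n X (\<tau> (Suc n) X x) = \<tau> n X (dQ n X x)" if "X \<in> Obj C" "x \<in> El (Q (Suc n)) X" for n X x
   using \<tau>(2)[of n] that by (simp add: step_def)
 qed
qed

text \<open>Only endomorphisms of one resolution are considered, as this is applied to differences
  between the identity and another chain map over the identity. The invariant
  \<open>d h d = f d\<close> makes \<open>f - h d\<close> a map into cycles in the next
  degree.\<close>

lemma null_homotopy:
 assumes P: "resolution K C F P d \<epsilon>" and pr: "\<And>n. projective K C (P n)"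
  and f: "\<And>n. mod_hom K C (P n) (P n) (f n)"
  and f0: "\<And>X x. X \<in> Obj C ==> x \<in> El (P 0) X ==> \<epsilon> X (f 0 X x) = 0[On F X]"
  and fS: "\<And>n X x. X \<in> Obj C ==> x \<in> El (P (Suc n)) X ==> d n X (f (Suc n) X x) = f n X (d n X x)"
 obtains h where "\<And>n. mod_hom K C (P n) (P (Suc n)) (h n)"
  "\<And>X x. X \<in> Obj C ==> x \<in> El (P 0) X ==> f 0 X x = d 0 X (h 0 X x)"
  "\<And>n X x. X \<in> Obj C ==> x \<in> El (P (Suc n)) X ==>
   f (Suc n) X x = d (Suc n) X (h (Suc n) X x) +[On (P (Suc n)) X] h n X (d n X x)"
proof -
 interpret P: resolution K C F P d \<epsilon> by fact
 let ?ok = "\<lambda>n h. mod_hom K C (P n) (P (Suc n)) h \<and>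
  (\<forall>X\<in>Obj C. \<forall>x\<in>El (P (Suc n)) X. d n X (h X (d n X x)) = f n X (d n X x))"
 let ?st = "\<lambda>n h h'. \<forall>X\<in>Obj C. \<forall>x\<in>El (P (Suc n)) X.
   d (Suc n) X (h' X x) = f (Suc n) X x -[On (P (Suc n)) X] h X (d n X x)"
 obtain h0 where h0: "mod_hom K C (P 0) (P (Suc 0)) h0"
  "\<And>X x. X \<in> Obj C ==> x \<in> El (P 0) X ==> d 0 X (h0 X x) = f 0 X x"
  by (rule projective_lift_exact[OF pr[of 0] P.P P.P P.M P.d[of 0] P.eps P.exact0 P.eps_d f[of 0] f0]) auto
 \<comment> \<open>The start \<open>h0\<close> is fixed beforehand and remembered in the invariant,
   since \<open>?ok 0\<close> is weaker than the equation \<open>f 0 = d h\<close> that the result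
   asserts.\<close>
 have "\<exists>h. \<forall>n. (?ok n (h n) \<and> (n = 0 \<longrightarrow> h n = h0)) \<and> ?st n (h n) (h (Suc n))"
 proof (rule dependent_nat_choice)
  show "\<exists>h. ?ok 0 h \<and> (0 = (0::nat) \<longrightarrow> h = h0)" using h0 hom_closed[OF P.d] by auto
  fix n h assume ok: "?ok n h \<and> (n = 0 \<longrightarrow> h = h0)"
  then have hm: "mod_hom K C (P n) (P (Suc n)) h" by blast
  have dif: "mod_hom K C (P (Suc n)) (P (Suc n)) (\<lambda>X x. f (Suc n) X x -[On (P (Suc n)) X] h X (d n X x))"
   by (rule hom_diff[OF P.P P.P f hom_comp[OF P.d hm]])
  have z: "d n X (f (Suc n) X x -[On (P (Suc n)) X] h X (d n X x)) = 0[On (P n) X]"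
   if X: "X \<in> Obj C" and x: "x \<in> El (P (Suc n)) X" for X x
  proof -
   interpret PX: kmod K "On (P n) X" by (rule on_kmod[OF P.P X])
   have "d n X (f (Suc n) X x -[On (P (Suc n)) X] h X (d n X x)) = f n X (d n X x) -[On (P n) X] f n X (d n X x)"
    using X x ok by (simp add: hom_minus[OF P.d P.P P.P] hom_closed[OF f] hom_closed[OF hm] hom_closed[OF P.d] fS)
   also have "\<dots> = 0[On (P n) X]" using X x
    by (simp add: PX.minus_eq_zero_iff hom_closed[OF f] hom_closed[OF P.d])
   finally show ?thesis .
  qed
  obtain h' where h': "mod_hom K C (P (Suc n)) (P (Suc (Suc n))) h'"
   "\<And>X x. X \<in> Obj C ==> x \<in> El (P (Suc n)) X ==>
     d (Suc n) X (h' X x) = f (Suc n) X x -[On (P (Suc n)) X] h X (d n X x)"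
   by (rule projective_lift_exact[OF pr[of "Suc n"] P.P P.P P.P P.d[of "Suc n"] P.d[of n] P.exact P.d_d dif z]) auto
  have "d (Suc n) X (h' X (d (Suc n) X x)) = f (Suc n) X (d (Suc n) X x)"
   if X: "X \<in> Obj C" and x: "x \<in> El (P (Suc (Suc n))) X" for X x
  proof -
   interpret PX: kmod K "On (P (Suc n)) X" by (rule on_kmod[OF P.P X])
   show ?thesis using X x
    by (simp add: h'(2) hom_closed[OF P.d] P.d_d hom_zero[OF hm P.P P.P] hom_closed[OF f])
  qed
  then show "\<exists>h'. (?ok (Suc n) h' \<and> (Suc n = 0 \<longrightarrow> h' = h0)) \<and> ?st n h h'" using h' by auto
 qed
 then obtain h where h: "\<And>n. mod_hom K C (P n) (P (Suc n)) (h n)" "h 0 = h0" "\<And>n. ?st n (h n) (h (Suc n))" by blast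
 show ?thesis
 proof (rule that[of h])
  fix n X x assume X: "X \<in> Obj C" and x: "x \<in> El (P (Suc n)) X"
  interpret PX: kmod K "On (P (Suc n)) X" by (rule on_kmod[OF P.P X])
  show "f (Suc n) X x = d (Suc n) X (h (Suc n) X x) +[On (P (Suc n)) X] h n X (d n X x)"
   using h(3)[of n] X x by (simp add: PX.minus_add_cancel hom_closed[OF f] hom_closed[OF h(1)] hom_closed[OF P.d])
 qed (use h h0 in auto)
qed

subsection \<open>Complexes of homomorphisms\<close>

lemma Hom_Mod_simps:
 "carrier (Hom_Mod K C M N) = nat_trans K C M N"
 "0[Hom_Mod K C M N] = ext_hom C M (\<lambda>X x. 0[On N X])"
 "\<eta> +[Hom_Mod K C M N] \<theta> = ext_hom C M (\<lambda>X x. \<eta> X x +[On N X] \<theta> X x)"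
 "a *[Hom_Mod K C M N] \<eta> = ext_hom C M (\<lambda>X x. a *[On N X] \<eta> X x)"
 by (simp_all add: Hom_Mod_def ext_hom_def)

lemma ext_hom_cong: "(\<And>X x. X \<in> Obj C ==> x \<in> El M X ==> \<eta> X x = \<theta> X x) ==> ext_hom C M \<eta> = ext_hom C M \<theta>"
 by (auto simp: ext_hom_def fun_eq_iff restrict_def)

lemma ext_hom_self: "c_module K C M ==> \<eta> \<in> nat_trans K C M N ==> ext_hom C M \<eta> = \<eta>"
 by (rule nat_trans_eqI[OF ext_hom_nat_trans[OF _ nat_trans_hom]]) (auto simp: ext_hom_apply)

lemma hom_scale:
 assumes M: "c_module K C M" and N: "c_module K C N" and h: "mod_hom K C M N \<eta>" and a: "a \<in> carrier K"
 shows "mod_hom K C M N (\<lambda>X x. a *[On N X] \<eta> X x)"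
 by (rule mod_homI[OF M N]) (use a in "auto simp: hom_closed[OF h] on_closed[OF N] hom_add[OF h] on_laws[OF N]
  hom_nat[OF h] act_smult[OF N]")

lemma Hom_Mod_module:
 assumes M: "c_module K C M" and N: "c_module K C N"
 shows "module K (Hom_Mod K C M N)"
proof -
 note E = ext_hom_nat_trans[OF M]
 note s = Hom_Mod_simps
 have c: "\<eta> \<in> nat_trans K C M N ==> X \<in> Obj C ==> x \<in> El M X ==> \<eta> X x \<in> El N X" for \<eta> X x
  using hom_closed[OF nat_trans_hom] .
 have eq: "\<theta> \<in> nat_trans K C M N ==> (\<And>X x. X \<in> Obj C ==> x \<in> El M X ==> \<eta> X x = \<theta> X x) ==> ext_hom C M \<eta> = \<theta>" for \<eta> \<theta>
  using ext_hom_cong[of M \<eta> \<theta>] ext_hom_self[OF M] by metis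
 note a = ext_hom_apply
 show ?thesis
 proof (rule moduleI)
  show "cring K" ..
  show "abelian_group (Hom_Mod K C M N)"
  proof (rule abelian_groupI, goal_cases)
   case (1 x y) then show ?case unfolding s by (intro E hom_plus[OF M N] nat_trans_hom)
  next
   case 2 then show ?case unfolding s by (intro E hom_zero_map[OF M N])
  next
   case (3 x y z) then show ?case unfolding s by (intro ext_hom_cong) (simp add: a c on_laws(1)[OF N] )
  next
   case (4 x y) then show ?case unfolding s by (intro ext_hom_cong) (simp add: c on_laws(2)[OF N])
  next
   case (5 x) then show ?case unfolding s by (intro eq) (simp_all add: a c on_laws(3)[OF N])
  next
   case (6 x)
   let ?y = "ext_hom C M (\<lambda>X u. 0[On N X] -[On N X] x X u)"
   have "?y \<in> nat_trans K C M N" using 6 unfolding s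
    by (intro E hom_diff[OF M N] hom_zero_map[OF M N] nat_trans_hom)
   moreover have "?y +[Hom_Mod K C M N] x = 0[Hom_Mod K C M N]" using 6 unfolding s
    by (intro ext_hom_cong) (simp add: a c on_laws(3-5,11)[OF N] a_minus_def)
   ultimately show ?case unfolding s by blast
  qed
 next
  fix b x assume b: "b \<in> carrier K" and x: "x \<in> carrier (Hom_Mod K C M N)"
  then show "b *[Hom_Mod K C M N] x \<in> carrier (Hom_Mod K C M N)"
   unfolding s by (intro E hom_scale[OF M N] nat_trans_hom)
 qed (unfold s, auto intro!: ext_hom_cong eq simp: a c on_laws(6-9)[OF N])
qed

abbreviation "hom_cx P N \<equiv> (\<lambda>n. Hom_Mod K C (P n) N)"
abbreviation "hom_d P d \<equiv> (\<lambda>n \<phi>. nt_comp C (P (Suc n)) \<phi> (d n))"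

lemma nt_comp_ext: "nt_comp C L \<psi> \<phi> = ext_hom C L (\<lambda>X x. \<psi> X (\<phi> X x))"
 by (simp add: nt_comp_def ext_hom_def compose_def)

lemma precomp_lin:
 assumes L: "c_module K C L" and M: "c_module K C M" and N: "c_module K C N" and t: "mod_hom K C L M t"
 shows "(\<lambda>\<phi>. nt_comp C L \<phi> t) \<in> lin_maps K (Hom_Mod K C M N) (Hom_Mod K C L N)"
proof (rule lin_mapsI)
 fix x assume "x \<in> carrier (Hom_Mod K C M N)"
 then have "mod_hom K C M N x" by (simp add: Hom_Mod_simps nat_trans_hom)
 then show "nt_comp C L x t \<in> carrier (Hom_Mod K C L N)"
  unfolding Hom_Mod_simps by (rule nt_comp_nat_trans[OF L t])
qed (unfold Hom_Mod_simps nt_comp_ext, auto intro!: ext_hom_cong simp: ext_hom_apply hom_closed[OF t])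

lemma postcomp_lin:
 assumes L: "c_module K C L" and M: "c_module K C M" and N: "c_module K C N" and t: "mod_hom K C M N t"
 shows "(\<lambda>\<phi>. nt_comp C L t \<phi>) \<in> lin_maps K (Hom_Mod K C L M) (Hom_Mod K C L N)"
proof (rule lin_mapsI)
 fix x assume "x \<in> carrier (Hom_Mod K C L M)"
 then have "mod_hom K C L M x" by (simp add: Hom_Mod_simps nat_trans_hom)
 then show "nt_comp C L t x \<in> carrier (Hom_Mod K C L N)"
  unfolding Hom_Mod_simps by (rule nt_comp_nat_trans[OF L _ t])
qed (unfold Hom_Mod_simps nt_comp_ext, auto intro!: ext_hom_cong
  simp: ext_hom_apply hom_add[OF t] hom_smult[OF t] hom_closed[OF nat_trans_hom])

lemma hom_cocomplex:
 assumes P: "\<And>n. c_module K C (P n)" and d: "\<And>n. mod_hom K C (P (Suc n)) (P n) (d n)"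
  and dd: "\<And>n X x. X \<in> Obj C ==> x \<in> El (P (Suc (Suc n))) X ==> d n X (d (Suc n) X x) = 0[On (P n) X]"
  and N: "c_module K C N"
 shows "cocomplex K (hom_cx P N) (hom_d P d)"
proof (rule cocomplex.intro)
 show "module K (Hom_Mod K C (P n) N)" for n by (rule Hom_Mod_module[OF P N])
 show "(\<lambda>\<phi>. nt_comp C (P (Suc n)) \<phi> (d n)) \<in> lin_maps K (Hom_Mod K C (P n) N) (Hom_Mod K C (P (Suc n)) N)" for n
  by (rule precomp_lin[OF P P N d])
 fix n x assume "x \<in> carrier (Hom_Mod K C (P n) N)"
 then have x: "mod_hom K C (P n) N x" by (simp add: Hom_Mod_simps nat_trans_hom)
 show "nt_comp C (P (Suc (Suc n))) (nt_comp C (P (Suc n)) x (d n)) (d (Suc n)) = 0[Hom_Mod K C (P (Suc (Suc n))) N]"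
  unfolding Hom_Mod_simps nt_comp_ext
  by (rule ext_hom_cong) (simp add: ext_hom_apply hom_closed[OF d] dd hom_zero[OF x P N])
qed

lemma cohomology_H_mod: "cohomology K C P d N n = H_mod (hom_cx P N) (hom_d P d) n"
proof -
 have "coboundaries K C P d N n = cobd (hom_cx P N) (hom_d P d) n"
  by (cases n) (simp_all add: coboundaries_def cobd_def Hom_Mod_simps(1))
 moreover have "cocycles K C P d N n = cocyc (hom_cx P N) (hom_d P d) n"
  by (auto simp: cocycles_def cocyc_def a_kernel_def kernel_def)
 ultimately show ?thesis by (simp add: cohomology_def H_mod_def)
qed

lemma coboundaries_cobd: "coboundaries K C P d N n = cobd (hom_cx P N) (hom_d P d) n"
 by (cases n) (simp_all add: coboundaries_def cobd_def Hom_Mod_simps(1))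

end

subsection \<open>Comparison of resolutions\<close>

context kcat
begin

lemma cocyc_iff:
 assumes P: "\<And>n. c_module K C (P n)" and N: "c_module K C N" and d: "\<And>n. mod_hom K C (P (Suc n)) (P n) (d n)"
 shows "f \<in> cocyc (hom_cx P N) (hom_d P d) n \<longleftrightarrow> f \<in> nat_trans K C (P n) N \<and>
  (\<forall>X\<in>Obj C. \<forall>x\<in>El (P (Suc n)) X. f X (d n X x) = 0[On N X])"
proof -
 have "nt_comp C (P (Suc n)) f (d n) = ext_hom C (P (Suc n)) (\<lambda>X x. 0[On N X]) \<longleftrightarrow>
   (\<forall>X\<in>Obj C. \<forall>x\<in>El (P (Suc n)) X. f X (d n X x) = 0[On N X])" if "f \<in> nat_trans K C (P n) N"
 proof
  assume eq: "nt_comp C (P (Suc n)) f (d n) = ext_hom C (P (Suc n)) (\<lambda>X x. 0[On N X])"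
  show "\<forall>X\<in>Obj C. \<forall>x\<in>El (P (Suc n)) X. f X (d n X x) = 0[On N X]"
  proof (intro ballI)
   fix X x assume "X \<in> Obj C" "x \<in> El (P (Suc n)) X"
   then show "f X (d n X x) = 0[On N X]"
    using fun_cong[OF fun_cong[OF eq], of X x] by (simp add: nt_comp_apply ext_hom_apply)
  qed
 next
  assume "\<forall>X\<in>Obj C. \<forall>x\<in>El (P (Suc n)) X. f X (d n X x) = 0[On N X]"
  then show "nt_comp C (P (Suc n)) f (d n) = ext_hom C (P (Suc n)) (\<lambda>X x. 0[On N X])"
   unfolding nt_comp_ext by (intro ext_hom_cong) simp
 qed
 then show ?thesis by (auto simp: cocyc_def Hom_Mod_simps)
qed

lemma precomp_cochain_map:
 assumes Q: "resolution K C F Q dQ \<epsilon>Q" and P: "resolution K C G P dP \<epsilon>P" and N: "c_module K C N"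
  and \<tau>: "\<And>n. mod_hom K C (Q n) (P n) (\<tau> n)"
  and \<tau>S: "\<And>n X x. X \<in> Obj C ==> x \<in> El (Q (Suc n)) X ==> dP n X (\<tau> (Suc n) X x) = \<tau> n X (dQ n X x)"
 shows "cochain_map K (hom_cx P N) (hom_d P dP) (hom_cx Q N) (hom_d Q dQ) (\<lambda>n \<phi>. nt_comp C (Q n) \<phi> (\<tau> n))"
proof -
 interpret Q: resolution K C F Q dQ \<epsilon>Q by fact
 interpret P: resolution K C G P dP \<epsilon>P by fact
 show ?thesis
 proof (intro cochain_map.intro cochain_map_axioms.intro)
  show "cocomplex K (hom_cx P N) (hom_d P dP)" by (rule hom_cocomplex[where P = P and d = dP, OF P.P P.d P.d_d N])
  show "cocomplex K (hom_cx Q N) (hom_d Q dQ)" by (rule hom_cocomplex[where P = Q and d = dQ, OF Q.P Q.d Q.d_d N])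
  show "(\<lambda>\<phi>. nt_comp C (Q n) \<phi> (\<tau> n)) \<in> lin_maps K (Hom_Mod K C (P n) N) (Hom_Mod K C (Q n) N)" for n
   by (rule precomp_lin[OF Q.P P.P N \<tau>])
  show "nt_comp C (Q (Suc n)) (nt_comp C (P (Suc n)) x (dP n)) (\<tau> (Suc n)) = nt_comp C (Q (Suc n)) (nt_comp C (Q n) x (\<tau> n)) (dQ n)" for x n
   unfolding nt_comp_ext by (rule ext_hom_cong) (simp add: ext_hom_apply hom_closed[OF \<tau>] hom_closed[OF Q.d] \<tau>S)
 qed
qed

text \<open>Negation in \<open>Hom_Mod\<close> is the abstract inverse of its addition. The
  pointwise formula is therefore obtained from \<open>?c + b = a\<close> instead of by
  unfolding.\<close>

lemma Hom_Mod_minus: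
 assumes M: "c_module K C M" and N: "c_module K C N" and a: "a \<in> nat_trans K C M N" and b: "b \<in> nat_trans K C M N"
 shows "a -[Hom_Mod K C M N] b = ext_hom C M (\<lambda>X x. a X x -[On N X] b X x)" (is "_ = ?c")
proof -
 interpret H: kmod K "Hom_Mod K C M N" unfolding kmod_def by (rule Hom_Mod_module[OF M N])
 have c: "?c \<in> nat_trans K C M N" by (rule ext_hom_nat_trans[OF M hom_diff[OF M N nat_trans_hom[OF a] nat_trans_hom[OF b]]])
 have "?c +[Hom_Mod K C M N] b = a"
 proof (rule nat_trans_eqI[OF _ a])
  show "?c +[Hom_Mod K C M N] b \<in> nat_trans K C M N" using H.a_closed[of ?c b] b c by (simp add: Hom_Mod_simps(1))
  fix X x assume X: "X \<in> Obj C" and x: "x \<in> El M X"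
  interpret NX: kmod K "On N X" by (rule on_kmod[OF N X])
  show "(?c +[Hom_Mod K C M N] b) X x = a X x"
   using hom_closed[OF nat_trans_hom[OF a] X x] hom_closed[OF nat_trans_hom[OF b] X x] X x
   by (simp add: Hom_Mod_simps(3) ext_hom_apply NX.minus_add_cancel)
 qed
 then show ?thesis using H.add_minus_cancel[of ?c b] b c by (simp add: Hom_Mod_simps(1))
qed

text \<open>With \<open>f = d h + h d\<close> and \<open>y d = 0\<close>, the composite
  \<open>y f\<close> equals \<open>(y h) d\<close>.\<close>

lemma null_homotopic_cobd:
 assumes P: "resolution K C F P d \<epsilon>" and pr: "\<And>n. projective K C (P n)"
  and f: "\<And>n. mod_hom K C (P n) (P n) (f n)"
  and f0: "\<And>X x. X \<in> Obj C ==> x \<in> El (P 0) X ==> \<epsilon> X (f 0 X x) = 0[On F X]"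
  and fS: "\<And>n X x. X \<in> Obj C ==> x \<in> El (P (Suc n)) X ==> d n X (f (Suc n) X x) = f n X (d n X x)"
  and N: "c_module K C N" and y: "y \<in> cocyc (hom_cx P N) (hom_d P d) n"
 shows "ext_hom C (P n) (\<lambda>X x. y X (f n X x)) \<in> cobd (hom_cx P N) (hom_d P d) n"
proof -
 interpret P: resolution K C F P d \<epsilon> by fact
 obtain h where h: "\<And>n. mod_hom K C (P n) (P (Suc n)) (h n)"
  "\<And>X x. X \<in> Obj C ==> x \<in> El (P 0) X ==> f 0 X x = d 0 X (h 0 X x)"
  "\<And>n X x. X \<in> Obj C ==> x \<in> El (P (Suc n)) X ==> f (Suc n) X x = d (Suc n) X (h (Suc n) X x) +[On (P (Suc n)) X] h n X (d n X x)"
  by (rule null_homotopy[where f = f, OF P pr f f0 fS]) (assumption | rule that)+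
 have y': "mod_hom K C (P n) N y" "\<And>X x. X \<in> Obj C ==> x \<in> El (P (Suc n)) X ==> y X (d n X x) = 0[On N X]"
  using y unfolding cocyc_iff[where P = P and d = d, OF P.P N P.d] by (blast intro: nat_trans_hom)+
 show ?thesis
 proof (cases n)
  case 0
  have "ext_hom C (P 0) (\<lambda>X x. y X (f 0 X x)) = ext_hom C (P 0) (\<lambda>X x. 0[On N X])"
   by (rule ext_hom_cong) (use y'(2) 0 in "simp add: h(2) hom_closed[OF h(1)]")
  then show ?thesis using 0 by (simp add: cobd_def Hom_Mod_simps(2))
 next
  case (Suc m)
  let ?g = "ext_hom C (P m) (\<lambda>X x. y X (h m X x))"
  have g: "?g \<in> nat_trans K C (P m) N" by (rule ext_hom_nat_trans[OF P.P]) (use hom_comp[OF h(1) y'(1)[unfolded Suc]] in simp)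
  have "ext_hom C (P n) (\<lambda>X x. y X (f n X x)) = nt_comp C (P (Suc m)) ?g (d m)"
   unfolding nt_comp_ext Suc
  proof (rule ext_hom_cong)
   fix X x assume X: "X \<in> Obj C" and x: "x \<in> El (P (Suc m)) X"
   interpret NX: kmod K "On N X" by (rule on_kmod[OF N X])
   note c = hom_closed[OF h(1) X hom_closed[OF P.d X x]] and c' = hom_closed[OF h(1) X x]
   show "y X (f (Suc m) X x) = ?g X (d m X x)"
    using hom_add[OF y'(1)[unfolded Suc] X hom_closed[OF P.d X c'] c] y'(2)[OF X, of "h n X x"] c' X
     hom_closed[OF y'(1)[unfolded Suc] X c]
    by (simp add: h(3)[OF X x] Suc ext_hom_apply hom_closed[OF P.d X x])
  qed
  then show ?thesis using g Suc by (auto simp: cobd_def Hom_Mod_simps(1))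
 qed
qed

text \<open>\<open>id - \<tau> \<rho>\<close> is a chain endomorphism of \<open>P\<close> over the
  zero map of \<open>F\<close>, hence null-homotopic.\<close>

lemma comparison_homotopy:
 assumes N: "c_module K C N" and Q: "resolution K C F Q dQ \<epsilon>Q"
  and P: "resolution K C F P dP \<epsilon>P" and pr: "\<And>n. projective K C (P n)"
  and \<tau>: "\<And>n. mod_hom K C (Q n) (P n) (\<tau> n)"
   "\<And>X x. X \<in> Obj C ==> x \<in> El (Q 0) X ==> \<epsilon>P X (\<tau> 0 X x) = \<epsilon>Q X x"
   "\<And>n X x. X \<in> Obj C ==> x \<in> El (Q (Suc n)) X ==> dP n X (\<tau> (Suc n) X x) = \<tau> n X (dQ n X x)"
  and \<rho>: "\<And>n. mod_hom K C (P n) (Q n) (\<rho> n)"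
   "\<And>X x. X \<in> Obj C ==> x \<in> El (P 0) X ==> \<epsilon>Q X (\<rho> 0 X x) = \<epsilon>P X x"
   "\<And>n X x. X \<in> Obj C ==> x \<in> El (P (Suc n)) X ==> dQ n X (\<rho> (Suc n) X x) = \<rho> n X (dP n X x)"
  and x: "x \<in> cocyc (hom_cx P N) (hom_d P dP) n"
 shows "x -[Hom_Mod K C (P n) N] nt_comp C (P n) (nt_comp C (Q n) x (\<tau> n)) (\<rho> n) \<in> cobd (hom_cx P N) (hom_d P dP) n"
proof -
 interpret Q: resolution K C F Q dQ \<epsilon>Q by fact
 interpret P: resolution K C F P dP \<epsilon>P by fact
 let ?f = "\<lambda>n X p. p -[On (P n) X] \<tau> n X (\<rho> n X p)"
 have c: "\<tau> n X (\<rho> n X p) \<in> El (P n) X" if "X \<in> Obj C" "p \<in> El (P n) X" for X p n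
  by (rule hom_closed[OF \<tau>(1) that(1) hom_closed[OF \<rho>(1) that]])
 have x': "mod_hom K C (P n) N x" using x unfolding cocyc_iff[where P = P and d = dP, OF P.P N P.d] by (blast intro: nat_trans_hom)
 have xn: "x \<in> nat_trans K C (P n) N" using x unfolding cocyc_iff[where P = P and d = dP, OF P.P N P.d] by blast
 have tn: "nt_comp C (Q n) x (\<tau> n) \<in> nat_trans K C (Q n) N" by (rule nt_comp_nat_trans[OF Q.P \<tau>(1) x'])
 have "x -[Hom_Mod K C (P n) N] nt_comp C (P n) (nt_comp C (Q n) x (\<tau> n)) (\<rho> n) = ext_hom C (P n) (\<lambda>X p. x X (?f n X p))"
  unfolding Hom_Mod_minus[OF P.P N xn nt_comp_nat_trans[OF P.P \<rho>(1) nat_trans_hom[OF tn]]]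
  by (rule ext_hom_cong) (simp add: nt_comp_apply hom_closed[OF \<rho>(1)] hom_minus[OF x' P.P N] c)
 also have "\<dots> \<in> cobd (hom_cx P N) (hom_d P dP) n"
 proof (rule null_homotopic_cobd[where f = ?f, OF P pr _ _ _ N x])
  show "mod_hom K C (P n) (P n) (?f n)" for n by (rule hom_diff[OF P.P P.P hom_id hom_comp[OF \<rho>(1) \<tau>(1)]])
  fix X p assume X: "X \<in> Obj C"
  { assume p: "p \<in> El (P 0) X"
   interpret FX: kmod K "On F X" by (rule on_kmod[OF P.M X])
   show "\<epsilon>P X (?f 0 X p) = 0[On F X]"
    using X p c hom_closed[OF P.eps X p] by (simp add: hom_minus[OF P.eps P.P P.M] \<tau>(2) \<rho>(2) hom_closed[OF \<rho>(1)] FX.minus_eq_zero_iff) }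
  { fix n assume p: "p \<in> El (P (Suc n)) X"
   show "dP n X (?f (Suc n) X p) = ?f n X (dP n X p)"
    using X p c by (simp add: hom_minus[OF P.d P.P P.P] \<tau>(3) \<rho>(3) hom_closed[OF \<rho>(1)]) }
 qed
 finally show ?thesis .
qed

text \<open>The isomorphism is induced by the given lift \<open>\<tau>\<close>, whichever it is.
  This matters because \<open>ext_canonical_map\<close> contains a particular lift, chosen by
  \<open>SOME\<close>. The lift \<open>\<rho>\<close> in the other direction is needed inside the
  proof only.\<close>

lemma projective_comparison:
 assumes N: "c_module K C N" and Q: "resolution K C F Q dQ \<epsilon>Q" and prQ: "\<And>n. projective K C (Q n)"
  and P: "resolution K C F P dP \<epsilon>P" and prP: "\<And>n. projective K C (P n)"
  and \<tau>: "\<And>n. mod_hom K C (Q n) (P n) (\<tau> n)"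
   "\<And>X x. X \<in> Obj C ==> x \<in> El (Q 0) X ==> \<epsilon>P X (\<tau> 0 X x) = \<epsilon>Q X x"
   "\<And>n X x. X \<in> Obj C ==> x \<in> El (Q (Suc n)) X ==> dP n X (\<tau> (Suc n) X x) = \<tau> n X (dQ n X x)"
 shows "H_map (hom_cx Q N) (hom_d Q dQ) n (\<lambda>\<phi>. nt_comp C (Q n) \<phi> (\<tau> n)) \<in>
  lin_isos K (H_mod (hom_cx P N) (hom_d P dP) n) (H_mod (hom_cx Q N) (hom_d Q dQ) n)"
proof -
 obtain \<rho> where \<rho>: "\<And>n. mod_hom K C (P n) (Q n) (\<rho> n)"
  "\<And>X x. X \<in> Obj C ==> x \<in> El (P 0) X ==> \<epsilon>Q X (\<rho> 0 X x) = \<epsilon>P X x"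
  "\<And>n X x. X \<in> Obj C ==> x \<in> El (P (Suc n)) X ==> dQ n X (\<rho> (Suc n) X x) = \<rho> n X (dP n X x)"
  by (rule chain_lift_exists[OF P prP Q hom_id]) (rule that)
 interpret t: cochain_map K "hom_cx P N" "hom_d P dP" "hom_cx Q N" "hom_d Q dQ" "\<lambda>n \<phi>. nt_comp C (Q n) \<phi> (\<tau> n)"
  by (rule precomp_cochain_map[where Q = Q and dQ = dQ and P = P and dP = dP and \<tau> = \<tau>, OF Q P N \<tau>(1,3)])
 interpret r: cochain_map K "hom_cx Q N" "hom_d Q dQ" "hom_cx P N" "hom_d P dP" "\<lambda>n \<phi>. nt_comp C (P n) \<phi> (\<rho> n)"
  by (rule precomp_cochain_map[where Q = P and dQ = dP and P = Q and dP = dQ and \<tau> = \<rho>, OF P Q N \<rho>(1,3)])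
 show ?thesis
 proof (rule t.H_map_iso)
  fix y assume y: "y \<in> cocyc (hom_cx Q N) (hom_d Q dQ) n"
  show "\<exists>x\<in>cocyc (hom_cx P N) (hom_d P dP) n. y -[Hom_Mod K C (Q n) N] nt_comp C (Q n) x (\<tau> n) \<in> cobd (hom_cx Q N) (hom_d Q dQ) n"
   by (rule bexI[OF _ r.f_cocyc[OF y]])
    (rule comparison_homotopy[where Q = P and dQ = dP and P = Q and dP = dQ and \<tau> = \<rho> and \<rho> = \<tau>, OF N P Q prQ \<rho> \<tau> y])
 next
  fix x assume x: "x \<in> cocyc (hom_cx P N) (hom_d P dP) n" and cb: "nt_comp C (Q n) x (\<tau> n) \<in> cobd (hom_cx Q N) (hom_d Q dQ) n"
  interpret H: kmod K "Hom_Mod K C (P n) N" by (rule t.A.kmod)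
  note sp = H.submodule_props[OF t.A.cobd_sub]
  have "x -[Hom_Mod K C (P n) N] nt_comp C (P n) (nt_comp C (Q n) x (\<tau> n)) (\<rho> n) \<in> cobd (hom_cx P N) (hom_d P dP) n"
   by (rule comparison_homotopy[where Q = Q and dQ = dQ and P = P and dP = dP and \<tau> = \<tau> and \<rho> = \<rho>, OF N Q P prP \<tau> \<rho> x])
  from sp(3)[OF this r.f_cobd[OF cb]] show "x \<in> cobd (hom_cx P N) (hom_d P dP) n"
   using H.minus_add_cancel[OF t.A.cocyc_carrier[OF x]] sp(1) r.f_cobd[OF cb] by (simp add: subset_iff)
 qed
qed

text \<open>An epimorphism is the cokernel of its kernel. This is used with an augmentation to
  describe the cocycles of degree 0.\<close>

lemma hom_factor_epi:
 assumes A: "c_module K C A" and B: "c_module K C B" and N: "c_module K C N" and e: "mod_hom K C A B e" "epi C A B e"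
  and f: "mod_hom K C A N f" and k: "\<And>X x. X \<in> Obj C ==> x \<in> El A X ==> e X x = 0[On B X] ==> f X x = 0[On N X]"
 obtains g where "mod_hom K C B N g" "\<And>X x. X \<in> Obj C ==> x \<in> El A X ==> g X (e X x) = f X x"
proof -
 have eq: "f X x = f X y" if "X \<in> Obj C" "x \<in> El A X" "y \<in> El A X" "e X x = e X y" for X x y
 proof -
  interpret NX: kmod K "On N X" by (rule on_kmod[OF N that(1)])
  interpret BX: kmod K "On B X" by (rule on_kmod[OF B that(1)])
  have "f X (x -[On A X] y) = 0[On N X]"
   using that by (intro k) (auto simp: on_closed[OF A] hom_minus[OF e(1) A B] BX.minus_eq_zero_iff hom_closed[OF e(1)])
  then show ?thesis using that by (simp add: hom_minus[OF f A N] NX.minus_eq_zero_iff hom_closed[OF f])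
 qed
 define g where "g X b = f X (SOME x. x \<in> El A X \<and> e X x = b)" for X b
 have ge: "g X (e X x) = f X x" if "X \<in> Obj C" "x \<in> El A X" for X x
  unfolding g_def using someI[of "\<lambda>y. y \<in> El A X \<and> e X y = e X x" x] that by (intro eq) auto
 have "mod_hom K C B N g"
 proof (rule mod_homI[OF B N])
  fix X b assume X: "X \<in> Obj C" and b: "b \<in> El B X"
  obtain x where x: "x \<in> El A X" "b = e X x" using epiD[OF e(2) X b] by metis
  show "g X b \<in> El N X" using x X by (simp add: ge hom_closed[OF f])
  { fix b' assume "b' \<in> El B X"
   then obtain x' where x': "x' \<in> El A X" "b' = e X x'" using epiD[OF e(2) X] by metis
   show "g X (b +[On B X] b') = g X b +[On N X] g X b'"
    using x x' X by (simp add: ge hom_add[OF f] on_closed[OF A] flip: hom_add[OF e(1)]) }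
  { fix Y a assume Y: "Y \<in> Obj C" and a: "a \<in> Mor C X Y"
   show "g Y (Act B X Y a b) = Act N X Y a (g X b)"
    using x X Y a by (simp add: ge hom_nat[OF f] act_closed[OF A] flip: hom_nat[OF e(1)]) }
 qed
 with ge that show ?thesis by blast
qed

end

section \<open>The quotient category and strongly idempotent ideals\<close>

locale ideal_kcat = kcat K C + two_sided_ideal K C I
 for K :: "'k ring" and C :: "('k, 'o, 'm) kcat" and I
begin

abbreviation "B \<equiv> quot_cat C I"

abbreviation q where "q X Y f \<equiv> I X Y +>[Hom C X Y] f"

lemma B_simps [simp]: "Obj B = Obj C" "Hom B X Y = quot_mod (Hom C X Y) (I X Y)" "Id B X = q X X (Id C X)"
 by (simp_all add: quot_cat_def)

lemma I_carrier: "X \<in> Obj C ==> Y \<in> Obj C ==> f \<in> I X Y ==> f \<in> Mor C X Y"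
 using module.submodule_props(1)[OF hom_module ideal_submodule] by blast

lemma B_cases:
 assumes "X \<in> Obj C" "Y \<in> Obj C" "F \<in> Mor B X Y"
 obtains f where "f \<in> Mor C X Y" "F = q X Y f"
 using assms kmod.quot_carrier[OF hom_kmod] by auto

lemma q_closed: "X \<in> Obj C ==> Y \<in> Obj C ==> f \<in> Mor C X Y ==> q X Y f \<in> Mor B X Y"
 using kmod.quot_carrier[OF hom_kmod] by auto

lemma q_add: "X \<in> Obj C ==> Y \<in> Obj C ==> f \<in> Mor C X Y ==> g \<in> Mor C X Y ==>
  q X Y f +[Hom B X Y] q X Y g = q X Y (f +[Hom C X Y] g)"
 using kmod.quot_add[OF hom_kmod ideal_submodule] by simp

lemma q_smult: "X \<in> Obj C ==> Y \<in> Obj C ==> a \<in> carrier K ==> f \<in> Mor C X Y ==>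
  a *[Hom B X Y] q X Y f = q X Y (a *[Hom C X Y] f)"
 using kmod.quot_smult[OF hom_kmod ideal_submodule] by simp

lemma q_zero_iff: "X \<in> Obj C ==> Y \<in> Obj C ==> f \<in> Mor C X Y ==>
  q X Y f = 0[Hom B X Y] \<longleftrightarrow> f \<in> I X Y"
 using kmod.coset_eq_self_iff[OF hom_kmod ideal_submodule] by (simp add: kmod.quot_zero[OF hom_kmod])

text \<open>The double union in \<open>quot_cat\<close> collapses first over \<open>f\<close>, then
  over \<open>g\<close>; each collapse uses one of the two absorption properties of the
  ideal.\<close>

lemma q_comp:
 assumes "X \<in> Obj C" "Y \<in> Obj C" "Z \<in> Obj C" "f \<in> Mor C X Y" "g \<in> Mor C Y Z"
 shows "Comp B X Y Z (q Y Z g) (q X Y f) = q X Z (Comp C X Y Z g f)"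
proof -
 interpret XY: kmod K "Hom C X Y" by (rule hom_kmod) fact+
 interpret YZ: kmod K "Hom C Y Z" by (rule hom_kmod) fact+
 interpret XZ: kmod K "Hom C X Z" by (rule hom_kmod) fact+
 have 1: "(\<Union>f'\<in>q X Y f. q X Z (Comp C X Y Z g' f')) = q X Z (Comp C X Y Z g' f)" if g': "g' \<in> Mor C Y Z" for g'
 proof (rule XY.UN_coset_eq)
  fix w assume w: "w \<in> I X Y"
  then have wc: "w \<in> Mor C X Y" using assms by (simp add: I_carrier)
  have "Comp C X Y Z g' (w +[Hom C X Y] f) -[Hom C X Z] Comp C X Y Z g' f = Comp C X Y Z g' w"
   using assms wc g' by (simp add: comp_add_right comp_closed XZ.add_minus_cancel)
  then show "q X Z (Comp C X Y Z g' (w +[Hom C X Y] f)) = q X Z (Comp C X Y Z g' f)"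
   using assms w wc g' by (subst XZ.coset_eq_iff) (auto simp: ideal_submodule comp_closed ideal_comp_left)
 qed (use assms in "auto simp: ideal_submodule")
 have "Comp B X Y Z (q Y Z g) (q X Y f) = (\<Union>g'\<in>q Y Z g. \<Union>f'\<in>q X Y f. q X Z (Comp C X Y Z g' f'))"
  by (simp add: quot_cat_def)
 also have "\<dots> = (\<Union>g'\<in>q Y Z g. q X Z (Comp C X Y Z g' f))"
  using assms by (intro SUP_cong refl 1) (auto intro: YZ.coset_carrier_subset[OF ideal_submodule])
 also have "\<dots> = q X Z (Comp C X Y Z g f)"
 proof (rule YZ.UN_coset_eq)
  fix w assume w: "w \<in> I Y Z"
  then have wc: "w \<in> Mor C Y Z" using assms by (simp add: I_carrier)
  have "Comp C X Y Z (w +[Hom C Y Z] g) f -[Hom C X Z] Comp C X Y Z g f = Comp C X Y Z w f"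
   using assms wc by (simp add: comp_add_left comp_closed XZ.add_minus_cancel)
  then show "q X Z (Comp C X Y Z (w +[Hom C Y Z] g) f) = q X Z (Comp C X Y Z g f)"
   using assms w wc by (subst XZ.coset_eq_iff) (auto simp: ideal_submodule comp_closed ideal_comp_right)
 qed (use assms in "auto simp: ideal_submodule")
 finally show ?thesis .
qed

lemma B_kcat: "kcat K B"
proof (rule kcat.intro)
 show "cring K" ..
 have kq: "X \<in> Obj C ==> Y \<in> Obj C ==> F \<in> Mor B X Y \<longleftrightarrow> (\<exists>f\<in>Mor C X Y. F = q X Y f)" for X Y F
  using kmod.quot_carrier[OF hom_kmod] by auto
 note mc = mod_closed[OF hom_module]
 show "k_category K B"
 proof (rule k_category.intro)
  fix X Y assume "X \<in> Obj B" "Y \<in> Obj B"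
  then show "module K (Hom B X Y)" using kmod.quot_module[OF hom_kmod ideal_submodule] by simp
 next
  fix X Y Z f assume "X \<in> Obj B" "Y \<in> Obj B" "Z \<in> Obj B" "f \<in> Mor B X Y"
  then show "(\<lambda>g. Comp B X Y Z g f) \<in> lin_maps K (Hom B Y Z) (Hom B X Z)"
   by (intro lin_mapsI) (auto simp: kq q_comp q_add q_smult comp_closed comp_add_left comp_smult_left mc simp del: B_simps(2))
 next
  fix X Y Z g assume "X \<in> Obj B" "Y \<in> Obj B" "Z \<in> Obj B" "g \<in> Mor B Y Z"
  then show "(\<lambda>f. Comp B X Y Z g f) \<in> lin_maps K (Hom B X Y) (Hom B X Z)"
   by (intro lin_mapsI) (auto simp: kq q_comp q_add q_smult comp_closed comp_add_right comp_smult_right mc simp del: B_simps(2))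
 qed (auto simp: kq q_comp id_closed comp_id_left comp_id_right comp_closed comp_assoc simp del: B_simps(2))
qed

sublocale B: kcat K B by (rule B_kcat)

abbreviation res where "res F \<equiv> restrict_mod C I F"

lemma res_simps [simp]: "On (res F) = On F" "Act (res F) X Y f = Act F X Y (q X Y f)"
 by (simp_all add: restrict_mod_def)

lemma res_c_module:
 assumes F: "c_module K B F" shows "c_module K C (res F)"
proof (rule c_moduleI)
 fix X assume "X \<in> Obj C" then show "module K (On (res F) X)" using c_module.on_module[OF F] by simp
next
 fix X x assume "X \<in> Obj C" "x \<in> El (res F) X"
 then show "Act (res F) X X (Id C X) x = x" using act_id[OF F, of X x] by simp
next
 fix X Y Z f g x
 assume *: "X \<in> Obj C" "Y \<in> Obj C" "Z \<in> Obj C" "f \<in> Mor C X Y" "g \<in> Mor C Y Z" "x \<in> El (res F) X"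
 then show "Act (res F) X Z (Comp C X Y Z g f) x = Act (res F) Y Z g (Act (res F) X Y f x)"
  using act_comp[OF F, of X Y Z "q X Y f" "q Y Z g" x] q_closed[of X Y f] q_closed[of Y Z g] by (simp add: q_comp)
qed (use act_closed[OF F] act_add[OF F] act_smult[OF F] act_hom_add[OF F] act_hom_smult[OF F] q_closed in
  "auto simp flip: q_add q_smult simp del: B_simps(2)")

text \<open>The projection is surjective on Hom-spaces, so naturality for all cosets and naturality
  for all morphisms of \<open>C\<close> are the same condition.\<close>

lemma res_hom_iff: "mod_hom K C (res F) (res G) \<eta> \<longleftrightarrow> mod_hom K B F G \<eta>"
proof -
 have "(\<forall>f\<in>Mor B X Y. T f) \<longleftrightarrow> (\<forall>f\<in>Mor C X Y. T (q X Y f))" if "X \<in> Obj C" "Y \<in> Obj C" for X Y T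
  using that B_cases q_closed by metis
 then show ?thesis unfolding mod_hom_def by (simp cong: ball_cong)
qed

lemma res_nat_trans: "nat_trans K C (res F) (res G) = nat_trans K B F G"
proof -
 have "(\<forall>f\<in>Mor B X Y. T f) \<longleftrightarrow> (\<forall>f\<in>Mor C X Y. T (q X Y f))" if "X \<in> Obj C" "Y \<in> Obj C" for X Y T
  using that B_cases q_closed by metis
 then show ?thesis unfolding nat_trans_def by (simp cong: ball_cong)
qed

text \<open>A literal equality of records: complexes of homomorphisms over \<open>C/I\<close> are
  complexes over \<open>C\<close>, and no isomorphism has to be carried along.\<close>

lemma res_Hom_Mod: "Hom_Mod K C (res F) (res G) = Hom_Mod K B F G"
 by (simp add: Hom_Mod_def res_nat_trans)

lemma res_nt_comp: "nt_comp C (res F) = nt_comp B F"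
 by (simp add: nt_comp_def fun_eq_iff)

lemma res_resolution:
 assumes "resolution K B F P d \<epsilon>" shows "resolution K C (res F) (\<lambda>n. res (P n)) d \<epsilon>"
proof -
 interpret R: resolution K B F P d \<epsilon> by fact
 show ?thesis
  by (rule resolutionI)
   (use R.M R.P R.d R.eps R.eps_onto R.eps_d R.d_d R.exact0 R.exact in
    "auto simp: res_c_module res_hom_iff")
qed

end

section \<open>Tensor products\<close>

definition bilin :: "'k ring \<Rightarrow> ('k, 'v) module \<Rightarrow> ('k, 'w) module \<Rightarrow> ('k, 'u) module \<Rightarrow> ('v \<times> 'w \<Rightarrow> 'u) \<Rightarrow> bool" where
 "bilin K V W U b \<longleftrightarrow> (\<forall>w\<in>carrier W. (\<lambda>v. b (v, w)) \<in> lin_maps K V U) \<and> (\<forall>v\<in>carrier V. (\<lambda>w. b (v, w)) \<in> lin_maps K W U)"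

lemma bilinI:
 assumes "\<And>v w. v \<in> carrier V ==> w \<in> carrier W ==> b (v, w) \<in> carrier U"
  and "\<And>v v' w. v \<in> carrier V ==> v' \<in> carrier V ==> w \<in> carrier W ==> b (v +[V] v', w) = b (v, w) +[U] b (v', w)"
  and "\<And>a v w. a \<in> carrier K ==> v \<in> carrier V ==> w \<in> carrier W ==> b (a *[V] v, w) = a *[U] b (v, w)"
  and "\<And>v w w'. v \<in> carrier V ==> w \<in> carrier W ==> w' \<in> carrier W ==> b (v, w +[W] w') = b (v, w) +[U] b (v, w')"
  and "\<And>a v w. a \<in> carrier K ==> v \<in> carrier V ==> w \<in> carrier W ==> b (v, a *[W] w) = a *[U] b (v, w)"
 shows "bilin K V W U b"
 using assms by (auto simp: bilin_def intro!: lin_mapsI)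

lemma bilinD:
 assumes "bilin K V W U b"
 shows "v \<in> carrier V ==> w \<in> carrier W ==> b (v, w) \<in> carrier U"
  and "v \<in> carrier V ==> v' \<in> carrier V ==> w \<in> carrier W ==> b (v +[V] v', w) = b (v, w) +[U] b (v', w)"
  and "a \<in> carrier K ==> v \<in> carrier V ==> w \<in> carrier W ==> b (a *[V] v, w) = a *[U] b (v, w)"
  and "v \<in> carrier V ==> w \<in> carrier W ==> w' \<in> carrier W ==> b (v, w +[W] w') = b (v, w) +[U] b (v, w')"
  and "a \<in> carrier K ==> v \<in> carrier V ==> w \<in> carrier W ==> b (v, a *[W] w) = a *[U] b (v, w)"
 using assms unfolding bilin_def lin_maps_def by auto

definition tens :: "'k ring \<Rightarrow> ('k, 'v) module \<Rightarrow> ('k, 'w) module \<Rightarrow> 'v \<times> 'w \<Rightarrow> ('v \<times> 'w \<Rightarrow> 'k) set" where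
 "tens K V W x = tensor_rels K V W +>[tensor_free K V W] basis_vec K x"

text \<open>The linear map on the tensor product induced by \<open>b\<close>, in the
  \<open>the_elem\<close> form that \<open>hom_bimod\<close> uses for its action.\<close>

definition tlift :: "'k ring \<Rightarrow> ('k, 'u) module \<Rightarrow> ('v \<times> 'w \<Rightarrow> 'u) \<Rightarrow> ('v \<times> 'w \<Rightarrow> 'k) set \<Rightarrow> 'u" where
 "tlift K U b A = the_elem (lin_ext K U b ` A)"

locale scalars = K: cring K for K :: "'k ring"
begin

lemma free_simps:
 "p \<in> carrier (free_mod K B) \<longleftrightarrow> (\<forall>b. p b \<in> carrier K) \<and> finite {b. p b \<noteq> 0[K]} \<and> {b. p b \<noteq> 0[K]} \<subseteq> B"
 "0[free_mod K B] = (\<lambda>b. 0[K])" "p +[free_mod K B] r = (\<lambda>b. p b +[K] r b)"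
 "a *[free_mod K B] p = (\<lambda>b. a \<otimes>\<^bsub>K\<^esub> p b)"
 by (simp_all add: free_mod_def)

lemma free_module: "module K (free_mod K B)"
proof (rule moduleI)
 show "cring K" ..
 have fin: "finite {b. p b +[K] r b \<noteq> 0[K]}" "{b. p b +[K] r b \<noteq> 0[K]} \<subseteq> B"
  if "p \<in> carrier (free_mod K B)" "r \<in> carrier (free_mod K B)" for p r
 proof -
  have "{b. p b +[K] r b \<noteq> 0[K]} \<subseteq> {b. p b \<noteq> 0[K]} \<union> {b. r b \<noteq> 0[K]}"
   using that by (auto simp: free_simps)
  then show "finite {b. p b +[K] r b \<noteq> 0[K]}" "{b. p b +[K] r b \<noteq> 0[K]} \<subseteq> B"
   using that unfolding free_simps by (auto intro: finite_subset)
 qed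
 show "abelian_group (free_mod K B)"
 proof (rule abelian_groupI)
  fix p assume p: "p \<in> carrier (free_mod K B)"
  have "{b. -[K] p b \<noteq> 0[K]} = {b. p b \<noteq> 0[K]}"
   using p K.minus_minus by (auto simp: free_simps)
  then show "\<exists>r\<in>carrier (free_mod K B). r +[free_mod K B] p = 0[free_mod K B]"
   using p by (intro bexI[of _ "\<lambda>b. -[K] p b"]) (auto simp: free_simps K.l_neg)
 qed (use fin in "auto simp: free_simps K.a_ac")
 fix a p assume a: "a \<in> carrier K" and p: "p \<in> carrier (free_mod K B)"
 have "{b. a \<otimes>\<^bsub>K\<^esub> p b \<noteq> 0[K]} \<subseteq> {b. p b \<noteq> 0[K]}" using a by auto
 then show "a *[free_mod K B] p \<in> carrier (free_mod K B)" using a p by (auto simp: free_simps intro: finite_subset)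
qed (auto simp: free_simps K.l_distr K.r_distr K.m_assoc)

lemma basis_carrier: "b \<in> B ==> basis_vec K b \<in> carrier (free_mod K B)"
 by (auto simp: free_simps basis_vec_def intro: finite_subset[of _ "{b}"])

lemma free_kmod: "kmod K (free_mod K B)"
 unfolding kmod_def by (rule free_module)

lemma lin_ext_over:
 assumes V: "module K V" and b: "\<And>x. x \<in> B ==> \<beta> x \<in> carrier V" and p: "p \<in> carrier (free_mod K B)"
  and T: "finite T" "T \<subseteq> B" "{x. p x \<noteq> 0[K]} \<subseteq> T"
 shows "lin_ext K V \<beta> p = (\<Oplus>\<^bsub>V\<^esub> x\<in>T. p x *[V] \<beta> x)"
proof -
 interpret V: kmod K V unfolding kmod_def by fact
 show ?thesis unfolding lin_ext_def
  by (rule V.add.finprod_mono_neutral_cong_left) (use T b p in "auto simp: free_simps")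
qed

lemma lin_ext_closed:
 assumes V: "module K V" and b: "\<And>x. x \<in> B ==> \<beta> x \<in> carrier V" and p: "p \<in> carrier (free_mod K B)"
 shows "lin_ext K V \<beta> p \<in> carrier V"
proof -
 interpret V: kmod K V unfolding kmod_def by fact
 show ?thesis unfolding lin_ext_def by (rule V.finsum_closed) (use b p in "auto simp: free_simps")
qed

lemma lin_ext_lin:
 assumes V: "module K V" and b: "\<And>x. x \<in> B ==> \<beta> x \<in> carrier V"
 shows "lin_ext K V \<beta> \<in> lin_maps K (free_mod K B) V"
proof (rule lin_mapsI)
 interpret V: kmod K V unfolding kmod_def by fact
 interpret F: kmod K "free_mod K B" by (rule free_kmod)
 fix p assume p: "p \<in> carrier (free_mod K B)"
 then show "lin_ext K V \<beta> p \<in> carrier V" by (intro lin_ext_closed[OF V b])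
 { fix r assume r: "r \<in> carrier (free_mod K B)"
  let ?T = "{x. p x \<noteq> 0[K]} \<union> {x. r x \<noteq> 0[K]}"
  have T: "finite ?T" "?T \<subseteq> B" using p r by (auto simp: free_simps)
  have s: "{x. (p +[free_mod K B] r) x \<noteq> 0[K]} \<subseteq> ?T" by (auto simp: free_simps)
  have pr: "p +[free_mod K B] r \<in> carrier (free_mod K B)" using p r by simp
  have "lin_ext K V \<beta> (p +[free_mod K B] r) = (\<Oplus>\<^bsub>V\<^esub> x\<in>?T. (p +[free_mod K B] r) x *[V] \<beta> x)"
   by (rule lin_ext_over[OF V b pr T s])
  also have "\<dots> = (\<Oplus>\<^bsub>V\<^esub> x\<in>?T. p x *[V] \<beta> x +[V] r x *[V] \<beta> x)"
   by (rule V.finsum_cong') (use p r T b in "auto simp: free_simps V.smult_l_distr")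
  also have "\<dots> = (\<Oplus>\<^bsub>V\<^esub> x\<in>?T. p x *[V] \<beta> x) +[V] (\<Oplus>\<^bsub>V\<^esub> x\<in>?T. r x *[V] \<beta> x)"
   by (rule V.finsum_addf) (use p r T b in "auto simp: free_simps")
  finally show "lin_ext K V \<beta> (p +[free_mod K B] r) = lin_ext K V \<beta> p +[V] lin_ext K V \<beta> r"
   using lin_ext_over[OF V b p T] lin_ext_over[OF V b r T] by simp }
 { fix a assume a: "a \<in> carrier K"
  let ?T = "{x. p x \<noteq> 0[K]}"
  have T: "finite ?T" "?T \<subseteq> B" using p by (auto simp: free_simps)
  have s: "{x. (a *[free_mod K B] p) x \<noteq> 0[K]} \<subseteq> ?T" using a by (auto simp: free_simps)
  have ap: "a *[free_mod K B] p \<in> carrier (free_mod K B)" using a p by simp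
  have "lin_ext K V \<beta> (a *[free_mod K B] p) = (\<Oplus>\<^bsub>V\<^esub> x\<in>?T. (a *[free_mod K B] p) x *[V] \<beta> x)"
   by (rule lin_ext_over[OF V b ap T s])
  also have "\<dots> = (\<Oplus>\<^bsub>V\<^esub> x\<in>?T. a *[V] (p x *[V] \<beta> x))"
   by (rule V.finsum_cong') (use p a T b in "auto simp: free_simps V.smult_assoc1")
  also have "\<dots> = a *[V] (\<Oplus>\<^bsub>V\<^esub> x\<in>?T. p x *[V] \<beta> x)"
   by (rule V.finsum_smult_ldistr[symmetric]) (use p a T b in "auto simp: free_simps")
  finally show "lin_ext K V \<beta> (a *[free_mod K B] p) = a *[V] lin_ext K V \<beta> p"
   by (simp add: lin_ext_def) }
qed

lemma lin_ext_basis: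
 assumes V: "module K V" and b: "\<And>x. x \<in> B ==> \<beta> x \<in> carrier V" and x: "x \<in> B"
 shows "lin_ext K V \<beta> (basis_vec K x) = \<beta> x"
proof -
 interpret V: kmod K V unfolding kmod_def by fact
 have "lin_ext K V \<beta> (basis_vec K x) = (\<Oplus>\<^bsub>V\<^esub> y\<in>{x}. basis_vec K x y *[V] \<beta> y)"
  by (rule lin_ext_over[OF V b basis_carrier[OF x]]) (use x in "auto simp: basis_vec_def")
 also have "\<dots> = \<beta> x" using b[OF x] by (simp add: basis_vec_def V.finsum_insert)
 finally show ?thesis .
qed

lemma lin_ext_comp:
 assumes V: "module K V" and W: "module K W" and T: "T \<in> lin_maps K V W"
  and b: "\<And>x. x \<in> B ==> \<beta> x \<in> carrier V" and p: "p \<in> carrier (free_mod K B)"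
 shows "T (lin_ext K V \<beta> p) = lin_ext K W (\<lambda>x. T (\<beta> x)) p"
proof -
 interpret V: kmod K V unfolding kmod_def by fact
 interpret W: kmod K W unfolding kmod_def by fact
 have "T (lin_ext K V \<beta> p) = (\<Oplus>\<^bsub>W\<^esub> x\<in>{x. p x \<noteq> 0[K]}. T (p x *[V] \<beta> x))"
  unfolding lin_ext_def by (rule lin_finsum[OF T V W]) (use b p in "auto simp: free_simps")
 also have "\<dots> = lin_ext K W (\<lambda>x. T (\<beta> x)) p" unfolding lin_ext_def
  by (rule W.finsum_cong') (use b p in "auto simp: free_simps lin_smult[OF T] lin_closed[OF T] subset_iff")
 finally show ?thesis .
qed

lemma free_decomp:
 assumes p: "p \<in> carrier (free_mod K B)"
 shows "p = lin_ext K (free_mod K B) (basis_vec K) p"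
proof
 fix y
 interpret F: kmod K "free_mod K B" by (rule free_kmod)
 let ?S = "{x. p x \<noteq> 0[K]}"
 have fin: "finite ?S" "?S \<subseteq> B" and pc: "\<And>x. p x \<in> carrier K" using p by (auto simp: free_simps)
 have *: "A \<subseteq> ?S ==> (\<Oplus>\<^bsub>free_mod K B\<^esub> x\<in>A. p x *[free_mod K B] basis_vec K x) y = (if y \<in> A then p y else 0[K])"
  if "finite A" for A using that
 proof (induction A)
  case empty then show ?case by (simp add: free_simps)
 next
  case (insert x A)
  have c: "p z *[free_mod K B] basis_vec K z \<in> carrier (free_mod K B)" if "z \<in> insert x A" for z
   using that insert.prems fin pc by (intro F.smult_closed basis_carrier) auto
  then show ?case using insert pc by (subst F.finsum_insert) (auto simp: free_simps(3,4) basis_vec_def)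
 qed
 show "p y = lin_ext K (free_mod K B) (basis_vec K) p y" unfolding lin_ext_def using *[OF fin(1)] by auto
qed

lemma lin_on_free:
 assumes V: "module K V" and T: "T \<in> lin_maps K (free_mod K B) V" and p: "p \<in> carrier (free_mod K B)"
 shows "T p = lin_ext K V (\<lambda>x. T (basis_vec K x)) p"
 by (subst free_decomp[OF p]) (rule lin_ext_comp[OF free_module V T basis_carrier p])

lemma lin_ext_cong:
 assumes V: "module K V" and p: "p \<in> carrier (free_mod K B)"
  and b: "\<And>x. x \<in> B ==> \<beta> x \<in> carrier V" and eq: "\<And>x. x \<in> B ==> \<beta> x = \<gamma> x"
 shows "lin_ext K V \<beta> p = lin_ext K V \<gamma> p"
proof -
 interpret V: kmod K V unfolding kmod_def by fact
 show ?thesis unfolding lin_ext_def by (rule V.finsum_cong') (use p b eq in "auto simp: free_simps subset_iff")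
qed

lemma lin_span_inc: "x \<in> S ==> x \<in> lin_span K V S"
 by (auto simp: lin_span_def)

lemma lin_span_submodule:
 assumes V: "module K V" and S: "S \<subseteq> carrier V"
 shows "submodule (lin_span K V S) K V" "S \<subseteq> lin_span K V S"
  "\<And>H. submodule H K V ==> S \<subseteq> H ==> lin_span K V S \<subseteq> H"
proof -
 interpret V: kmod K V unfolding kmod_def by fact
 have c: "submodule (carrier V) K V" by (rule V.carrier_is_submodule)
 show "submodule (lin_span K V S) K V"
 proof (rule V.submoduleI')
  show "lin_span K V S \<subseteq> carrier V" using c S by (auto simp: lin_span_def)
 qed (use V.submodule_props in "auto simp: lin_span_def")
 show "S \<subseteq> lin_span K V S" by (auto simp: lin_span_def)
 show "\<And>H. submodule H K V ==> S \<subseteq> H ==> lin_span K V S \<subseteq> H" by (auto simp: lin_span_def)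
qed

context
 fixes V :: "('k, 'v) module" and W :: "('k, 'w) module"
 assumes V: "module K V" and W: "module K W"
begin

interpretation V: kmod K V unfolding kmod_def by (rule V)
interpretation W: kmod K W unfolding kmod_def by (rule W)
interpretation F: kmod K "tensor_free K V W" by (rule free_kmod)

private lemma bc: "v \<in> carrier V ==> w \<in> carrier W ==> basis_vec K (v, w) \<in> carrier (tensor_free K V W)"
 by (rule basis_carrier) simp

lemma rels_sub: "submodule (tensor_rels K V W) K (tensor_free K V W)"
 unfolding tensor_rels_def by (rule lin_span_submodule(1)[OF free_module]) (auto intro!: F.minus_closed F.a_closed F.smult_closed bc)

lemma rels_gens:
 "v \<in> carrier V ==> v' \<in> carrier V ==> w \<in> carrier W ==> basis_vec K (v +[V] v', w) -[tensor_free K V W]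
   (basis_vec K (v, w) +[tensor_free K V W] basis_vec K (v', w)) \<in> tensor_rels K V W"
 "v \<in> carrier V ==> w \<in> carrier W ==> w' \<in> carrier W ==> basis_vec K (v, w +[W] w') -[tensor_free K V W]
   (basis_vec K (v, w) +[tensor_free K V W] basis_vec K (v, w')) \<in> tensor_rels K V W"
 "a \<in> carrier K ==> v \<in> carrier V ==> w \<in> carrier W ==> basis_vec K (a *[V] v, w) -[tensor_free K V W]
   (a *[tensor_free K V W] basis_vec K (v, w)) \<in> tensor_rels K V W"
 "a \<in> carrier K ==> v \<in> carrier V ==> w \<in> carrier W ==> basis_vec K (v, a *[W] w) -[tensor_free K V W]
   (a *[tensor_free K V W] basis_vec K (v, w)) \<in> tensor_rels K V W"
 unfolding tensor_rels_def by (rule lin_span_inc, blast)+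

lemma tensor_module: "module K (tensor_mod K V W)"
 unfolding tensor_mod_def by (rule F.quot_module[OF rels_sub])

lemma tensor_carrier: "carrier (tensor_mod K V W) = (\<lambda>p. tensor_rels K V W +>[tensor_free K V W] p) ` carrier (tensor_free K V W)"
 unfolding tensor_mod_def by (rule F.quot_carrier)

lemma tensor_proj: "(\<lambda>p. tensor_rels K V W +>[tensor_free K V W] p) \<in> lin_maps K (tensor_free K V W) (tensor_mod K V W)"
 unfolding tensor_mod_def by (rule F.proj_lin[OF rels_sub])

lemma tens_closed: "x \<in> carrier V \<times> carrier W ==> tens K V W x \<in> carrier (tensor_mod K V W)"
 unfolding tens_def by (cases x) (auto intro!: lin_closed[OF tensor_proj] bc)

lemma tens_bilin: "bilin K V W (tensor_mod K V W) (tens K V W)"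
proof -
 have eq: "tensor_rels K V W +>[tensor_free K V W] p = tensor_rels K V W +>[tensor_free K V W] r"
  if "p -[tensor_free K V W] r \<in> tensor_rels K V W" "p \<in> carrier (tensor_free K V W)" "r \<in> carrier (tensor_free K V W)" for p r
  using that F.coset_eq_iff[OF rels_sub] by blast
 show ?thesis
 proof (rule bilinI)
  show "tens K V W (v, w) \<in> carrier (tensor_mod K V W)" if "v \<in> carrier V" "w \<in> carrier W" for v w
   using that by (intro tens_closed) simp
 qed (unfold tens_def, simp_all only: bc flip: lin_add[OF tensor_proj] lin_smult[OF tensor_proj], (rule eq; simp add: rels_gens bc)+)
qed

text \<open>The kernel of the linear extension is a subspace, and bilinearity puts each generating
  relation into it.\<close>

lemma lin_ext_kills_rels:
 assumes U: "module K U" and b: "bilin K V W U b" and r: "r \<in> tensor_rels K V W"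
 shows "lin_ext K U b r = 0[U]"
proof -
 interpret U: kmod K U unfolding kmod_def by fact
 have c: "x \<in> carrier V \<times> carrier W ==> b x \<in> carrier U" for x using bilinD(1)[OF b] by auto
 note L = lin_ext_lin[OF U c]
 have be: "v \<in> carrier V ==> w \<in> carrier W ==> lin_ext K U b (basis_vec K (v, w)) = b (v, w)" for v w
  by (rule lin_ext_basis[OF U c]) auto
 let ?k = "{p \<in> carrier (tensor_free K V W). lin_ext K U b p = 0[U]}"
 have "tensor_rels K V W \<subseteq> ?k" unfolding tensor_rels_def
  by (rule lin_span_submodule(3)[OF free_module _ kernel_submodule[OF free_module U L]])
   (auto intro!: F.minus_closed F.a_closed F.smult_closed bc U.minus_eq_zero_iff[THEN iffD2]
    simp: lin_minus[OF L free_module U] lin_add[OF L] lin_smult[OF L] bc be bilinD[OF b])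
 then show ?thesis using r by blast
qed

lemma tlift_tens:
 assumes U: "module K U" and b: "bilin K V W U b" and x: "x \<in> carrier V \<times> carrier W"
 shows "tlift K U b (tens K V W x) = b x"
proof -
 have c: "x \<in> carrier V \<times> carrier W ==> b x \<in> carrier U" for x using bilinD(1)[OF b] by auto
 show ?thesis unfolding tlift_def tens_def
  using F.the_elem_coset[OF rels_sub lin_ext_lin[OF U c] U lin_ext_kills_rels[OF U b] basis_carrier[OF x]]
   lin_ext_basis[OF U c x] by simp
qed

lemma tlift_coset:
 assumes U: "module K U" and b: "bilin K V W U b" and p: "p \<in> carrier (tensor_free K V W)"
 shows "tlift K U b (tensor_rels K V W +>[tensor_free K V W] p) = lin_ext K U b p"
proof -
 have c: "x \<in> carrier V \<times> carrier W ==> b x \<in> carrier U" for x using bilinD(1)[OF b] by auto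
 show ?thesis unfolding tlift_def
  using F.the_elem_coset[OF rels_sub lin_ext_lin[OF U c] U lin_ext_kills_rels[OF U b] p] .
qed

lemma tlift_lin:
 assumes U: "module K U" and b: "bilin K V W U b"
 shows "tlift K U b \<in> lin_maps K (tensor_mod K V W) U"
proof -
 have c: "x \<in> carrier V \<times> carrier W ==> b x \<in> carrier U" for x using bilinD(1)[OF b] by auto
 show ?thesis unfolding tlift_def[abs_def] tensor_mod_def
  by (rule F.the_elem_lin[OF rels_sub lin_ext_lin[OF U c] U lin_ext_kills_rels[OF U b]])
qed

lemma tensor_span:
 assumes H: "submodule H K (tensor_mod K V W)" and t: "\<And>x. x \<in> carrier V \<times> carrier W ==> tens K V W x \<in> H"
  and A: "A \<in> carrier (tensor_mod K V W)"
 shows "A \<in> H"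
proof -
 interpret T: kmod K "tensor_mod K V W" unfolding kmod_def by (rule tensor_module)
 obtain p where p: "p \<in> carrier (tensor_free K V W)" "A = tensor_rels K V W +>[tensor_free K V W] p"
  using A unfolding tensor_carrier by blast
 have "A = lin_ext K (tensor_mod K V W) (tens K V W) p"
  unfolding p(2) tens_def[abs_def] by (rule lin_on_free[OF tensor_module tensor_proj p(1)])
 also have "\<dots> \<in> H" unfolding lin_ext_def
  using p(1) t T.submodule_props(6)[OF H] by (intro T.submodule_finsum[OF H]) (auto simp: free_simps subset_iff)
 finally show ?thesis .
qed

text \<open>The kernel of the difference \<open>S - T\<close> is a subspace that contains all pure
  tensors, hence everything. Identities below are reduced to pure tensors by this lemma.\<close>

lemma tensor_ext:
 assumes U: "module K U" and S: "S \<in> lin_maps K (tensor_mod K V W) U" and T: "T \<in> lin_maps K (tensor_mod K V W) U"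
  and eq: "\<And>x. x \<in> carrier V \<times> carrier W ==> S (tens K V W x) = T (tens K V W x)" and A: "A \<in> carrier (tensor_mod K V W)"
 shows "S A = T A"
proof -
 interpret U: kmod K U unfolding kmod_def by fact
 have "A \<in> {A \<in> carrier (tensor_mod K V W). S A -[U] T A = 0[U]}"
  by (rule tensor_span[OF kernel_submodule[OF tensor_module U lin_diff[OF S T tensor_module U]] _ A])
   (simp add: tens_closed eq U.minus_eq_zero_iff lin_closed[OF T])
 then show ?thesis using A by (simp add: U.minus_eq_zero_iff lin_closed[OF T] lin_closed[OF S])
qed

end

text \<open>The induced map in two tensor arguments, as an iterated lift. Composition in
  \<open>tensor_cat\<close> is an instance, see \<open>TC_comp_tlift2\<close>.\<close>

definition tlift2 :: "('k, 'u) module \<Rightarrow> ('v \<times> 'w \<Rightarrow> 'x \<times> 'y \<Rightarrow> 'u) \<Rightarrow> ('v \<times> 'w \<Rightarrow> 'k) set \<Rightarrow> ('x \<times> 'y \<Rightarrow> 'k) set \<Rightarrow> 'u" where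
 "tlift2 U \<beta> A A' = tlift K U (\<lambda>x. tlift K U (\<beta> x) A') A"

lemma tlift2:
 assumes V: "module K V" and W: "module K W" and V': "module K V'" and W': "module K W'" and U: "module K U"
  and b1: "\<And>x. x \<in> carrier V \<times> carrier W ==> bilin K V' W' U (\<beta> x)"
  and b2: "\<And>y. y \<in> carrier V' \<times> carrier W' ==> bilin K V W U (\<lambda>x. \<beta> x y)"
 shows "A' \<in> carrier (tensor_mod K V' W') ==> bilin K V W U (\<lambda>x. tlift K U (\<beta> x) A')"
  and "A' \<in> carrier (tensor_mod K V' W') ==> (\<lambda>A. tlift2 U \<beta> A A') \<in> lin_maps K (tensor_mod K V W) U"
  and "A \<in> carrier (tensor_mod K V W) ==> tlift2 U \<beta> A \<in> lin_maps K (tensor_mod K V' W') U"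
  and "x \<in> carrier V \<times> carrier W ==> y \<in> carrier V' \<times> carrier W' ==>
   tlift2 U \<beta> (tens K V W x) (tens K V' W' y) = \<beta> x y"
proof -
 interpret U: kmod K U unfolding kmod_def by fact
 interpret T: kmod K "tensor_mod K V' W'" unfolding kmod_def by (rule tensor_module[OF V' W'])
 interpret S: kmod K "tensor_mod K V W" unfolding kmod_def by (rule tensor_module[OF V W])
 interpret V: kmod K V unfolding kmod_def by fact
 interpret W: kmod K W unfolding kmod_def by fact
 note tl = tlift_lin[OF V' W' U b1]
 have ext: "S A' = T A'" if "S \<in> lin_maps K (tensor_mod K V' W') U" "T \<in> lin_maps K (tensor_mod K V' W') U"
   "\<And>y. y \<in> carrier V' \<times> carrier W' ==> S (tens K V' W' y) = T (tens K V' W' y)" "A' \<in> carrier (tensor_mod K V' W')" for S T A'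
  by (rule tensor_ext[OF V' W' U that])
 have smul: "(\<lambda>A. a *[U] S A) \<in> lin_maps K Z U" if "a \<in> carrier K" "S \<in> lin_maps K Z U" for a S and Z :: "('k, 'z) module"
  by (rule lin_mapsI) (use that in "auto simp: lin_closed[OF that(2)] lin_add[OF that(2)] lin_smult[OF that(2)]
    U.smult_r_distr U.smult_assoc1[symmetric] K.m_comm")
 show bl: "bilin K V W U (\<lambda>x. tlift K U (\<beta> x) A')" if A': "A' \<in> carrier (tensor_mod K V' W')" for A'
 proof (rule bilinI)
  fix v v' w assume c: "v \<in> carrier V" "v' \<in> carrier V" "w \<in> carrier W"
  show "tlift K U (\<beta> (v +[V] v', w)) A' = tlift K U (\<beta> (v, w)) A' +[U] tlift K U (\<beta> (v', w)) A'"
   by (rule ext[OF tl lin_plus[OF tl tl U] _ A']) (use c in "auto simp: tlift_tens[OF V' W' U b1] bilinD(2)[OF b2]")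
 next
  fix a v w assume c: "a \<in> carrier K" "v \<in> carrier V" "w \<in> carrier W"
  show "tlift K U (\<beta> (a *[V] v, w)) A' = a *[U] tlift K U (\<beta> (v, w)) A'"
   by (rule ext[OF tl smul[OF c(1) tl] _ A']) (use c in "auto simp: tlift_tens[OF V' W' U b1] bilinD(3)[OF b2]")
  show "tlift K U (\<beta> (v, a *[W] w)) A' = a *[U] tlift K U (\<beta> (v, w)) A'"
   by (rule ext[OF tl smul[OF c(1) tl] _ A']) (use c in "auto simp: tlift_tens[OF V' W' U b1] bilinD(5)[OF b2]")
 next
  fix v w w' assume c: "v \<in> carrier V" "w \<in> carrier W" "w' \<in> carrier W"
  show "tlift K U (\<beta> (v, w +[W] w')) A' = tlift K U (\<beta> (v, w)) A' +[U] tlift K U (\<beta> (v, w')) A'"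
   by (rule ext[OF tl lin_plus[OF tl tl U] _ A']) (use c in "auto simp: tlift_tens[OF V' W' U b1] bilinD(4)[OF b2]")
 qed (use A' lin_closed[OF tl] in auto)
 show l1: "(\<lambda>A. tlift2 U \<beta> A A') \<in> lin_maps K (tensor_mod K V W) U" if "A' \<in> carrier (tensor_mod K V' W')" for A'
  unfolding tlift2_def[abs_def] by (rule tlift_lin[OF V W U bl[OF that]])
 have tt: "tlift2 U \<beta> (tens K V W x) A' = tlift K U (\<beta> x) A'"
  if "x \<in> carrier V \<times> carrier W" "A' \<in> carrier (tensor_mod K V' W')" for x A'
  unfolding tlift2_def by (rule tlift_tens[OF V W U bl[OF that(2)] that(1)])
 show "tlift2 U \<beta> A \<in> lin_maps K (tensor_mod K V' W') U" if A: "A \<in> carrier (tensor_mod K V W)" for A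
 proof (rule lin_mapsI)
  fix B assume B: "B \<in> carrier (tensor_mod K V' W')"
  show "tlift2 U \<beta> A B \<in> carrier U" by (rule lin_closed[OF l1[OF B] A])
  { fix B' assume B': "B' \<in> carrier (tensor_mod K V' W')"
   show "tlift2 U \<beta> A (B +[tensor_mod K V' W'] B') = tlift2 U \<beta> A B +[U] tlift2 U \<beta> A B'"
    by (rule tensor_ext[OF V W U l1 lin_plus[OF l1 l1 U] _ A]) (use B B' in "auto simp: tt lin_add[OF tl]") }
  { fix a assume a: "a \<in> carrier K"
   show "tlift2 U \<beta> A (a *[tensor_mod K V' W'] B) = a *[U] tlift2 U \<beta> A B"
    by (rule tensor_ext[OF V W U l1 smul[OF a l1] _ A]) (use a B in "auto simp: tt lin_smult[OF tl]") }
 qed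
 show "tlift2 U \<beta> (tens K V W x) (tens K V' W' y) = \<beta> x y"
  if "x \<in> carrier V \<times> carrier W" "y \<in> carrier V' \<times> carrier W'" for x y
  using that by (simp add: tt tens_closed[OF V' W'] tlift_tens[OF V' W' U b1])
qed

end

section \<open>Tensor products of categories and bimodules\<close>

sublocale kcat \<subseteq> scalars K ..

lemma op_simps [simp]: "Obj (op_cat C) = Obj C" "Hom (op_cat C) X Y = Hom C Y X"
 "Comp (op_cat C) X Y Z g f = Comp C Z Y X f g" "Id (op_cat C) = Id C"
 by (simp_all add: op_cat_def)

lemma (in kcat) op_kcat: "kcat K (op_cat C)"
proof (rule kcat.intro)
 show "cring K" ..
 show "k_category K (op_cat C)"
  by (rule k_category.intro)
   (auto simp: hom_module id_closed comp_linear_left comp_linear_right comp_id_left comp_id_right comp_assoc)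
qed

locale two_kcats = C: kcat K C + D: kcat K D
 for K :: "'k ring" and C :: "('k, 'o, 'm) kcat" and D :: "('k, 'p, 'n) kcat"
begin

abbreviation "TC \<equiv> tensor_cat K C D"

abbreviation tm where "tm Z Z' \<equiv> tens K (Hom C (fst Z) (fst Z')) (Hom D (snd Z) (snd Z'))"

abbreviation pr where "pr Z Z' \<equiv> Mor C (fst Z) (fst Z') \<times> Mor D (snd Z) (snd Z')"

definition pcomp where "pcomp Z Z' Z'' x y =
 (Comp C (fst Z) (fst Z') (fst Z'') (fst x) (fst y), Comp D (snd Z) (snd Z') (snd Z'') (snd x) (snd y))"

definition pid where "pid Z = (Id C (fst Z), Id D (snd Z))"

lemma TC_simps: "Z \<in> Obj TC \<longleftrightarrow> fst Z \<in> Obj C \<and> snd Z \<in> Obj D"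
 "Hom TC Z Z' = tensor_mod K (Hom C (fst Z) (fst Z')) (Hom D (snd Z) (snd Z'))"
 "Id TC Z = tm Z Z (pid Z)"
 by (cases Z; cases Z'; simp add: tensor_cat_def tens_def pid_def)+

lemma homs: "Z \<in> Obj TC ==> Z' \<in> Obj TC ==> module K (Hom C (fst Z) (fst Z'))"
 "Z \<in> Obj TC ==> Z' \<in> Obj TC ==> module K (Hom D (snd Z) (snd Z'))"
 by (simp_all add: TC_simps C.hom_module D.hom_module)

lemma TC_hom_module: "Z \<in> Obj TC ==> Z' \<in> Obj TC ==> module K (Hom TC Z Z')"
 unfolding TC_simps(2) by (rule C.tensor_module[OF homs])

lemma tm_closed: "Z \<in> Obj TC ==> Z' \<in> Obj TC ==> x \<in> pr Z Z' ==> tm Z Z' x \<in> Mor TC Z Z'"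
 unfolding TC_simps(2) by (rule C.tens_closed[OF homs])

lemma tm_bilin: "Z \<in> Obj TC ==> Z' \<in> Obj TC ==> bilin K (Hom C (fst Z) (fst Z')) (Hom D (snd Z) (snd Z')) (Hom TC Z Z') (tm Z Z')"
 unfolding TC_simps(2) by (rule C.tens_bilin[OF homs])

lemma TC_ext:
 assumes "Z \<in> Obj TC" "Z' \<in> Obj TC" "module K U" "S \<in> lin_maps K (Hom TC Z Z') U" "T \<in> lin_maps K (Hom TC Z Z') U"
  "\<And>x. x \<in> pr Z Z' ==> S (tm Z Z' x) = T (tm Z Z' x)" "A \<in> Mor TC Z Z'"
 shows "S A = T A"
 by (rule C.tensor_ext[OF homs[OF assms(1,2)] assms(3-7)[unfolded TC_simps(2)]])

lemma pcomp_closed: "Z \<in> Obj TC ==> Z' \<in> Obj TC ==> Z'' \<in> Obj TC ==> x \<in> pr Z' Z'' ==> y \<in> pr Z Z' ==>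
  pcomp Z Z' Z'' x y \<in> pr Z Z''"
 by (auto simp: TC_simps pcomp_def C.comp_closed D.comp_closed)

lemma pid_closed: "Z \<in> Obj TC ==> pid Z \<in> pr Z Z"
 by (auto simp: TC_simps pid_def C.id_closed D.id_closed)

lemma pcomp_bilin:
 assumes Z: "Z \<in> Obj TC" "Z' \<in> Obj TC" "Z'' \<in> Obj TC"
 shows "x \<in> pr Z' Z'' ==> bilin K (Hom C (fst Z) (fst Z')) (Hom D (snd Z) (snd Z')) (Hom TC Z Z'') (\<lambda>y. tm Z Z'' (pcomp Z Z' Z'' x y))"
  and "y \<in> pr Z Z' ==> bilin K (Hom C (fst Z') (fst Z'')) (Hom D (snd Z') (snd Z'')) (Hom TC Z Z'') (\<lambda>x. tm Z Z'' (pcomp Z Z' Z'' x y))"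
proof -
 note b = bilinD[OF tm_bilin[OF Z(1,3)]]
 have c: "fst Z \<in> Obj C" "fst Z' \<in> Obj C" "fst Z'' \<in> Obj C" "snd Z \<in> Obj D" "snd Z' \<in> Obj D" "snd Z'' \<in> Obj D"
  using Z by (simp_all add: TC_simps)
 note cl = C.comp_closed[OF c(1-3)] D.comp_closed[OF c(4-6)]
 show "x \<in> pr Z' Z'' ==> bilin K (Hom C (fst Z) (fst Z')) (Hom D (snd Z) (snd Z')) (Hom TC Z Z'') (\<lambda>y. tm Z Z'' (pcomp Z Z' Z'' x y))"
  by (rule bilinI) (auto simp: pcomp_def b cl C.comp_add_right[OF c(1-3)] D.comp_add_right[OF c(4-6)]
    C.comp_smult_right[OF c(1-3)] D.comp_smult_right[OF c(4-6)])
 show "y \<in> pr Z Z' ==> bilin K (Hom C (fst Z') (fst Z'')) (Hom D (snd Z') (snd Z'')) (Hom TC Z Z'') (\<lambda>x. tm Z Z'' (pcomp Z Z' Z'' x y))"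
  by (rule bilinI) (auto simp: pcomp_def b cl C.comp_add_left[OF c(1-3)] D.comp_add_left[OF c(4-6)]
    C.comp_smult_left[OF c(1-3)] D.comp_smult_left[OF c(4-6)])
qed

text \<open>\<open>tensor_cat\<close> composes by running over all representatives of both classes.
  Projecting the double linear extension gives the double lift of the classes, which is the same for
  all representatives.\<close>

lemma TC_comp_tlift2:
 assumes Z: "Z \<in> Obj TC" "Z' \<in> Obj TC" "Z'' \<in> Obj TC"
  and A: "A \<in> Mor TC Z' Z''" and A': "A' \<in> Mor TC Z Z'"
 shows "Comp TC Z Z' Z'' A A' = C.tlift2 (Hom TC Z Z'') (\<lambda>x y. tm Z Z'' (pcomp Z Z' Z'' x y)) A A'"
proof -
 let ?V = "Hom C (fst Z) (fst Z'')" and ?W = "Hom D (snd Z) (snd Z'')"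
 let ?V1 = "Hom C (fst Z') (fst Z'')" and ?W1 = "Hom D (snd Z') (snd Z'')"
 let ?V2 = "Hom C (fst Z) (fst Z')" and ?W2 = "Hom D (snd Z) (snd Z')"
 let ?F = "tensor_free K ?V ?W" and ?T = "Hom TC Z Z''"
 note V = homs[OF Z(1,3)] and V1 = homs[OF Z(2,3)] and V2 = homs[OF Z(1,2)]
 note T = TC_hom_module[OF Z(1,3)]
 let ?\<beta> = "\<lambda>x y. tm Z Z'' (pcomp Z Z' Z'' x y)" and ?b = "\<lambda>x y. basis_vec K (pcomp Z Z' Z'' x y)"
 let ?\<Phi> = "\<lambda>p p'. lin_ext K ?F (\<lambda>x. lin_ext K ?F (?b x) p') p"
 let ?\<pi> = "\<lambda>p. tensor_rels K ?V ?W +>[?F] p"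
 have \<pi>: "?\<pi> \<in> lin_maps K ?F ?T" unfolding TC_simps(2) by (rule C.tensor_proj[OF V])
 have bc: "?b x y \<in> carrier ?F" if "x \<in> pr Z' Z''" "y \<in> pr Z Z'" for x y
  using pcomp_closed[OF Z that] by (rule C.basis_carrier)
 have Comp: "Comp TC Z Z' Z'' A A' = (\<Union>p\<in>A. \<Union>p'\<in>A'. ?\<pi> (?\<Phi> p p'))"
  by (cases Z; cases Z'; cases Z'') (simp add: tensor_cat_def Let_def case_prod_unfold pcomp_def)
 note bl = pcomp_bilin[OF Z]
 have eq: "?\<pi> (?\<Phi> p p') = C.tlift2 ?T ?\<beta> A A'" if p: "p \<in> A" and p': "p' \<in> A'" for p p'
 proof -
  obtain p0 where p0: "p0 \<in> carrier (tensor_free K ?V1 ?W1)" "A = tensor_rels K ?V1 ?W1 +>[tensor_free K ?V1 ?W1] p0"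
   using A unfolding TC_simps(2) C.tensor_carrier[OF V1] by blast
  obtain p0' where p0': "p0' \<in> carrier (tensor_free K ?V2 ?W2)" "A' = tensor_rels K ?V2 ?W2 +>[tensor_free K ?V2 ?W2] p0'"
   using A' unfolding TC_simps(2) C.tensor_carrier[OF V2] by blast
  have pc: "p \<in> carrier (tensor_free K ?V1 ?W1)" "A = tensor_rels K ?V1 ?W1 +>[tensor_free K ?V1 ?W1] p"
   using kmod.coset_carrier_subset[OF C.free_kmod C.rels_sub[OF V1] p0(1)] kmod.coset_eq_mem[OF C.free_kmod C.rels_sub[OF V1] p0(1)] p
   unfolding p0(2) by blast+
  have pc': "p' \<in> carrier (tensor_free K ?V2 ?W2)" "A' = tensor_rels K ?V2 ?W2 +>[tensor_free K ?V2 ?W2] p'"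
   using kmod.coset_carrier_subset[OF C.free_kmod C.rels_sub[OF V2] p0'(1)] kmod.coset_eq_mem[OF C.free_kmod C.rels_sub[OF V2] p0'(1)] p'
   unfolding p0'(2) by blast+
  have ic: "lin_ext K ?F (?b x) p' \<in> carrier ?F" if "x \<in> pr Z' Z''" for x
   by (rule C.lin_ext_closed[OF C.free_module bc[OF that] pc'(1)])
  have in1: "?\<pi> (lin_ext K ?F (?b x) p') = tlift K ?T (?\<beta> x) A'" if x: "x \<in> pr Z' Z''" for x
  proof -
   have "?\<pi> (lin_ext K ?F (?b x) p') = lin_ext K ?T (\<lambda>y. ?\<pi> (?b x y)) p'"
    by (rule C.lin_ext_comp[OF C.free_module T \<pi> bc[OF x] pc'(1)])
   also have "\<dots> = tlift K ?T (?\<beta> x) A'"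
    using C.tlift_coset[OF V2 T bl(1)[OF x] pc'(1)] unfolding pc'(2)[symmetric] by (simp add: tens_def)
   finally show ?thesis .
  qed
  have "?\<pi> (?\<Phi> p p') = lin_ext K ?T (\<lambda>x. ?\<pi> (lin_ext K ?F (?b x) p')) p"
   by (rule C.lin_ext_comp[OF C.free_module T \<pi> ic pc(1)])
  also have "\<dots> = lin_ext K ?T (\<lambda>x. tlift K ?T (?\<beta> x) A') p"
   by (rule C.lin_ext_cong[OF T pc(1)]) (use in1 lin_closed[OF \<pi> ic] in auto)
  also have "\<dots> = tlift K ?T (\<lambda>x. tlift K ?T (?\<beta> x) A') A"
   using C.tlift_coset[OF V1 T C.tlift2(1)[OF V1 V2 T bl(1) bl(2)] pc(1)] A' unfolding pc(2)[symmetric] TC_simps(2)[of Z Z']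
   by simp
  finally show ?thesis by (simp add: C.tlift2_def)
 qed
 \<comment> \<open>A union of a constant family is that constant only over a nonempty index
   set.\<close>
 have ne: "A \<noteq> {}" "A' \<noteq> {}"
  using A A' kmod.coset_self[OF C.free_kmod C.rels_sub[OF V1]] kmod.coset_self[OF C.free_kmod C.rels_sub[OF V2]]
  unfolding TC_simps(2) C.tensor_carrier[OF V1] C.tensor_carrier[OF V2] by blast+
 have "(\<Union>p\<in>A. \<Union>p'\<in>A'. ?\<pi> (?\<Phi> p p')) = (\<Union>p\<in>A. \<Union>p'\<in>A'. C.tlift2 ?T ?\<beta> A A')"
  by (intro SUP_cong refl eq)
 then show ?thesis unfolding Comp using ne by simp
qed

lemma TC_comp:
 assumes Z: "Z \<in> Obj TC" "Z' \<in> Obj TC" "Z'' \<in> Obj TC"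
 shows "A' \<in> Mor TC Z Z' ==> (\<lambda>A. Comp TC Z Z' Z'' A A') \<in> lin_maps K (Hom TC Z' Z'') (Hom TC Z Z'')"
  and "A \<in> Mor TC Z' Z'' ==> (\<lambda>A'. Comp TC Z Z' Z'' A A') \<in> lin_maps K (Hom TC Z Z') (Hom TC Z Z'')"
  and "x \<in> pr Z' Z'' ==> y \<in> pr Z Z' ==> Comp TC Z Z' Z'' (tm Z' Z'' x) (tm Z Z' y) = tm Z Z'' (pcomp Z Z' Z'' x y)"
proof -
 let ?t = "C.tlift2 (Hom TC Z Z'') (\<lambda>x y. tm Z Z'' (pcomp Z Z' Z'' x y))"
 note t' = C.tlift2[OF homs[OF Z(2,3)] homs[OF Z(1,2)] TC_hom_module[OF Z(1,3)] pcomp_bilin[OF Z], folded TC_simps(2)]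
 have t: "A' \<in> Mor TC Z Z' ==> (\<lambda>A. ?t A A') \<in> lin_maps K (Hom TC Z' Z'') (Hom TC Z Z'')"
  "A \<in> Mor TC Z' Z'' ==> ?t A \<in> lin_maps K (Hom TC Z Z') (Hom TC Z Z'')"
  "x \<in> pr Z' Z'' ==> y \<in> pr Z Z' ==> ?t (tm Z' Z'' x) (tm Z Z' y) = tm Z Z'' (pcomp Z Z' Z'' x y)" for A A' x y
  by ((rule t'(2); assumption), (rule t'(3); assumption), (rule t'(4); assumption))
 interpret M1: kmod K "Hom TC Z' Z''" unfolding kmod_def by (rule TC_hom_module[OF Z(2,3)])
 interpret M2: kmod K "Hom TC Z Z'" unfolding kmod_def by (rule TC_hom_module[OF Z(1,2)])
 have cong: "T \<in> lin_maps K V W" if "S \<in> lin_maps K V W" "module K V" "\<And>x. x \<in> carrier V ==> T x = S x"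
  for S T and V :: "('k, 'x) module" and W :: "('k, 'y) module"
  using that mod_closed[OF that(2)] by (auto simp: lin_maps_def)
 show "(\<lambda>A. Comp TC Z Z' Z'' A A') \<in> lin_maps K (Hom TC Z' Z'') (Hom TC Z Z'')" if "A' \<in> Mor TC Z Z'"
  by (rule cong[OF t(1)[OF that] M1.module_axioms]) (rule TC_comp_tlift2[OF Z _ that])
 show "(\<lambda>A'. Comp TC Z Z' Z'' A A') \<in> lin_maps K (Hom TC Z Z') (Hom TC Z Z'')" if "A \<in> Mor TC Z' Z''"
  by (rule cong[OF t(2)[OF that] M2.module_axioms]) (rule TC_comp_tlift2[OF Z that])
 show "Comp TC Z Z' Z'' (tm Z' Z'' x) (tm Z Z' y) = tm Z Z'' (pcomp Z Z' Z'' x y)" if "x \<in> pr Z' Z''" "y \<in> pr Z Z'"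
  using t(3)[OF that] TC_comp_tlift2[OF Z tm_closed[OF Z(2,3) that(1)] tm_closed[OF Z(1,2) that(2)]] by simp
qed

lemma TC_kcat: "kcat K TC"
proof (rule kcat.intro)
 show "cring K" ..
 have id_lin: "(\<lambda>A. A) \<in> lin_maps K V V" for V :: "('k, 'x) module" by (auto simp: lin_maps_def)
 show "k_category K TC"
 proof (rule k_category.intro)
  show "Id TC X \<in> Mor TC X X" if "X \<in> Obj TC" for X
   unfolding TC_simps(3) by (rule tm_closed[OF that that pid_closed[OF that]])
  show "Comp TC X Y Y (Id TC Y) f = f" if Z: "X \<in> Obj TC" "Y \<in> Obj TC" "f \<in> Mor TC X Y" for X Y f
  proof (rule TC_ext[OF Z(1,2) TC_hom_module[OF Z(1,2)] TC_comp(2)[OF Z(1,2,2)] id_lin _ Z(3)])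
   show "Id TC Y \<in> Mor TC Y Y" unfolding TC_simps(3) by (rule tm_closed[OF Z(2,2) pid_closed[OF Z(2)]])
   fix x assume x: "x \<in> pr X Y"
   then show "Comp TC X Y Y (Id TC Y) (tm X Y x) = tm X Y x"
    using Z unfolding TC_simps(3) TC_comp(3)[OF Z(1,2,2) pid_closed[OF Z(2)] x]
    by (auto simp: pcomp_def pid_def TC_simps C.comp_id_left D.comp_id_left)
  qed
  show "Comp TC X X Y f (Id TC X) = f" if Z: "X \<in> Obj TC" "Y \<in> Obj TC" "f \<in> Mor TC X Y" for X Y f
  proof (rule TC_ext[OF Z(1,2) TC_hom_module[OF Z(1,2)] TC_comp(1)[OF Z(1,1,2)] id_lin _ Z(3)])
   show "Id TC X \<in> Mor TC X X" unfolding TC_simps(3) by (rule tm_closed[OF Z(1,1) pid_closed[OF Z(1)]])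
   fix x assume x: "x \<in> pr X Y"
   then show "Comp TC X X Y (tm X Y x) (Id TC X) = tm X Y x"
    using Z unfolding TC_simps(3) TC_comp(3)[OF Z(1,1,2) x pid_closed[OF Z(1)]]
    by (auto simp: pcomp_def pid_def TC_simps C.comp_id_right D.comp_id_right)
  qed
  fix W X Y Z f g h
  assume O: "W \<in> Obj TC" "X \<in> Obj TC" "Y \<in> Obj TC" "Z \<in> Obj TC"
   and f: "f \<in> Mor TC W X" and g: "g \<in> Mor TC X Y" and h: "h \<in> Mor TC Y Z"
  note m = TC_hom_module[OF O(1,4)]
  have cl: "Comp TC A B E b a \<in> Mor TC A E"
   if "A \<in> Obj TC" "B \<in> Obj TC" "E \<in> Obj TC" "a \<in> Mor TC A B" "b \<in> Mor TC B E" for A B E a b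
   using lin_closed[OF TC_comp(1)[OF that(1-4)] that(5)] .
  \<comment> \<open>Associativity for three pure tensors; in 2, 3 and the final step the arguments
    \<open>f\<close>, \<open>g\<close>, \<open>h\<close> are released one after the other by
    \<open>TC_ext\<close>.\<close>
  have 1: "Comp TC W Y Z (tm Y Z z) (Comp TC W X Y (tm X Y y) (tm W X x)) = Comp TC W X Z (Comp TC X Y Z (tm Y Z z) (tm X Y y)) (tm W X x)"
   if "x \<in> pr W X" "y \<in> pr X Y" "z \<in> pr Y Z" for x y z
   using that O pcomp_closed[OF O(1,2,3) that(2,1)] pcomp_closed[OF O(2,3,4) that(3,2)]
   by (simp add: TC_comp(3)) (auto simp: pcomp_def TC_simps C.comp_assoc D.comp_assoc)
  have 2: "Comp TC W Y Z (tm Y Z z) (Comp TC W X Y (tm X Y y) f) = Comp TC W X Z (Comp TC X Y Z (tm Y Z z) (tm X Y y)) f"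
   if "y \<in> pr X Y" "z \<in> pr Y Z" for y z
   by (rule TC_ext[OF O(1,2) m lin_comp[OF TC_comp(2)[OF O(1,2,3)] TC_comp(2)[OF O(1,3,4)]] TC_comp(2)[OF O(1,2,4)] 1[OF _ that] f])
    (use that O in "auto intro!: tm_closed cl")
  have 3: "Comp TC W Y Z (tm Y Z z) (Comp TC W X Y g f) = Comp TC W X Z (Comp TC X Y Z (tm Y Z z) g) f" if "z \<in> pr Y Z" for z
   by (rule TC_ext[OF O(2,3) m lin_comp[OF TC_comp(1)[OF O(1,2,3) f] TC_comp(2)[OF O(1,3,4)]]
     lin_comp[OF TC_comp(2)[OF O(2,3,4)] TC_comp(1)[OF O(1,2,4) f]] 2[OF _ that] g])
    (use that O in "auto intro!: tm_closed cl")
  show "Comp TC W Y Z h (Comp TC W X Y g f) = Comp TC W X Z (Comp TC X Y Z h g) f"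
   by (rule TC_ext[OF O(3,4) m TC_comp(1)[OF O(1,3,4) cl[OF O(1,2,3) f g]]
     lin_comp[OF TC_comp(1)[OF O(2,3,4) g] TC_comp(1)[OF O(1,2,4) f]] 3 h])
 qed (auto intro: TC_hom_module TC_comp(1,2))
qed

sublocale T: kcat K TC by (rule TC_kcat)

subsection \<open>Modules over a tensor product\<close>

text \<open>The construction principle for bimodules: prescribe a bilinear, functorial action of
  pairs of morphisms and extend it by \<open>tlift\<close>. The action on pure tensors, given by the
  second claim, is all that is used afterwards.\<close>

lemma bimod_c_module:
 fixes M :: "('k, 'o \<times> 'p, ('m \<times> 'n \<Rightarrow> 'k) set, 'v) cmod"
 assumes on: "\<And>Z. Z \<in> Obj TC ==> module K (On M Z)"
  and Act: "\<And>Z Z' A h. Z \<in> Obj TC ==> Z' \<in> Obj TC ==> A \<in> Mor TC Z Z' ==> h \<in> El M Z ==>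
    Act M Z Z' A h = tlift K (On M Z') (\<lambda>x. act Z Z' x h) A"
  and lin: "\<And>Z Z' x. Z \<in> Obj TC ==> Z' \<in> Obj TC ==> x \<in> pr Z Z' ==> act Z Z' x \<in> lin_maps K (On M Z) (On M Z')"
  and bil: "\<And>Z Z' h. Z \<in> Obj TC ==> Z' \<in> Obj TC ==> h \<in> El M Z ==>
    bilin K (Hom C (fst Z) (fst Z')) (Hom D (snd Z) (snd Z')) (On M Z') (\<lambda>x. act Z Z' x h)"
  and id: "\<And>Z h. Z \<in> Obj TC ==> h \<in> El M Z ==> act Z Z (pid Z) h = h"
  and comp: "\<And>Z Z' Z'' x y h. Z \<in> Obj TC ==> Z' \<in> Obj TC ==> Z'' \<in> Obj TC ==> x \<in> pr Z' Z'' ==> y \<in> pr Z Z' ==>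
    h \<in> El M Z ==> act Z Z'' (pcomp Z Z' Z'' x y) h = act Z' Z'' x (act Z Z' y h)"
 shows "c_module K TC M"
  and "\<And>Z Z' x h. Z \<in> Obj TC ==> Z' \<in> Obj TC ==> x \<in> pr Z Z' ==> h \<in> El M Z ==>
   Act M Z Z' (tm Z Z' x) h = act Z Z' x h"
proof -
 show tn: "Act M Z Z' (tm Z Z' x) h = act Z Z' x h"
  if "Z \<in> Obj TC" "Z' \<in> Obj TC" "x \<in> pr Z Z'" "h \<in> El M Z" for Z Z' x h
  using that by (simp add: Act tm_closed C.tlift_tens[OF homs on bil])
 have cong: "T \<in> lin_maps K V W" if "S \<in> lin_maps K V W" "module K V" "\<And>x. x \<in> carrier V ==> T x = S x"
  for S T and V :: "('k, 'x) module" and W :: "('k, 'y) module"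
  using that mod_closed[OF that(2)] by (auto simp: lin_maps_def)
 have lh: "(\<lambda>A. Act M Z Z' A h) \<in> lin_maps K (Hom TC Z Z') (On M Z')"
  if "Z \<in> Obj TC" "Z' \<in> Obj TC" "h \<in> El M Z" for Z Z' h
  by (rule cong[OF C.tlift_lin[OF homs[OF that(1,2)] on[OF that(2)] bil[OF that], folded TC_simps(2)] TC_hom_module[OF that(1,2)]])
   (simp add: Act that)
 show "c_module K TC M"
 proof (rule c_module.intro)
  fix X Y A assume O: "X \<in> Obj TC" "Y \<in> Obj TC" and A: "A \<in> Mor TC X Y"
  interpret MX: kmod K "On M X" unfolding kmod_def by (rule on[OF O(1)])
  interpret MY: kmod K "On M Y" unfolding kmod_def by (rule on[OF O(2)])
  have smul: "(\<lambda>A. a *[On M Y] S A) \<in> lin_maps K V (On M Y)" if "a \<in> carrier K" "S \<in> lin_maps K V (On M Y)" for a S and V :: "('k, 'z) module"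
   by (rule lin_mapsI) (use that in "auto simp: lin_closed[OF that(2)] lin_add[OF that(2)] lin_smult[OF that(2)]
     MY.smult_r_distr MY.smult_assoc1[symmetric] C.K.m_comm")
  show "Act M X Y A \<in> lin_maps K (On M X) (On M Y)"
  proof (rule lin_mapsI)
   fix h assume h: "h \<in> El M X"
   show "Act M X Y A h \<in> El M Y" by (rule lin_closed[OF lh[OF O h] A])
   { fix h' assume h': "h' \<in> El M X"
    show "Act M X Y A (h +[On M X] h') = Act M X Y A h +[On M Y] Act M X Y A h'"
     by (rule TC_ext[OF O on[OF O(2)] lh[OF O MX.a_closed[OF h h']] lin_plus[OF lh[OF O h] lh[OF O h'] on[OF O(2)]] _ A])
      (simp add: tn O h h' lin_add[OF lin]) }
   { fix a assume a: "a \<in> carrier K"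
    show "Act M X Y A (a *[On M X] h) = a *[On M Y] Act M X Y A h"
     by (rule TC_ext[OF O on[OF O(2)] lh[OF O MX.smult_closed[OF a h]] smul[OF a lh[OF O h]] _ A])
      (simp add: tn O h a lin_smult[OF lin]) }
  qed
 next
  fix X h assume "X \<in> Obj TC" "h \<in> El M X"
  then show "Act M X X (Id TC X) h = h" by (simp add: TC_simps(3) tn pid_closed id)
 next
  fix X Y Z f g h assume O: "X \<in> Obj TC" "Y \<in> Obj TC" "Z \<in> Obj TC" and f: "f \<in> Mor TC X Y"
   and g: "g \<in> Mor TC Y Z" and h: "h \<in> El M X"
  have al: "Act M Y Z (tm Y Z y) \<in> lin_maps K (On M Y) (On M Z)" if "y \<in> pr Y Z" for y
   by (rule cong[OF lin[OF O(2,3) that] on[OF O(2)]]) (simp add: tn O that)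
  have 1: "Act M X Z (Comp TC X Y Z (tm Y Z y) f) h = Act M Y Z (tm Y Z y) (Act M X Y f h)" if y: "y \<in> pr Y Z" for y
  proof (rule TC_ext[OF O(1,2) on[OF O(3)] lin_comp[OF TC_comp(2)[OF O tm_closed[OF O(2,3) y]] lh[OF O(1,3) h]] lin_comp[OF lh[OF O(1,2) h] al[OF y]] _ f])
   fix x assume x: "x \<in> pr X Y"
   have "act X Y x h \<in> El M Y" using lin_closed[OF lin[OF O(1,2) x] h] .
   then show "Act M X Z (Comp TC X Y Z (tm Y Z y) (tm X Y x)) h = Act M Y Z (tm Y Z y) (Act M X Y (tm X Y x) h)"
    using x y O h pcomp_closed[OF O y x] by (simp add: TC_comp(3) tn comp)
  qed
  have fh: "Act M X Y f h \<in> El M Y" by (rule lin_closed[OF lh[OF O(1,2) h] f])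
  show "Act M X Z (Comp TC X Y Z g f) h = Act M Y Z g (Act M X Y f h)"
   by (rule TC_ext[OF O(2,3) on[OF O(3)] lin_comp[OF TC_comp(1)[OF O f] lh[OF O(1,3) h]] lh[OF O(2,3) fh] 1 g])
 qed (use on lh in auto)
qed

lemma tensor_mod_homI:
 assumes M: "c_module K TC M" and N: "c_module K TC N"
  and lin: "\<And>Z. Z \<in> Obj TC ==> \<eta> Z \<in> lin_maps K (On M Z) (On N Z)"
  and nat: "\<And>Z Z' x h. Z \<in> Obj TC ==> Z' \<in> Obj TC ==> x \<in> pr Z Z' ==> h \<in> El M Z ==>
   \<eta> Z' (Act M Z Z' (tm Z Z' x) h) = Act N Z Z' (tm Z Z' x) (\<eta> Z h)"
 shows "mod_hom K TC M N \<eta>"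
 unfolding mod_hom_def
proof (intro conjI ballI lin)
 fix Z Z' A h assume O: "Z \<in> Obj TC" "Z' \<in> Obj TC" and A: "A \<in> Mor TC Z Z'" and h: "h \<in> El M Z"
 show "\<eta> Z' (Act M Z Z' A h) = Act N Z Z' A (\<eta> Z h)"
  by (rule TC_ext[OF O c_module.on_module[OF N O(2)] lin_comp[OF c_module.act_linear_hom[OF M O h] lin[OF O(2)]]
    c_module.act_linear_hom[OF N O lin_closed[OF lin[OF O(1)] h]] nat[OF O _ h] A])
qed

lemma pure_act:
 assumes M: "c_module K TC M"
 shows "Z \<in> Obj TC ==> Z' \<in> Obj TC ==> x \<in> pr Z Z' ==> Act M Z Z' (tm Z Z' x) \<in> lin_maps K (On M Z) (On M Z')"
  and "Z \<in> Obj TC ==> Z' \<in> Obj TC ==> x \<in> pr Z Z' ==> h \<in> El M Z ==> Act M Z Z' (tm Z Z' x) h \<in> El M Z'"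
  and "Z \<in> Obj TC ==> Z' \<in> Obj TC ==> h \<in> El M Z ==>
    bilin K (Hom C (fst Z) (fst Z')) (Hom D (snd Z) (snd Z')) (On M Z') (\<lambda>x. Act M Z Z' (tm Z Z' x) h)"
  and "Z \<in> Obj TC ==> h \<in> El M Z ==> Act M Z Z (tm Z Z (pid Z)) h = h"
  and "Z \<in> Obj TC ==> Z' \<in> Obj TC ==> Z'' \<in> Obj TC ==> x \<in> pr Z' Z'' ==> y \<in> pr Z Z' ==> h \<in> El M Z ==>
    Act M Z Z'' (tm Z Z'' (pcomp Z Z' Z'' x y)) h = Act M Z' Z'' (tm Z' Z'' x) (Act M Z Z' (tm Z Z' y) h)"
proof -
 show l: "Z \<in> Obj TC ==> Z' \<in> Obj TC ==> x \<in> pr Z Z' ==> Act M Z Z' (tm Z Z' x) \<in> lin_maps K (On M Z) (On M Z')" for Z Z' x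
  by (intro c_module.act_linear[OF M] tm_closed)
 show "Z \<in> Obj TC ==> Z' \<in> Obj TC ==> x \<in> pr Z Z' ==> h \<in> El M Z ==> Act M Z Z' (tm Z Z' x) h \<in> El M Z'"
  by (rule lin_closed[OF l])
 show "bilin K (Hom C (fst Z) (fst Z')) (Hom D (snd Z) (snd Z')) (On M Z') (\<lambda>x. Act M Z Z' (tm Z Z' x) h)"
  if "Z \<in> Obj TC" "Z' \<in> Obj TC" "h \<in> El M Z"
 proof -
  have "(\<lambda>v. Act M Z Z' (tm Z Z' (v, w)) h) \<in> lin_maps K (Hom C (fst Z) (fst Z')) (On M Z')"
   if "w \<in> Mor D (snd Z) (snd Z')" for w
   using lin_comp[of "\<lambda>v. tm Z Z' (v, w)"] c_module.act_linear_hom[OF M \<open>Z \<in> Obj TC\<close> \<open>Z' \<in> Obj TC\<close> \<open>h \<in> _\<close>]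
    tm_bilin[OF \<open>Z \<in> Obj TC\<close> \<open>Z' \<in> Obj TC\<close>] that unfolding bilin_def by blast
  moreover have "(\<lambda>w. Act M Z Z' (tm Z Z' (v, w)) h) \<in> lin_maps K (Hom D (snd Z) (snd Z')) (On M Z')"
   if "v \<in> Mor C (fst Z) (fst Z')" for v
   using lin_comp[of "\<lambda>w. tm Z Z' (v, w)"] c_module.act_linear_hom[OF M \<open>Z \<in> Obj TC\<close> \<open>Z' \<in> Obj TC\<close> \<open>h \<in> _\<close>]
    tm_bilin[OF \<open>Z \<in> Obj TC\<close> \<open>Z' \<in> Obj TC\<close>] that unfolding bilin_def by blast
  ultimately show ?thesis by (simp add: bilin_def)
 qed
 show "Z \<in> Obj TC ==> h \<in> El M Z ==> Act M Z Z (tm Z Z (pid Z)) h = h"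
  using act_id[OF M, of Z h] by (simp add: TC_simps(3))
 show "Z \<in> Obj TC ==> Z' \<in> Obj TC ==> Z'' \<in> Obj TC ==> x \<in> pr Z' Z'' ==> y \<in> pr Z Z' ==> h \<in> El M Z ==>
    Act M Z Z'' (tm Z Z'' (pcomp Z Z' Z'' x y)) h = Act M Z' Z'' (tm Z' Z'' x) (Act M Z Z' (tm Z Z' y) h)"
  by (simp only: TC_comp(3)[symmetric]) (rule act_comp[OF M], auto intro!: tm_closed)
qed

lemma tensor_subfunctorI:
 assumes M: "c_module K TC M" and sub: "\<And>Z. Z \<in> Obj TC ==> submodule (S Z) K (On M Z)"
  and cl: "\<And>Z Z' x h. Z \<in> Obj TC ==> Z' \<in> Obj TC ==> x \<in> pr Z Z' ==> h \<in> S Z ==> Act M Z Z' (tm Z Z' x) h \<in> S Z'"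
 shows "T.subfunctor M S"
 unfolding T.subfunctor_def
proof (intro conjI ballI sub)
 fix Z Z' A h assume O: "Z \<in> Obj TC" "Z' \<in> Obj TC" and A: "A \<in> Mor TC Z Z'" and h: "h \<in> S Z"
 interpret Z: kmod K "On M Z" by (rule on_kmod[OF M O(1)])
 interpret Z': kmod K "On M Z'" by (rule on_kmod[OF M O(2)])
 interpret H: kmod K "Hom TC Z Z'" unfolding kmod_def by (rule TC_hom_module[OF O])
 have hc: "h \<in> El M Z" using Z.submodule_props(1)[OF sub[OF O(1)]] h by blast
 note l = c_module.act_linear_hom[OF M O hc]
 note sp = Z'.submodule_props[OF sub[OF O(2)]]
 have sm: "submodule {A \<in> Mor TC Z Z'. Act M Z Z' A h \<in> S Z'} K (Hom TC Z Z')"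
  by (rule H.submoduleI') (use sp in "auto simp: lin_add[OF l] lin_smult[OF l] T.act_hom_zero[OF M O hc]")
 have "A \<in> {A \<in> Mor TC Z Z'. Act M Z Z' A h \<in> S Z'}"
  by (rule C.tensor_span[OF homs[OF O], folded TC_simps(2), OF sm _ A]) (use O cl[OF O _ h] tm_closed[OF O] in auto)
 then show "Act M Z Z' A h \<in> S Z'" by simp
qed

end

lemma preimage_submodule:
 assumes "module K V" "module K W" "T \<in> lin_maps K V W" "submodule H K W"
 shows "submodule {x \<in> carrier V. T x \<in> H} K V"
proof -
 interpret V: kmod K V unfolding kmod_def by fact
 interpret W: kmod K W unfolding kmod_def by fact
 note p = W.submodule_props[OF assms(4)]
 show ?thesis
  by (rule V.submoduleI') (use p in "auto simp: lin_zero[OF assms(3,1,2)] lin_add[OF assms(3)] lin_smult[OF assms(3)]")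
qed

subsection \<open>Fixing one argument of a bimodule\<close>

context two_kcats
begin

lemma two_kcats_swap: "two_kcats K D C"
 by (rule two_kcats.intro) unfold_locales

interpretation S: two_kcats K D C by (rule two_kcats_swap)

definition rslice :: "('k, 'o \<times> 'p, ('m \<times> 'n \<Rightarrow> 'k) set, 'v) cmod \<Rightarrow> 'o \<Rightarrow> ('k, 'p, 'n, 'v) cmod" where
 "rslice M X = \<lparr>On = (\<lambda>Y. On M (X, Y)), Act = (\<lambda>Y Y' g. Act M (X, Y) (X, Y') (tm (X, Y) (X, Y') (Id C X, g)))\<rparr>"

lemma rslice_simps [simp]: "On (rslice M X) Y = On M (X, Y)"
 "Act (rslice M X) Y Y' g = Act M (X, Y) (X, Y') (tm (X, Y) (X, Y') (Id C X, g))"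
 by (simp_all add: rslice_def)

lemma rslice_c_module:
 assumes M: "c_module K TC M" and X: "X \<in> Obj C"
 shows "c_module K D (rslice M X)"
proof (rule c_moduleI)
 note i = C.id_closed[OF X]
 fix Y assume Y: "Y \<in> Obj D"
 show "module K (On (rslice M X) Y)" using c_module.on_module[OF M] X Y by (simp add: TC_simps)
 fix Y' g h assume Y': "Y' \<in> Obj D" and g: "g \<in> Mor D Y Y'" and h: "h \<in> El (rslice M X) Y"
 have O: "(X, Y) \<in> Obj TC" "(X, Y') \<in> Obj TC" using X Y Y' by (simp_all add: TC_simps)
 have hc: "h \<in> El M (X, Y)" using h by simp
 note l = pure_act(1)[OF M O, of "(Id C X, g)"] and b = bilinD[OF pure_act(3)[OF M O hc]]
 show "Act (rslice M X) Y Y' g h \<in> El (rslice M X) Y'" using lin_closed[OF l] i g hc by simp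
 { fix h' assume "h' \<in> El (rslice M X) Y"
  then show "Act (rslice M X) Y Y' g (h +[On (rslice M X) Y] h') = Act (rslice M X) Y Y' g h +[On (rslice M X) Y'] Act (rslice M X) Y Y' g h'"
   using lin_add[OF l] i g hc by simp }
 { fix a assume "a \<in> carrier K"
  then show "Act (rslice M X) Y Y' g (a *[On (rslice M X) Y] h) = a *[On (rslice M X) Y'] Act (rslice M X) Y Y' g h"
   using lin_smult[OF l] i g hc by simp }
 { fix g' assume "g' \<in> Mor D Y Y'"
  then show "Act (rslice M X) Y Y' (g +[Hom D Y Y'] g') h = Act (rslice M X) Y Y' g h +[On (rslice M X) Y'] Act (rslice M X) Y Y' g' h"
   using b(4) i g by simp }
 { fix a assume "a \<in> carrier K"
  then show "Act (rslice M X) Y Y' (a *[Hom D Y Y'] g) h = a *[On (rslice M X) Y'] Act (rslice M X) Y Y' g h"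
   using b(5) i g by simp }
 { fix Y'' g' assume Y'': "Y'' \<in> Obj D" and g': "g' \<in> Mor D Y' Y''"
  have O'': "(X, Y'') \<in> Obj TC" using X Y'' by (simp add: TC_simps)
  show "Act (rslice M X) Y Y'' (Comp D Y Y' Y'' g' g) h = Act (rslice M X) Y' Y'' g' (Act (rslice M X) Y Y' g h)"
   using pure_act(5)[OF M O O'', of "(Id C X, g')" "(Id C X, g)" h] i g g' hc by (simp add: pcomp_def C.comp_id_left[OF X X]) }
next
 fix Y h assume "Y \<in> Obj D" "h \<in> El (rslice M X) Y"
 then show "Act (rslice M X) Y Y (Id D Y) h = h" using pure_act(4)[OF M, of "(X, Y)" h] X by (simp add: TC_simps pid_def)
qed

text \<open>\<open>Hom\<^sub>K(C(-, X), N)\<close>, restricted to the maps that vanish on \<open>J\<close>: the coinduced bimodule that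
  represents \<open>D\<close>-module maps from \<open>M(X,-)\<close> to \<open>N\<close>. It depends exactly on \<open>N\<close> since \<open>K\<close> is a field.\<close>

definition hon :: "'o \<Rightarrow> ('o \<Rightarrow> 'm set) \<Rightarrow> ('k, 'p, 'n, 'v) cmod \<Rightarrow> 'o \<times> 'p \<Rightarrow> ('k, 'm \<Rightarrow> 'v) module" where
 "hon X J N Z = (let V = Hom C (fst Z) X; W = On N (snd Z) in
   \<lparr>carrier = {\<psi> \<in> lin_maps K V W. \<psi> \<in> extensional (carrier V) \<and> (\<forall>c\<in>J (fst Z). \<psi> c = 0[W])},
   mult = undefined, one = undefined, zero = (\<lambda>c\<in>carrier V. 0[W]),
   add = (\<lambda>\<psi> \<chi>. \<lambda>c\<in>carrier V. \<psi> c +[W] \<chi> c), smult = (\<lambda>a \<psi>. \<lambda>c\<in>carrier V. a *[W] \<psi> c)\<rparr>)"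

definition hact :: "'o \<Rightarrow> ('k, 'p, 'n, 'v) cmod \<Rightarrow> 'o \<times> 'p \<Rightarrow> 'o \<times> 'p \<Rightarrow> 'm \<times> 'n \<Rightarrow> ('m \<Rightarrow> 'v) \<Rightarrow> 'm \<Rightarrow> 'v" where
 "hact X N Z Z' x \<psi> = (\<lambda>c\<in>Mor C (fst Z') X. Act N (snd Z) (snd Z') (snd x) (\<psi> (Comp C (fst Z) (fst Z') X c (fst x))))"

definition hmod :: "'o \<Rightarrow> ('o \<Rightarrow> 'm set) \<Rightarrow> ('k, 'p, 'n, 'v) cmod \<Rightarrow> ('k, 'o \<times> 'p, ('m \<times> 'n \<Rightarrow> 'k) set, 'm \<Rightarrow> 'v) cmod" where
 "hmod X J N = \<lparr>On = hon X J N, Act = (\<lambda>Z Z' A \<psi>. tlift K (hon X J N Z') (\<lambda>x. hact X N Z Z' x \<psi>) A)\<rparr>"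

lemma hon_simps:
 "\<psi> \<in> carrier (hon X J N Z) \<longleftrightarrow> \<psi> \<in> lin_maps K (Hom C (fst Z) X) (On N (snd Z)) \<and>
   \<psi> \<in> extensional (Mor C (fst Z) X) \<and> (\<forall>c\<in>J (fst Z). \<psi> c = 0[On N (snd Z)])"
 "0[hon X J N Z] = (\<lambda>c\<in>Mor C (fst Z) X. 0[On N (snd Z)])"
 "\<psi> +[hon X J N Z] \<chi> = (\<lambda>c\<in>Mor C (fst Z) X. \<psi> c +[On N (snd Z)] \<chi> c)"
 "a *[hon X J N Z] \<psi> = (\<lambda>c\<in>Mor C (fst Z) X. a *[On N (snd Z)] \<psi> c)"
 by (simp_all add: hon_def Let_def)

lemma hmod_On [simp]: "On (hmod X J N) = hon X J N"
 by (simp add: hmod_def)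

context
 fixes X :: 'o and J :: "'o \<Rightarrow> 'm set"
 assumes X: "X \<in> Obj C" and Jc: "\<And>X' c. X' \<in> Obj C ==> c \<in> J X' ==> c \<in> Mor C X' X"
  and Jr: "\<And>X' X'' f c. X' \<in> Obj C ==> X'' \<in> Obj C ==> f \<in> Mor C X' X'' ==> c \<in> J X'' ==> Comp C X' X'' X c f \<in> J X'"
begin

lemma hon_restrictI:
 assumes "Z \<in> Obj TC" "(\<lambda>c. F c) \<in> lin_maps K (Hom C (fst Z) X) (On N (snd Z))" "\<And>c. c \<in> J (fst Z) ==> F c = 0[On N (snd Z)]"
 shows "(\<lambda>c\<in>Mor C (fst Z) X. F c) \<in> carrier (hon X J N Z)"
proof -
 have Z: "fst Z \<in> Obj C" using assms(1) by (simp add: TC_simps)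
 note m = mod_closed[OF C.hom_module[OF Z X]]
 show ?thesis using assms(2,3) Jc[OF Z] m by (auto simp: hon_simps lin_maps_def)
qed

lemma hon_module:
 assumes N: "c_module K D N" and Z: "Z \<in> Obj TC" shows "module K (hon X J N Z)"
proof -
 have Z': "fst Z \<in> Obj C" "snd Z \<in> Obj D" using Z by (simp_all add: TC_simps)
 interpret V: kmod K "Hom C (fst Z) X" by (rule C.hom_kmod[OF Z'(1) X])
 interpret W: kmod K "On N (snd Z)" by (rule on_kmod[OF N Z'(2)])
 have c: "\<psi> \<in> carrier (hon X J N Z) ==> v \<in> Mor C (fst Z) X ==> \<psi> v \<in> El N (snd Z)" for \<psi> v
  by (auto simp: hon_simps lin_closed)
 have l: "\<psi> \<in> carrier (hon X J N Z) ==> \<psi> \<in> lin_maps K (Hom C (fst Z) X) (On N (snd Z))" for \<psi> by (simp add: hon_simps)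
 have z: "\<psi> \<in> carrier (hon X J N Z) ==> v \<in> J (fst Z) ==> \<psi> v = 0[On N (snd Z)]" for \<psi> v by (simp add: hon_simps)
 have e: "\<psi> \<in> carrier (hon X J N Z) ==> \<psi> \<in> extensional (Mor C (fst Z) X)" for \<psi> by (simp add: hon_simps)
 have zl: "(\<lambda>v. 0[On N (snd Z)]) \<in> lin_maps K (Hom C (fst Z) X) (On N (snd Z))" by (auto intro!: lin_mapsI)
 have sl: "(\<lambda>v. a *[On N (snd Z)] \<psi> v) \<in> lin_maps K (Hom C (fst Z) X) (On N (snd Z))" if "a \<in> carrier K" "\<psi> \<in> carrier (hon X J N Z)" for a \<psi>
  by (rule lin_mapsI) (use that c in "auto simp: lin_add[OF l[OF that(2)]] lin_smult[OF l[OF that(2)]] W.smult_r_distr W.smult_assoc1[symmetric] C.K.m_comm")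
 show ?thesis
 proof (rule moduleI)
  show "cring K" ..
  show "abelian_group (hon X J N Z)"
  proof (rule abelian_groupI, goal_cases)
   case (1 x y) then show ?case unfolding hon_simps(3) by (intro hon_restrictI[OF Z] lin_plus l W.module_axioms) (simp_all add: z[of x] z[of y])
  next
   case 2 then show ?case unfolding hon_simps(2) by (intro hon_restrictI[OF Z] zl) simp
  next
   case (6 x)
   have "(\<lambda>v\<in>Mor C (fst Z) X. 0[On N (snd Z)] -[On N (snd Z)] x v) \<in> carrier (hon X J N Z)"
    using 6 by (intro hon_restrictI[OF Z] lin_diff zl l W.module_axioms V.module_axioms) (simp_all add: z[of x])
   then show ?case
    by (rule bexI[rotated]) (use 6 in "auto simp: hon_simps(2,3) c W.minus_eq W.l_neg intro!: restrict_ext")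
  qed (auto simp: hon_simps(2,3) c W.a_ac intro!: restrict_ext restrict_eq_ext e)
  fix a \<psi> assume "a \<in> carrier K" "\<psi> \<in> carrier (hon X J N Z)"
  then show "a *[hon X J N Z] \<psi> \<in> carrier (hon X J N Z)" unfolding hon_simps(4)
   by (intro hon_restrictI[OF Z] sl) (simp_all add: z[of \<psi>])
 qed (auto simp: hon_simps(3,4) c W.smult_l_distr W.smult_r_distr W.smult_assoc1 intro!: restrict_ext restrict_eq_ext e)
qed

lemma hmod_c_module:
 assumes N: "c_module K D N" shows "c_module K TC (hmod X J N)"
  and "\<And>Z Z' x h. Z \<in> Obj TC ==> Z' \<in> Obj TC ==> x \<in> pr Z Z' ==> h \<in> carrier (hon X J N Z) ==>
   Act (hmod X J N) Z Z' (tm Z Z' x) h = hact X N Z Z' x h"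
proof -
 have ob: "Z \<in> Obj TC ==> fst Z \<in> Obj C" "Z \<in> Obj TC ==> snd Z \<in> Obj D" for Z by (simp_all add: TC_simps)
 have lh: "h \<in> carrier (hon X J N Z) ==> h \<in> lin_maps K (Hom C (fst Z) X) (On N (snd Z))" for h Z by (simp add: hon_simps)
 have hz: "h \<in> carrier (hon X J N Z) ==> c \<in> J (fst Z) ==> h c = 0[On N (snd Z)]" for h Z c by (simp add: hon_simps)
 have he: "h \<in> carrier (hon X J N Z) ==> h \<in> extensional (Mor C (fst Z) X)" for h Z by (simp add: hon_simps)
 have cc: "Comp C (fst Z) (fst Z') X c (fst x) \<in> Mor C (fst Z) X"
  if "Z \<in> Obj TC" "Z' \<in> Obj TC" "x \<in> pr Z Z'" "c \<in> Mor C (fst Z') X" for Z Z' x c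
  using that by (auto simp: TC_simps X intro!: C.comp_closed)
 have cl: "hact X N Z Z' x h \<in> carrier (hon X J N Z')"
  if Z: "Z \<in> Obj TC" "Z' \<in> Obj TC" and x: "x \<in> pr Z Z'" and h: "h \<in> carrier (hon X J N Z)" for Z Z' x h
  unfolding hact_def
 proof (rule hon_restrictI[OF Z(2)])
  have x': "fst x \<in> Mor C (fst Z) (fst Z')" "snd x \<in> Mor D (snd Z) (snd Z')" using x by auto
  show "(\<lambda>c. Act N (snd Z) (snd Z') (snd x) (h (Comp C (fst Z) (fst Z') X c (fst x)))) \<in> lin_maps K (Hom C (fst Z') X) (On N (snd Z'))"
   by (rule lin_comp[OF lin_comp[OF C.comp_linear_left[OF ob(1)[OF Z(1)] ob(1)[OF Z(2)] X x'(1)] lh[OF h]]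
      c_module.act_linear[OF N ob(2)[OF Z(1)] ob(2)[OF Z(2)] x'(2)]])
  show "Act N (snd Z) (snd Z') (snd x) (h (Comp C (fst Z) (fst Z') X c (fst x))) = 0[On N (snd Z')]" if "c \<in> J (fst Z')" for c
   using Jr[OF ob(1)[OF Z(1)] ob(1)[OF Z(2)] x'(1) that] h x' ob Z by (simp add: hz act_zero[OF N])
 qed
 have act_lin: "hact X N Z Z' x \<in> lin_maps K (hon X J N Z) (hon X J N Z')"
  if Z: "Z \<in> Obj TC" "Z' \<in> Obj TC" and x: "x \<in> pr Z Z'" for Z Z' x
 proof (rule lin_mapsI)
  note oo = ob(1)[OF Z(1)] ob(1)[OF Z(2)] ob(2)[OF Z(1)] ob(2)[OF Z(2)]
  have x': "snd x \<in> Mor D (snd Z) (snd Z')" using x by auto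
  fix h assume h: "h \<in> carrier (hon X J N Z)"
  then show "hact X N Z Z' x h \<in> carrier (hon X J N Z')" using cl[OF Z x] by simp
  { fix h' assume "h' \<in> carrier (hon X J N Z)"
   with h show "hact X N Z Z' x (h +[hon X J N Z] h') = hact X N Z Z' x h +[hon X J N Z'] hact X N Z Z' x h'"
    using cc[OF Z x] lin_closed[OF lh[of _ Z]] x' oo by (simp add: hact_def hon_simps(3) act_add[OF N] cong: restrict_cong) }
  { fix a assume "a \<in> carrier K"
   with h show "hact X N Z Z' x (a *[hon X J N Z] h) = a *[hon X J N Z'] hact X N Z Z' x h"
    using cc[OF Z x] lin_closed[OF lh[of _ Z]] x' oo by (simp add: hact_def hon_simps(4) act_smult[OF N] cong: restrict_cong) }
 qed
 have act_bil: "bilin K (Hom C (fst Z) (fst Z')) (Hom D (snd Z) (snd Z')) (hon X J N Z') (\<lambda>x. hact X N Z Z' x h)"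
  if Z: "Z \<in> Obj TC" "Z' \<in> Obj TC" and h: "h \<in> carrier (hon X J N Z)" for Z Z' h
 proof -
  note oo = ob(1)[OF Z(1)] ob(1)[OF Z(2)] ob(2)[OF Z(1)] ob(2)[OF Z(2)]
  note hl = lh[OF h]
  note hh = lin_closed[OF hl] lin_add[OF hl] lin_smult[OF hl]
  show ?thesis
   by (rule bilinI) (use cl[OF Z _ h] in "auto simp: hact_def hon_simps(3,4) C.comp_closed[OF oo(1,2) X] hh oo X
     C.comp_add_right C.comp_smult_right act_add[OF N] act_smult[OF N] act_hom_add[OF N] act_hom_smult[OF N] intro!: restrict_ext")
 qed
 have act_id: "hact X N Z Z (pid Z) h = h" if Z: "Z \<in> Obj TC" and h: "h \<in> carrier (hon X J N Z)" for Z h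
  unfolding hact_def
  by (rule restrict_eq_ext[OF he[OF h]]) (use ob[OF Z] X lin_closed[OF lh[OF h]] in "simp add: pid_def C.comp_id_right act_id[OF N]")
 have act_cmp: "hact X N Z Z'' (pcomp Z Z' Z'' x y) h = hact X N Z' Z'' x (hact X N Z Z' y h)"
  if Z: "Z \<in> Obj TC" "Z' \<in> Obj TC" "Z'' \<in> Obj TC" and x: "x \<in> pr Z' Z''" and y: "y \<in> pr Z Z'" and h: "h \<in> carrier (hon X J N Z)"
  for Z Z' Z'' x y h
 proof -
  have cy: "fst y \<in> Mor C (fst Z) (fst Z')" "fst x \<in> Mor C (fst Z') (fst Z'')"
   "snd y \<in> Mor D (snd Z) (snd Z')" "snd x \<in> Mor D (snd Z') (snd Z'')" using x y by auto
  show ?thesis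
   using ob[OF Z(1)] ob[OF Z(2)] ob[OF Z(3)] X cy lin_closed[OF lh[OF h]]
   by (auto simp: hact_def pcomp_def C.comp_closed C.comp_assoc act_comp[OF N] intro!: restrict_ext)
 qed
 note bm = bimod_c_module[where M = "hmod X J N" and act = "hact X N"]
 show "c_module K TC (hmod X J N)"
  by (rule bm(1)) (simp_all add: hon_module[OF N] act_lin act_bil act_id act_cmp, simp add: hmod_def)
 show "Act (hmod X J N) Z Z' (tm Z Z' x) h = hact X N Z Z' x h"
  if "Z \<in> Obj TC" "Z' \<in> Obj TC" "x \<in> pr Z Z'" "h \<in> carrier (hon X J N Z)" for Z Z' x h
  by (rule bm(2)) (simp_all add: hon_module[OF N] act_lin act_bil act_id act_cmp that, simp add: hmod_def)
qed

text \<open>By adjunction a map from \<open>M(X,-)\<close> to \<open>B\<close> that kills the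
  translates by \<open>J\<close> is a bimodule map from \<open>M\<close> to
  \<open>hmod X J B\<close>. Projectivity of \<open>M\<close> lifts the latter to
  \<open>hmod X J A\<close>, and evaluation at the identity of \<open>X\<close> returns the wanted
  map. With \<open>J\<close> empty this concerns the slice itself, with \<open>J = I X\<close> its
  quotient by the action of the ideal.\<close>

lemma rslice_lift:
 assumes fK: "field K" and M: "projective K TC M"
  and A: "c_module K D A" and B: "c_module K D B" and e: "mod_hom K D A B e" "epi D A B e"
  and f: "mod_hom K D (rslice M X) B f"
  and fJ: "\<And>X' Y c p. X' \<in> Obj C ==> Y \<in> Obj D ==> c \<in> J X' ==> p \<in> El M (X', Y) ==>
   f Y (Act M (X', Y) (X, Y) (tm (X', Y) (X, Y) (c, Id D Y)) p) = 0[On B Y]"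
 obtains g where "mod_hom K D (rslice M X) A g" "\<And>Y p. Y \<in> Obj D ==> p \<in> El M (X, Y) ==> e Y (g Y p) = f Y p"
  "\<And>X' Y c p. X' \<in> Obj C ==> Y \<in> Obj D ==> c \<in> J X' ==> p \<in> El M (X', Y) ==>
   g Y (Act M (X', Y) (X, Y) (tm (X', Y) (X, Y) (c, Id D Y)) p) = 0[On A Y]"
proof -
 have Mm: "c_module K TC M" by (rule T.projective_c_module[OF M])
 note HA = hmod_c_module[OF A] and HB = hmod_c_module[OF B]
 have ob: "Z \<in> Obj TC ==> fst Z \<in> Obj C" "Z \<in> Obj TC ==> snd Z \<in> Obj D" for Z by (simp_all add: TC_simps)
 have lh: "h \<in> carrier (hon X J N Z) ==> h \<in> lin_maps K (Hom C (fst Z) X) (On N (snd Z))" for h Z and N :: "('k, 'p, 'n, 'x) cmod" by (simp add: hon_simps)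
 have hz: "h \<in> carrier (hon X J N Z) ==> c \<in> J (fst Z) ==> h c = 0[On N (snd Z)]" for h Z c and N :: "('k, 'p, 'n, 'x) cmod" by (simp add: hon_simps)
 have he: "h \<in> carrier (hon X J N Z) ==> h \<in> extensional (Mor C (fst Z) X)" for h Z and N :: "('k, 'p, 'n, 'x) cmod" by (simp add: hon_simps)
 note i = C.id_closed[OF X] D.id_closed
 let ?e = "\<lambda>Z \<psi>. \<lambda>c\<in>Mor C (fst Z) X. e (snd Z) (\<psi> c)"
 have ec: "?e Z \<psi> \<in> carrier (hon X J B Z)" if Z: "Z \<in> Obj TC" and p: "\<psi> \<in> carrier (hon X J A Z)" for Z \<psi>
  by (rule hon_restrictI[OF Z lin_comp[OF lh[OF p] hom_lin[OF e(1) ob(2)[OF Z]]]])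
   (simp add: hz[OF p] hom_zero[OF e(1) A B ob(2)[OF Z]])
 have eh: "mod_hom K TC (hmod X J A) (hmod X J B) ?e"
 proof (rule tensor_mod_homI[OF HA(1) HB(1)])
  fix Z assume Z: "Z \<in> Obj TC"
  show "?e Z \<in> lin_maps K (On (hmod X J A) Z) (On (hmod X J B) Z)"
   by (rule lin_mapsI) (use ec[OF Z] lin_closed[OF lh[of _ A Z]] ob[OF Z] in
     "auto simp: hon_simps(3,4) hom_add[OF e(1)] hom_smult[OF e(1)] intro!: restrict_ext")
  fix Z' x h assume Z': "Z' \<in> Obj TC" and x: "x \<in> pr Z Z'" and h: "h \<in> El (hmod X J A) Z"
  then have hc: "h \<in> carrier (hon X J A Z)" by simp
  have x': "fst x \<in> Mor C (fst Z) (fst Z')" "snd x \<in> Mor D (snd Z) (snd Z')" using x by auto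
  show "?e Z' (Act (hmod X J A) Z Z' (tm Z Z' x) h) = Act (hmod X J B) Z Z' (tm Z Z' x) (?e Z h)"
   using ob[OF Z] ob[OF Z'] x' X lin_closed[OF lh[OF hc]]
   by (auto simp: HA(2)[OF Z Z' x hc] HB(2)[OF Z Z' x ec[OF Z hc]] hact_def C.comp_closed hom_nat[OF e(1)] intro!: restrict_ext)
 qed
 have ee: "epi TC (hmod X J A) (hmod X J B) ?e"
 proof (rule epiI[OF eh])
  fix Z \<chi> assume Z: "Z \<in> Obj TC" and "\<chi> \<in> El (hmod X J B) Z"
  then have ch: "\<chi> \<in> carrier (hon X J B Z)" by simp
  note o = ob[OF Z]
  \<comment> \<open>Coinduction preserves epimorphisms: compose \<open>\<chi>\<close> with a
    \<open>K\<close>-linear section of \<open>e\<close>. Linearity of the section also preserves the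
    vanishing on \<open>J\<close>.\<close>
  obtain t where t: "t \<in> lin_maps K (On B (snd Z)) (On A (snd Z))" "\<And>w. w \<in> El B (snd Z) ==> e (snd Z) (t w) = w"
   using linear_section[OF fK c_module.on_module[OF A o(2)] c_module.on_module[OF B o(2)] hom_lin[OF e(1) o(2)]] e(2) o(2)
   unfolding epi_def by blast
  have "(\<lambda>c\<in>Mor C (fst Z) X. t (\<chi> c)) \<in> carrier (hon X J A Z)"
   by (rule hon_restrictI[OF Z lin_comp[OF lh[OF ch] t(1)]])
    (simp add: hz[OF ch] lin_zero[OF t(1) c_module.on_module[OF B o(2)] c_module.on_module[OF A o(2)]])
  moreover have "?e Z (\<lambda>c\<in>Mor C (fst Z) X. t (\<chi> c)) = \<chi>"
   by (rule restrict_eq_ext[OF he[OF ch]]) (use lin_closed[OF lh[OF ch]] t(2) in simp)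
  ultimately show "\<exists>\<psi>\<in>El (hmod X J A) Z. ?e Z \<psi> = \<chi>" unfolding hmod_On by blast
 qed
 let ?a = "\<lambda>Z c p. Act M Z (X, snd Z) (tm Z (X, snd Z) (c, Id D (snd Z))) p"
 have XY: "Z \<in> Obj TC ==> (X, snd Z) \<in> Obj TC" for Z using X by (simp add: TC_simps)
 have al: "(\<lambda>c. ?a Z c p) \<in> lin_maps K (Hom C (fst Z) X) (On M (X, snd Z))" if Z: "Z \<in> Obj TC" and p: "p \<in> El M Z" for Z p
  using pure_act(3)[OF Mm Z XY[OF Z] p] i(2)[OF ob(2)[OF Z]] unfolding bilin_def by simp
 have al2: "?a Z c \<in> lin_maps K (On M Z) (On M (X, snd Z))" if Z: "Z \<in> Obj TC" and c: "c \<in> Mor C (fst Z) X" for Z c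
  using pure_act(1)[OF Mm Z XY[OF Z], of "(c, Id D (snd Z))"] c i(2)[OF ob(2)[OF Z]] by simp
 \<comment> \<open>The transpose of \<open>f\<close>: an element \<open>p\<close> is sent to the map
   \<open>c \<mapsto> f (c p)\<close>, which vanishes on \<open>J\<close> by
   \<open>fJ\<close>.\<close>
 let ?\<phi> = "\<lambda>Z p. \<lambda>c\<in>Mor C (fst Z) X. f (snd Z) (?a Z c p)"
 have fl: "f Y \<in> lin_maps K (On M (X, Y)) (On B Y)" if "Y \<in> Obj D" for Y using hom_lin[OF f that] by simp
 have pc: "?\<phi> Z p \<in> carrier (hon X J B Z)" if Z: "Z \<in> Obj TC" and p: "p \<in> El M Z" for Z p
  by (rule hon_restrictI[OF Z lin_comp[OF al[OF Z p] fl[OF ob(2)[OF Z]]]])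
   (use fJ[OF ob[OF Z], of _ p] p in "simp")
 have ph: "mod_hom K TC M (hmod X J B) ?\<phi>"
 proof (rule tensor_mod_homI[OF Mm HB(1)])
  fix Z assume Z: "Z \<in> Obj TC"
  show "?\<phi> Z \<in> lin_maps K (On M Z) (On (hmod X J B) Z)"
   by (rule lin_mapsI) (use pc[OF Z] lin_closed[OF al[OF Z]] ob[OF Z] in
     "auto simp: hon_simps(3,4) lin_add[OF al2[OF Z], simplified] lin_smult[OF al2[OF Z], simplified] lin_closed[OF al2[OF Z], simplified] lin_add[OF fl] lin_smult[OF fl] intro!: restrict_ext")
  fix Z' x h assume Z': "Z' \<in> Obj TC" and x: "x \<in> pr Z Z'" and h: "h \<in> El M Z"
  have x': "fst x \<in> Mor C (fst Z) (fst Z')" "snd x \<in> Mor D (snd Z) (snd Z')" using x by auto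
  note o = ob[OF Z] and o' = ob[OF Z']
  have "f (snd Z') (?a Z' c (Act M Z Z' (tm Z Z' x) h)) = Act B (snd Z) (snd Z') (snd x) (f (snd Z) (?a Z (Comp C (fst Z) (fst Z') X c (fst x)) h))"
   if c: "c \<in> Mor C (fst Z') X" for c
  proof -
   have cc: "Comp C (fst Z) (fst Z') X c (fst x) \<in> Mor C (fst Z) X" using c x' o o' X by (simp add: C.comp_closed)
   have "?a Z' c (Act M Z Z' (tm Z Z' x) h) = Act M Z (X, snd Z') (tm Z (X, snd Z') (pcomp Z Z' (X, snd Z') (c, Id D (snd Z')) x)) h"
    using pure_act(5)[OF Mm Z Z' XY[OF Z'], of "(c, Id D (snd Z'))" x h] c x' h i(2)[OF o'(2)] x by simp
   \<comment> \<open>The interchange law: acting by \<open>x\<close> and then by \<open>c\<close> is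
     the same as acting first in the left argument only and then by \<open>snd x\<close> in the
     right one, where naturality of \<open>f\<close> applies.\<close>
   also have "pcomp Z Z' (X, snd Z') (c, Id D (snd Z')) x = pcomp Z (X, snd Z) (X, snd Z') (Id C X, snd x) (Comp C (fst Z) (fst Z') X c (fst x), Id D (snd Z))"
    using x' o o' X cc by (simp add: pcomp_def D.comp_id_left D.comp_id_right C.comp_id_left)
   also have "Act M Z (X, snd Z') (tm Z (X, snd Z') \<dots>) h =
     Act M (X, snd Z) (X, snd Z') (tm (X, snd Z) (X, snd Z') (Id C X, snd x)) (?a Z (Comp C (fst Z) (fst Z') X c (fst x)) h)"
    by (rule pure_act(5)[OF Mm Z XY[OF Z] XY[OF Z']]) (use cc x' i o h in auto)
   finally show ?thesis
    using hom_nat[OF f o(2) o'(2) x'(2), of "?a Z (Comp C (fst Z) (fst Z') X c (fst x)) h"] lin_closed[OF al2[OF Z cc] h] by simp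
  qed
  then show "?\<phi> Z' (Act M Z Z' (tm Z Z' x) h) = Act (hmod X J B) Z Z' (tm Z Z' x) (?\<phi> Z h)"
   unfolding HB(2)[OF Z Z' x pc[OF Z h]] using o o' x' X by (auto simp: hact_def C.comp_closed intro!: restrict_ext)
 qed
 obtain \<Psi> where \<Psi>: "mod_hom K TC M (hmod X J A) \<Psi>" "\<And>Z p. Z \<in> Obj TC ==> p \<in> El M Z ==> ?e Z (\<Psi> Z p) = ?\<phi> Z p"
  by (rule liftsD[OF T.projective_lifts[OF M HA(1) HB(1) eh ee] ph]) (rule that)
 have pl: "\<Psi> Z \<in> lin_maps K (On M Z) (hon X J A Z)" if "Z \<in> Obj TC" for Z using hom_lin[OF \<Psi>(1) that] by simp
 have O: "Y \<in> Obj D ==> (X, Y) \<in> Obj TC" for Y using X by (simp add: TC_simps)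
 have O': "X' \<in> Obj C ==> Y \<in> Obj D ==> (X', Y) \<in> Obj TC" for X' Y by (simp add: TC_simps)
 have ev: "\<Psi> Z' (Act M Z Z' (tm Z Z' x) h) = hact X A Z Z' x (\<Psi> Z h)"
  if "Z \<in> Obj TC" "Z' \<in> Obj TC" "x \<in> pr Z Z'" "h \<in> El M Z" for Z Z' x h
  using hom_nat[OF \<Psi>(1) that(1,2) tm_closed[OF that(1-3)] that(4)] HA(2)[OF that(1-3) lin_closed[OF pl[OF that(1)] that(4)]] by simp
 let ?g = "\<lambda>Y p. \<Psi> (X, Y) p (Id C X)"
 show ?thesis
 proof (rule that[of ?g])
  show "mod_hom K D (rslice M X) A ?g"
  proof (rule D.mod_homI[OF rslice_c_module[OF Mm X] A])
   fix Y h assume Y: "Y \<in> Obj D" and "h \<in> El (rslice M X) Y"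
   then have h: "h \<in> El M (X, Y)" by simp
   note l = lh[OF lin_closed[OF pl[OF O[OF Y]] h]]
   show "\<Psi> (X, Y) h (Id C X) \<in> El A Y" using lin_closed[OF l] i(1) by simp
   { fix h' assume "h' \<in> El (rslice M X) Y"
    then show "\<Psi> (X, Y) (h +[On (rslice M X) Y] h') (Id C X) = \<Psi> (X, Y) h (Id C X) +[On A Y] \<Psi> (X, Y) h' (Id C X)"
     using lin_add[OF pl[OF O[OF Y]] h] i(1) by (simp add: hon_simps(3)) }
   { fix Y' g assume Y': "Y' \<in> Obj D" and g: "g \<in> Mor D Y Y'"
    show "\<Psi> (X, Y') (Act (rslice M X) Y Y' g h) (Id C X) = Act A Y Y' g (\<Psi> (X, Y) h (Id C X))"
     using ev[OF O[OF Y] O[OF Y'], of "(Id C X, g)" h] g h i(1) by (simp add: hact_def C.comp_id_left[OF X X]) }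
  qed
  show "e Y (\<Psi> (X, Y) p (Id C X)) = f Y p" if Y: "Y \<in> Obj D" and p: "p \<in> El M (X, Y)" for Y p
   using fun_cong[OF \<Psi>(2)[OF O[OF Y] p], of "Id C X"] i(1) pure_act(4)[OF Mm O[OF Y] p] by (simp add: pid_def)
  \<comment> \<open>By naturality of \<open>\<Psi>\<close> this value is that of
    \<open>\<Psi> p\<close> at \<open>c\<close>, and members of \<open>hon X J A\<close> vanish on
    \<open>J\<close>.\<close>
  show "\<Psi> (X, Y) (Act M (X', Y) (X, Y) (tm (X', Y) (X, Y) (c, Id D Y)) p) (Id C X) = 0[On A Y]"
   if X': "X' \<in> Obj C" and Y: "Y \<in> Obj D" and c: "c \<in> J X'" and p: "p \<in> El M (X', Y)" for X' Y c p
  proof -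
   note pc' = lin_closed[OF pl[OF O'[OF X' Y]] p]
   show ?thesis
    using ev[OF O'[OF X' Y] O[OF Y], of "(c, Id D Y)" p] Jc[OF X' c] i(1) i(2)[OF Y] p hz[OF pc', of c] c lin_closed[OF lh[OF pc']]
    by (simp add: hact_def C.comp_id_left[OF X' X] act_id[OF A Y] mod_closed[OF c_module.on_module[OF A Y]])
  qed
 qed
qed

end

end

context scalars
begin

lemma lin_span_mapsto:
 assumes V: "module K V" and W: "module K W" and T: "T \<in> lin_maps K V W" and S: "S \<subseteq> carrier V"
  and H: "submodule H K W" and TS: "\<And>x. x \<in> S ==> T x \<in> H" and x: "x \<in> lin_span K V S"
 shows "T x \<in> H"
 using lin_span_submodule(3)[OF V S preimage_submodule[OF V W T H]] TS S x by blast

end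

lemma mod_hom_cong:
 assumes "mod_hom K C M N \<eta>" "\<And>X. X \<in> Obj C ==> On M' X = On M X"
  and "\<And>X Y f x. X \<in> Obj C ==> Y \<in> Obj C ==> f \<in> Mor C X Y ==> x \<in> El M X ==> Act M' X Y f x = Act M X Y f x"
  and "\<And>X. X \<in> Obj C ==> On N' X = On N X"
  and "\<And>X Y f x. X \<in> Obj C ==> Y \<in> Obj C ==> f \<in> Mor C X Y ==> x \<in> El N X ==> Act N' X Y f x = Act N X Y f x"
 shows "mod_hom K C M' N' \<eta>"
proof -
 have "\<eta> X x \<in> El N X" if "X \<in> Obj C" "x \<in> El M X" for X x
  using hom_closed[OF assms(1) that] .
 with assms show ?thesis unfolding mod_hom_def by simp
qed

section \<open>Projectivity of slices and of their quotients\<close>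

context two_kcats
begin

interpretation S: two_kcats K D C by (rule two_kcats_swap)

lemma rslice_hom: "X \<in> Obj C ==> mod_hom K TC M N \<eta> ==> mod_hom K D (rslice M X) (rslice N X) (\<lambda>Y. \<eta> (X, Y))"
 unfolding mod_hom_def using tm_closed by (auto simp: TC_simps(1) C.id_closed)

lemma rslice_resolution:
 assumes X: "X \<in> Obj C" and R: "resolution K TC M P d \<epsilon>"
 shows "resolution K D (rslice M X) (\<lambda>n. rslice (P n) X) (\<lambda>n Y. d n (X, Y)) (\<lambda>Y. \<epsilon> (X, Y))"
proof -
 interpret R: resolution K TC M P d \<epsilon> by fact
 show ?thesis
  by (rule D.resolutionI)
   (use R.eps_onto R.eps_d R.d_d R.exact0 R.exact X in
    "auto simp: rslice_c_module R.M R.P TC_simps(1) intro!: rslice_hom[OF X] R.d R.eps")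
qed

lemma rslice_projective:
 fixes M :: "('k, 'o \<times> 'p, ('m \<times> 'n \<Rightarrow> 'k) set, 'v) cmod"
 assumes fK: "field K" and M: "projective K TC M" and X: "X \<in> Obj C"
 shows "projective K D (rslice M X)"
proof (rule D.projectiveI[OF rslice_c_module[OF T.projective_c_module[OF M] X]])
 fix A B :: "('k, 'p, 'n, ('p, 'n, 'v) elt) cmod" and e
 assume AB: "c_module K D A" "c_module K D B" "mod_hom K D A B e" "epi D A B e"
 show "lifts K D (rslice M X) A B e" unfolding lifts_def
 proof (intro allI impI)
  fix f assume f: "mod_hom K D (rslice M X) B f"
  obtain g where "mod_hom K D (rslice M X) A g" "\<And>Y p. Y \<in> Obj D ==> p \<in> El M (X, Y) ==> e Y (g Y p) = f Y p"
   by (rule rslice_lift[where J = "\<lambda>_. {}", OF X _ _ fK M AB f]) auto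
  then show "\<exists>g. mod_hom K D (rslice M X) A g \<and> (\<forall>Xa\<in>Obj D. \<forall>x\<in>El (rslice M X) Xa. e Xa (g Xa x) = f Xa x)" by auto
 qed
qed

text \<open>The part of \<open>M(X,-)\<close> reached by acting with \<open>J\<close> in the left
  argument. For \<open>op_cat C\<close> and \<open>J = I X\<close> it is the left submodule
  \<open>I M\<close> at \<open>X\<close>.\<close>

definition jspan :: "'o \<Rightarrow> ('o \<Rightarrow> 'm set) \<Rightarrow> ('k, 'o \<times> 'p, ('m \<times> 'n \<Rightarrow> 'k) set, 'v) cmod \<Rightarrow> 'p \<Rightarrow> 'v set" where
 "jspan X J M Y = lin_span K (On M (X, Y)) {Act M (X', Y) (X, Y) (tm (X', Y) (X, Y) (c, Id D Y)) p |X' c p.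
   X' \<in> Obj C \<and> c \<in> J X' \<and> p \<in> El M (X', Y)}"

context
 fixes X :: 'o and J :: "'o \<Rightarrow> 'm set"
 assumes X: "X \<in> Obj C" and Jc: "\<And>X' c. X' \<in> Obj C ==> c \<in> J X' ==> c \<in> Mor C X' X"
  and Jr: "\<And>X' X'' f c. X' \<in> Obj C ==> X'' \<in> Obj C ==> f \<in> Mor C X' X'' ==> c \<in> J X'' ==> Comp C X' X'' X c f \<in> J X'"
begin

lemma jspan_gens_carrier:
 assumes M: "c_module K TC M" and Y: "Y \<in> Obj D"
 shows "{Act M (X', Y) (X, Y) (tm (X', Y) (X, Y) (c, Id D Y)) p |X' c p. X' \<in> Obj C \<and> c \<in> J X' \<and> p \<in> El M (X', Y)}
  \<subseteq> El M (X, Y)"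
proof clarify
 fix X' c p assume "X' \<in> Obj C" "c \<in> J X'" "p \<in> El M (X', Y)"
 then show "Act M (X', Y) (X, Y) (tm (X', Y) (X, Y) (c, Id D Y)) p \<in> El M (X, Y)"
  using pure_act(2)[OF M, of "(X', Y)" "(X, Y)" "(c, Id D Y)" p] X Y Jc D.id_closed[OF Y] by (simp add: TC_simps(1))
qed

lemma jspan_gen: "X' \<in> Obj C ==> c \<in> J X' ==> p \<in> El M (X', Y) ==>
  Act M (X', Y) (X, Y) (tm (X', Y) (X, Y) (c, Id D Y)) p \<in> jspan X J M Y"
 unfolding jspan_def by (rule C.lin_span_inc) blast

lemma jspan_submodule: "c_module K TC M ==> Y \<in> Obj D ==> submodule (jspan X J M Y) K (On M (X, Y))"
 using C.lin_span_submodule(1)[OF c_module.on_module[of K TC M "(X, Y)"] jspan_gens_carrier] X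
 unfolding jspan_def by (simp add: TC_simps(1))

lemma jspan_mapsto:
 assumes M: "c_module K TC M" and Y: "Y \<in> Obj D" and W: "module K W" and T: "T \<in> lin_maps K (On M (X, Y)) W"
  and H: "submodule H K W" and x: "x \<in> jspan X J M Y"
  and g: "\<And>X' c p. X' \<in> Obj C ==> c \<in> J X' ==> p \<in> El M (X', Y) ==>
   T (Act M (X', Y) (X, Y) (tm (X', Y) (X, Y) (c, Id D Y)) p) \<in> H"
 shows "T x \<in> H"
proof (rule C.lin_span_mapsto[OF _ W T jspan_gens_carrier[OF M Y] H _ x[unfolded jspan_def]])
 show "module K (On M (X, Y))" using c_module.on_module[OF M] X Y by (simp add: TC_simps(1))
qed (use g in auto)

text \<open>The action of \<open>D\<close> on the right commutes with the action of \<open>J\<close>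
  on the left, so generators go to generators.\<close>

lemma jspan_subfunctor:
 assumes M: "c_module K TC M"
 shows "D.subfunctor (rslice M X) (jspan X J M)"
 unfolding D.subfunctor_def
proof (intro conjI ballI)
 fix Y assume Y: "Y \<in> Obj D"
 show "submodule (jspan X J M Y) K (On (rslice M X) Y)" using jspan_submodule[OF M Y] by simp
 fix Y' g x assume Y': "Y' \<in> Obj D" and g: "g \<in> Mor D Y Y'" and x: "x \<in> jspan X J M Y"
 have O: "(X', Y) \<in> Obj TC" "(X', Y') \<in> Obj TC" if "X' \<in> Obj C" for X' using that Y Y' by (simp_all add: TC_simps(1))
 have i: "Id C X' \<in> Mor C X' X'" if "X' \<in> Obj C" for X' by (rule C.id_closed[OF that])
 note iY = D.id_closed[OF Y] D.id_closed[OF Y']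
 have "Act M (X, Y) (X, Y') (tm (X, Y) (X, Y') (Id C X, g)) x \<in> jspan X J M Y'"
 proof (rule jspan_mapsto[OF M Y _ pure_act(1)[OF M O[OF X]] jspan_submodule[OF M Y'] x])
  show "module K (On M (X, Y'))" by (rule c_module.on_module[OF M O(2)[OF X]])
  show "(Id C X, g) \<in> pr (X, Y) (X, Y')" using i[OF X] g by simp
  fix X' c p assume X': "X' \<in> Obj C" and c: "c \<in> J X'" and p: "p \<in> El M (X', Y)"
  note cc = Jc[OF X' c]
  have "Act M (X, Y) (X, Y') (tm (X, Y) (X, Y') (Id C X, g)) (Act M (X', Y) (X, Y) (tm (X', Y) (X, Y) (c, Id D Y)) p)
   = Act M (X', Y) (X, Y') (tm (X', Y) (X, Y') (pcomp (X', Y) (X, Y) (X, Y') (Id C X, g) (c, Id D Y))) p"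
   by (rule pure_act(5)[OF M O(1)[OF X'] O[OF X], symmetric]) (use i[OF X] g cc iY p in auto)
  also have "pcomp (X', Y) (X, Y) (X, Y') (Id C X, g) (c, Id D Y) = pcomp (X', Y) (X', Y') (X, Y') (c, Id D Y') (Id C X', g)"
   using X X' Y Y' g cc by (simp add: pcomp_def C.comp_id_left C.comp_id_right D.comp_id_left D.comp_id_right)
  also have "Act M (X', Y) (X, Y') (tm (X', Y) (X, Y') \<dots>) p =
    Act M (X', Y') (X, Y') (tm (X', Y') (X, Y') (c, Id D Y')) (Act M (X', Y) (X', Y') (tm (X', Y) (X', Y') (Id C X', g)) p)"
   by (rule pure_act(5)[OF M O[OF X'] O(2)[OF X]]) (use i[OF X'] g cc iY p in auto)
  also have "\<dots> \<in> jspan X J M Y'"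
   by (rule jspan_gen[OF X' c]) (rule pure_act(2)[OF M O[OF X'] _ p], use i[OF X'] g in simp)
  finally show "Act M (X, Y) (X, Y') (tm (X, Y) (X, Y') (Id C X, g)) (Act M (X', Y) (X, Y) (tm (X', Y) (X, Y) (c, Id D Y)) p) \<in> jspan X J M Y'" .
 qed
 then show "Act (rslice M X) Y Y' g x \<in> jspan X J M Y'" by simp
qed

text \<open>Maps out of the quotient are maps out of the slice that kill \<open>jspan\<close>. The
  third conclusion of \<open>rslice_lift\<close> keeps this property for the lift, which therefore
  descends again.\<close>

lemma quot_rslice_projective:
 fixes M :: "('k, 'o \<times> 'p, ('m \<times> 'n \<Rightarrow> 'k) set, 'v) cmod"
 assumes fK: "field K" and M: "projective K TC M"
 shows "projective K D (D.quotm (rslice M X) (jspan X J M))"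
proof -
 have Mm: "c_module K TC M" by (rule T.projective_c_module[OF M])
 note R = rslice_c_module[OF Mm X] and sf = jspan_subfunctor[OF Mm]
 let ?U = "D.quotm (rslice M X) (jspan X J M)"
 have U: "c_module K D ?U" by (rule D.quotm_c_module[OF R sf])
 have pr: "mod_hom K D (rslice M X) ?U (\<lambda>Y x. jspan X J M Y +>[On (rslice M X) Y] x)" by (rule D.quotm_proj[OF R sf])
 show ?thesis
 proof (rule D.projectiveI[OF U])
  fix A B :: "('k, 'p, 'n, ('p, 'n, 'v set) elt) cmod" and e
  assume AB: "c_module K D A" "c_module K D B" "mod_hom K D A B e" "epi D A B e"
  show "lifts K D ?U A B e" unfolding lifts_def
  proof (intro allI impI)
   fix f assume f: "mod_hom K D ?U B f"
   have fz: "f Y (jspan X J M Y +>[On M (X, Y)] x) = 0[On B Y]" if Y: "Y \<in> Obj D" and x: "x \<in> jspan X J M Y" for Y x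
   proof -
    have xc: "x \<in> El (rslice M X) Y" by (rule D.subfunctor_carrier[OF R sf Y x])
    interpret RX: kmod K "On (rslice M X) Y" by (rule on_kmod[OF R Y])
    have "jspan X J M Y +>[On (rslice M X) Y] x = 0[On ?U Y]"
     using RX.coset_eq_self_iff[OF _ xc, of "jspan X J M Y"] jspan_submodule[OF Mm Y] x by (simp add: RX.quot_zero[simplified])
    then show ?thesis using hom_zero[OF f U AB(2) Y] by simp
   qed
   have fz': "f Y (jspan X J M Y +>[On (rslice M X) Y] Act M (X', Y) (X, Y) (tm (X', Y) (X, Y) (c, Id D Y)) p) = 0[On B Y]"
    if "X' \<in> Obj C" "Y \<in> Obj D" "c \<in> J X'" "p \<in> El M (X', Y)" for X' Y c p
    unfolding rslice_simps(1) by (rule fz[OF that(2) jspan_gen[OF that(1,3,4)]])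
   obtain g where g: "mod_hom K D (rslice M X) A g"
    "\<And>Y p. Y \<in> Obj D ==> p \<in> El M (X, Y) ==> e Y (g Y p) = f Y (jspan X J M Y +>[On (rslice M X) Y] p)"
    "\<And>X' Y c p. X' \<in> Obj C ==> Y \<in> Obj D ==> c \<in> J X' ==> p \<in> El M (X', Y) ==>
      g Y (Act M (X', Y) (X, Y) (tm (X', Y) (X, Y) (c, Id D Y)) p) = 0[On A Y]"
    by (rule rslice_lift[where J = J, OF X Jc Jr fK M AB hom_comp[OF pr f]])
     ((rule fz' that; assumption) | assumption)+
   have gz: "g Y x = 0[On A Y]" if Y: "Y \<in> Obj D" and x: "x \<in> jspan X J M Y" for Y x
    using jspan_mapsto[OF Mm Y c_module.on_module[OF AB(1) Y] hom_lin[OF g(1) Y, simplified] zero_submodule[OF c_module.on_module[OF AB(1) Y]] x] g(3) Y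
    by blast
   obtain g' where g': "mod_hom K D ?U A g'" "\<forall>Y\<in>Obj D. \<forall>x\<in>El (rslice M X) Y. g' Y (jspan X J M Y +>[On (rslice M X) Y] x) = g Y x"
    using D.quotm_factor[OF R sf AB(1) g(1) gz] by blast
   have "e Y (g' Y u) = f Y u" if Y: "Y \<in> Obj D" and u: "u \<in> carrier (On ?U Y)" for Y u
   proof -
    interpret RX: kmod K "On (rslice M X) Y" by (rule on_kmod[OF R Y])
    obtain x where x: "x \<in> El (rslice M X) Y" "u = jspan X J M Y +>[On (rslice M X) Y] x"
     using u RX.quot_carrier by auto
    then show ?thesis using g'(2) g(2)[OF Y, of x] Y by simp
   qed
   with g'(1) show "\<exists>g. mod_hom K D ?U A g \<and> (\<forall>Y\<in>Obj D. \<forall>x\<in>carrier (On ?U Y). e Y (g Y x) = f Y x)" by blast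
  qed
 qed
qed

end

subsection \<open>Exchanging the arguments of a bimodule\<close>

text \<open>Slices are taken at an object of the left factor. Exchanging the factors makes the same
  results available for slices at an object of the right factor.\<close>

definition sw :: "('k, 'o \<times> 'p, ('m \<times> 'n \<Rightarrow> 'k) set, 'v) cmod \<Rightarrow> ('k, 'p \<times> 'o, ('n \<times> 'm \<Rightarrow> 'k) set, 'v) cmod" where
 "sw M = \<lparr>On = (\<lambda>Z. On M (prod.swap Z)),
   Act = (\<lambda>Z Z' A h. tlift K (On M (prod.swap Z')) (\<lambda>x. Act M (prod.swap Z) (prod.swap Z') (tm (prod.swap Z) (prod.swap Z') (prod.swap x)) h) A)\<rparr>"

lemma sw_On [simp]: "On (sw M) Z = On M (prod.swap Z)"
 by (simp add: sw_def)

lemma swap_obj: "prod.swap Z \<in> Obj TC \<longleftrightarrow> Z \<in> Obj S.TC"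
 by (auto simp: TC_simps(1) S.TC_simps(1))

lemma sw_c_module:
 assumes M: "c_module K TC M"
 shows "c_module K S.TC (sw M)"
  and "\<And>Z Z' x h. Z \<in> Obj S.TC ==> Z' \<in> Obj S.TC ==> x \<in> S.pr Z Z' ==> h \<in> El (sw M) Z ==>
   Act (sw M) Z Z' (S.tm Z Z' x) h = Act M (prod.swap Z) (prod.swap Z') (tm (prod.swap Z) (prod.swap Z') (prod.swap x)) h"
proof -
 let ?act = "\<lambda>Z Z' x h. Act M (prod.swap Z) (prod.swap Z') (tm (prod.swap Z) (prod.swap Z') (prod.swap x)) h"
 note bm = S.bimod_c_module[where M = "sw M" and act = ?act]
 have sx: "prod.swap x \<in> pr (prod.swap Z) (prod.swap Z')" if "x \<in> S.pr Z Z'" for x Z Z' using that by auto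
 have o: "Z \<in> Obj S.TC ==> prod.swap Z \<in> Obj TC" for Z by (simp add: swap_obj)
 have 1: "module K (On (sw M) Z)" if "Z \<in> Obj S.TC" for Z using c_module.on_module[OF M o[OF that]] by simp
 have 2: "Act (sw M) Z Z' A h = tlift K (On (sw M) Z') (\<lambda>x. ?act Z Z' x h) A" for Z Z' A h by (simp add: sw_def)
 have 3: "?act Z Z' x \<in> lin_maps K (On (sw M) Z) (On (sw M) Z')" if "Z \<in> Obj S.TC" "Z' \<in> Obj S.TC" "x \<in> S.pr Z Z'" for Z Z' x
  using pure_act(1)[OF M o[OF that(1)] o[OF that(2)] sx[OF that(3)]] by simp
 have 4: "bilin K (Hom D (fst Z) (fst Z')) (Hom C (snd Z) (snd Z')) (On (sw M) Z') (\<lambda>x. ?act Z Z' x h)"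
  if "Z \<in> Obj S.TC" "Z' \<in> Obj S.TC" "h \<in> El (sw M) Z" for Z Z' h
  using pure_act(3)[OF M o[OF that(1)] o[OF that(2)], of h] that(3) unfolding bilin_def by simp
 have 5: "?act Z Z (S.pid Z) h = h" if "Z \<in> Obj S.TC" "h \<in> El (sw M) Z" for Z h
  using pure_act(4)[OF M o[OF that(1)], of h] that(2) by (simp add: pid_def S.pid_def)
 have 6: "?act Z Z'' (S.pcomp Z Z' Z'' x y) h = ?act Z' Z'' x (?act Z Z' y h)"
  if "Z \<in> Obj S.TC" "Z' \<in> Obj S.TC" "Z'' \<in> Obj S.TC" "x \<in> S.pr Z' Z''" "y \<in> S.pr Z Z'" "h \<in> El (sw M) Z" for Z Z' Z'' x y h
  using pure_act(5)[OF M o[OF that(1)] o[OF that(2)] o[OF that(3)] sx[OF that(4)] sx[OF that(5)], of h] that(6)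
  by (simp add: pcomp_def S.pcomp_def)
 show "c_module K S.TC (sw M)" by (rule bm(1)) (rule 1 2 3 4 5 6; assumption)+
 show "Act (sw M) Z Z' (S.tm Z Z' x) h = ?act Z Z' x h"
  if "Z \<in> Obj S.TC" "Z' \<in> Obj S.TC" "x \<in> S.pr Z Z'" "h \<in> El (sw M) Z" for Z Z' x h
  by (rule bm(2)) (rule 1 2 3 4 5 6 that; assumption?)+
qed

end

context two_kcats
begin

interpretation S: two_kcats K D C by (rule two_kcats_swap)

lemma sw_hom:
 assumes M: "c_module K TC M" and N: "c_module K S.TC N"
 shows "mod_hom K S.TC (sw M) N f ==> mod_hom K TC M (S.sw N) (\<lambda>Z. f (prod.swap Z))"
  and "mod_hom K TC M (S.sw N) g ==> mod_hom K S.TC (sw M) N (\<lambda>Z. g (prod.swap Z))"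
proof -
 have o: "Z \<in> Obj S.TC ==> prod.swap Z \<in> Obj TC" "Y \<in> Obj TC ==> prod.swap Y \<in> Obj S.TC" for Z Y
  by (auto simp: TC_simps(1) S.TC_simps(1))
 have sx: "x \<in> pr Z Z' ==> prod.swap x \<in> S.pr (prod.swap Z) (prod.swap Z')" for x Z Z' by auto
 have sx': "x \<in> S.pr Z Z' ==> prod.swap x \<in> pr (prod.swap Z) (prod.swap Z')" for x Z Z' by auto
 note sM = sw_c_module[OF M] and sN = S.sw_c_module[OF N]
 show "mod_hom K TC M (S.sw N) (\<lambda>Z. f (prod.swap Z))" if f: "mod_hom K S.TC (sw M) N f"
 proof (rule tensor_mod_homI[OF M sN(1)])
  fix Z assume Z: "Z \<in> Obj TC"
  show "f (prod.swap Z) \<in> lin_maps K (On M Z) (On (S.sw N) Z)" using hom_lin[OF f o(2)[OF Z]] by simp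
  fix Z' x h assume Z': "Z' \<in> Obj TC" and x: "x \<in> pr Z Z'" and h: "h \<in> El M Z"
  have fh: "f (prod.swap Z) h \<in> El (S.sw N) Z" using hom_closed[OF f o(2)[OF Z], of h] h by simp
  show "f (prod.swap Z') (Act M Z Z' (tm Z Z' x) h) = Act (S.sw N) Z Z' (tm Z Z' x) (f (prod.swap Z) h)"
   using hom_nat[OF f o(2)[OF Z] o(2)[OF Z'] S.tm_closed[OF o(2)[OF Z] o(2)[OF Z'] sx[OF x]], of h] h
    sM(2)[OF o(2)[OF Z] o(2)[OF Z'] sx[OF x], of h] sN(2)[OF Z Z' x fh] by simp
 qed
 show "mod_hom K S.TC (sw M) N (\<lambda>Z. g (prod.swap Z))" if g: "mod_hom K TC M (S.sw N) g"
 proof (rule S.tensor_mod_homI[OF sM(1) N])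
  fix Z assume Z: "Z \<in> Obj S.TC"
  show "g (prod.swap Z) \<in> lin_maps K (On (sw M) Z) (On N Z)" using hom_lin[OF g o(1)[OF Z]] by simp
  fix Z' x h assume Z': "Z' \<in> Obj S.TC" and x: "x \<in> S.pr Z Z'" and h: "h \<in> El (sw M) Z"
  have gh: "g (prod.swap Z) h \<in> El (S.sw N) (prod.swap Z)" using hom_closed[OF g o(1)[OF Z], of h] h by simp
  show "g (prod.swap Z') (Act (sw M) Z Z' (S.tm Z Z' x) h) = Act N Z Z' (S.tm Z Z' x) (g (prod.swap Z) h)"
   using hom_nat[OF g o(1)[OF Z] o(1)[OF Z'] tm_closed[OF o(1)[OF Z] o(1)[OF Z'] sx'[OF x]], of h] h
    sM(2)[OF Z Z' x h] sN(2)[OF o(1)[OF Z] o(1)[OF Z'] sx'[OF x] gh] by simp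
 qed
qed

lemma sw_map:
 assumes M: "c_module K TC M" and N: "c_module K TC N" and f: "mod_hom K TC M N f"
 shows "mod_hom K S.TC (sw M) (sw N) (\<lambda>Z. f (prod.swap Z))"
proof (rule S.tensor_mod_homI[OF sw_c_module(1)[OF M] sw_c_module(1)[OF N]])
 have o: "Z \<in> Obj S.TC ==> prod.swap Z \<in> Obj TC" for Z by (auto simp: TC_simps(1) S.TC_simps(1))
 fix Z assume Z: "Z \<in> Obj S.TC"
 show "f (prod.swap Z) \<in> lin_maps K (On (sw M) Z) (On (sw N) Z)" using hom_lin[OF f o[OF Z]] by simp
 fix Z' x h assume Z': "Z' \<in> Obj S.TC" and x: "x \<in> S.pr Z Z'" and h: "h \<in> El (sw M) Z"
 have sx: "prod.swap x \<in> pr (prod.swap Z) (prod.swap Z')" using x by auto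
 have fh: "f (prod.swap Z) h \<in> El (sw N) Z" using hom_closed[OF f o[OF Z], of h] h by simp
 show "f (prod.swap Z') (Act (sw M) Z Z' (S.tm Z Z' x) h) = Act (sw N) Z Z' (S.tm Z Z' x) (f (prod.swap Z) h)"
  using hom_nat[OF f o[OF Z] o[OF Z'] tm_closed[OF o[OF Z] o[OF Z'] sx], of h] h
   sw_c_module(2)[OF M Z Z' x h] sw_c_module(2)[OF N Z Z' x fh] by simp
qed

end

context two_kcats
begin

interpretation S: two_kcats K D C by (rule two_kcats_swap)

text \<open>A lifting problem over the exchanged product is carried back by \<open>S.sw\<close>
  through the adjunction \<open>sw_hom\<close>. Epimorphisms are kept because the objects are merely
  permuted.\<close>

lemma sw_projective:
 fixes M :: "('k, 'o \<times> 'p, ('m \<times> 'n \<Rightarrow> 'k) set, 'v) cmod"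
 assumes M: "projective K TC M" shows "projective K S.TC (sw M)"
proof -
 have Mm: "c_module K TC M" by (rule T.projective_c_module[OF M])
 have o: "Y \<in> Obj TC ==> prod.swap Y \<in> Obj S.TC" "Z \<in> Obj S.TC ==> prod.swap Z \<in> Obj TC" for Y Z by (auto simp: TC_simps(1) S.TC_simps(1))
 show ?thesis
 proof (rule S.T.projectiveI[OF sw_c_module(1)[OF Mm]])
  fix A B :: "('k, 'p \<times> 'o, ('n \<times> 'm \<Rightarrow> 'k) set, ('p \<times> 'o, ('n \<times> 'm \<Rightarrow> 'k) set, 'v) elt) cmod" and e
  assume AB: "c_module K S.TC A" "c_module K S.TC B" "mod_hom K S.TC A B e" "epi S.TC A B e"
  note e' = S.sw_map[OF AB(1-3)]
  have ee: "epi TC (S.sw A) (S.sw B) (\<lambda>Z. e (prod.swap Z))"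
   by (rule epiI[OF e']) (use epiD[OF AB(4) o(1)] in auto)
  show "lifts K S.TC (sw M) A B e" unfolding lifts_def
  proof (intro allI impI)
   fix f assume f: "mod_hom K S.TC (sw M) B f"
   obtain g where g: "mod_hom K TC M (S.sw A) g"
    "\<And>Z x. Z \<in> Obj TC ==> x \<in> El M Z ==> e (prod.swap Z) (g Z x) = f (prod.swap Z) x"
    by (rule liftsD[OF T.projective_lifts[OF M S.sw_c_module(1)[OF AB(1)] S.sw_c_module(1)[OF AB(2)] e' ee] sw_hom(1)[OF Mm AB(2) f]]) (rule that)
   show "\<exists>g. mod_hom K S.TC (sw M) A g \<and> (\<forall>X\<in>Obj S.TC. \<forall>x\<in>El (sw M) X. e X (g X x) = f X x)"
    using sw_hom(2)[OF Mm AB(1) g(1)] g(2)[OF o(2)] by (intro exI[of _ "\<lambda>Z. g (prod.swap Z)"]) auto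
  qed
 qed
qed

lemma sw_resolution:
 assumes R: "resolution K TC M P d \<epsilon>"
 shows "resolution K S.TC (sw M) (\<lambda>n. sw (P n)) (\<lambda>n Z. d n (prod.swap Z)) (\<lambda>Z. \<epsilon> (prod.swap Z))"
proof -
 interpret R: resolution K TC M P d \<epsilon> by fact
 have o: "Z \<in> Obj S.TC ==> prod.swap Z \<in> Obj TC" for Z by (auto simp: TC_simps(1) S.TC_simps(1))
 show ?thesis
  by (rule S.T.resolutionI)
   (use R.eps_onto R.eps_d R.d_d R.exact0 R.exact o in "auto intro!: sw_c_module(1) sw_map R.M R.P R.d R.eps")
qed

end

section \<open>Reducing resolutions modulo an ideal\<close>

lemma (in abelian_group) minus_sum_add_cancel:
 assumes "x \<in> carrier G" "a \<in> carrier G" "b \<in> carrier G"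
 shows "(x \<ominus> (a \<oplus> b)) \<oplus> b = x \<ominus> a"
 using assms by (simp add: minus_eq minus_add a_assoc l_neg)

context kcat
begin

text \<open>Slices of \<open>hom_bimod\<close> have the Hom-spaces of representables, but their
  actions are only known to agree on morphisms and elements of the carriers. This lets one replace
  the other as the target of an augmentation.\<close>

lemma resolution_cong:
 assumes R: "resolution K C M P d \<epsilon>" and M': "c_module K C M'"
  and on: "\<And>X. X \<in> Obj C ==> On M' X = On M X"
  and act: "\<And>X Y f x. X \<in> Obj C ==> Y \<in> Obj C ==> f \<in> Mor C X Y ==> x \<in> El M X ==>
   Act M' X Y f x = Act M X Y f x"
 shows "resolution K C M' P d \<epsilon>"
proof -
 interpret R: resolution K C M P d \<epsilon> by fact
 show ?thesis
  by (rule resolutionI)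
   (use R.eps_onto R.eps_d R.d_d R.exact0 R.exact M' R.P R.d on in "auto intro!: mod_hom_cong[OF R.eps _ _ on act]")
qed

text \<open>Exactness of the quotient complex in terms of representatives: an element whose
  differential falls into \<open>S\<close> has to be a boundary modulo \<open>S\<close>. The target
  \<open>N\<close> with its augmentation \<open>e\<close> is new, since reducing \<open>P\<close>
  also reduces what it resolves.\<close>

lemma quotient_resolution:
 assumes R: "resolution K C M P d \<epsilon>" and S: "\<And>n. subfunctor (P n) (S n)"
  and N: "c_module K C N" and e: "mod_hom K C (P 0) N e"
  and eo: "\<And>X y. X \<in> Obj C ==> y \<in> El N X ==> \<exists>x\<in>El (P 0) X. e X x = y"
  and ed: "\<And>X x. X \<in> Obj C ==> x \<in> El (P (Suc 0)) X ==> e X (d 0 X x) = 0[On N X]"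
  and dS: "\<And>n X x. X \<in> Obj C ==> x \<in> S (Suc n) X ==> d n X x \<in> S n X"
  and eS: "\<And>X x. X \<in> Obj C ==> x \<in> S 0 X ==> e X x = 0[On N X]"
  and r0: "\<And>X p. X \<in> Obj C ==> p \<in> El (P 0) X ==> e X p = 0[On N X] ==>
   \<exists>r\<in>El (P (Suc 0)) X. p -[On (P 0) X] d 0 X r \<in> S 0 X"
  and rS: "\<And>n X p. X \<in> Obj C ==> p \<in> El (P (Suc n)) X ==> d n X p \<in> S n X ==>
   \<exists>r\<in>El (P (Suc (Suc n))) X. p -[On (P (Suc n)) X] d (Suc n) X r \<in> S (Suc n) X"
 obtains D e' where "resolution K C N (\<lambda>n. quotm (P n) (S n)) D e'"
  "\<And>n X x. X \<in> Obj C ==> x \<in> El (P (Suc n)) X ==>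
    D n X (S (Suc n) X +>[On (P (Suc n)) X] x) = S n X +>[On (P n) X] d n X x"
  "\<And>X x. X \<in> Obj C ==> x \<in> El (P 0) X ==> e' X (S 0 X +>[On (P 0) X] x) = e X x"
proof -
 interpret R: resolution K C M P d \<epsilon> by fact
 let ?P = "\<lambda>n X x. S n X +>[On (P n) X] x"
 have sm: "X \<in> Obj C ==> submodule (S n X) K (On (P n) X)" for n X using S by (auto simp: subfunctor_def)
 have cP: "x \<in> El (quotm (P n) (S n)) X \<longleftrightarrow> (\<exists>y\<in>El (P n) X. x = ?P n X y)" if "X \<in> Obj C" for x n X
  using kmod.quot_carrier[OF on_kmod[OF R.P that]] by auto
 have zP: "?P n X x = 0[On (quotm (P n) (S n)) X] \<longleftrightarrow> x \<in> S n X" if "X \<in> Obj C" "x \<in> El (P n) X" for n X x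
  using kmod.coset_eq_self_iff[OF on_kmod[OF R.P that(1)] sm[OF that(1)] that(2)] kmod.quot_zero[OF on_kmod[OF R.P that(1)]] by simp
 have eq: "?P n X x = ?P n X y \<longleftrightarrow> x -[On (P n) X] y \<in> S n X" if "X \<in> Obj C" "x \<in> El (P n) X" "y \<in> El (P n) X" for n X x y
  by (rule kmod.coset_eq_iff[OF on_kmod[OF R.P that(1)] sm[OF that(1)] that(2,3)])
 have dc: "X \<in> Obj C ==> x \<in> El (P (Suc n)) X ==> d n X x \<in> El (P n) X" for X x n by (rule hom_closed[OF R.d])
 have "\<exists>D. mod_hom K C (quotm (P (Suc n)) (S (Suc n))) (quotm (P n) (S n)) D \<and>
   (\<forall>X\<in>Obj C. \<forall>x\<in>El (P (Suc n)) X. D X (?P (Suc n) X x) = ?P n X (d n X x))" for n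
  by (rule quotm_factor[OF R.P S quotm_c_module[OF R.P S] hom_comp[OF R.d quotm_proj[OF R.P S]]])
   (use zP dS subfunctor_carrier[OF R.P S] in "simp del: quotm_On")
 then obtain D where D: "\<And>n. mod_hom K C (quotm (P (Suc n)) (S (Suc n))) (quotm (P n) (S n)) (D n)"
  "\<And>n X x. X \<in> Obj C ==> x \<in> El (P (Suc n)) X ==> D n X (?P (Suc n) X x) = ?P n X (d n X x)" by metis
 obtain e' where e': "mod_hom K C (quotm (P 0) (S 0)) N e'" "\<And>X x. X \<in> Obj C ==> x \<in> El (P 0) X ==> e' X (?P 0 X x) = e X x"
  using quotm_factor[OF R.P S N e eS] by blast
 have "resolution K C N (\<lambda>n. quotm (P n) (S n)) D e'"
 proof (rule resolutionI[OF N quotm_c_module[OF R.P S] D(1) e'(1)])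
  fix X assume X: "X \<in> Obj C"
  { fix y assume "y \<in> El N X"
   then show "\<exists>x\<in>El (quotm (P 0) (S 0)) X. e' X x = y" using eo[OF X] cP[OF X] e'(2)[OF X] by metis }
  { fix x assume "x \<in> El (quotm (P (Suc 0)) (S (Suc 0))) X"
   then obtain z where z: "z \<in> El (P (Suc 0)) X" "x = ?P (Suc 0) X z" using cP[OF X] by blast
   show "e' X (D 0 X x) = 0[On N X]" unfolding z(2) D(2)[OF X z(1)] e'(2)[OF X dc[OF X z(1)]] by (rule ed[OF X z(1)]) }
  { fix x n assume "x \<in> carrier (On (quotm (P (Suc (Suc n))) (S (Suc (Suc n)))) X)"
   then obtain z where z: "z \<in> El (P (Suc (Suc n))) X" "x = ?P (Suc (Suc n)) X z" using cP[OF X] by blast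
   show "D n X (D (Suc n) X x) = 0[On (quotm (P n) (S n)) X]"
    unfolding z(2) D(2)[OF X z(1)] D(2)[OF X dc[OF X z(1)]] R.d_d[OF X z(1)]
    using zP[OF X mod_closed(1)[OF c_module.on_module[OF R.P X]]] module.submodule_props(2)[OF c_module.on_module[OF R.P X] sm[OF X]] by blast }
  { fix x assume "x \<in> El (quotm (P 0) (S 0)) X" and e: "e' X x = 0[On N X]"
   then obtain z where z: "z \<in> El (P 0) X" "x = ?P 0 X z" using cP[OF X] by blast
   obtain r where r: "r \<in> El (P (Suc 0)) X" "z -[On (P 0) X] d 0 X r \<in> S 0 X"
    using r0[OF X z(1)] e unfolding z(2) e'(2)[OF X z(1)] by blast
   then show "\<exists>y\<in>El (quotm (P (Suc 0)) (S (Suc 0))) X. D 0 X y = x"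
    using cP[OF X] D(2)[OF X r(1)] eq[OF X z(1) dc[OF X r(1)]] z(2) by metis }
  { fix x n assume "x \<in> El (quotm (P (Suc n)) (S (Suc n))) X" and e: "D n X x = 0[On (quotm (P n) (S n)) X]"
   then obtain z where z: "z \<in> El (P (Suc n)) X" "x = ?P (Suc n) X z" using cP[OF X] by blast
   obtain r where r: "r \<in> El (P (Suc (Suc n))) X" "z -[On (P (Suc n)) X] d (Suc n) X r \<in> S (Suc n) X"
    using rS[OF X z(1)] e unfolding z(2) D(2)[OF X z(1)] zP[OF X dc[OF X z(1)]] by blast
   then show "\<exists>y\<in>carrier (On (quotm (P (Suc (Suc n))) (S (Suc (Suc n)))) X). D (Suc n) X y = x"
    using cP[OF X] D(2)[OF X r(1)] eq[OF X z(1) dc[OF X r(1)]] z(2) by metis }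
 qed
 then show ?thesis using D(2) e'(2) by (rule that)
qed

end

section \<open>The submodule \<open>I M\<close> and exactness modulo it\<close>

context ideal_kcat
begin

lemma op_ideal_kcat: "ideal_kcat K (op_cat C) (\<lambda>X Y. I Y X)"
 by (rule ideal_kcat.intro[OF op_kcat], rule two_sided_ideal.intro)
  (auto simp: ideal_submodule ideal_comp_left ideal_comp_right)

text \<open>This is \<open>I M\<close>, with all intermediate objects \<open>Z\<close> allowed. A
  span is taken because elements \<open>g w\<close> need not be closed under addition.\<close>

definition ideal_span :: "('k, 'o, 'm, 'v) cmod \<Rightarrow> 'o \<Rightarrow> 'v set" where
 "ideal_span M Y = lin_span K (On M Y) {Act M Z Y g w |Z g w. Z \<in> Obj C \<and> g \<in> I Z Y \<and> w \<in> El M Z}"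

lemma ideal_span_gen: "Z \<in> Obj C ==> g \<in> I Z Y ==> w \<in> El M Z ==> Act M Z Y g w \<in> ideal_span M Y"
 unfolding ideal_span_def by (rule lin_span_inc) blast

lemma ideal_span_gens_carrier:
 "c_module K C M ==> Y \<in> Obj C ==> {Act M Z Y g w |Z g w. Z \<in> Obj C \<and> g \<in> I Z Y \<and> w \<in> El M Z} \<subseteq> El M Y"
 by (auto intro: act_closed I_carrier)

lemma ideal_span_submodule: "c_module K C M ==> Y \<in> Obj C ==> submodule (ideal_span M Y) K (On M Y)"
 unfolding ideal_span_def by (rule lin_span_submodule(1)[OF c_module.on_module ideal_span_gens_carrier])

lemma ideal_span_mapsto:
 assumes M: "c_module K C M" and Y: "Y \<in> Obj C" and W: "module K W" and T: "T \<in> lin_maps K (On M Y) W"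
  and H: "submodule H K W" and x: "x \<in> ideal_span M Y"
  and g: "\<And>Z g w. Z \<in> Obj C ==> g \<in> I Z Y ==> w \<in> El M Z ==> T (Act M Z Y g w) \<in> H"
 shows "T x \<in> H"
 by (rule lin_span_mapsto[OF c_module.on_module[OF M Y] W T ideal_span_gens_carrier[OF M Y] H _ x[unfolded ideal_span_def]])
  (use g in auto)

lemma ideal_span_hom:
 assumes M: "c_module K C M" and N: "c_module K C N" and h: "mod_hom K C M N \<eta>" and Y: "Y \<in> Obj C" and x: "x \<in> ideal_span M Y"
 shows "\<eta> Y x \<in> ideal_span N Y"
 by (rule ideal_span_mapsto[OF M Y c_module.on_module[OF N Y] hom_lin[OF h Y] ideal_span_submodule[OF N Y] x])
  (use hom_nat[OF h _ Y I_carrier[OF _ Y]] hom_closed[OF h] in "simp add: ideal_span_gen")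

text \<open>\<open>f\<close> is a null-homotopic chain map that is the identity modulo
  \<open>I P\<close>, in degree 0 at least where the augmentation lies in \<open>T\<close>. From
  \<open>x - d h x = (x - f x) + h d x\<close> the homotopy \<open>h\<close> contracts the complex
  modulo \<open>I P\<close>, since \<open>h\<close> maps \<open>I P\<close> into itself by
  naturality.\<close>

lemma reduction:
 assumes R: "resolution K C M P d \<epsilon>" and pr: "\<And>n. projective K C (P n)"
  and f: "\<And>n. mod_hom K C (P n) (P n) (f n)"
  and f0: "\<And>X x. X \<in> Obj C ==> x \<in> El (P 0) X ==> \<epsilon> X (f 0 X x) = 0[On M X]"
  and fS: "\<And>n X x. X \<in> Obj C ==> x \<in> El (P (Suc n)) X ==> d n X (f (Suc n) X x) = f n X (d n X x)"
  and a: "\<And>n X x. X \<in> Obj C ==> x \<in> El (P (Suc n)) X ==> x -[On (P (Suc n)) X] f (Suc n) X x \<in> ideal_span (P (Suc n)) X"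
  and b: "\<And>X x. X \<in> Obj C ==> x \<in> El (P 0) X ==> \<epsilon> X x \<in> T X ==> x -[On (P 0) X] f 0 X x \<in> ideal_span (P 0) X"
 shows "\<And>X x. X \<in> Obj C ==> x \<in> El (P 0) X ==> \<epsilon> X x \<in> T X ==>
   \<exists>r\<in>El (P (Suc 0)) X. x -[On (P 0) X] d 0 X r \<in> ideal_span (P 0) X"
  and "\<And>n X x. X \<in> Obj C ==> x \<in> El (P (Suc n)) X ==> d n X x \<in> ideal_span (P n) X ==>
   \<exists>r\<in>El (P (Suc (Suc n))) X. x -[On (P (Suc n)) X] d (Suc n) X r \<in> ideal_span (P (Suc n)) X"
proof -
 interpret R: resolution K C M P d \<epsilon> by fact
 obtain h where h: "\<And>n. mod_hom K C (P n) (P (Suc n)) (h n)"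
  "\<And>X x. X \<in> Obj C ==> x \<in> El (P 0) X ==> f 0 X x = d 0 X (h 0 X x)"
  "\<And>n X x. X \<in> Obj C ==> x \<in> El (P (Suc n)) X ==> f (Suc n) X x = d (Suc n) X (h (Suc n) X x) +[On (P (Suc n)) X] h n X (d n X x)"
  by (rule null_homotopy[where f = f, OF R pr f f0 fS]) (assumption | rule that)+
 fix X assume X: "X \<in> Obj C"
 show "\<exists>r\<in>El (P (Suc 0)) X. x -[On (P 0) X] d 0 X r \<in> ideal_span (P 0) X"
  if x: "x \<in> El (P 0) X" "\<epsilon> X x \<in> T X" for x
  using hom_closed[OF h(1) X x(1)] b[OF X x] h(2)[OF X x(1)] by (intro bexI[of _ "h 0 X x"]) simp_all
 show "\<exists>r\<in>El (P (Suc (Suc n))) X. x -[On (P (Suc n)) X] d (Suc n) X r \<in> ideal_span (P (Suc n)) X"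
  if x: "x \<in> El (P (Suc n)) X" "d n X x \<in> ideal_span (P n) X" for n x
 proof (rule bexI)
  interpret PX: kmod K "On (P (Suc n)) X" by (rule on_kmod[OF R.P X])
  note ip = PX.submodule_props[OF ideal_span_submodule[OF R.P X]]
  show hc: "h (Suc n) X x \<in> El (P (Suc (Suc n))) X" by (rule hom_closed[OF h(1) X x(1)])
  have dc: "d n X x \<in> El (P n) X" by (rule hom_closed[OF R.d X x(1)])
  have "x -[On (P (Suc n)) X] d (Suc n) X (h (Suc n) X x) = (x -[On (P (Suc n)) X] f (Suc n) X x) +[On (P (Suc n)) X] h n X (d n X x)"
   unfolding h(3)[OF X x(1)]
   by (rule PX.minus_sum_add_cancel[symmetric, OF x(1) hom_closed[OF R.d X hc] hom_closed[OF h(1) X dc]])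
  also have "\<dots> \<in> ideal_span (P (Suc n)) X"
   by (rule ip(3)[OF a[OF X x(1)] ideal_span_hom[OF R.P R.P h(1) X x(2)]])
  finally show "x -[On (P (Suc n)) X] d (Suc n) X (h (Suc n) X x) \<in> ideal_span (P (Suc n)) X" .
 qed
qed

text \<open>By Yoneda the augmentation of a resolution of a representable has a section
  \<open>s\<close>, determined by a preimage \<open>u\<close> of the identity. The chain map for
  \<open>reduction\<close> is the identity in positive degrees and \<open>id - s \<epsilon>\<close>
  in degree 0. Its defect \<open>s (\<epsilon> x)\<close> is \<open>\<epsilon> x\<close> acting on
  \<open>u\<close>, hence in \<open>I P\<close> when \<open>\<epsilon> x\<close> is in
  \<open>I\<close>.\<close>

lemma representable_reduction:
 assumes Y: "Y \<in> Obj C" and R: "resolution K C (representable C Y) P d \<epsilon>" and pr: "\<And>n. projective K C (P n)"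
 shows "\<And>X x. X \<in> Obj C ==> x \<in> El (P 0) X ==> \<epsilon> X x \<in> I Y X ==>
   \<exists>r\<in>El (P (Suc 0)) X. x -[On (P 0) X] d 0 X r \<in> ideal_span (P 0) X"
  and "\<And>n X x. X \<in> Obj C ==> x \<in> El (P (Suc n)) X ==> d n X x \<in> ideal_span (P n) X ==>
   \<exists>r\<in>El (P (Suc (Suc n))) X. x -[On (P (Suc n)) X] d (Suc n) X r \<in> ideal_span (P (Suc n)) X"
proof -
 interpret R: resolution K C "representable C Y" P d \<epsilon> by fact
 obtain u where u: "u \<in> El (P 0) Y" "\<epsilon> Y u = Id C Y"
  using R.eps_onto[OF Y, of "Id C Y"] id_closed[OF Y] by auto
 let ?s = "\<lambda>X h. Act (P 0) Y X h u"
 have s: "mod_hom K C (representable C Y) (P 0) ?s" by (rule yoneda_hom[OF R.P Y u(1)])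
 have es: "\<epsilon> X (?s X h) = h" if "X \<in> Obj C" "h \<in> Mor C Y X" for X h
  using hom_nat[OF R.eps Y that u(1)] that u(2) Y by (simp add: comp_id_right)
 let ?f = "\<lambda>n X x. case n of 0 \<Rightarrow> x -[On (P 0) X] ?s X (\<epsilon> X x) | Suc _ \<Rightarrow> x"
 have ec: "X \<in> Obj C ==> x \<in> El (P 0) X ==> \<epsilon> X x \<in> Mor C Y X" for X x using hom_closed[OF R.eps] by simp
 have sc: "X \<in> Obj C ==> x \<in> Mor C Y X ==> ?s X x \<in> El (P 0) X" for X x using hom_closed[OF s] by simp
 have f: "mod_hom K C (P n) (P n) (?f n)" for n
  using hom_diff[OF R.P R.P hom_id hom_comp[OF R.eps s]] hom_id by (cases n) simp_all
 have f0: "\<epsilon> X (?f 0 X x) = 0[On (representable C Y) X]" if "X \<in> Obj C" "x \<in> El (P 0) X" for X x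
 proof -
  interpret H: kmod K "Hom C Y X" by (rule hom_kmod[OF Y that(1)])
  show ?thesis using hom_minus[OF R.eps R.P R.M that(1,2) sc[OF that(1) ec[OF that]]] es[OF that(1) ec[OF that]] ec[OF that]
   by (simp add: H.minus_eq_zero_iff)
 qed
 have fS: "d n X (?f (Suc n) X x) = ?f n X (d n X x)" if X: "X \<in> Obj C" and x: "x \<in> El (P (Suc n)) X" for n X x
 proof (cases n)
  case 0
  interpret PX: kmod K "On (P 0) X" by (rule on_kmod[OF R.P X])
  show ?thesis using R.eps_d[OF X, of x] x hom_zero[OF s R.M R.P X] hom_closed[OF R.d X, of x 0] by (simp add: 0)
 qed simp
 have a: "x -[On (P (Suc n)) X] ?f (Suc n) X x \<in> ideal_span (P (Suc n)) X" if X: "X \<in> Obj C" and x: "x \<in> El (P (Suc n)) X" for n X x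
 proof -
  interpret PX: kmod K "On (P (Suc n)) X" by (rule on_kmod[OF R.P X])
  show ?thesis using PX.submodule_props(2)[OF ideal_span_submodule[OF R.P X]] PX.minus_eq_zero_iff[OF x x] by simp
 qed
 have b: "x -[On (P 0) X] ?f 0 X x \<in> ideal_span (P 0) X" if X: "X \<in> Obj C" and x: "x \<in> El (P 0) X" "\<epsilon> X x \<in> I Y X" for X x
 proof -
  interpret PX: kmod K "On (P 0) X" by (rule on_kmod[OF R.P X])
  show ?thesis using PX.minus_minus_cancel[OF x(1) sc[OF X ec[OF X x(1)]]] ideal_span_gen[where M = "P 0", OF Y x(2) u(1)] by simp
 qed
 note rd = reduction[where f = ?f and T = "I Y" and P = P and d = d and \<epsilon> = \<epsilon> and M = "representable C Y"]
 show "\<And>X x. X \<in> Obj C ==> x \<in> El (P 0) X ==> \<epsilon> X x \<in> I Y X ==>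
   \<exists>r\<in>El (P (Suc 0)) X. x -[On (P 0) X] d 0 X r \<in> ideal_span (P 0) X" by (rule rd(1)) (rule R pr f f0 fS a b | assumption)+
 show "\<And>n X x. X \<in> Obj C ==> x \<in> El (P (Suc n)) X ==> d n X x \<in> ideal_span (P n) X ==>
   \<exists>r\<in>El (P (Suc (Suc n))) X. x -[On (P (Suc n)) X] d (Suc n) X r \<in> ideal_span (P (Suc n)) X" by (rule rd(2)) (rule R pr f f0 fS a b | assumption)+
qed

lemma ideal_subfunctor: "X \<in> Obj C ==> subfunctor (representable C X) (I X)"
 by (auto simp: subfunctor_def ideal_submodule ideal_comp_left)

lemma ideal_span_subfunctor:
 assumes M: "c_module K C M" shows "subfunctor M (ideal_span M)"
 unfolding subfunctor_def
proof (intro conjI ballI)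
 fix X assume X: "X \<in> Obj C"
 show "submodule (ideal_span M X) K (On M X)" by (rule ideal_span_submodule[OF M X])
 fix Y f x assume Y: "Y \<in> Obj C" and f: "f \<in> Mor C X Y" and x: "x \<in> ideal_span M X"
 show "Act M X Y f x \<in> ideal_span M Y"
 proof (rule ideal_span_mapsto[OF M X c_module.on_module[OF M Y] c_module.act_linear[OF M X Y f] ideal_span_submodule[OF M Y] x])
  fix Z g w assume Z: "Z \<in> Obj C" and g: "g \<in> I Z X" and w: "w \<in> El M Z"
  show "Act M X Y f (Act M Z X g w) \<in> ideal_span M Y"
   using ideal_span_gen[where M = M, OF Z ideal_comp_left[OF Z X Y g f] w] act_comp[OF M Z X Y I_carrier[OF Z X g] f w] by simp
 qed
qed

lemma ideal_span_hom_submod: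
 assumes M: "c_module K C M" and N: "c_module K C N" and h: "mod_hom K C M N h"
 shows "mod_hom K C (submod M (ideal_span M)) (submod N (ideal_span N)) h"
 by (rule hom_into_submod[OF hom_from_submod[OF M ideal_span_subfunctor[OF M] h]]) (simp add: ideal_span_hom[OF M N h])

definition annihilated :: "('k, 'o, 'm, 'v) cmod \<Rightarrow> bool" where
 "annihilated M \<longleftrightarrow> (\<forall>X\<in>Obj C. \<forall>Y\<in>Obj C. \<forall>f\<in>I X Y. \<forall>x\<in>El M X. Act M X Y f x = 0[On M Y])"

lemma annihilated_hom:
 assumes M: "c_module K C M" and N: "c_module K C N" and a: "annihilated N" and h: "mod_hom K C M N h"
  and X: "X \<in> Obj C" and x: "x \<in> ideal_span M X"
 shows "h X x = 0[On N X]"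
 using ideal_span_mapsto[OF M X c_module.on_module[OF N X] hom_lin[OF h X] zero_submodule[OF c_module.on_module[OF N X]] x]
  hom_nat[OF h _ X I_carrier[OF _ X]] a hom_closed[OF h] X by (simp add: annihilated_def)

text \<open>This is \<open>I M = I (I M)\<close>: writing \<open>f\<close> in \<open>I\<close> as a
  sum of products \<open>b a\<close> turns \<open>f w\<close> into a sum of terms
  \<open>b (a w)\<close> with \<open>a w\<close> in \<open>I M\<close>. The map \<open>T\<close> is
  linear on \<open>I M\<close> only, because in \<open>reduction_step\<close> it involves a section
  that is defined on a submodule.\<close>

lemma ideal_span_idem:
 assumes idem: "idempotent_ideal C I" and M: "c_module K C M" and Y: "Y \<in> Obj C" and W: "module K W"
  and T: "T \<in> lin_maps K ((On M Y)\<lparr>carrier := ideal_span M Y\<rparr>) W" and H: "submodule H K W" and x: "x \<in> ideal_span M Y"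
  and g: "\<And>Z b u. Z \<in> Obj C ==> b \<in> I Z Y ==> u \<in> ideal_span M Z ==> T (Act M Z Y b u) \<in> H"
 shows "T x \<in> H"
proof -
 interpret MY: kmod K "On M Y" by (rule on_kmod[OF M Y])
 interpret W: kmod K W unfolding kmod_def by (rule W)
 note ip = ideal_span_submodule[OF M Y]
 note sp = MY.submodule_props[OF ip] and hp = W.submodule_props[OF H]
 have T0: "T 0[On M Y] = 0[W]"
  using lin_zero[OF T submodule.submodule_is_module[OF ip MY.module_axioms] W] by simp
 let ?G = "{x \<in> ideal_span M Y. T x \<in> H}"
 have G: "submodule ?G K (On M Y)"
  by (rule MY.submoduleI') (use sp hp T0 lin_add[OF T] lin_smult[OF T] in auto)
 have "x \<in> ?G"
 proof (rule ideal_span_mapsto[where T = "\<lambda>x. x", OF M Y MY.module_axioms _ G x])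
  show "(\<lambda>x. x) \<in> lin_maps K (On M Y) (On M Y)" by (rule lin_mapsI) simp_all
  fix Z f w assume Z: "Z \<in> Obj C" and f: "f \<in> I Z Y" and w: "w \<in> El M Z"
  interpret H: kmod K "Hom C Z Y" by (rule hom_kmod[OF Z Y])
  let ?F = "{f \<in> Mor C Z Y. Act M Z Y f w \<in> ?G}"
  have F: "submodule ?F K (Hom C Z Y)"
   by (rule preimage_submodule[OF H.module_axioms MY.module_axioms c_module.act_linear_hom[OF M Z Y w] G])
  have "f \<in> ideal_square C I Z Y" using idem Z Y f by (simp add: idempotent_ideal_def)
  then obtain n V b a where f': "f = (\<Oplus>\<^bsub>Hom C Z Y\<^esub> i \<in> {..<n}. Comp C Z (V i) Y (b i) (a i))"
   "\<forall>i<(n::nat). V i \<in> Obj C \<and> a i \<in> I Z (V i) \<and> b i \<in> I (V i) Y" by (auto simp: ideal_square_def)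
  have "Comp C Z (V i) Y (b i) (a i) \<in> ?F" if i: "i < n" for i
  proof -
   have c: "V i \<in> Obj C" "a i \<in> I Z (V i)" "b i \<in> I (V i) Y" using f'(2) i by auto
   note bc = I_carrier[OF c(1) Y c(3)] and ac = I_carrier[OF Z c(1,2)]
   show ?thesis
    using c ac bc Z Y w act_closed[OF M Z c(1) ac w] ideal_span_gen[where M = M, OF Z c(2) w] ideal_span_gen[where M = M, OF c(1,3)]
     g[OF c(1,3)] by (simp add: act_comp[OF M Z c(1) Y ac bc w] comp_closed)
  qed
  then show "Act M Z Y f w \<in> ?G" unfolding f'(1) using H.submodule_finsum[OF F, of "\<lambda>i. Comp C Z (V i) Y (b i) (a i)" "{..<n}"] by auto
 qed
 then show ?thesis by simp
qed

text \<open>For a free module, a sum of representables \<open>C(D,-)\<close>, the submodule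
  \<open>I M\<close> is the sum of the \<open>I(D,-)\<close> and so projective by hypothesis.
  Forming \<open>I M\<close> is functorial, so the retraction of the free cover onto
  \<open>Q\<close> restricts to one of projective modules onto \<open>I Q\<close>.\<close>

lemma ideal_span_projective:
 assumes pI: "\<And>X. X \<in> Obj C ==> projective K C (ideal_at C I X)" and Q: "projective K C Q"
 shows "projective K C (submod Q (ideal_span Q))"
proof -
 note Qm = projective_c_module[OF Q]
 let ?G = "fcov Q" and ?NC = "\<lambda>g. representable C (fst g)" and ?NI = "\<lambda>g. ideal_at C I (fst g)"
 let ?D = "dsum (gens Q) ?NI"
 have G: "?G = dsum (gens Q) ?NC" by (simp add: fcov_def)
 note Gm = fcov_c_module[of Q]
 have Sg: "fst g \<in> Obj C" if "g \<in> gens Q" for g using that by (auto simp: gens_def)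
 note NI = projective_c_module[OF pI[OF Sg]]
 have k: "x \<in> ideal_span ?G X \<longleftrightarrow> x \<in> carrier (On ?D X)" if X: "X \<in> Obj C" for X x
 proof
  assume x: "x \<in> ideal_span ?G X"
  have xG: "x \<in> carrier (On ?G X)" by (rule subfunctor_carrier[OF Gm ideal_span_subfunctor[OF Gm] X x])
  have "x g \<in> I (fst g) X" if g: "g \<in> gens Q" for g
  proof (rule ideal_span_mapsto[where T = "\<lambda>p. p g", OF Gm X hom_module[OF Sg[OF g] X] _ ideal_submodule[OF Sg[OF g] X] x])
   show "(\<lambda>p. p g) \<in> lin_maps K (On ?G X) (Hom C (fst g) X)" using dsum_eval_lin[OF gens_rep g X] by (simp add: G)
   fix Z f w assume "Z \<in> Obj C" "f \<in> I Z X" "w \<in> carrier (On ?G Z)"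
   then show "Act ?G Z X f w g \<in> I (fst g) X" using g X Sg[OF g] dsumD[of w "gens Q" ?NC Z g] by (simp add: G dsum_simps ideal_comp_right)
  qed
  then show "x \<in> carrier (On ?D X)" using xG by (auto simp: G dsum_simps ideal_at_def supp_def)
 next
  assume x: "x \<in> carrier (On ?D X)"
  interpret GX: kmod K "On ?G X" by (rule on_kmod[OF Gm X])
  have xG: "x \<in> El (dsum (gens Q) ?NC) X"
   using x I_carrier[OF Sg X] by (auto simp: dsum_simps ideal_at_def supp_def)
  \<comment> \<open>A coordinate lying in \<open>I\<close> is itself acting on the generator given
    by the identity, hence an element of \<open>I G\<close>.\<close>
  have "dsum_inj (gens Q) ?NC g X (x g) \<in> ideal_span ?G X" if g: "g \<in> gens Q" for g
  proof -
   have f: "x g \<in> I (fst g) X" using dsumD[OF x g] by (simp add: ideal_at_def)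
   note o = Sg[OF g]
   have i: "mod_hom K C (?NC g) ?G (dsum_inj (gens Q) ?NC g)" unfolding G by (rule dsum_inj_hom[OF gens_rep g])
   have "dsum_inj (gens Q) ?NC g X (Act (?NC g) (fst g) X (x g) (Id C (fst g))) = Act ?G (fst g) X (x g) (dsum_inj (gens Q) ?NC g (fst g) (Id C (fst g)))"
    using hom_nat[OF i o X I_carrier[OF o X f], of "Id C (fst g)"] id_closed[OF o] by (simp add: G)
   then show ?thesis
    using ideal_span_gen[where M = ?G, OF o f] hom_closed[OF i o, of "Id C (fst g)"] comp_id_right[OF o X I_carrier[OF o X f]] id_closed[OF o]
    by (simp add: G)
  qed
  then have "(\<Oplus>\<^bsub>On ?G X\<^esub> g\<in>supp (gens Q) ?NC X x. dsum_inj (gens Q) ?NC g X (x g)) \<in> ideal_span ?G X"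
   by (intro GX.submodule_finsum[OF ideal_span_submodule[OF Gm X]]) (auto simp: supp_def)
  then show "x \<in> ideal_span ?G X" using dsum_decomp[OF gens_rep X xG] by (simp add: G)
 qed
 have to: "mod_hom K C (submod ?G (ideal_span ?G)) ?D (\<lambda>X x. x)" and fr: "mod_hom K C ?D (submod ?G (ideal_span ?G)) (\<lambda>X x. x)"
  by (auto simp: mod_hom_def lin_maps_def k) (auto simp: G dsum_simps ideal_at_def)
 have prI: "projective K C ?D"
  by (rule projectiveI[OF dsum_c_module[OF NI]]) (auto intro!: lifts_dsum[OF NI] projective_lifts[OF pI] Sg)
 obtain s where s: "mod_hom K C Q ?G s" "\<And>X x. X \<in> Obj C ==> x \<in> El Q X ==> fcov_map Q X (s X x) = x"
  using projective_section[OF Q] by blast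
 show ?thesis
  by (rule projective_iso[OF prI submod_c_module[OF Qm ideal_span_subfunctor[OF Qm]]
    hom_comp[OF ideal_span_hom_submod[OF Qm Gm s(1)] to] hom_comp[OF fr ideal_span_hom_submod[OF Gm Qm fcov_map_hom[OF Qm]]]])
   (simp add: s(2) subfunctor_carrier[OF Qm ideal_span_subfunctor[OF Qm]])
qed

text \<open>\<open>\<pi> = id - s e\<close> maps \<open>I Q = I (I Q)\<close> into \<open>I (ker e) = d (I A)\<close> and is the identity on \<open>I Q \<inter> ker e\<close>.\<close>

lemma reduction_step:
 assumes idem: "idempotent_ideal C I" and A: "c_module K C A" and Q: "c_module K C Q" and N: "c_module K C N"
  and d: "mod_hom K C A Q d" and e: "mod_hom K C Q N e"
  and ed: "\<And>X x. X \<in> Obj C ==> x \<in> El A X ==> e X (d X x) = 0[On N X]"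
  and ex: "\<And>X x. X \<in> Obj C ==> x \<in> El Q X ==> e X x = 0[On N X] ==> \<exists>y\<in>El A X. d X y = x"
  and V: "subfunctor N V" and eV: "\<And>X x. X \<in> Obj C ==> x \<in> ideal_span Q X ==> e X x \<in> V X"
  and s: "mod_hom K C (submod N V) Q s" and es: "\<And>X v. X \<in> Obj C ==> v \<in> V X ==> e X (s X v) = v"
  and pr: "projective K C (submod Q (ideal_span Q))"
 shows "subfunctor Q (\<lambda>X. d X ` ideal_span A X)"
  and "\<And>X x. X \<in> Obj C ==> x \<in> ideal_span Q X ==> e X x = 0[On N X] ==> x \<in> d X ` ideal_span A X"
  and "projective K C (submod Q (\<lambda>X. d X ` ideal_span A X))"
proof -
 let ?W = "\<lambda>X. d X ` ideal_span A X" and ?I = "submod Q (ideal_span Q)"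
 note sA = ideal_span_subfunctor[OF A] and sQ = ideal_span_subfunctor[OF Q]
 note Im = submod_c_module[OF Q sQ] and Vm = submod_c_module[OF N V]
 have cA: "X \<in> Obj C ==> y \<in> ideal_span A X ==> y \<in> El A X" for X y by (rule subfunctor_carrier[OF A sA])
 have cQ: "X \<in> Obj C ==> y \<in> ideal_span Q X ==> y \<in> El Q X" for X y by (rule subfunctor_carrier[OF Q sQ])
 have sm: "submodule (?W X) K (On Q X)" if X: "X \<in> Obj C" for X
  using image_submodule[OF c_module.on_module[OF submod_c_module[OF A sA] X] c_module.on_module[OF Q X] hom_lin[OF hom_from_submod[OF A sA d] X]] by simp
 show W: "subfunctor Q ?W"
  using sm sA hom_nat[OF d, symmetric] cA unfolding subfunctor_def by (auto intro!: imageI)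
 have e': "mod_hom K C ?I (submod N V) e" by (rule hom_into_submod[OF hom_from_submod[OF Q sQ e]]) (simp add: eV)
 define \<pi> where "\<pi> X x = x -[On Q X] s X (e X x)" for X x
 have ph: "mod_hom K C ?I Q \<pi>" unfolding \<pi>_def by (rule hom_diff[OF Im Q submod_incl[OF Q sQ] hom_comp[OF e' s]])
 have sc: "s X (e X x) \<in> El Q X" if "X \<in> Obj C" "x \<in> ideal_span Q X" for X x
  using hom_closed[OF hom_comp[OF e' s] that(1), of x] that(2) by simp
 have ep: "e X (\<pi> X x) = 0[On N X]" if X: "X \<in> Obj C" and x: "x \<in> ideal_span Q X" for X x
 proof -
  interpret NX: kmod K "On N X" by (rule on_kmod[OF N X])
  show ?thesis using hom_closed[OF e X cQ[OF X x]] by (simp add: \<pi>_def hom_minus[OF e Q N X cQ[OF X x] sc[OF X x]] es[OF X eV[OF X x]] NX.minus_eq_zero_iff)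
 qed
 have pW: "\<pi> X x \<in> ?W X" if X: "X \<in> Obj C" and x: "x \<in> ideal_span Q X" for X x
 proof (rule ideal_span_idem[OF idem Q X c_module.on_module[OF Q X] _ sm[OF X] x])
  show "\<pi> X \<in> lin_maps K ((On Q X)\<lparr>carrier := ideal_span Q X\<rparr>) (On Q X)" using hom_lin[OF ph X] by simp
  fix Z b u assume Z: "Z \<in> Obj C" and b: "b \<in> I Z X" and u: "u \<in> ideal_span Q Z"
  note bc = I_carrier[OF Z X b]
  have "\<pi> Z u \<in> El Q Z" using hom_closed[OF ph Z, of u] u by simp
  then obtain y where y: "y \<in> El A Z" "d Z y = \<pi> Z u" using ex[OF Z _ ep[OF Z u]] by blast
  have "\<pi> X (Act Q Z X b u) = d X (Act A Z X b y)"
   using hom_nat[OF ph Z X bc, of u] u hom_nat[OF d Z X bc y(1)] y(2) by simp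
  then show "\<pi> X (Act Q Z X b u) \<in> ?W X" using ideal_span_gen[where M = A, OF Z b y(1)] by simp
 qed
 have pid: "\<pi> X x = x" if X: "X \<in> Obj C" and x: "x \<in> ideal_span Q X" "e X x = 0[On N X]" for X x
 proof -
  interpret QX: kmod K "On Q X" by (rule on_kmod[OF Q X])
  have "s X 0[On N X] = 0[On Q X]" using hom_zero[OF s Vm Q X] by simp
  then show ?thesis using x(2) cQ[OF X x(1)] by (simp add: \<pi>_def)
 qed
 show "x \<in> ?W X" if "X \<in> Obj C" "x \<in> ideal_span Q X" "e X x = 0[On N X]" for X x
  using pW[OF that(1,2)] pid[OF that] by simp
 have WI: "x \<in> ideal_span Q X" "e X x = 0[On N X]" if "X \<in> Obj C" "x \<in> ?W X" for X x
  using that ideal_span_hom[OF A Q d that(1)] ed[OF that(1) cA[OF that(1)]] by auto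
 \<comment> \<open>By \<open>pW\<close> and \<open>pid\<close> the map \<open>\<pi>\<close> retracts
   the projective module \<open>I Q\<close> onto \<open>d (I A)\<close>.\<close>
 show "projective K C (submod Q ?W)"
  by (rule projective_iso[OF pr submod_c_module[OF Q W] hom_into_submod[OF submod_incl[OF Q W]] hom_into_submod[OF ph]])
   (simp_all add: WI pW pid)
qed

text \<open>Put \<open>W n = d (I P_{n+1})\<close> inside \<open>P_n\<close>. If \<open>W n\<close>
  is projective, the epimorphism from \<open>I P_{n+1}\<close> onto it splits, and the section is
  what \<open>reduction_step\<close> needs to show that \<open>W (n+1)\<close> is projective and
  contains all cycles of \<open>I P_{n+1}\<close>. Consequently an element \<open>d x\<close> of
  \<open>I P_n\<close> equals \<open>d y\<close> with \<open>y\<close> in \<open>I P_{n+1}\<close>,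
  and \<open>x - y\<close> is a boundary.\<close>

lemma annihilated_reduction:
 assumes idem: "idempotent_ideal C I" and pI: "\<And>X. X \<in> Obj C ==> projective K C (ideal_at C I X)"
  and R: "resolution K C M P d \<epsilon>" and pr: "\<And>n. projective K C (P n)" and M: "annihilated M"
  and X: "X \<in> Obj C" and x: "x \<in> El (P (Suc n)) X" "d n X x \<in> ideal_span (P n) X"
 shows "\<exists>r\<in>El (P (Suc (Suc n))) X. x -[On (P (Suc n)) X] d (Suc n) X r \<in> ideal_span (P (Suc n)) X"
proof -
 interpret R: resolution K C M P d \<epsilon> by fact
 define W where "W n = (\<lambda>X. d n X ` ideal_span (P (Suc n)) X)" for n
 note prI = ideal_span_projective[OF pI pr]
 \<comment> \<open>Start of the induction: since \<open>M\<close> is annihilated, the augmentation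
   kills \<open>I P_0\<close>, so the zero submodule of \<open>M\<close> with the zero section fits
   \<open>reduction_step\<close>.\<close>
 have V: "subfunctor M (\<lambda>X. {0[On M X]})"
  unfolding subfunctor_def by (auto intro!: zero_submodule c_module.on_module[OF R.M] simp: act_zero[OF R.M])
 have s: "mod_hom K C (submod M (\<lambda>X. {0[On M X]})) (P 0) (\<lambda>X x. 0[On (P 0) X])"
  by (rule hom_zero_map[OF submod_c_module[OF R.M V] R.P])
 have eV: "X \<in> Obj C ==> x \<in> ideal_span (P 0) X ==> \<epsilon> X x \<in> {0[On M X]}" for X x
  using annihilated_hom[OF R.P R.M M R.eps] by simp
 have es: "X \<in> Obj C ==> v \<in> {0[On M X]} ==> \<epsilon> X 0[On (P 0) X] = v" for X v using hom_zero[OF R.eps R.P R.M] by simp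
 have r0: "subfunctor (P 0) (W 0)" "\<And>X x. X \<in> Obj C ==> x \<in> ideal_span (P 0) X ==> \<epsilon> X x = 0[On M X] ==> x \<in> W 0 X"
  "projective K C (submod (P 0) (W 0))"
  unfolding W_def by (rule reduction_step[OF idem R.P R.P R.M R.d R.eps R.eps_d R.exact0 V eV s es prI]; assumption)+
 have 1: "subfunctor (P n) (W n) \<and> projective K C (submod (P n) (W n)) \<and>
   (\<forall>X\<in>Obj C. \<forall>x\<in>ideal_span (P (Suc n)) X. d n X x = 0[On (P n) X] \<longrightarrow> x \<in> W (Suc n) X)" for n
 proof -
  have st: "\<exists>s. mod_hom K C (submod (P n) (W n)) (P (Suc n)) s \<and> (\<forall>X\<in>Obj C. \<forall>v\<in>W n X. d n X (s X v) = v)"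
   if W: "subfunctor (P n) (W n)" and p: "projective K C (submod (P n) (W n))" for n
  proof -
   note sI = ideal_span_subfunctor[OF R.P, of "Suc n"] and Wm = submod_c_module[OF R.P W]
   have d': "mod_hom K C (submod (P (Suc n)) (ideal_span (P (Suc n)))) (submod (P n) (W n)) (d n)"
    by (rule hom_into_submod[OF hom_from_submod[OF R.P sI R.d]]) (simp add: W_def)
   have "epi C (submod (P (Suc n)) (ideal_span (P (Suc n)))) (submod (P n) (W n)) (d n)"
    by (rule epiI[OF d']) (auto simp: W_def)
   then obtain s where s: "mod_hom K C (submod (P n) (W n)) (submod (P (Suc n)) (ideal_span (P (Suc n)))) s"
    "\<And>X x. X \<in> Obj C ==> x \<in> El (submod (P n) (W n)) X ==> d n X (s X x) = x"
    by (rule liftsD[OF projective_lifts[OF p submod_c_module[OF R.P sI] Wm d'] hom_id]) (rule that)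
   show ?thesis using hom_comp[OF s(1) submod_incl[OF R.P sI]] s(2) by (intro exI[of _ s]) simp
  qed
  have step: "subfunctor (P (Suc n)) (W (Suc n)) \<and> projective K C (submod (P (Suc n)) (W (Suc n))) \<and>
    (\<forall>X\<in>Obj C. \<forall>x\<in>ideal_span (P (Suc n)) X. d n X x = 0[On (P n) X] \<longrightarrow> x \<in> W (Suc n) X)"
   if W: "subfunctor (P n) (W n)" and p: "projective K C (submod (P n) (W n))" for n
  proof -
   obtain s where s: "mod_hom K C (submod (P n) (W n)) (P (Suc n)) s" "\<And>X v. X \<in> Obj C ==> v \<in> W n X ==> d n X (s X v) = v"
    using st[OF W p] by blast
   have dW: "X \<in> Obj C ==> x \<in> ideal_span (P (Suc n)) X ==> d n X x \<in> W n X" for X x by (simp add: W_def)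
   have "subfunctor (P (Suc n)) (W (Suc n))" "projective K C (submod (P (Suc n)) (W (Suc n)))"
    "\<And>X x. X \<in> Obj C ==> x \<in> ideal_span (P (Suc n)) X ==> d n X x = 0[On (P n) X] ==> x \<in> W (Suc n) X"
    unfolding W_def[of "Suc n"] by (rule reduction_step[OF idem R.P R.P R.P R.d R.d R.d_d R.exact W dW s prI]; assumption)+
   then show ?thesis by blast
  qed
  have "subfunctor (P n) (W n) \<and> projective K C (submod (P n) (W n))"
   by (induction n) (use r0(1,3) step in blast)+
  then show ?thesis using step by blast
 qed
 have dI: "d n X x \<in> W n X"
 proof (cases n)
  case 0
  then show ?thesis using r0(2)[OF X] x R.eps_d[OF X] by simp
 next
  case (Suc m)
  then show ?thesis using 1[of m] x R.d_d[OF X] X by simp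
 qed
 then obtain y where y: "y \<in> ideal_span (P (Suc n)) X" "d n X x = d n X y" by (auto simp: W_def)
 interpret PX: kmod K "On (P (Suc n)) X" by (rule on_kmod[OF R.P X])
 interpret PX': kmod K "On (P n) X" by (rule on_kmod[OF R.P X])
 have yc: "y \<in> El (P (Suc n)) X" by (rule subfunctor_carrier[OF R.P ideal_span_subfunctor[OF R.P] X y(1)])
 have "d n X (x -[On (P (Suc n)) X] y) = 0[On (P n) X]"
  using y(2) hom_closed[OF R.d X yc] by (simp add: hom_minus[OF R.d R.P R.P X x(1) yc] PX'.minus_eq_zero_iff)
 then obtain r where "r \<in> El (P (Suc (Suc n))) X" "d (Suc n) X r = x -[On (P (Suc n)) X] y"
  using R.exact[OF X] x(1) yc by (metis PX.minus_closed)
 then show ?thesis using PX.minus_minus_cancel[OF x(1) yc] y(1) by (intro bexI[of _ r]) simp_all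
qed

section \<open>Annihilated modules as modules over the quotient category\<close>

lemma res_annihilated:
 assumes F: "c_module K B F" shows "annihilated (res F)"
 unfolding annihilated_def
proof (intro ballI)
 fix X Y f x assume *: "X \<in> Obj C" "Y \<in> Obj C" "f \<in> I X Y" "x \<in> El (res F) X"
 have "q X Y f = 0[Hom B X Y]" using q_zero_iff[OF *(1,2) I_carrier[OF *(1-3)]] *(3) by simp
 then show "Act (res F) X Y f x = 0[On (res F) Y]" using B.act_hom_zero[OF F, of X Y x] * by simp
qed

lemma quotm_annihilated:
 assumes M: "c_module K C M" and S: "subfunctor M S"
  and IS: "\<And>X Y f x. X \<in> Obj C ==> Y \<in> Obj C ==> f \<in> I X Y ==> x \<in> El M X ==> Act M X Y f x \<in> S Y"
 shows "annihilated (quotm M S)"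
 unfolding annihilated_def
proof (intro ballI)
 fix X Y f u assume X: "X \<in> Obj C" and Y: "Y \<in> Obj C" and f: "f \<in> I X Y" and "u \<in> El (quotm M S) X"
 then obtain x where x: "x \<in> El M X" "u = S X +>[On M X] x" using kmod.quot_carrier[OF on_kmod[OF M X]] by auto
 interpret MY: kmod K "On M Y" by (rule on_kmod[OF M Y])
 note fc = I_carrier[OF X Y f]
 show "Act (quotm M S) X Y f u = 0[On (quotm M S) Y]"
  unfolding x(2) quotm_Act[OF M S X Y fc x(1)]
  using MY.coset_eq_self_iff[OF _ act_closed[OF M X Y fc x(1)]] IS[OF X Y f x(1)] S Y
  by (simp add: MY.quot_zero subfunctor_def)
qed

lemma span_quot_annihilated: "c_module K C M ==> annihilated (quotm M (ideal_span M))"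
 by (rule quotm_annihilated[OF _ ideal_span_subfunctor]) (auto intro: ideal_span_gen)

text \<open>The inverse of \<open>res\<close> on modules annihilated by \<open>I\<close>. A coset
  acts through an arbitrary representative, and \<open>fac_act\<close> shows that the choice does
  not matter.\<close>

definition fac :: "('k, 'o, 'm, 'v) cmod \<Rightarrow> ('k, 'o, 'm set, 'v) cmod" where
 "fac M = \<lparr>On = On M, Act = (\<lambda>X Y F. Act M X Y (SOME f. f \<in> Mor C X Y \<and> q X Y f = F))\<rparr>"

lemma fac_On [simp]: "On (fac M) = On M"
 by (simp add: fac_def)

lemma fac_act:
 assumes M: "c_module K C M" and a: "annihilated M" and X: "X \<in> Obj C" and Y: "Y \<in> Obj C"
  and f: "f \<in> Mor C X Y" and x: "x \<in> El M X"
 shows "Act (fac M) X Y (q X Y f) x = Act M X Y f x"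
proof -
 interpret H: kmod K "Hom C X Y" by (rule hom_kmod[OF X Y])
 interpret MY: kmod K "On M Y" by (rule on_kmod[OF M Y])
 define g where "g = (SOME g. g \<in> Mor C X Y \<and> q X Y g = q X Y f)"
 have g: "g \<in> Mor C X Y" "q X Y g = q X Y f"
  using someI[of "\<lambda>g. g \<in> Mor C X Y \<and> q X Y g = q X Y f" f] f by (auto simp: g_def)
 have "g -[Hom C X Y] f \<in> I X Y" using H.coset_eq_iff[OF ideal_submodule[OF X Y] g(1) f] g(2) by simp
 then have "Act M X Y (g -[Hom C X Y] f) x = 0[On M Y]" using a X Y x by (simp add: annihilated_def)
 then have "Act M X Y g x = Act M X Y f x"
  using lin_minus[OF c_module.act_linear_hom[OF M X Y x] H.module_axioms MY.module_axioms g(1) f]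
   MY.minus_eq_zero_iff act_closed[OF M X Y _ x] g(1) f by simp
 then show ?thesis by (simp add: fac_def g_def)
qed

lemma fac_c_module:
 assumes M: "c_module K C M" and a: "annihilated M" shows "c_module K B (fac M)"
proof (rule c_moduleI)
 have kq: "X \<in> Obj C ==> Y \<in> Obj C ==> F \<in> Mor B X Y \<longleftrightarrow> (\<exists>f\<in>Mor C X Y. F = q X Y f)" for X Y F
  using kmod.quot_carrier[OF hom_kmod] by auto
 note s = kq fac_act[OF M a] q_comp q_add q_smult comp_closed mod_closed[OF hom_module]
  act_closed[OF M] act_add[OF M] act_smult[OF M] act_hom_add[OF M] act_hom_smult[OF M] act_comp[OF M] on_closed[OF M]
 fix X assume "X \<in> Obj B"
 then show "module K (On (fac M) X)" using c_module.on_module[OF M] by simp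
 { fix x assume "x \<in> El (fac M) X"
  then show "Act (fac M) X X (Id B X) x = x" using \<open>X \<in> Obj B\<close> fac_act[OF M a, of X X "Id C X" x] by (simp add: id_closed act_id[OF M]) }
 fix Y f x assume "Y \<in> Obj B" "f \<in> Mor B X Y" "x \<in> El (fac M) X"
 note * = \<open>X \<in> Obj B\<close> this
 then show "Act (fac M) X Y f x \<in> El (fac M) Y" by (auto simp: s simp del: B_simps(2))
 { fix y assume "y \<in> El (fac M) X"
  with * show "Act (fac M) X Y f (x +[On (fac M) X] y) = Act (fac M) X Y f x +[On (fac M) Y] Act (fac M) X Y f y"
   by (auto simp: s simp del: B_simps(2)) }
 { fix b assume "b \<in> carrier K"
  with * show "Act (fac M) X Y f (b *[On (fac M) X] x) = b *[On (fac M) Y] Act (fac M) X Y f x"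
   "Act (fac M) X Y (b *[Hom B X Y] f) x = b *[On (fac M) Y] Act (fac M) X Y f x"
   by (auto simp: s simp del: B_simps(2)) }
 { fix g assume "g \<in> Mor B X Y"
  with * show "Act (fac M) X Y (f +[Hom B X Y] g) x = Act (fac M) X Y f x +[On (fac M) Y] Act (fac M) X Y g x"
   by (auto simp: s simp del: B_simps(2)) }
 { fix Z g assume "Z \<in> Obj B" "g \<in> Mor B Y Z"
  with * show "Act (fac M) X Z (Comp B X Y Z g f) x = Act (fac M) Y Z g (Act (fac M) X Y f x)"
   by (auto simp: s simp del: B_simps(2)) }
qed

lemma fac_hom_iff:
 assumes M: "c_module K C M" and a: "annihilated M"
 shows "mod_hom K B (fac M) G h \<longleftrightarrow> mod_hom K C M (res G) h"
 unfolding res_hom_iff[symmetric]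
 by (rule iffI; erule mod_hom_cong) (simp_all add: fac_act[OF M a])

context
 fixes Q :: "('k, 'o, 'm, 'v) cmod"
 assumes Q: "c_module K C Q"
begin

abbreviation (input) "cls X x \<equiv> ideal_span Q X +>[On Q X] x"

lemma span_quot_c_module: "c_module K C (quotm Q (ideal_span Q))"
 by (rule quotm_c_module[OF Q ideal_span_subfunctor[OF Q]])

lemma span_quot_cases:
 assumes "X \<in> Obj C" "u \<in> El (quotm Q (ideal_span Q)) X"
 obtains x where "x \<in> El Q X" "u = cls X x"
 using kmod.quot_carrier[OF on_kmod[OF Q assms(1)]] assms(2) by auto

text \<open>The universal property that makes \<open>Q \<mapsto> Q / I Q\<close> left adjoint to
  \<open>res\<close>: a map into a restricted module kills \<open>I Q\<close>.\<close>

lemma fac_factor: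
 assumes G: "c_module K B G" and h: "mod_hom K C Q (res G) h"
 obtains g where "mod_hom K B (fac (quotm Q (ideal_span Q))) G g" "\<And>X x. X \<in> Obj C ==> x \<in> El Q X ==> g X (cls X x) = h X x"
 using quotm_factor[OF Q ideal_span_subfunctor[OF Q] res_c_module[OF G] h annihilated_hom[OF Q res_c_module[OF G] res_annihilated[OF G] h]]
  fac_hom_iff[OF span_quot_c_module span_quot_annihilated[OF Q]] by blast

end

text \<open>A left adjoint of a functor that preserves epimorphisms preserves projectives.\<close>

lemma fac_projective:
 fixes Q :: "('k, 'o, 'm, 'v) cmod"
 assumes pr: "projective K C Q"
 shows "projective K B (fac (quotm Q (ideal_span Q)))" (is "projective K B ?F")
proof -
 note Q = projective_c_module[OF pr]
 note Qm = span_quot_c_module[OF Q] and a = span_quot_annihilated[OF Q]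
 show ?thesis
 proof (rule B.projectiveI[OF fac_c_module[OF Qm a]])
  fix A N :: "('k, 'o, 'm set, ('o, 'm set, 'v set) elt) cmod" and e
  assume A: "c_module K B A" and N: "c_module K B N" and e: "mod_hom K B A N e" "epi B A N e"
  have re: "mod_hom K C (res A) (res N) e" using e(1) by (simp add: res_hom_iff)
  have ep: "epi C (res A) (res N) e" by (rule epiI[OF re]) (use epiD[OF e(2)] in auto)
  show "lifts K B ?F A N e" unfolding lifts_def
  proof (intro allI impI)
   fix f assume f: "mod_hom K B ?F N f"
   then have "mod_hom K C (quotm Q (ideal_span Q)) (res N) f" using fac_hom_iff[OF Qm a] by blast
   from hom_comp[OF quotm_proj[OF Q ideal_span_subfunctor[OF Q]] this] obtain g where g: "mod_hom K C Q (res A) g"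
    "\<And>X x. X \<in> Obj C ==> x \<in> El Q X ==> e X (g X x) = f X (cls Q X x)"
    by (rule liftsD[OF projective_lifts[OF pr res_c_module[OF A] res_c_module[OF N] re ep]]) (rule that)
   obtain g' where g': "mod_hom K B ?F A g'" "\<And>X x. X \<in> Obj C ==> x \<in> El Q X ==> g' X (cls Q X x) = g X x"
    by (rule fac_factor[OF Q A g(1)]) (rule that)
   have "e X (g' X u) = f X u" if X: "X \<in> Obj C" and u: "u \<in> carrier (On ?F X)" for X u
    by (rule span_quot_cases[OF Q X u[unfolded fac_On]]) (simp add: g'(2)[OF X] g(2)[OF X])
   then show "\<exists>g. mod_hom K B ?F A g \<and> (\<forall>X\<in>Obj B. \<forall>x\<in>carrier (On ?F X). e X (g X x) = f X x)"
    using g'(1) by auto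
  qed
 qed
qed

text \<open>The lift \<open>\<tau>\<close> from \<open>Q\<close> to the restricted resolution
  \<open>P\<close> factors as \<open>Q -> Q / I Q -> P\<close>. The first map induces bijections of
  homomorphism spaces by adjunction. The second is a chain map between projective resolutions of
  \<open>F\<close> over \<open>B\<close>, where the comparison theorem applies; over
  \<open>C\<close> it need not, as restricted projectives need not be projective.\<close>

lemma ext_canonical_map_iso:
 assumes idem: "idempotent_ideal C I" and pI: "\<And>X. X \<in> Obj C ==> projective K C (ideal_at C I X)"
  and F: "c_module K B F" and F': "c_module K B F'"
 shows "ext_canonical_map K C I n F F' \<in> lin_isos K (Ext K B n F F') (Ext K C n (res F) (res F'))"
proof -
 obtain P dP \<epsilon>P where P: "chosen_resolution K B F = (P, dP, \<epsilon>P)" by (metis prod_cases3)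
 obtain Q dQ \<epsilon>Q where Q: "chosen_resolution K C (res F) = (Q, dQ, \<epsilon>Q)" by (metis prod_cases3)
 note rF = res_c_module[OF F] and rF' = res_c_module[OF F']
 have P': "proj_resolution K B F P dP \<epsilon>P" by (rule B.chosen_resolution[OF F P])
 have Q': "proj_resolution K C (res F) Q dQ \<epsilon>Q" by (rule chosen_resolution[OF rF Q])
 note PR = B.proj_resolution_resolution[OF F P'] and QR = proj_resolution_resolution[OF rF Q']
 let ?P = "\<lambda>n. res (P n)"
 have rP: "resolution K C (res F) ?P dP \<epsilon>P" by (rule res_resolution[OF PR(1)])
 interpret Q: resolution K C "res F" Q dQ \<epsilon>Q by (rule QR(1))
 interpret P: resolution K C "res F" ?P dP \<epsilon>P by (rule rP)
 \<comment> \<open>Exactly the lift chosen inside \<open>ext_canonical_map\<close>; existence has to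
   be shown first so that its properties can be extracted.\<close>
 define \<tau> where "\<tau> = (SOME \<tau>. chain_lift K C Q dQ \<epsilon>Q ?P dP \<epsilon>P \<tau>)"
 have "\<exists>\<tau>. chain_lift K C Q dQ \<epsilon>Q ?P dP \<epsilon>P \<tau>"
 proof -
  obtain t where t: "\<And>n. mod_hom K C (Q n) (?P n) (t n)"
   "\<And>X x. X \<in> Obj C ==> x \<in> El (Q 0) X ==> \<epsilon>P X (t 0 X x) = \<epsilon>Q X x"
   "\<And>n X x. X \<in> Obj C ==> x \<in> El (Q (Suc n)) X ==> dP n X (t (Suc n) X x) = t n X (dQ n X x)"
   by (rule chain_lift_exists[OF QR rP hom_id]) (rule that)
  let ?t = "\<lambda>n. ext_hom C (Q n) (t n)"
  have tn: "?t n \<in> nat_trans K C (Q n) (?P n)" for n by (rule ext_hom_nat_trans[OF Q.P t(1)])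
  have eQ: "\<epsilon>Q \<in> nat_trans K C (Q 0) (res F)" using Q' by (simp add: proj_resolution_def)
  have "nt_comp C (Q 0) \<epsilon>P (?t 0) = \<epsilon>Q"
   by (rule nat_trans_eqI[OF nt_comp_nat_trans[OF Q.P nat_trans_hom[OF tn] P.eps] eQ]) (simp add: nt_comp_apply ext_hom_apply t(2))
  moreover have "nt_comp C (Q (Suc n)) (dP n) (?t (Suc n)) = nt_comp C (Q (Suc n)) (?t n) (dQ n)" for n
   unfolding nt_comp_ext by (rule ext_hom_cong) (simp add: ext_hom_apply hom_closed[OF Q.d] t(3))
  ultimately show ?thesis using tn unfolding chain_lift_def by (intro exI[of _ ?t]) simp
 qed
 then have cl: "chain_lift K C Q dQ \<epsilon>Q ?P dP \<epsilon>P \<tau>" unfolding \<tau>_def by (rule someI_ex)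
 have t1: "mod_hom K C (Q n) (?P n) (\<tau> n)" for n using cl by (auto simp: chain_lift_def intro: nat_trans_hom)
 have t2: "\<epsilon>P X (\<tau> 0 X x) = \<epsilon>Q X x" if "X \<in> Obj C" "x \<in> El (Q 0) X" for X x
 proof -
  have "nt_comp C (Q 0) \<epsilon>P (\<tau> 0) = \<epsilon>Q" using cl by (simp add: chain_lift_def)
  from fun_cong[OF fun_cong[OF this], of X x] show ?thesis using that by (simp add: nt_comp_apply)
 qed
 have t3: "dP n X (\<tau> (Suc n) X x) = \<tau> n X (dQ n X x)" if "X \<in> Obj C" "x \<in> El (Q (Suc n)) X" for n X x
 proof -
  have "nt_comp C (Q (Suc n)) (dP n) (\<tau> (Suc n)) = nt_comp C (Q (Suc n)) (\<tau> n) (dQ n)" using cl by (simp add: chain_lift_def)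
  from fun_cong[OF fun_cong[OF this], of X x] show ?thesis using that by (simp add: nt_comp_apply)
 qed
 let ?R = "\<lambda>n. fac (quotm (Q n) (ideal_span (Q n)))" and ?c = "\<lambda>n. cls (Q n)"
 note sf = ideal_span_subfunctor[OF Q.P]
 have ss: "x \<in> ideal_span (Q n) X ==> X \<in> Obj C ==> x \<in> El (Q n) X" for n X x by (rule subfunctor_carrier[OF Q.P sf])
 have r0: "\<exists>r\<in>El (Q (Suc 0)) X. p -[On (Q 0) X] dQ 0 X r \<in> ideal_span (Q 0) X"
  if X: "X \<in> Obj C" and p: "p \<in> El (Q 0) X" "\<epsilon>Q X p = 0[On (res F) X]" for X p
 proof -
  interpret V: kmod K "On (Q 0) X" by (rule on_kmod[OF Q.P X])
  obtain r where "r \<in> El (Q (Suc 0)) X" "dQ 0 X r = p" using Q.exact0[OF X p] by blast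
  then show ?thesis using V.minus_eq_zero_iff[OF p(1) p(1)] V.submodule_props(2)[OF ideal_span_submodule[OF Q.P X]] by (intro bexI[of _ r]) simp_all
 qed
 \<comment> \<open>\<open>Q / I Q\<close> is exact: in degree 0 by exactness of \<open>Q\<close>, as
   \<open>F\<close> stays unreduced, and in higher degrees by
   \<open>annihilated_reduction\<close>.\<close>
 obtain D e where De: "resolution K C (res F) (\<lambda>n. quotm (Q n) (ideal_span (Q n))) D e"
  "\<And>n X x. X \<in> Obj C ==> x \<in> El (Q (Suc n)) X ==> D n X (?c (Suc n) X x) = ?c n X (dQ n X x)"
  "\<And>X x. X \<in> Obj C ==> x \<in> El (Q 0) X ==> e X (?c 0 X x) = \<epsilon>Q X x"
  by (rule quotient_resolution[OF QR(1) sf rF Q.eps Q.eps_onto Q.eps_d ideal_span_hom[OF Q.P Q.P Q.d]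
    annihilated_hom[OF Q.P rF res_annihilated[OF F] Q.eps] r0 annihilated_reduction[OF idem pI QR res_annihilated[OF F]]])
   (assumption | rule that)+
 interpret D: resolution K C "res F" "\<lambda>n. quotm (Q n) (ideal_span (Q n))" D e by (rule De(1))
 note qa = span_quot_annihilated[OF Q.P] and fm = fac_c_module[OF D.P span_quot_annihilated[OF Q.P]]
 have fc: "mod_hom K B (fac M) (fac N) h" if "mod_hom K C M N h" "c_module K C M" "annihilated M" "c_module K C N" "annihilated N"
  for h and M N :: "('k, 'o, 'm, ('o, 'm, 'v) elt set) cmod"
  unfolding fac_hom_iff[OF that(2,3)] by (rule mod_hom_cong[OF that(1)]) (simp_all add: fac_act[OF that(4,5)])
 have RB: "resolution K B F ?R D e"
  by (rule B.resolutionI[where M = F and P = ?R and d = D and \<epsilon> = e, OF F fm fc[OF D.d D.P qa D.P qa]])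
   (use D.eps D.eps_onto D.eps_d D.d_d D.exact0 D.exact in "simp_all add: fac_hom_iff[OF D.P qa] del: quotm_On")
 have "\<exists>g. mod_hom K B (?R n) (P n) g \<and> (\<forall>X\<in>Obj C. \<forall>x\<in>El (Q n) X. g X (?c n X x) = \<tau> n X x)" for n
  using fac_factor[OF Q.P B.projective_c_module[OF PR(2)] t1[of n]] by metis
 then obtain \<sigma> where \<sigma>: "\<And>n. mod_hom K B (?R n) (P n) (\<sigma> n)" "\<And>n X x. X \<in> Obj C ==> x \<in> El (Q n) X ==> \<sigma> n X (?c n X x) = \<tau> n X x" by metis
 have s2: "\<epsilon>P X (\<sigma> 0 X u) = e X u" if X: "X \<in> Obj B" and u: "u \<in> El (?R 0) X" for X u
 proof -
  have X': "X \<in> Obj C" using X by simp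
  obtain x where x: "x \<in> El (Q 0) X" "u = ?c 0 X x" by (rule span_quot_cases[OF Q.P X' u[unfolded fac_On]])
  show ?thesis using \<sigma>(2)[OF X' x(1)] De(3)[OF X' x(1)] t2[OF X' x(1)] by (simp add: x(2))
 qed
 have s3: "dP n X (\<sigma> (Suc n) X u) = \<sigma> n X (D n X u)" if X: "X \<in> Obj B" and u: "u \<in> El (?R (Suc n)) X" for n X u
 proof -
  have X': "X \<in> Obj C" using X by simp
  obtain x where x: "x \<in> El (Q (Suc n)) X" "u = ?c (Suc n) X x" by (rule span_quot_cases[OF Q.P X' u[unfolded fac_On]])
  show ?thesis using \<sigma>(2)[OF X' x(1)] De(2)[OF X' x(1)] t3[OF X' x(1)] \<sigma>(2)[OF X' hom_closed[OF Q.d X' x(1)]] by (simp add: x(2))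
 qed
 interpret RB: resolution K B F ?R D e by (rule RB)
 let ?r = "\<lambda>n. res (?R n)"
 have rR: "resolution K C (res F) ?r D e" by (rule res_resolution[OF RB])
 have ch: "mod_hom K C (Q n) (?r n) (?c n)" for n
  using fac_hom_iff[OF D.P qa, of n "?R n" "\<lambda>X x. x"] hom_comp[OF quotm_proj[OF Q.P sf]] hom_id by blast
 interpret c: cochain_map K "hom_cx ?r (res F')" "hom_d ?r D" "hom_cx Q (res F')" "hom_d Q dQ" "\<lambda>n \<phi>. nt_comp C (Q n) \<phi> (?c n)"
  by (rule precomp_cochain_map[where Q = Q and dQ = dQ and P = ?r and dP = D and \<tau> = ?c, OF QR(1) rR rF' ch De(2)])
 \<comment> \<open>Precomposition with the projection onto \<open>Q / I Q\<close> is injective since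
   the projection is onto, and surjective by \<open>fac_factor\<close>.\<close>
 have ciso: "c.f_star n \<in> lin_isos K (H_mod (hom_cx ?r (res F')) (hom_d ?r D) n) (H_mod (hom_cx Q (res F')) (hom_d Q dQ) n)"
 proof (rule c.H_map_bij)
  fix n
  have "inj_on (\<lambda>\<phi>. nt_comp C (Q n) \<phi> (?c n)) (nat_trans K C (?r n) (res F'))"
  proof (rule inj_onI)
   fix x y assume xy: "x \<in> nat_trans K C (?r n) (res F')" "y \<in> nat_trans K C (?r n) (res F')"
    and eq: "nt_comp C (Q n) x (?c n) = nt_comp C (Q n) y (?c n)"
   show "x = y"
   proof (rule nat_trans_eqI[OF xy])
    fix X u assume X: "X \<in> Obj C" and u: "u \<in> El (?r n) X"
    obtain p where p: "p \<in> El (Q n) X" "u = ?c n X p"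
     by (rule span_quot_cases[OF Q.P X u[unfolded res_simps fac_On]])
    show "x X u = y X u" using fun_cong[OF fun_cong[OF eq], of X p] unfolding nt_comp_apply[OF X p(1)] p(2) .
   qed
  qed
  moreover have "\<exists>x\<in>nat_trans K C (?r n) (res F'). nt_comp C (Q n) x (?c n) = g" if g: "g \<in> nat_trans K C (Q n) (res F')" for g
  proof -
   obtain g' where g': "mod_hom K B (?R n) F' g'" "\<And>X x. X \<in> Obj C ==> x \<in> El (Q n) X ==> g' X (?c n X x) = g X x"
    by (rule fac_factor[OF Q.P F' nat_trans_hom[OF g]]) (rule that)
   have r: "mod_hom K C (?r n) (res F') g'" using g'(1) by (simp add: res_hom_iff)
   note en = ext_hom_nat_trans[OF resolution.P[OF rR] r]
   have "nt_comp C (Q n) (ext_hom C (?r n) g') (?c n) = g"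
    by (rule nat_trans_eqI[OF nt_comp_nat_trans[OF Q.P ch nat_trans_hom[OF en]] g])
     (simp add: nt_comp_apply ext_hom_apply hom_closed[OF ch] g'(2) del: res_simps quotm_On)
   then show ?thesis using en by blast
  qed
  moreover have "nt_comp C (Q n) x (?c n) \<in> nat_trans K C (Q n) (res F')" if "x \<in> nat_trans K C (?r n) (res F')" for x
   by (rule nt_comp_nat_trans[OF Q.P ch nat_trans_hom[OF that]])
  ultimately show "bij_betw (\<lambda>\<phi>. nt_comp C (Q n) \<phi> (?c n)) (carrier (Hom_Mod K C (?r n) (res F'))) (carrier (Hom_Mod K C (Q n) (res F')))"
   unfolding bij_betw_def Hom_Mod_simps(1) by blast
 qed
 have sr: "mod_hom K C (?r n) (?P n) (\<sigma> n)" for n using \<sigma>(1) by (simp add: res_hom_iff)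
 interpret s: cochain_map K "hom_cx ?P (res F')" "hom_d ?P dP" "hom_cx ?r (res F')" "hom_d ?r D" "\<lambda>n \<phi>. nt_comp C (?r n) \<phi> (\<sigma> n)"
  by (rule precomp_cochain_map[where Q = ?r and dQ = D and P = ?P and dP = dP and \<tau> = \<sigma>, OF rR rP rF' sr]) (use s3 in simp)
 have siso: "s.f_star n \<in> lin_isos K (H_mod (hom_cx ?P (res F')) (hom_d ?P dP) n) (H_mod (hom_cx ?r (res F')) (hom_d ?r D) n)"
  using B.projective_comparison[where Q = ?R and dQ = D and P = P and dP = dP and \<tau> = \<sigma> and n = n, OF F' RB fac_projective[OF QR(2)] PR \<sigma>(1) s2 s3]
  by (simp add: res_Hom_Mod res_nt_comp)
 interpret t: cochain_map K "hom_cx ?P (res F')" "hom_d ?P dP" "hom_cx Q (res F')" "hom_d Q dQ" "\<lambda>n \<phi>. nt_comp C (Q n) \<phi> (\<tau> n)"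
  by (rule precomp_cochain_map[where Q = Q and dQ = dQ and P = ?P and dP = dP and \<tau> = \<tau>, OF QR(1) rP rF' t1 t3])
 \<comment> \<open>On representatives, composing with \<open>\<sigma>\<close> and then with the
   projection is composing with \<open>\<tau>\<close>, so the map in question is the composite of
   the two isomorphisms.\<close>
 have "t.f_star n \<in> lin_isos K (H_mod (hom_cx ?P (res F')) (hom_d ?P dP) n) (H_mod (hom_cx Q (res F')) (hom_d Q dQ) n)"
 proof (rule lin_isos_cong[OF lin_isos_comp[OF siso ciso] s.A.H_module])
  fix X assume "X \<in> carrier (H_mod (hom_cx ?P (res F')) (hom_d ?P dP) n)"
  then obtain x where x: "x \<in> cocyc (hom_cx ?P (res F')) (hom_d ?P dP) n" "X = s.A.cls n x" by (rule s.A.H_cases) (rule that)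
  have "nt_comp C (Q n) (nt_comp C (?r n) x (\<sigma> n)) (?c n) = nt_comp C (Q n) x (\<tau> n)"
   unfolding nt_comp_ext by (rule ext_hom_cong) (simp add: ext_hom_apply hom_closed[OF ch] \<sigma>(2) del: res_simps quotm_On)
  then show "t.f_star n X = c.f_star n (s.f_star n X)"
   unfolding x(2) by (simp add: t.H_map_cls[OF x(1)] s.H_map_cls[OF x(1)] c.H_map_cls[OF s.f_cocyc[OF x(1)]])
 qed
 moreover have "Ext K B n F F' = H_mod (hom_cx ?P (res F')) (hom_d ?P dP) n"
  by (simp add: Ext_def P B.cohomology_H_mod res_Hom_Mod res_nt_comp)
 moreover have "Ext K C n (res F) (res F') = H_mod (hom_cx Q (res F')) (hom_d Q dQ) n"
  by (simp add: Ext_def Q cohomology_H_mod)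
 moreover have "ext_canonical_map K C I n F F' = H_map (hom_cx Q (res F')) (hom_d Q dQ) n (\<lambda>\<phi>. nt_comp C (Q n) \<phi> (\<tau> n))"
  by (simp add: ext_canonical_map_def P Q \<tau>_def[symmetric] Let_def H_map_def coboundaries_cobd)
 ultimately show ?thesis by simp
qed

end

section \<open>Reducing a bimodule resolution on both sides\<close>

lemma hom_bimod_On [simp]: "On (hom_bimod K C) Z = Hom C (fst Z) (snd Z)"
 by (simp add: hom_bimod_def case_prod_unfold)

context kcat
begin

interpretation E: two_kcats K "op_cat C" C
 by (rule two_kcats.intro[OF op_kcat kcat_axioms])

lemma hom_bimod_c_module:
 shows "c_module K E.TC (hom_bimod K C)"
  and "\<And>Z Z' x h. Z \<in> Obj E.TC ==> Z' \<in> Obj E.TC ==> x \<in> E.pr Z Z' ==> h \<in> El (hom_bimod K C) Z ==>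
   Act (hom_bimod K C) Z Z' (E.tm Z Z' x) h = Comp C (fst Z') (snd Z) (snd Z') (snd x) (Comp C (fst Z') (fst Z) (snd Z) h (fst x))"
proof -
 let ?M = "hom_bimod K C"
 let ?act = "\<lambda>Z Z' x h. Comp C (fst Z') (snd Z) (snd Z') (snd x) (Comp C (fst Z') (fst Z) (snd Z) h (fst x))"
 note bm = E.bimod_c_module[where M = ?M and act = ?act]
 have o: "fst Z \<in> Obj C" "snd Z \<in> Obj C" if "Z \<in> Obj E.TC" for Z using that by (simp_all add: E.TC_simps(1))
 have 1: "module K (On ?M Z)" if "Z \<in> Obj E.TC" for Z using o[OF that] by (simp add: hom_module)
 have 2: "Act ?M Z Z' A h = tlift K (On ?M Z') (\<lambda>x. ?act Z Z' x h) A" for Z Z' A h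
  by (simp add: hom_bimod_def tlift_def case_prod_unfold)
 have 3: "?act Z Z' x \<in> lin_maps K (On ?M Z) (On ?M Z')" if "Z \<in> Obj E.TC" "Z' \<in> Obj E.TC" "x \<in> E.pr Z Z'" for Z Z' x
  by (rule lin_mapsI) (use o[OF that(1)] o[OF that(2)] that(3) in
   "auto simp: comp_closed comp_add_left comp_add_right comp_smult_left comp_smult_right")
 have 4: "bilin K (Hom (op_cat C) (fst Z) (fst Z')) (Hom C (snd Z) (snd Z')) (On ?M Z') (\<lambda>x. ?act Z Z' x h)"
  if "Z \<in> Obj E.TC" "Z' \<in> Obj E.TC" "h \<in> carrier (On ?M Z)" for Z Z' h
  by (rule bilinI) (use o[OF that(1)] o[OF that(2)] that(3) in
   "auto simp: comp_closed comp_add_left comp_add_right comp_smult_left comp_smult_right")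
 have 5: "?act Z Z (E.pid Z) h = h" if "Z \<in> Obj E.TC" "h \<in> carrier (On ?M Z)" for Z h
  using o[OF that(1)] that(2) by (simp add: E.pid_def comp_id_left comp_id_right)
 have 6: "?act Z Z'' (E.pcomp Z Z' Z'' x y) h = ?act Z' Z'' x (?act Z Z' y h)"
  if "Z \<in> Obj E.TC" "Z' \<in> Obj E.TC" "Z'' \<in> Obj E.TC" "x \<in> E.pr Z' Z''" "y \<in> E.pr Z Z'" "h \<in> carrier (On ?M Z)" for Z Z' Z'' x y h
 proof -
  obtain X Y X' Y' X'' Y'' a b a' b' where [simp]: "Z = (X, Y)" "Z' = (X', Y')" "Z'' = (X'', Y'')" "x = (a', b')" "y = (a, b)"
   by (metis surj_pair)
  have O: "X \<in> Obj C" "Y \<in> Obj C" "X' \<in> Obj C" "Y' \<in> Obj C" "X'' \<in> Obj C" "Y'' \<in> Obj C"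
   using o[OF that(1)] o[OF that(2)] o[OF that(3)] by simp_all
  have m: "a \<in> Mor C X' X" "b \<in> Mor C Y Y'" "a' \<in> Mor C X'' X'" "b' \<in> Mor C Y' Y''" "h \<in> Mor C X Y"
   using that(4-6) by auto
  have ha: "Comp C X' X Y h a \<in> Mor C X' Y" by (rule comp_closed[OF O(3,1,2) m(1,5)])
  have "Comp C X'' X Y h (Comp C X'' X' X a a') = Comp C X'' X' Y (Comp C X' X Y h a) a'"
   by (rule comp_assoc[OF O(5,3,1,2) m(3,1,5)])
  moreover have "Comp C X'' X' Y' (Comp C X' Y Y' b (Comp C X' X Y h a)) a' = Comp C X'' Y Y' b (Comp C X'' X' Y (Comp C X' X Y h a) a')"
   by (rule comp_assoc[OF O(5,3,2,4) m(3) ha m(2), symmetric])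
  moreover have "Comp C X'' Y Y'' (Comp C Y Y' Y'' b' b) k = Comp C X'' Y' Y'' b' (Comp C X'' Y Y' b k)" if "k \<in> Mor C X'' Y" for k
   by (rule comp_assoc[OF O(5,2,4,6) that m(2,4), symmetric])
  ultimately show ?thesis using comp_closed[OF O(5,3,2) m(3) ha] by (simp add: E.pcomp_def)
 qed
 show "c_module K E.TC ?M" by (rule bm(1)) (rule 1 2 3 4 5 6; assumption)+
 show "Act ?M Z Z' (E.tm Z Z' x) h = ?act Z Z' x h"
  if "Z \<in> Obj E.TC" "Z' \<in> Obj E.TC" "x \<in> E.pr Z Z'" "h \<in> carrier (On ?M Z)" for Z Z' x h
  by (rule bm(2)) (rule 1 2 3 4 5 6 that; assumption?)+
qed

end

context two_kcats
begin

lemma jspan_hom: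
 assumes X: "X \<in> Obj C" and Jc: "\<And>X' c. X' \<in> Obj C ==> c \<in> J X' ==> c \<in> Mor C X' X"
  and Jr: "\<And>X' X'' f c. X' \<in> Obj C ==> X'' \<in> Obj C ==> f \<in> Mor C X' X'' ==> c \<in> J X'' ==> Comp C X' X'' X c f \<in> J X'"
  and M: "c_module K TC M" and N: "c_module K TC N" and h: "mod_hom K TC M N \<eta>" and Y: "Y \<in> Obj D" and x: "x \<in> jspan X J M Y"
 shows "\<eta> (X, Y) x \<in> jspan X J N Y"
proof -
 have O: "X' \<in> Obj C ==> (X', Y) \<in> Obj TC" for X' using Y by (simp add: TC_simps(1))
 show ?thesis
 proof (rule jspan_mapsto[where J = J, OF X Jc Jr M Y c_module.on_module[OF N O[OF X]] hom_lin[OF h O[OF X]] jspan_submodule[where J = J, OF X Jc Jr N Y] x])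
  fix X' c p assume X': "X' \<in> Obj C" and c: "c \<in> J X'" and p: "p \<in> El M (X', Y)"
  have cx: "(c, Id D Y) \<in> pr (X', Y) (X, Y)" using Jc[OF X' c] D.id_closed[OF Y] by simp
  show "\<eta> (X, Y) (Act M (X', Y) (X, Y) (tm (X', Y) (X, Y) (c, Id D Y)) p) \<in> jspan X J N Y"
   unfolding hom_nat[OF h O[OF X'] O[OF X] tm_closed[OF O[OF X'] O[OF X] cx] p]
   by (rule jspan_gen[where J = J, OF X Jc Jr X' c hom_closed[OF h O[OF X'] p]])
 qed
qed

end

section \<open>The left action of the ideal on a bimodule resolution\<close>

context ideal_kcat
begin

sublocale E: two_kcats K "op_cat C" C
 by (rule two_kcats.intro[OF op_kcat kcat_axioms])

interpretation S: two_kcats K C "op_cat C" by (rule E.two_kcats_swap)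

interpretation Op: ideal_kcat K "op_cat C" "\<lambda>X Y. I Y X" by (rule op_ideal_kcat)

abbreviation "CC \<equiv> hom_bimod K C"

lemma E_obj: "(X, Y) \<in> Obj E.TC \<longleftrightarrow> X \<in> Obj C \<and> Y \<in> Obj C"
 by (simp add: E.TC_simps(1))

text \<open>With \<open>J_comp\<close>, this supplies the premises on \<open>J\<close> in the slice
  results for \<open>J = I X\<close>. A morphism from \<open>X'\<close> to \<open>X\<close> in
  \<open>op_cat C\<close> is one from \<open>X\<close> to \<open>X'\<close> in \<open>C\<close>,
  whence the order of the arguments.\<close>

lemma J_carrier: "X \<in> Obj C ==> X' \<in> Obj (op_cat C) ==> c \<in> I X X' ==> c \<in> Mor (op_cat C) X' X"
 by (simp add: I_carrier)

lemma J_comp: "X \<in> Obj C ==> X' \<in> Obj (op_cat C) ==> X'' \<in> Obj (op_cat C) ==> f \<in> Mor (op_cat C) X' X'' ==> c \<in> I X X'' ==>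
  Comp (op_cat C) X' X'' X c f \<in> I X X'"
 by (simp add: ideal_comp_left)

lemma left_act:
 assumes M: "c_module K E.TC M" and O: "X \<in> Obj C" "X' \<in> Obj C" "Y \<in> Obj C" and g: "g \<in> Mor C X' X" and p: "p \<in> El M (X, Y)"
 shows "Act (S.rslice (E.sw M) Y) X X' g p = Act M (X, Y) (X', Y) (E.tm (X, Y) (X', Y) (g, Id C Y)) p"
 using E.sw_c_module(2)[OF M, of "(Y, X)" "(Y, X')" "(Id C Y, g)" p] O g p id_closed[OF O(3)] by (simp add: S.TC_simps(1))

text \<open>For fixed \<open>Y\<close>, the exchanged slice \<open>P(-,Y)\<close> is a projective
  resolution over \<open>op_cat C\<close> of \<open>C(-,Y)\<close>, which is the representable of
  \<open>op_cat C\<close> at \<open>Y\<close>. So \<open>representable_reduction\<close> applies to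
  the opposite ideal.\<close>

lemma left_reduction:
 assumes fK: "field K" and R: "resolution K E.TC CC P d \<epsilon>" and pr: "\<And>n. projective K E.TC (P n)"
 shows "\<And>X Y p. X \<in> Obj C ==> Y \<in> Obj C ==> p \<in> El (P 0) (X, Y) ==> \<epsilon> (X, Y) p \<in> I X Y ==>
   \<exists>r\<in>El (P (Suc 0)) (X, Y). p -[On (P 0) (X, Y)] d 0 (X, Y) r \<in> E.jspan X (I X) (P 0) Y"
  and "\<And>n X Y p. X \<in> Obj C ==> Y \<in> Obj C ==> p \<in> El (P (Suc n)) (X, Y) ==> d n (X, Y) p \<in> E.jspan X (I X) (P n) Y ==>
   \<exists>r\<in>El (P (Suc (Suc n))) (X, Y). p -[On (P (Suc n)) (X, Y)] d (Suc n) (X, Y) r \<in> E.jspan X (I X) (P (Suc n)) Y"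
proof -
 interpret R: resolution K E.TC CC P d \<epsilon> by fact
 have RL: "resolution K (op_cat C) (representable (op_cat C) Y) (\<lambda>n. S.rslice (E.sw (P n)) Y) (\<lambda>n X. d n (X, Y)) (\<lambda>X. \<epsilon> (X, Y))"
  if Y: "Y \<in> Obj C" for Y
 proof -
  have "resolution K (op_cat C) (S.rslice (E.sw CC) Y) (\<lambda>n. S.rslice (E.sw (P n)) Y) (\<lambda>n X. d n (X, Y)) (\<lambda>X. \<epsilon> (X, Y))"
   using S.rslice_resolution[OF Y E.sw_resolution[OF R]] by simp
  then show ?thesis
  proof (rule E.C.resolution_cong)
   show "c_module K (op_cat C) (representable (op_cat C) Y)" by (rule E.C.representable_c_module) (simp add: Y)
   fix X X' f x assume O: "X \<in> Obj (op_cat C)" "X' \<in> Obj (op_cat C)" and f: "f \<in> Mor (op_cat C) X X'"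
    and x: "x \<in> El (S.rslice (E.sw CC) Y) X"
   have O': "X \<in> Obj C" "X' \<in> Obj C" and f': "f \<in> Mor C X' X" and x': "x \<in> Mor C X Y" using O f x by simp_all
   have xf: "Comp C X' X Y x f \<in> Mor C X' Y" by (rule comp_closed[OF O'(2,1) Y f' x'])
   have fi: "(f, Id C Y) \<in> E.pr (X, Y) (X', Y)" using f' id_closed[OF Y] by simp
   have x'': "x \<in> El CC (X, Y)" using x' by simp
   show "Act (representable (op_cat C) Y) X X' f x = Act (S.rslice (E.sw CC) Y) X X' f x"
    unfolding left_act[OF R.M O' Y f' x''] hom_bimod_c_module(2)[OF E_obj[THEN iffD2, OF conjI, OF O'(1) Y] E_obj[THEN iffD2, OF conjI, OF O'(2) Y] fi x'']
    using comp_id_left[OF O'(2) Y xf] by simp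
  qed simp
 qed
 have PL: "projective K (op_cat C) (S.rslice (E.sw (P n)) Y)" if Y: "Y \<in> Obj C" for Y n
  by (rule S.rslice_projective[OF fK E.sw_projective[OF pr] Y])
 \<comment> \<open>The result is wanted for slices at \<open>X\<close>; \<open>I M\<close> computed
   in the slice at \<open>Y\<close> and \<open>jspan\<close> computed in the slice at
   \<open>X\<close> have the same generators at \<open>(X, Y)\<close>.\<close>
 have sp: "Op.ideal_span (S.rslice (E.sw (P n)) Y) X = E.jspan X (I X) (P n) Y" if O: "X \<in> Obj C" "Y \<in> Obj C" for X Y n
 proof -
  have "{Act (S.rslice (E.sw (P n)) Y) Z X g w |Z g w. Z \<in> Obj (op_cat C) \<and> g \<in> I X Z \<and> w \<in> El (S.rslice (E.sw (P n)) Y) Z} =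
   {Act (P n) (X', Y) (X, Y) (E.tm (X', Y) (X, Y) (c, Id C Y)) p |X' c p. X' \<in> Obj (op_cat C) \<and> c \<in> I X X' \<and> p \<in> El (P n) (X', Y)}"
  proof (intro Collect_cong ex_cong1)
   fix u Z g w
   have "Act (S.rslice (E.sw (P n)) Y) Z X g w = Act (P n) (Z, Y) (X, Y) (E.tm (Z, Y) (X, Y) (g, Id C Y)) w"
    if "Z \<in> Obj C" "g \<in> I X Z" "w \<in> El (P n) (Z, Y)"
    by (rule left_act[OF R.P that(1) O(1,2) I_carrier[OF O(1) that(1,2)] that(3)])
   then show "(u = Act (S.rslice (E.sw (P n)) Y) Z X g w \<and> Z \<in> Obj (op_cat C) \<and> g \<in> I X Z \<and> w \<in> El (S.rslice (E.sw (P n)) Y) Z) =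
     (u = Act (P n) (Z, Y) (X, Y) (E.tm (Z, Y) (X, Y) (g, Id C Y)) w \<and> Z \<in> Obj (op_cat C) \<and> g \<in> I X Z \<and> w \<in> El (P n) (Z, Y))"
    by auto
  qed
  then show ?thesis unfolding Op.ideal_span_def E.jspan_def by simp
 qed
 fix X Y assume X: "X \<in> Obj C" and Y: "Y \<in> Obj C"
 note rd = Op.representable_reduction[OF _ RL[OF Y] PL[OF Y], of X, unfolded sp[OF X Y]]
 show "\<exists>r\<in>El (P (Suc 0)) (X, Y). p -[On (P 0) (X, Y)] d 0 (X, Y) r \<in> E.jspan X (I X) (P 0) Y"
  if "p \<in> El (P 0) (X, Y)" "\<epsilon> (X, Y) p \<in> I X Y" for p
  using rd(1)[of p] that X Y by simp
 show "\<exists>r\<in>El (P (Suc (Suc n))) (X, Y). p -[On (P (Suc n)) (X, Y)] d (Suc n) (X, Y) r \<in> E.jspan X (I X) (P (Suc n)) Y"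
  if "p \<in> El (P (Suc n)) (X, Y)" "d n (X, Y) p \<in> E.jspan X (I X) (P n) Y" for n p
  using rd(2)[of p n] that X Y by simp
qed

text \<open>The slice at \<open>X\<close> of \<open>M\<close> modulo the left action of
  \<open>I\<close>; the right action survives and makes it a \<open>C\<close>-module.\<close>

definition halfq :: "('k, 'o \<times> 'o, ('m \<times> 'm \<Rightarrow> 'k) set, 'v) cmod \<Rightarrow> 'o \<Rightarrow> ('k, 'o, 'm, 'v set) cmod" where
 "halfq M X = quotm (E.rslice M X) (E.jspan X (I X) M)"

abbreviation halfp where "halfp M X Y x \<equiv> E.jspan X (I X) M Y +>[On M (X, Y)] x"

lemma jspan_sub:
 assumes M: "c_module K E.TC M" and X: "X \<in> Obj C"
 shows "c_module K C (E.rslice M X)" "subfunctor (E.rslice M X) (E.jspan X (I X) M)"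
proof -
 have X': "X \<in> Obj (op_cat C)" using X by simp
 show "c_module K C (E.rslice M X)" by (rule E.rslice_c_module[OF M X'])
 show "subfunctor (E.rslice M X) (E.jspan X (I X) M)"
  by (rule E.jspan_subfunctor[where J = "I X", OF X' J_carrier[OF X] J_comp[OF X] M])
qed

lemma halfq_facts:
 assumes M: "c_module K E.TC M" and X: "X \<in> Obj C"
 shows "c_module K C (halfq M X)" "mod_hom K C (E.rslice M X) (halfq M X) (\<lambda>Y. halfp M X Y)"
  and "\<And>Y u. Y \<in> Obj C ==> u \<in> El (halfq M X) Y \<longleftrightarrow> (\<exists>x\<in>El M (X, Y). u = halfp M X Y x)"
  and "\<And>Y x. Y \<in> Obj C ==> x \<in> El M (X, Y) ==> halfp M X Y x = 0[On (halfq M X) Y] \<longleftrightarrow> x \<in> E.jspan X (I X) M Y"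
proof -
 note js = jspan_sub[OF M X]
 show "c_module K C (halfq M X)" unfolding halfq_def by (rule quotm_c_module[OF js])
 show "mod_hom K C (E.rslice M X) (halfq M X) (\<lambda>Y. halfp M X Y)" using quotm_proj[OF js] unfolding halfq_def by simp
 fix Y assume Y: "Y \<in> Obj C"
 have sm: "submodule (E.jspan X (I X) M Y) K (On M (X, Y))" using js(2) Y by (simp add: subfunctor_def)
 interpret V: kmod K "On M (X, Y)" using on_kmod[OF js(1) Y] by simp
 show "u \<in> El (halfq M X) Y \<longleftrightarrow> (\<exists>x\<in>El M (X, Y). u = halfp M X Y x)" for u
  using V.quot_carrier by (auto simp: halfq_def)
 show "halfp M X Y x = 0[On (halfq M X) Y] \<longleftrightarrow> x \<in> E.jspan X (I X) M Y" if "x \<in> El M (X, Y)" for x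
  using V.coset_eq_self_iff[OF sm that] by (simp add: halfq_def V.quot_zero)
qed

text \<open>\<open>left_reduction\<close> gives the exactness modulo \<open>jspan\<close>. The
  augmentation sends the left translates by \<open>I\<close> into \<open>I\<close>, so the complex
  resolves \<open>C(X,-)/I(X,-)\<close>, that is \<open>B(X,-)\<close> as a
  \<open>C\<close>-module.\<close>

lemma halfq_resolution:
 fixes P :: "nat \<Rightarrow> ('k, 'o \<times> 'o, ('m \<times> 'm \<Rightarrow> 'k) set, 'v) cmod"
 assumes fK: "field K" and R: "resolution K E.TC CC P d \<epsilon>" and pr: "\<And>n. projective K E.TC (P n)" and X: "X \<in> Obj C"
 obtains D e where "resolution K C (quotm (representable C X) (I X)) (\<lambda>n. halfq (P n) X) D e"
  "\<And>n Y x. Y \<in> Obj C ==> x \<in> El (P (Suc n)) (X, Y) ==> D n Y (halfp (P (Suc n)) X Y x) = halfp (P n) X Y (d n (X, Y) x)"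
  "\<And>Y x. Y \<in> Obj C ==> x \<in> El (P 0) (X, Y) ==> e Y (halfp (P 0) X Y x) = I X Y +>[Hom C X Y] \<epsilon> (X, Y) x"
proof -
 interpret R: resolution K E.TC CC P d \<epsilon> by fact
 have X': "X \<in> Obj (op_cat C)" using X by simp
 have O: "X' \<in> Obj C ==> Y \<in> Obj C ==> (X', Y) \<in> Obj E.TC" for X' Y by (simp add: E_obj)
 have "resolution K C (E.rslice CC X) (\<lambda>n. E.rslice (P n) X) (\<lambda>n Y. d n (X, Y)) (\<lambda>Y. \<epsilon> (X, Y))"
  by (rule E.rslice_resolution[OF X' R])
 then have RX: "resolution K C (representable C X) (\<lambda>n. E.rslice (P n) X) (\<lambda>n Y. d n (X, Y)) (\<lambda>Y. \<epsilon> (X, Y))"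
 proof (rule resolution_cong[OF _ representable_c_module[OF X]])
  fix Y Y' f x assume Y: "Y \<in> Obj C" and Y': "Y' \<in> Obj C" and f: "f \<in> Mor C Y Y'" and "x \<in> El (E.rslice CC X) Y"
  then have x: "x \<in> Mor C X Y" by simp
  have fi: "(Id C X, f) \<in> E.pr (X, Y) (X, Y')" using f id_closed[OF X] by simp
  have x': "x \<in> El CC (X, Y)" using x by simp
  show "Act (representable C X) Y Y' f x = Act (E.rslice CC X) Y Y' f x"
   using hom_bimod_c_module(2)[OF O[OF X Y] O[OF X Y'] fi x'] comp_id_right[OF X Y x] by simp
 qed simp
 note js = jspan_sub[OF R.P X]
 have dj: "d n (X, Y) x \<in> E.jspan X (I X) (P n) Y" if "Y \<in> Obj C" "x \<in> E.jspan X (I X) (P (Suc n)) Y" for n Y x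
  by (rule E.jspan_hom[where J = "I X", OF X' J_carrier[OF X] J_comp[OF X] R.P R.P R.d that])
 have ej: "\<epsilon> (X, Y) x \<in> I X Y" if Y: "Y \<in> Obj C" and x: "x \<in> E.jspan X (I X) (P 0) Y" for Y x
 proof (rule E.jspan_mapsto[where J = "I X", OF X' J_carrier[OF X] J_comp[OF X] R.P Y hom_module[OF X Y] _ ideal_submodule[OF X Y] x])
  show "\<epsilon> (X, Y) \<in> lin_maps K (On (P 0) (X, Y)) (Hom C X Y)" using hom_lin[OF R.eps O[OF X Y]] by simp
  fix X1 c p assume "X1 \<in> Obj (op_cat C)" and c: "c \<in> I X X1" and p: "p \<in> El (P 0) (X1, Y)"
  then have X1: "X1 \<in> Obj C" by simp
  note cc = I_carrier[OF X X1 c]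
  have ci: "(c, Id C Y) \<in> E.pr (X1, Y) (X, Y)" using cc id_closed[OF Y] by simp
  have ep: "\<epsilon> (X1, Y) p \<in> El CC (X1, Y)" by (rule hom_closed[OF R.eps O[OF X1 Y] p])
  then have ep': "\<epsilon> (X1, Y) p \<in> Mor C X1 Y" by simp
  have cI: "Comp C X X1 Y (\<epsilon> (X1, Y) p) c \<in> I X Y" by (rule ideal_comp_left[OF X X1 Y c ep'])
  show "\<epsilon> (X, Y) (Act (P 0) (X1, Y) (X, Y) (E.tm (X1, Y) (X, Y) (c, Id C Y)) p) \<in> I X Y"
   unfolding hom_nat[OF R.eps O[OF X1 Y] O[OF X Y] E.tm_closed[OF O[OF X1 Y] O[OF X Y] ci] p] hom_bimod_c_module(2)[OF O[OF X1 Y] O[OF X Y] ci ep]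
   using cI comp_id_left[OF X Y I_carrier[OF X Y cI]] by simp
 qed
 note lr = left_reduction[OF fK R pr]
 let ?T = "quotm (representable C X) (I X)"
 note Rm = representable_c_module[OF X] and sf = ideal_subfunctor[OF X]
 have pz: "q X Y h = 0[On ?T Y] \<longleftrightarrow> h \<in> I X Y" if "Y \<in> Obj C" "h \<in> Mor C X Y" for Y h
  using kmod.coset_eq_self_iff[OF hom_kmod[OF X that(1)] ideal_submodule[OF X that(1)] that(2)] kmod.quot_zero[OF hom_kmod[OF X that(1)]] by simp
 have e: "mod_hom K C (E.rslice (P 0) X) ?T (\<lambda>Y x. q X Y (\<epsilon> (X, Y) x))"
  using hom_comp[OF resolution.eps[OF RX] quotm_proj[OF Rm sf]] by simp
 have ec: "Y \<in> Obj C ==> x \<in> El (P 0) (X, Y) ==> \<epsilon> (X, Y) x \<in> Mor C X Y" for Y x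
  using hom_closed[OF resolution.eps[OF RX], of Y x] by simp
 show ?thesis
 proof (rule quotient_resolution[OF RX js(2) quotm_c_module[OF Rm sf] e])
  fix Y assume Y: "Y \<in> Obj C"
  { fix y assume "y \<in> carrier (On ?T Y)"
   then obtain h where "h \<in> Mor C X Y" "y = q X Y h" using kmod.quot_carrier[OF hom_kmod[OF X Y]] by auto
   then show "\<exists>x\<in>El (E.rslice (P 0) X) Y. q X Y (\<epsilon> (X, Y) x) = y" using resolution.eps_onto[OF RX Y, of h] by auto }
  { fix x assume "x \<in> El (E.rslice (P (Suc 0)) X) Y"
   then show "q X Y (\<epsilon> (X, Y) (d 0 (X, Y) x)) = 0[On ?T Y]"
    using pz[OF Y, of "0[Hom C X Y]"] resolution.eps_d[OF RX Y, of x] mod_closed(1)[OF hom_module[OF X Y]]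
     module.submodule_props(2)[OF hom_module[OF X Y] ideal_submodule[OF X Y]] by simp }
  { fix x assume x: "x \<in> E.jspan X (I X) (P 0) Y"
   have "\<epsilon> (X, Y) x \<in> I X Y" by (rule ej[OF Y x])
   then show "q X Y (\<epsilon> (X, Y) x) = 0[On ?T Y]" using pz[OF Y I_carrier[OF X Y]] by blast }
  { fix p assume p: "p \<in> El (E.rslice (P 0) X) Y" and "q X Y (\<epsilon> (X, Y) p) = 0[On ?T Y]"
   then have "\<epsilon> (X, Y) p \<in> I X Y" using pz[OF Y ec[OF Y]] by simp
   then show "\<exists>r\<in>El (E.rslice (P (Suc 0)) X) Y. p -[On (E.rslice (P 0) X) Y] d 0 (X, Y) r \<in> E.jspan X (I X) (P 0) Y"
    using lr(1)[OF X Y] p by simp }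
 next
  fix D e' assume De: "resolution K C ?T (\<lambda>n. quotm (E.rslice (P n) X) (E.jspan X (I X) (P n))) D e'"
   "\<And>n Y x. Y \<in> Obj C ==> x \<in> El (E.rslice (P (Suc n)) X) Y ==>
    D n Y (E.jspan X (I X) (P (Suc n)) Y +>[On (E.rslice (P (Suc n)) X) Y] x) = E.jspan X (I X) (P n) Y +>[On (E.rslice (P n) X) Y] d n (X, Y) x"
   "\<And>Y x. Y \<in> Obj C ==> x \<in> El (E.rslice (P 0) X) Y ==>
    e' Y (E.jspan X (I X) (P 0) Y +>[On (E.rslice (P 0) X) Y] x) = q X Y (\<epsilon> (X, Y) x)"
  show thesis by (rule that[unfolded halfq_def, OF De(1)]) (use De(2,3) in simp_all)
 qed (use dj lr(2)[OF X] in simp_all)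
qed

end

section \<open>Both actions of the ideal together\<close>

context ideal_kcat
begin

abbreviation bi_ideal where "bi_ideal Z' Z x \<equiv> fst x \<in> I (fst Z) (fst Z') \<or> snd x \<in> I (snd Z') (snd Z)"

text \<open>This is \<open>I M + M I\<close>: pure tensors with at least one component in the ideal
  span the kernel of the projection from \<open>C^e\<close> to \<open>B^e\<close>.\<close>

definition bi_span :: "('k, 'o \<times> 'o, ('m \<times> 'm \<Rightarrow> 'k) set, 'v) cmod \<Rightarrow> 'o \<times> 'o \<Rightarrow> 'v set" where
 "bi_span M Z = lin_span K (On M Z) {Act M Z' Z (E.tm Z' Z x) p |Z' x p.
   Z' \<in> Obj E.TC \<and> x \<in> E.pr Z' Z \<and> bi_ideal Z' Z x \<and> p \<in> El M Z'}"

lemma bi_span_gen: "Z' \<in> Obj E.TC ==> x \<in> E.pr Z' Z ==> bi_ideal Z' Z x ==> p \<in> El M Z' ==>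
  Act M Z' Z (E.tm Z' Z x) p \<in> bi_span M Z"
 unfolding bi_span_def by (rule lin_span_inc) blast

lemma bi_span_gens_carrier:
 assumes "c_module K E.TC M" "Z \<in> Obj E.TC"
 shows "{Act M Z' Z (E.tm Z' Z x) p |Z' x p. Z' \<in> Obj E.TC \<and> x \<in> E.pr Z' Z \<and> bi_ideal Z' Z x \<and> p \<in> El M Z'} \<subseteq> El M Z"
proof -
 have "Act M Z' Z (E.tm Z' Z x) p \<in> El M Z" if "Z' \<in> Obj E.TC" "x \<in> E.pr Z' Z" "p \<in> El M Z'" for Z' x p
  by (rule E.pure_act(2)[OF assms(1) that(1) assms(2) that(2,3)])
 then show ?thesis by blast
qed

lemma bi_span_submodule: "c_module K E.TC M ==> Z \<in> Obj E.TC ==> submodule (bi_span M Z) K (On M Z)"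
 unfolding bi_span_def by (rule lin_span_submodule(1)[OF c_module.on_module bi_span_gens_carrier])

lemma bi_span_mapsto:
 assumes M: "c_module K E.TC M" and Z: "Z \<in> Obj E.TC" and W: "module K W" and T: "T \<in> lin_maps K (On M Z) W"
  and H: "submodule H K W" and x: "x \<in> bi_span M Z"
  and g: "\<And>Z' x p. Z' \<in> Obj E.TC ==> x \<in> E.pr Z' Z ==> bi_ideal Z' Z x ==> p \<in> El M Z' ==> T (Act M Z' Z (E.tm Z' Z x) p) \<in> H"
 shows "T x \<in> H"
proof (rule lin_span_mapsto[OF c_module.on_module[OF M Z] W T bi_span_gens_carrier[OF M Z] H _ x[unfolded bi_span_def]])
 fix y assume "y \<in> {Act M Z' Z (E.tm Z' Z x) p |Z' x p. Z' \<in> Obj E.TC \<and> x \<in> E.pr Z' Z \<and> bi_ideal Z' Z x \<and> p \<in> El M Z'}"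
 then obtain Z' x p where "y = Act M Z' Z (E.tm Z' Z x) p" and *: "Z' \<in> Obj E.TC" "x \<in> E.pr Z' Z" "bi_ideal Z' Z x" "p \<in> El M Z'" by blast
 then show "T y \<in> H" using g[OF *] by simp
qed

lemma bi_span_hom:
 assumes M: "c_module K E.TC M" and N: "c_module K E.TC N" and h: "mod_hom K E.TC M N \<eta>" and Z: "Z \<in> Obj E.TC" and x: "x \<in> bi_span M Z"
 shows "\<eta> Z x \<in> bi_span N Z"
proof (rule bi_span_mapsto[OF M Z c_module.on_module[OF N Z] hom_lin[OF h Z] bi_span_submodule[OF N Z] x])
 fix Z' x p assume Z': "Z' \<in> Obj E.TC" and x: "x \<in> E.pr Z' Z" "bi_ideal Z' Z x" and p: "p \<in> El M Z'"
 show "\<eta> Z (Act M Z' Z (E.tm Z' Z x) p) \<in> bi_span N Z"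
  unfolding hom_nat[OF h Z' Z E.tm_closed[OF Z' Z x(1)] p] by (rule bi_span_gen[OF Z' x hom_closed[OF h Z' p]])
qed

lemma E_objD: "Z \<in> Obj E.TC ==> fst Z \<in> Obj C" "Z \<in> Obj E.TC ==> snd Z \<in> Obj C"
 by (simp_all add: E.TC_simps(1))

lemma E_prD: "x \<in> E.pr Z Z' ==> fst x \<in> Mor C (fst Z') (fst Z)" "x \<in> E.pr Z Z' ==> snd x \<in> Mor C (snd Z) (snd Z')"
 by auto

lemma bi_span_subfunctor:
 assumes M: "c_module K E.TC M" shows "E.T.subfunctor M (bi_span M)"
proof (rule E.tensor_subfunctorI[OF M bi_span_submodule[OF M]])
 fix Z Z' x h assume Z: "Z \<in> Obj E.TC" and Z': "Z' \<in> Obj E.TC" and x: "x \<in> E.pr Z Z'" and h: "h \<in> bi_span M Z"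
 show "Act M Z Z' (E.tm Z Z' x) h \<in> bi_span M Z'"
 proof (rule bi_span_mapsto[OF M Z c_module.on_module[OF M Z'] E.pure_act(1)[OF M Z Z' x] bi_span_submodule[OF M Z'] h])
  fix W y p assume W: "W \<in> Obj E.TC" and y: "y \<in> E.pr W Z" "bi_ideal W Z y" and p: "p \<in> El M W"
  have "bi_ideal W Z' (E.pcomp W Z Z' x y)"
   using y(2) ideal_comp_right[OF E_objD(1)[OF Z'] E_objD(1)[OF Z] E_objD(1)[OF W] E_prD(1)[OF x], of "fst y"]
    ideal_comp_left[OF E_objD(2)[OF W] E_objD(2)[OF Z] E_objD(2)[OF Z'] _ E_prD(2)[OF x], of "snd y"]
   by (auto simp: E.pcomp_def)
  then show "Act M Z Z' (E.tm Z Z' x) (Act M W Z (E.tm W Z y) p) \<in> bi_span M Z'"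
   unfolding E.pure_act(5)[OF M W Z Z' x y(1) p, symmetric]
   by (intro bi_span_gen[OF W E.pcomp_closed[OF W Z Z' x y(1)] _ p])
 qed
qed

lemma id_lin: "(\<lambda>x. x) \<in> lin_maps K V V"
 by (auto simp: lin_maps_def)

lemma jspan_bi_span:
 assumes M: "c_module K E.TC M" and X: "X \<in> Obj C" and Y: "Y \<in> Obj C" and x: "x \<in> E.jspan X (I X) M Y"
 shows "x \<in> bi_span M (X, Y)"
proof -
 have X': "X \<in> Obj (op_cat C)" using X by simp
 have Z: "(X, Y) \<in> Obj E.TC" using X Y by (simp add: E_obj)
 show ?thesis
 proof (rule E.jspan_mapsto[where J = "I X" and T = "\<lambda>x. x", OF X' J_carrier[OF X] J_comp[OF X] M Y c_module.on_module[OF M Z] id_lin bi_span_submodule[OF M Z] x])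
  fix X1 c p assume "X1 \<in> Obj (op_cat C)" and c: "c \<in> I X X1" and p: "p \<in> El M (X1, Y)"
  then have X1: "X1 \<in> Obj C" by simp
  show "Act M (X1, Y) (X, Y) (E.tm (X1, Y) (X, Y) (c, Id C Y)) p \<in> bi_span M (X, Y)"
  proof (rule bi_span_gen[OF _ _ _ p])
   show "(X1, Y) \<in> Obj E.TC" using X1 Y by (simp add: E_obj)
   show "(c, Id C Y) \<in> E.pr (X1, Y) (X, Y)" using I_carrier[OF X X1 c] id_closed[OF Y] by simp
   show "bi_ideal (X1, Y) (X, Y) (c, Id C Y)" using c by simp
  qed
 qed
qed

text \<open>Dividing by \<open>I M + M I\<close> is dividing by the left action first and by the
  right action afterwards. A generator \<open>(f, g)\<close> factors as
  \<open>(f, id) (id, g)\<close>, which dies in \<open>halfq\<close> if \<open>f\<close> is in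
  \<open>I\<close>, and as \<open>(id, g) (f, id)\<close>, which lands in the right span if
  \<open>g\<close> is.\<close>

lemma bi_span_iff:
 assumes M: "c_module K E.TC M" and X: "X \<in> Obj C" and Y: "Y \<in> Obj C" and x: "x \<in> El M (X, Y)"
 shows "x \<in> bi_span M (X, Y) \<longleftrightarrow> halfp M X Y x \<in> ideal_span (halfq M X) Y"
proof
 note hq = halfq_facts[OF M X]
 have O: "X' \<in> Obj C ==> Y' \<in> Obj C ==> (X', Y') \<in> Obj E.TC" for X' Y' by (simp add: E_obj)
 note Z = O[OF X Y]
 have pl: "halfp M X Y \<in> lin_maps K (On M (X, Y)) (On (halfq M X) Y)" using hom_lin[OF hq(2) Y] by simp
 have pn: "halfp M X Y (Act M (X, Y') (X, Y) (E.tm (X, Y') (X, Y) (Id C X, g)) w) = Act (halfq M X) Y' Y g (halfp M X Y' w)"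
  if "Y' \<in> Obj C" "g \<in> Mor C Y' Y" "w \<in> El M (X, Y')" for Y' g w
  using hom_nat[OF hq(2) that(1) Y that(2), of w] that(3) by simp
 interpret V: kmod K "On M (X, Y)" by (rule on_kmod[OF M Z])
 interpret W: kmod K "On (halfq M X) Y" by (rule on_kmod[OF hq(1) Y])
 {
  assume "x \<in> bi_span M (X, Y)"
  then show "halfp M X Y x \<in> ideal_span (halfq M X) Y"
  proof (rule bi_span_mapsto[OF M Z W.module_axioms pl ideal_span_submodule[OF hq(1) Y]])
   fix Z' y p assume Z': "Z' \<in> Obj E.TC" and y: "y \<in> E.pr Z' (X, Y)" "bi_ideal Z' (X, Y) y" and p: "p \<in> El M Z'"
   obtain X' Y' where Zp: "Z' = (X', Y')" by (cases Z')
   obtain f g where yp: "y = (f, g)" by (cases y)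
   have O': "X' \<in> Obj C" "Y' \<in> Obj C" using Z' by (simp_all add: Zp E_obj)
   have m: "f \<in> Mor C X X'" "g \<in> Mor C Y' Y" using y(1) by (simp_all add: Zp yp)
   have p': "p \<in> El M (X', Y')" using p by (simp add: Zp)
   note i = id_closed[OF X] id_closed[OF Y] id_closed[OF O'(1)] id_closed[OF O'(2)]
   from y(2) consider "f \<in> I X X'" | "g \<in> I Y' Y" by (auto simp: Zp yp)
   then show "halfp M X Y (Act M Z' (X, Y) (E.tm Z' (X, Y) y) p) \<in> ideal_span (halfq M X) Y"
   proof cases
    case 1
    have m1: "(f, Id C Y) \<in> E.pr (X', Y) (X, Y)" "(Id C X', g) \<in> E.pr (X', Y') (X', Y)" using m i by simp_all
    have pc: "E.pcomp (X', Y') (X', Y) (X, Y) (f, Id C Y) (Id C X', g) = (f, g)"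
     using m O' X Y by (simp add: E.pcomp_def comp_id_left comp_id_right)
    let ?w = "Act M (X', Y') (X', Y) (E.tm (X', Y') (X', Y) (Id C X', g)) p"
    have wc: "?w \<in> El M (X', Y)" by (rule E.pure_act(2)[OF M O[OF O'] O[OF O'(1) Y] m1(2) p'])
    have X': "X \<in> Obj (op_cat C)" "X' \<in> Obj (op_cat C)" using X O' by simp_all
    have "Act M (X', Y') (X, Y) (E.tm (X', Y') (X, Y) (f, g)) p = Act M (X', Y) (X, Y) (E.tm (X', Y) (X, Y) (f, Id C Y)) ?w"
     using E.pure_act(5)[OF M O[OF O'] O[OF O'(1) Y] Z m1 p'] unfolding pc .
    also have "\<dots> \<in> E.jspan X (I X) M Y"
     by (rule E.jspan_gen[where J = "I X", OF X'(1) J_carrier[OF X] J_comp[OF X] X'(2) 1 wc])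
    finally have j: "Act M Z' (X, Y) (E.tm Z' (X, Y) y) p \<in> E.jspan X (I X) M Y" by (simp add: Zp yp)
    have "halfp M X Y (Act M Z' (X, Y) (E.tm Z' (X, Y) y) p) = 0[On (halfq M X) Y]"
     using hq(4)[OF Y E.pure_act(2)[OF M Z' Z y(1) p]] j by blast
    then show ?thesis using W.submodule_props(2)[OF ideal_span_submodule[OF hq(1) Y]] by simp
   next
    case 2
    have m1: "(Id C X, g) \<in> E.pr (X, Y') (X, Y)" "(f, Id C Y') \<in> E.pr (X', Y') (X, Y')" using m i by simp_all
    have pc: "E.pcomp (X', Y') (X, Y') (X, Y) (Id C X, g) (f, Id C Y') = (f, g)"
     using m O' X Y by (simp add: E.pcomp_def comp_id_left comp_id_right)
    let ?w = "Act M (X', Y') (X, Y') (E.tm (X', Y') (X, Y') (f, Id C Y')) p"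
    have wc: "?w \<in> El M (X, Y')" by (rule E.pure_act(2)[OF M O[OF O'] O[OF X O'(2)] m1(2) p'])
    have "Act M (X', Y') (X, Y) (E.tm (X', Y') (X, Y) (f, g)) p = Act M (X, Y') (X, Y) (E.tm (X, Y') (X, Y) (Id C X, g)) ?w"
     using E.pure_act(5)[OF M O[OF O'] O[OF X O'(2)] Z m1 p'] unfolding pc .
    then have "halfp M X Y (Act M Z' (X, Y) (E.tm Z' (X, Y) y) p) = Act (halfq M X) Y' Y g (halfp M X Y' ?w)"
     unfolding Zp yp using pn[OF O'(2) m(2) wc] by (rule trans[OF arg_cong])
    also have "\<dots> \<in> ideal_span (halfq M X) Y"
     by (rule ideal_span_gen[where M = "halfq M X", OF O'(2) 2]) (use hq(3)[OF O'(2)] wc in blast)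
    finally show ?thesis .
   qed
  qed
 }
 assume px: "halfp M X Y x \<in> ideal_span (halfq M X) Y"
 note bs = V.submodule_props[OF bi_span_submodule[OF M Z]]
 \<comment> \<open>The image of \<open>bi_span\<close> is a subspace that contains the generators of
   the right span. Since \<open>jspan\<close> lies in \<open>bi_span\<close>, membership of the
   image can be pulled back to \<open>x\<close>.\<close>
 have im: "submodule (halfp M X Y ` bi_span M (X, Y)) K (On (halfq M X) Y)"
 proof -
  have "halfp M X Y \<in> lin_maps K ((On M (X, Y))\<lparr>carrier := bi_span M (X, Y)\<rparr>) (On (halfq M X) Y)"
   by (rule lin_mapsI) (simp_all add: lin_closed[OF pl] lin_add[OF pl] lin_smult[OF pl] subsetD[OF bs(1)])
  from image_submodule[OF submodule.submodule_is_module[OF bi_span_submodule[OF M Z] V.module_axioms] W.module_axioms this]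
  show ?thesis by simp
 qed
 have "halfp M X Y x \<in> halfp M X Y ` bi_span M (X, Y)"
 proof (rule ideal_span_mapsto[where T = "\<lambda>x. x", OF hq(1) Y W.module_axioms id_lin im px])
  fix Y' g u assume Y': "Y' \<in> Obj C" and g: "g \<in> I Y' Y" and "u \<in> El (halfq M X) Y'"
  then obtain w where w: "w \<in> El M (X, Y')" "u = halfp M X Y' w" using hq(3)[OF Y'] by blast
  have gc: "g \<in> Mor C Y' Y" by (rule I_carrier[OF Y' Y g])
  have "Act M (X, Y') (X, Y) (E.tm (X, Y') (X, Y) (Id C X, g)) w \<in> bi_span M (X, Y)"
   by (rule bi_span_gen[OF O[OF X Y'] _ _ w(1)]) (use gc g id_closed[OF X] in auto)
  then show "Act (halfq M X) Y' Y g u \<in> halfp M X Y ` bi_span M (X, Y)" unfolding w(2) pn[OF Y' gc w(1), symmetric] by blast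
 qed
 then obtain y where y: "y \<in> bi_span M (X, Y)" "halfp M X Y x = halfp M X Y y" by blast
 have yc: "y \<in> El M (X, Y)" using bs(1) y(1) by blast
 have sm: "submodule (E.jspan X (I X) M Y) K (On M (X, Y))" using jspan_sub(2)[OF M X] Y by (simp add: subfunctor_def)
 have "x -[On M (X, Y)] y \<in> E.jspan X (I X) M Y" using V.coset_eq_iff[OF sm x yc] y(2) by simp
 then have "x -[On M (X, Y)] y \<in> bi_span M (X, Y)" by (rule jspan_bi_span[OF M X Y])
 from bs(3)[OF this y(1)] show "x \<in> bi_span M (X, Y)" using V.minus_add_cancel[OF x yc] by simp
qed

abbreviation "IZ \<equiv> \<lambda>Z. I (fst Z) (snd Z)"

lemma IZ_subfunctor: "E.T.subfunctor CC IZ"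
proof (rule E.tensor_subfunctorI[OF hom_bimod_c_module(1)])
 show "submodule (IZ Z) K (On CC Z)" if "Z \<in> Obj E.TC" for Z using ideal_submodule[OF E_objD[OF that]] by simp
 fix Z Z' x h assume Z: "Z \<in> Obj E.TC" "Z' \<in> Obj E.TC" and x: "x \<in> E.pr Z Z'" and h: "h \<in> IZ Z"
 note o = E_objD[OF Z(1)] E_objD[OF Z(2)] and m = E_prD[OF x]
 have hc: "h \<in> El CC Z" using I_carrier[OF o(1,2) h] by simp
 show "Act CC Z Z' (E.tm Z Z' x) h \<in> IZ Z'"
  unfolding hom_bimod_c_module(2)[OF Z x hc]
  by (rule ideal_comp_left[OF o(3,2,4) ideal_comp_right[OF o(3,1,2) m(1) h] m(2)])
qed

lemma hom_bimod_bi_ideal: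
 assumes "Z \<in> Obj E.TC" "Z' \<in> Obj E.TC" "x \<in> E.pr Z' Z" "bi_ideal Z' Z x" "h \<in> El CC Z'"
 shows "Act CC Z' Z (E.tm Z' Z x) h \<in> IZ Z"
proof -
 note o = E_objD[OF assms(1)] E_objD[OF assms(2)] and m = E_prD[OF assms(3)]
 have h: "h \<in> Mor C (fst Z') (snd Z')" using assms(5) by simp
 note hc = comp_closed[OF o(1,3,4) m(1) h]
 show ?thesis
  unfolding hom_bimod_c_module(2)[OF assms(2,1,3,5)]
  using assms(4) ideal_comp_left[OF o(1,4,2) ideal_comp_left[OF o(1,3,4) _ h] m(2)] ideal_comp_right[OF o(1,4,2) hc, of "snd x"] by blast
qed

text \<open>Exactness is a pointwise matter, so \<open>X\<close> can be fixed. There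
  \<open>halfq\<close> gives a projective resolution of a module annihilated by \<open>I\<close>, to
  which \<open>annihilated_reduction\<close> applies for the right action;
  \<open>bi_span_iff\<close> translates the outcome.\<close>

lemma biq_resolution:
 fixes P :: "nat \<Rightarrow> ('k, 'o \<times> 'o, ('m \<times> 'm \<Rightarrow> 'k) set, 'v) cmod"
 assumes fK: "field K" and idem: "idempotent_ideal C I" and pI: "\<And>X. X \<in> Obj C ==> projective K C (ideal_at C I X)"
  and R: "resolution K E.TC CC P d \<epsilon>" and pr: "\<And>n. projective K E.TC (P n)"
 obtains D e where "resolution K E.TC (E.T.quotm CC IZ) (\<lambda>n. E.T.quotm (P n) (bi_span (P n))) D e"
  "\<And>n Z x. Z \<in> Obj E.TC ==> x \<in> El (P (Suc n)) Z ==>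
    D n Z (bi_span (P (Suc n)) Z +>[On (P (Suc n)) Z] x) = bi_span (P n) Z +>[On (P n) Z] d n Z x"
  "\<And>Z x. Z \<in> Obj E.TC ==> x \<in> El (P 0) Z ==> e Z (bi_span (P 0) Z +>[On (P 0) Z] x) = IZ Z +>[On CC Z] \<epsilon> Z x"
proof -
 interpret R: resolution K E.TC CC P d \<epsilon> by fact
 have dS: "d n Z x \<in> bi_span (P n) Z" if "Z \<in> Obj E.TC" "x \<in> bi_span (P (Suc n)) Z" for n Z x
  by (rule bi_span_hom[OF R.P R.P R.d that])
 have eS: "\<epsilon> Z x \<in> IZ Z" if Z: "Z \<in> Obj E.TC" and x: "x \<in> bi_span (P 0) Z" for Z x
 proof (rule bi_span_mapsto[OF R.P Z c_module.on_module[OF R.M Z] hom_lin[OF R.eps Z] _ x])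
  show "submodule (IZ Z) K (On CC Z)" using ideal_submodule[OF E_objD[OF Z]] by simp
  fix Z' y p assume Z': "Z' \<in> Obj E.TC" and y: "y \<in> E.pr Z' Z" "bi_ideal Z' Z y" and p: "p \<in> El (P 0) Z'"
  show "\<epsilon> Z (Act (P 0) Z' Z (E.tm Z' Z y) p) \<in> IZ Z"
   unfolding hom_nat[OF R.eps Z' Z E.tm_closed[OF Z' Z y(1)] p]
   by (rule hom_bimod_bi_ideal[OF Z Z' y hom_closed[OF R.eps Z' p]])
 qed
 have r: "(p \<in> El (P 0) (X, Y) \<longrightarrow> \<epsilon> (X, Y) p \<in> I X Y \<longrightarrow>
   (\<exists>r\<in>El (P (Suc 0)) (X, Y). p -[On (P 0) (X, Y)] d 0 (X, Y) r \<in> bi_span (P 0) (X, Y))) \<and>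
   (p \<in> El (P (Suc n)) (X, Y) \<longrightarrow> d n (X, Y) p \<in> bi_span (P n) (X, Y) \<longrightarrow>
   (\<exists>r\<in>El (P (Suc (Suc n))) (X, Y). p -[On (P (Suc n)) (X, Y)] d (Suc n) (X, Y) r \<in> bi_span (P (Suc n)) (X, Y)))"
  if X: "X \<in> Obj C" and Y: "Y \<in> Obj C" for X Y p n
 proof -
  obtain D e where De: "resolution K C (quotm (representable C X) (I X)) (\<lambda>n. halfq (P n) X) D e"
   "\<And>n Y x. Y \<in> Obj C ==> x \<in> El (P (Suc n)) (X, Y) ==> D n Y (halfp (P (Suc n)) X Y x) = halfp (P n) X Y (d n (X, Y) x)"
   "\<And>Y x. Y \<in> Obj C ==> x \<in> El (P 0) (X, Y) ==> e Y (halfp (P 0) X Y x) = I X Y +>[Hom C X Y] \<epsilon> (X, Y) x"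
   by (rule halfq_resolution[OF fK R pr X]) (rule that)
  have X': "X \<in> Obj (op_cat C)" using X by simp
  have ph: "projective K C (halfq (P n) X)" for n
   unfolding halfq_def by (rule E.quot_rslice_projective[where J = "I X", OF X' J_carrier[OF X] J_comp[OF X] fK pr])
  let ?T = "quotm (representable C X) (I X)"
  have "annihilated ?T"
   by (rule quotm_annihilated[OF representable_c_module[OF X] ideal_subfunctor[OF X]]) (simp add: ideal_comp_right X)
  note qr = annihilated_reduction[OF idem pI De(1) ph this Y]
  note hq = halfq_facts[OF R.P X]
  have Z: "(X, Y) \<in> Obj E.TC" using X Y by (simp add: E_obj)
  have dc: "x \<in> El (P (Suc n)) (X, Y) ==> d n (X, Y) x \<in> El (P n) (X, Y)" for x n by (rule hom_closed[OF R.d Z])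
  have minus: "halfp (P n) X Y (x -[On (P n) (X, Y)] y) = halfp (P n) X Y x -[On (halfq (P n) X) Y] halfp (P n) X Y y"
   if "x \<in> El (P n) (X, Y)" "y \<in> El (P n) (X, Y)" for n x y
   using hom_minus[OF hq(2) jspan_sub(1)[OF R.P X] hq(1) Y, of x n y] that by simp
  have cl: "x -[On (P n) (X, Y)] d n (X, Y) r \<in> El (P n) (X, Y)"
   if "x \<in> El (P n) (X, Y)" "r \<in> El (P (Suc n)) (X, Y)" for n x r
   using mod_closed(3)[OF c_module.on_module[OF R.P Z] that(1) dc[OF that(2)]] .
  have hc: "x \<in> El (P n) (X, Y) ==> halfp (P n) X Y x \<in> El (halfq (P n) X) Y" for n x using hq(3)[OF Y] by blast
  \<comment> \<open>Passage from \<open>halfq\<close> back to \<open>P\<close>: a correction term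
    modulo the right span of \<open>halfq\<close> lifts to one modulo
    \<open>bi_span\<close>.\<close>
  have fin: "\<exists>r\<in>El (P (Suc n)) (X, Y). p -[On (P n) (X, Y)] d n (X, Y) r \<in> bi_span (P n) (X, Y)"
   if p: "p \<in> El (P n) (X, Y)"
    and ex: "\<exists>r\<in>El (halfq (P (Suc n)) X) Y. halfp (P n) X Y p -[On (halfq (P n) X) Y] D n Y r \<in> ideal_span (halfq (P n) X) Y" for p n
  proof -
   from ex obtain u where u: "u \<in> El (halfq (P (Suc n)) X) Y" "halfp (P n) X Y p -[On (halfq (P n) X) Y] D n Y u \<in> ideal_span (halfq (P n) X) Y" by blast
   from u(1) obtain r where r: "r \<in> El (P (Suc n)) (X, Y)" "u = halfp (P (Suc n)) X Y r" using hq(3)[OF Y] by blast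
   have "halfp (P n) X Y (p -[On (P n) (X, Y)] d n (X, Y) r) \<in> ideal_span (halfq (P n) X) Y"
    using u(2) unfolding r(2) De(2)[OF Y r(1)] minus[OF p dc[OF r(1)], symmetric] .
   then have "p -[On (P n) (X, Y)] d n (X, Y) r \<in> bi_span (P n) (X, Y)" using bi_span_iff[OF R.P X Y cl[OF p r(1)]] by blast
   then show ?thesis using r(1) by blast
  qed
  show ?thesis
  proof (intro conjI impI)
   assume p: "p \<in> El (P 0) (X, Y)" and ep: "\<epsilon> (X, Y) p \<in> I X Y"
   have e0: "e Y (halfp (P 0) X Y p) = 0[On ?T Y]"
    using kmod.coset_eq_self_iff[OF hom_kmod[OF X Y] ideal_submodule[OF X Y] I_carrier[OF X Y ep]] ep kmod.quot_zero[OF hom_kmod[OF X Y]]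
    unfolding De(3)[OF Y p] by simp
   interpret V: kmod K "On (halfq (P 0) X) Y" by (rule on_kmod[OF hq(1) Y])
   obtain u where "u \<in> El (halfq (P (Suc 0)) X) Y" "D 0 Y u = halfp (P 0) X Y p" using resolution.exact0[OF De(1) Y hc[OF p] e0] by blast
   then have "\<exists>r\<in>El (halfq (P (Suc 0)) X) Y. halfp (P 0) X Y p -[On (halfq (P 0) X) Y] D 0 Y r \<in> ideal_span (halfq (P 0) X) Y"
    using V.minus_eq_zero_iff[OF hc[OF p] hc[OF p]] V.submodule_props(2)[OF ideal_span_submodule[OF hq(1) Y]] by (intro bexI[of _ u]) simp_all
   from fin[OF p this]
   show "\<exists>r\<in>El (P (Suc 0)) (X, Y). p -[On (P 0) (X, Y)] d 0 (X, Y) r \<in> bi_span (P 0) (X, Y)" .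
  next
   assume p: "p \<in> El (P (Suc n)) (X, Y)" and dp: "d n (X, Y) p \<in> bi_span (P n) (X, Y)"
   have dD: "D n Y (halfp (P (Suc n)) X Y p) \<in> ideal_span (halfq (P n) X) Y"
    unfolding De(2)[OF Y p] using bi_span_iff[OF R.P X Y dc[OF p]] dp by blast
   show "\<exists>r\<in>El (P (Suc (Suc n))) (X, Y). p -[On (P (Suc n)) (X, Y)] d (Suc n) (X, Y) r \<in> bi_span (P (Suc n)) (X, Y)"
    by (rule fin[OF p qr[OF _ hc[OF p] dD]])
  qed
 qed
 have r0: "\<exists>r\<in>El (P (Suc 0)) Z. p -[On (P 0) Z] d 0 Z r \<in> bi_span (P 0) Z"
  if "Z \<in> Obj E.TC" "p \<in> El (P 0) Z" "\<epsilon> Z p \<in> IZ Z" for Z p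
  using r[OF E_objD[OF that(1)], of p] that(2,3) by (cases Z) simp
 have rS: "\<exists>r\<in>El (P (Suc (Suc n))) Z. p -[On (P (Suc n)) Z] d (Suc n) Z r \<in> bi_span (P (Suc n)) Z"
  if "Z \<in> Obj E.TC" "p \<in> El (P (Suc n)) Z" "d n Z p \<in> bi_span (P n) Z" for n Z p
  using r[OF E_objD[OF that(1)], of p n] that(2,3) by (cases Z) simp
 note bsf = bi_span_subfunctor[OF R.P]
 note Cm = hom_bimod_c_module(1)
 have pz: "IZ Z +>[On CC Z] h = 0[On (E.T.quotm CC IZ) Z] \<longleftrightarrow> h \<in> IZ Z" if "Z \<in> Obj E.TC" "h \<in> El CC Z" for Z h
  using kmod.coset_eq_self_iff[OF on_kmod[OF Cm that(1)] _ that(2), of "IZ Z"] kmod.quot_zero[OF on_kmod[OF Cm that(1)]]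
   ideal_submodule[OF E_objD[OF that(1)]] by simp
 note ec = hom_closed[OF R.eps]
 show ?thesis
 proof (rule E.T.quotient_resolution[OF R bsf E.T.quotm_c_module[OF Cm IZ_subfunctor] hom_comp[OF R.eps E.T.quotm_proj[OF Cm IZ_subfunctor]]])
  fix Z assume Z: "Z \<in> Obj E.TC"
  show "\<exists>x\<in>El (P 0) Z. IZ Z +>[On CC Z] \<epsilon> Z x = y" if y: "y \<in> El (E.T.quotm CC IZ) Z" for y
  proof -
   obtain h where "h \<in> El CC Z" "y = IZ Z +>[On CC Z] h" using y kmod.quot_carrier[OF on_kmod[OF Cm Z]] by auto
   then show ?thesis using R.eps_onto[OF Z, of h] by blast
  qed
  show "IZ Z +>[On CC Z] \<epsilon> Z (d 0 Z x) = 0[On (E.T.quotm CC IZ) Z]" if "x \<in> El (P (Suc 0)) Z" for x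
   unfolding R.eps_d[OF Z that] by (rule hom_zero[OF E.T.quotm_proj[OF Cm IZ_subfunctor] Cm E.T.quotm_c_module[OF Cm IZ_subfunctor] Z])
  show "IZ Z +>[On CC Z] \<epsilon> Z x = 0[On (E.T.quotm CC IZ) Z]" if "x \<in> bi_span (P 0) Z" for x
   using pz[OF Z ec[OF Z E.T.subfunctor_carrier[OF R.P bsf Z that]]] eS[OF Z that] by blast
  show "\<exists>r\<in>El (P (Suc 0)) Z. p -[On (P 0) Z] d 0 Z r \<in> bi_span (P 0) Z"
   if "p \<in> El (P 0) Z" "IZ Z +>[On CC Z] \<epsilon> Z p = 0[On (E.T.quotm CC IZ) Z]" for p
   by (rule r0[OF Z that(1)]) (use pz[OF Z ec[OF Z that(1)]] that(2) in blast)
 qed (rule dS rS that; assumption)+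
qed

end

section \<open>Bimodules over the quotient category\<close>

context two_kcats
begin

lemma tensor_mod_hom_iff:
 assumes M: "c_module K TC M" and N: "c_module K TC N"
 shows "mod_hom K TC M N \<eta> \<longleftrightarrow> (\<forall>Z\<in>Obj TC. \<eta> Z \<in> lin_maps K (On M Z) (On N Z)) \<and>
  (\<forall>Z\<in>Obj TC. \<forall>Z'\<in>Obj TC. \<forall>x\<in>pr Z Z'. \<forall>h\<in>El M Z. \<eta> Z' (Act M Z Z' (tm Z Z' x) h) = Act N Z Z' (tm Z Z' x) (\<eta> Z h))"
proof
 assume h: "mod_hom K TC M N \<eta>"
 show "(\<forall>Z\<in>Obj TC. \<eta> Z \<in> lin_maps K (On M Z) (On N Z)) \<and>
  (\<forall>Z\<in>Obj TC. \<forall>Z'\<in>Obj TC. \<forall>x\<in>pr Z Z'. \<forall>h\<in>El M Z. \<eta> Z' (Act M Z Z' (tm Z Z' x) h) = Act N Z Z' (tm Z Z' x) (\<eta> Z h))"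
  by (intro conjI ballI hom_lin[OF h] hom_nat[OF h] tm_closed)
next
 assume a: "(\<forall>Z\<in>Obj TC. \<eta> Z \<in> lin_maps K (On M Z) (On N Z)) \<and>
  (\<forall>Z\<in>Obj TC. \<forall>Z'\<in>Obj TC. \<forall>x\<in>pr Z Z'. \<forall>h\<in>El M Z. \<eta> Z' (Act M Z Z' (tm Z Z' x) h) = Act N Z Z' (tm Z Z' x) (\<eta> Z h))"
 show "mod_hom K TC M N \<eta>"
  by (rule tensor_mod_homI[OF M N]) (simp only: a[THEN conjunct1, rule_format], simp only: a[THEN conjunct2, rule_format])
qed

end

context ideal_kcat
begin

sublocale EB: two_kcats K "op_cat B" B
 by (rule two_kcats.intro[OF B.op_kcat B.kcat_axioms])

text \<open>The spaces \<open>Hom B X Y\<close> are kept folded from here on, so that facts such as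
  \<open>q_add\<close> and \<open>q_smult\<close> and tensor products over \<open>B\<close> are
  matched.\<close>

declare B_simps(2) [simp del]

abbreviation "BB \<equiv> hom_bimod K B"

definition bq where "bq Z Z' x = (q (fst Z') (fst Z) (fst x), q (snd Z) (snd Z') (snd x))"

lemma EB_obj: "Z \<in> Obj EB.TC \<longleftrightarrow> Z \<in> Obj E.TC"
 by (simp add: E.TC_simps(1) EB.TC_simps(1))

lemma bq_closed:
 assumes "Z \<in> Obj E.TC" "Z' \<in> Obj E.TC" "x \<in> E.pr Z Z'" shows "bq Z Z' x \<in> EB.pr Z Z'"
 using q_closed[OF E_objD(1)[OF assms(2)] E_objD(1)[OF assms(1)] E_prD(1)[OF assms(3)]]
  q_closed[OF E_objD(2)[OF assms(1)] E_objD(2)[OF assms(2)] E_prD(2)[OF assms(3)]] by (simp add: bq_def)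

lemma bq_cases:
 assumes Z: "Z \<in> Obj E.TC" "Z' \<in> Obj E.TC" and y: "y \<in> EB.pr Z Z'"
 obtains x where "x \<in> E.pr Z Z'" "y = bq Z Z' x"
proof -
 have y': "fst y \<in> Mor B (fst Z') (fst Z)" "snd y \<in> Mor B (snd Z) (snd Z')" using y by auto
 obtain f where f: "f \<in> Mor C (fst Z') (fst Z)" "fst y = q (fst Z') (fst Z) f"
  by (rule B_cases[OF E_objD(1)[OF Z(2)] E_objD(1)[OF Z(1)] y'(1)]) (rule that)
 obtain g where g: "g \<in> Mor C (snd Z) (snd Z')" "snd y = q (snd Z) (snd Z') g"
  by (rule B_cases[OF E_objD(2)[OF Z(1)] E_objD(2)[OF Z(2)] y'(2)]) (rule that)
 show thesis by (rule that[of "(f, g)"]) (use f g in "simp_all add: bq_def prod_eq_iff")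
qed

lemma bq_comp:
 assumes Z: "Z \<in> Obj E.TC" "Z' \<in> Obj E.TC" "Z'' \<in> Obj E.TC" and x: "x \<in> E.pr Z' Z''" and y: "y \<in> E.pr Z Z'"
 shows "EB.pcomp Z Z' Z'' (bq Z' Z'' x) (bq Z Z' y) = bq Z Z'' (E.pcomp Z Z' Z'' x y)"
 using q_comp[OF E_objD(1)[OF Z(3)] E_objD(1)[OF Z(2)] E_objD(1)[OF Z(1)] E_prD(1)[OF x] E_prD(1)[OF y]]
  q_comp[OF E_objD(2)[OF Z(1)] E_objD(2)[OF Z(2)] E_objD(2)[OF Z(3)] E_prD(2)[OF y] E_prD(2)[OF x]]
 by (simp add: bq_def E.pcomp_def EB.pcomp_def)

lemma bq_id: "EB.pid Z = bq Z Z (E.pid Z)"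
 by (simp add: bq_def E.pid_def EB.pid_def)

text \<open>Restriction along the projection from \<open>C^e\<close> to \<open>B^e\<close>. That
  functor is not constructed on whole tensor products; its effect \<open>bq\<close> on pairs of
  morphisms determines the action.\<close>

definition resb :: "('k, 'o \<times> 'o, ('m set \<times> 'm set \<Rightarrow> 'k) set, 'v) cmod \<Rightarrow> ('k, 'o \<times> 'o, ('m \<times> 'm \<Rightarrow> 'k) set, 'v) cmod" where
 "resb N = \<lparr>On = On N, Act = (\<lambda>Z Z' A h. tlift K (On N Z') (\<lambda>x. Act N Z Z' (EB.tm Z Z' (bq Z Z' x)) h) A)\<rparr>"

lemma resb_On [simp]: "On (resb N) = On N"
 by (simp add: resb_def)

lemma resb_c_module:
 assumes N: "c_module K EB.TC N"
 shows "c_module K E.TC (resb N)"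
  and "\<And>Z Z' x h. Z \<in> Obj E.TC ==> Z' \<in> Obj E.TC ==> x \<in> E.pr Z Z' ==> h \<in> El N Z ==>
   Act (resb N) Z Z' (E.tm Z Z' x) h = Act N Z Z' (EB.tm Z Z' (bq Z Z' x)) h"
proof -
 let ?act = "\<lambda>Z Z' x h. Act N Z Z' (EB.tm Z Z' (bq Z Z' x)) h"
 note bm = E.bimod_c_module[where M = "resb N" and act = ?act]
 have 1: "module K (On (resb N) Z)" if "Z \<in> Obj E.TC" for Z using c_module.on_module[OF N] that by (simp add: EB_obj)
 have 2: "Act (resb N) Z Z' A h = tlift K (On (resb N) Z') (\<lambda>x. ?act Z Z' x h) A" for Z Z' A h
  by (simp add: resb_def)
 have 3: "?act Z Z' x \<in> lin_maps K (On (resb N) Z) (On (resb N) Z')" if "Z \<in> Obj E.TC" "Z' \<in> Obj E.TC" "x \<in> E.pr Z Z'" for Z Z' x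
  unfolding resb_On by (rule EB.pure_act(1)[OF N _ _ bq_closed[OF that]]) (simp_all add: EB_obj that)
 have 4: "bilin K (Hom (op_cat C) (fst Z) (fst Z')) (Hom C (snd Z) (snd Z')) (On (resb N) Z') (\<lambda>x. ?act Z Z' x h)"
  if "Z \<in> Obj E.TC" "Z' \<in> Obj E.TC" "h \<in> El (resb N) Z" for Z Z' h
 proof -
  have b: "bilin K (Hom (op_cat B) (fst Z) (fst Z')) (Hom B (snd Z) (snd Z')) (On N Z') (\<lambda>x. Act N Z Z' (EB.tm Z Z' x) h)"
   by (rule EB.pure_act(3)[OF N]) (use that in "simp_all add: EB_obj")
  show ?thesis
   by (rule bilinI) (use bilinD[OF b] E_objD[OF that(1)] E_objD[OF that(2)] in "simp_all add: bq_def q_closed flip: q_add q_smult")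
 qed
 have 5: "?act Z Z (E.pid Z) h = h" if "Z \<in> Obj E.TC" "h \<in> El (resb N) Z" for Z h
  using EB.pure_act(4)[OF N, of Z h] that by (simp only: bq_id EB_obj resb_On)
 have 6: "?act Z Z'' (E.pcomp Z Z' Z'' x y) h = ?act Z' Z'' x (?act Z Z' y h)"
  if "Z \<in> Obj E.TC" "Z' \<in> Obj E.TC" "Z'' \<in> Obj E.TC" "x \<in> E.pr Z' Z''" "y \<in> E.pr Z Z'" "h \<in> El (resb N) Z" for Z Z' Z'' x y h
  unfolding bq_comp[OF that(1-5), symmetric]
  by (rule EB.pure_act(5)[OF N _ _ _ bq_closed[OF that(2,3,4)] bq_closed[OF that(1,2,5)]]) (use that in "simp_all add: EB_obj")
 show "c_module K E.TC (resb N)" by (rule bm(1)) (rule 1 2 3 4 5 6; assumption)+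
 show "Act (resb N) Z Z' (E.tm Z Z' x) h = ?act Z Z' x h"
  if "Z \<in> Obj E.TC" "Z' \<in> Obj E.TC" "x \<in> E.pr Z Z'" "h \<in> El N Z" for Z Z' x h
  by (rule bm(2)) (rule 1 2 3 4 5 6 that that(4)[folded resb_On]; assumption?)+
qed

text \<open>The counterpart over \<open>C^e\<close> of \<open>annihilated\<close>, for the kernel of
  the projection to \<open>B^e\<close>.\<close>

definition killed :: "('k, 'o \<times> 'o, ('m \<times> 'm \<Rightarrow> 'k) set, 'v) cmod \<Rightarrow> bool" where
 "killed M \<longleftrightarrow> (\<forall>Z\<in>Obj E.TC. \<forall>Z'\<in>Obj E.TC. \<forall>x\<in>E.pr Z Z'. \<forall>h\<in>El M Z. bi_ideal Z Z' x \<longrightarrow>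
   Act M Z Z' (E.tm Z Z' x) h = 0[On M Z'])"

lemma resb_killed:
 assumes N: "c_module K EB.TC N" shows "killed (resb N)"
 unfolding killed_def
proof (intro ballI impI)
 fix Z Z' x h assume Z: "Z \<in> Obj E.TC" "Z' \<in> Obj E.TC" and x: "x \<in> E.pr Z Z'" and h: "h \<in> El (resb N) Z"
  and i: "bi_ideal Z Z' x"
 have Z': "Z \<in> Obj EB.TC" "Z' \<in> Obj EB.TC" using Z by (simp_all add: EB_obj)
 have hN: "h \<in> El N Z" using h by simp
 note b = EB.pure_act(3)[OF N Z' hN, unfolded bilin_def] and y = bq_closed[OF Z x] and m = EB.homs[OF Z'] c_module.on_module[OF N Z'(2)]
 note o = E_objD[OF Z(1)] E_objD[OF Z(2)]
 have "fst (bq Z Z' x) = 0[Hom (op_cat B) (fst Z) (fst Z')] \<or> snd (bq Z Z' x) = 0[Hom B (snd Z) (snd Z')]"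
  using i q_zero_iff[OF o(3,1) E_prD(1)[OF x]] q_zero_iff[OF o(2,4) E_prD(2)[OF x]] by (auto simp: bq_def)
 moreover have f: "fst (bq Z Z' x) \<in> Mor (op_cat B) (fst Z) (fst Z')" "snd (bq Z Z' x) \<in> Mor B (snd Z) (snd Z')"
  using y by (metis mem_Times_iff)+
 moreover have "Act N Z Z' (EB.tm Z Z' (0[Hom (op_cat B) (fst Z) (fst Z')], w)) h = 0[On N Z']" if "w \<in> Mor B (snd Z) (snd Z')" for w
  by (rule lin_zero[OF b[THEN conjunct1, rule_format, OF that] m(1,3)])
 moreover have "Act N Z Z' (EB.tm Z Z' (v, 0[Hom B (snd Z) (snd Z')])) h = 0[On N Z']" if "v \<in> Mor (op_cat B) (fst Z) (fst Z')" for v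
  by (rule lin_zero[OF b[THEN conjunct2, rule_format, OF that] m(2,3)])
 ultimately have "Act N Z Z' (EB.tm Z Z' (fst (bq Z Z' x), snd (bq Z Z' x))) h = 0[On N Z']" by metis
 then show "Act (resb N) Z Z' (E.tm Z Z' x) h = 0[On (resb N) Z']"
  using resb_c_module(2)[OF N Z x hN] by simp
qed

text \<open>The two components are exchanged one at a time. Each exchange alters the action by a
  pure tensor with a component in the ideal, which acts as zero.\<close>

lemma killed_cong:
 assumes M: "c_module K E.TC M" and k: "killed M" and Z: "Z \<in> Obj E.TC" "Z' \<in> Obj E.TC"
  and x: "x \<in> E.pr Z Z'" and y: "y \<in> E.pr Z Z'" and e: "bq Z Z' x = bq Z Z' y" and h: "h \<in> El M Z"
 shows "Act M Z Z' (E.tm Z Z' x) h = Act M Z Z' (E.tm Z Z' y) h"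
proof -
 note o = E_objD[OF Z(1)] E_objD[OF Z(2)]
 interpret A: kmod K "Hom C (fst Z') (fst Z)" by (rule hom_kmod[OF o(3,1)])
 interpret D: kmod K "Hom C (snd Z) (snd Z')" by (rule hom_kmod[OF o(2,4)])
 interpret M: kmod K "On M Z'" by (rule on_kmod[OF M Z(2)])
 note mx = E_prD[OF x] and my = E_prD[OF y]
 have b: "\<And>w. w \<in> Mor C (snd Z) (snd Z') ==> (\<lambda>v. Act M Z Z' (E.tm Z Z' (v, w)) h) \<in> lin_maps K (Hom C (fst Z') (fst Z)) (On M Z')"
  "\<And>v. v \<in> Mor C (fst Z') (fst Z) ==> (\<lambda>w. Act M Z Z' (E.tm Z Z' (v, w)) h) \<in> lin_maps K (Hom C (snd Z) (snd Z')) (On M Z')"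
  using E.pure_act(3)[OF M Z h] unfolding bilin_def by simp_all
 have e': "fst x -[Hom C (fst Z') (fst Z)] fst y \<in> I (fst Z') (fst Z)" "snd x -[Hom C (snd Z) (snd Z')] snd y \<in> I (snd Z) (snd Z')"
  using e A.coset_eq_iff[OF ideal_submodule[OF o(3,1)] mx(1) my(1)] D.coset_eq_iff[OF ideal_submodule[OF o(2,4)] mx(2) my(2)]
  by (simp_all add: bq_def)
 have k': "Act M Z Z' (E.tm Z Z' (v, w)) h = 0[On M Z']"
  if "v \<in> Mor C (fst Z') (fst Z)" "w \<in> Mor C (snd Z) (snd Z')" "v \<in> I (fst Z') (fst Z) \<or> w \<in> I (snd Z) (snd Z')" for v w
  using k[unfolded killed_def, rule_format, OF Z, of "(v, w)" h] that h by simp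
 have c: "Act M Z Z' (E.tm Z Z' (v, w)) h \<in> El M Z'"
  if "v \<in> Mor C (fst Z') (fst Z)" "w \<in> Mor C (snd Z) (snd Z')" for v w by (rule lin_closed[OF b(1)[OF that(2)] that(1)])
 have "Act M Z Z' (E.tm Z Z' (fst x, snd x)) h = Act M Z Z' (E.tm Z Z' (fst y, snd x)) h"
  using lin_minus[OF b(1)[OF mx(2)] A.module_axioms M.module_axioms mx(1) my(1)] k'[of "fst x -[Hom C (fst Z') (fst Z)] fst y" "snd x"]
   e'(1) mx my M.minus_eq_zero_iff[OF c[OF mx] c[OF my(1) mx(2)]] by simp
 also have "\<dots> = Act M Z Z' (E.tm Z Z' (fst y, snd y)) h"
  using lin_minus[OF b(2)[OF my(1)] D.module_axioms M.module_axioms mx(2) my(2)] k'[of "fst y" "snd x -[Hom C (snd Z) (snd Z')] snd y"]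
   e'(2) mx my M.minus_eq_zero_iff[OF c[OF my(1) mx(2)] c[OF my]] by simp
 finally show ?thesis by simp
qed

text \<open>A \<open>C\<^sup>e\<close>-module annihilated by \<open>I\<close> on both sides is a \<open>B\<^sup>e\<close>-module; cosets act through arbitrary
  representatives.\<close>

definition toB :: "('k, 'o \<times> 'o, ('m \<times> 'm \<Rightarrow> 'k) set, 'v) cmod \<Rightarrow> ('k, 'o \<times> 'o, ('m set \<times> 'm set \<Rightarrow> 'k) set, 'v) cmod" where
 "toB M = \<lparr>On = On M, Act = (\<lambda>Z Z' A h. tlift K (On M Z')
   (\<lambda>y. Act M Z Z' (E.tm Z Z' (SOME x. x \<in> E.pr Z Z' \<and> bq Z Z' x = y)) h) A)\<rparr>"

lemma toB_On [simp]: "On (toB M) = On M"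
 by (simp add: toB_def)

lemma toB_c_module:
 assumes M: "c_module K E.TC M" and k: "killed M"
 shows "c_module K EB.TC (toB M)"
  and "\<And>Z Z' x h. Z \<in> Obj E.TC ==> Z' \<in> Obj E.TC ==> x \<in> E.pr Z Z' ==> h \<in> El M Z ==>
   Act (toB M) Z Z' (EB.tm Z Z' (bq Z Z' x)) h = Act M Z Z' (E.tm Z Z' x) h"
proof -
 let ?act = "\<lambda>Z Z' y h. Act M Z Z' (E.tm Z Z' (SOME x. x \<in> E.pr Z Z' \<and> bq Z Z' x = y)) h"
 note bm = EB.bimod_c_module[where M = "toB M" and act = ?act]
 have a: "?act Z Z' (bq Z Z' x) h = Act M Z Z' (E.tm Z Z' x) h"
  if "Z \<in> Obj E.TC" "Z' \<in> Obj E.TC" "x \<in> E.pr Z Z'" "h \<in> El M Z" for Z Z' x h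
 proof -
  let ?P = "\<lambda>x'. x' \<in> E.pr Z Z' \<and> bq Z Z' x' = bq Z Z' x"
  have "?P (Eps ?P)" by (rule someI[of ?P x], rule conjI[OF that(3) refl])
  then show ?thesis by (rule conjE) (rule killed_cong[OF M k that(1,2) _ that(3) _ that(4)])
 qed
 have 1: "module K (On (toB M) Z)" if "Z \<in> Obj EB.TC" for Z using c_module.on_module[OF M] that by (simp add: EB_obj)
 have 2: "Act (toB M) Z Z' A h = tlift K (On (toB M) Z') (\<lambda>x. ?act Z Z' x h) A" for Z Z' A h
  by (simp add: toB_def)
 have lin_cong: "T \<in> lin_maps K V W" if "S \<in> lin_maps K V W" "module K V" "\<And>x. x \<in> carrier V ==> T x = S x"
  for S T and V :: "('k, 'x) module" and W :: "('k, 'y) module"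
  using that mod_closed[OF that(2)] by (auto simp: lin_maps_def)
 have 3: "?act Z Z' y \<in> lin_maps K (On (toB M) Z) (On (toB M) Z')" if "Z \<in> Obj EB.TC" "Z' \<in> Obj EB.TC" "y \<in> EB.pr Z Z'" for Z Z' y
 proof -
  have Z: "Z \<in> Obj E.TC" "Z' \<in> Obj E.TC" using that by (simp_all add: EB_obj)
  from that(3) obtain x where x: "x \<in> E.pr Z Z'" "y = bq Z Z' x" by (rule bq_cases[OF Z])
  show ?thesis unfolding toB_On x(2)
   by (rule lin_cong[OF E.pure_act(1)[OF M Z x(1)] c_module.on_module[OF M Z(1)] a[OF Z x(1)]])
 qed
 have 4: "bilin K (Hom (op_cat B) (fst Z) (fst Z')) (Hom B (snd Z) (snd Z')) (On (toB M) Z') (\<lambda>x. ?act Z Z' x h)"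
  if "Z \<in> Obj EB.TC" "Z' \<in> Obj EB.TC" "h \<in> El (toB M) Z" for Z Z' h
 proof -
  have Z: "Z \<in> Obj E.TC" "Z' \<in> Obj E.TC" and h: "h \<in> El M Z" using that by (simp_all add: EB_obj)
  note o = E_objD[OF Z(1)] E_objD[OF Z(2)]
  have cs: "(F \<in> Mor B X Y) = (\<exists>f\<in>Mor C X Y. F = q X Y f)" if "X \<in> Obj C" "Y \<in> Obj C" for F X Y
   using B_cases[OF that] q_closed[OF that] by metis
  have a': "?act Z Z' (q (fst Z') (fst Z) f, q (snd Z) (snd Z') g) h = Act M Z Z' (E.tm Z Z' (f, g)) h"
   if "f \<in> Mor C (fst Z') (fst Z)" "g \<in> Mor C (snd Z) (snd Z')" for f g
   using a[OF Z, of "(f, g)" h] that h unfolding bq_def fst_conv snd_conv by simp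
  note bD = bilinD[OF E.pure_act(3)[OF M Z h], unfolded op_simps]
  note mc = mod_closed[OF hom_module[OF o(3,1)]] mod_closed[OF hom_module[OF o(2,4)]]
  let ?A = "\<lambda>y. ?act Z Z' y h"
  define A where "A = ?A"
  have A: "A (q (fst Z') (fst Z) f, q (snd Z) (snd Z') g) = Act M Z Z' (E.tm Z Z' (f, g)) h"
   if "f \<in> Mor C (fst Z') (fst Z)" "g \<in> Mor C (snd Z) (snd Z')" for f g
   unfolding A_def by (rule a'[OF that])
  have "bilin K (Hom (op_cat B) (fst Z) (fst Z')) (Hom B (snd Z) (snd Z')) (On (toB M) Z') A"
   by (rule bilinI) (use o bD in "auto simp: cs A q_add q_smult mc")
  then show ?thesis unfolding A_def .
 qed
 have 5: "?act Z Z (EB.pid Z) h = h" if "Z \<in> Obj EB.TC" "h \<in> El (toB M) Z" for Z h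
 proof -
  have Z: "Z \<in> Obj E.TC" and h: "h \<in> El M Z" using that by (simp_all add: EB_obj)
  show ?thesis unfolding bq_id a[OF Z Z E.pid_closed[OF Z] h] by (rule E.pure_act(4)[OF M Z h])
 qed
 have 6: "?act Z Z'' (EB.pcomp Z Z' Z'' x y) h = ?act Z' Z'' x (?act Z Z' y h)"
  if "Z \<in> Obj EB.TC" "Z' \<in> Obj EB.TC" "Z'' \<in> Obj EB.TC" "x \<in> EB.pr Z' Z''" "y \<in> EB.pr Z Z'" "h \<in> El (toB M) Z" for Z Z' Z'' x y h
 proof -
  have Z: "Z \<in> Obj E.TC" "Z' \<in> Obj E.TC" "Z'' \<in> Obj E.TC" and h: "h \<in> El M Z" using that by (simp_all add: EB_obj)
  from that(4) obtain x1 where x: "x1 \<in> E.pr Z' Z''" "x = bq Z' Z'' x1" by (rule bq_cases[OF Z(2,3)])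
  from that(5) obtain y1 where y: "y1 \<in> E.pr Z Z'" "y = bq Z Z' y1" by (rule bq_cases[OF Z(1,2)])
  show ?thesis
   unfolding x(2) y(2) bq_comp[OF Z x(1) y(1)] a[OF Z(1,3) E.pcomp_closed[OF Z x(1) y(1)] h] a[OF Z(1,2) y(1) h]
    a[OF Z(2,3) x(1) E.pure_act(2)[OF M Z(1,2) y(1) h]]
   by (rule E.pure_act(5)[OF M Z x(1) y(1) h])
 qed
 show "c_module K EB.TC (toB M)" by (rule bm(1)) (rule 1 2 3 4 5 6; assumption)+
 show "Act (toB M) Z Z' (EB.tm Z Z' (bq Z Z' x)) h = Act M Z Z' (E.tm Z Z' x) h"
  if "Z \<in> Obj E.TC" "Z' \<in> Obj E.TC" "x \<in> E.pr Z Z'" "h \<in> El M Z" for Z Z' x h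
 proof -
  have Z: "Z \<in> Obj EB.TC" "Z' \<in> Obj EB.TC" using that by (simp_all add: EB_obj)
  have "Act (toB M) Z Z' (EB.tm Z Z' (bq Z Z' x)) h = ?act Z Z' (bq Z Z' x) h"
   by (rule bm(2)) (rule 1 2 3 4 5 6 Z bq_closed[OF that(1-3)] that(4)[folded toB_On]; assumption?)+
  then show ?thesis using a[OF that] by simp
 qed
qed

text \<open>Every pair of morphisms of \<open>B\<close> is of the form \<open>bq\<close> of a pair
  over \<open>C\<close>, and naturality on pure tensors suffices on both sides.\<close>

lemma toB_hom_iff:
 assumes M: "c_module K E.TC M" and k: "killed M" and N: "c_module K EB.TC N"
 shows "mod_hom K EB.TC (toB M) N \<eta> \<longleftrightarrow> mod_hom K E.TC M (resb N) \<eta>"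
proof -
 note tM = toB_c_module[OF M k] and rN = resb_c_module[OF N]
 have "(\<forall>y\<in>EB.pr Z Z'. \<forall>h\<in>El M Z. \<eta> Z' (Act (toB M) Z Z' (EB.tm Z Z' y) h) = Act N Z Z' (EB.tm Z Z' y) (\<eta> Z h)) \<longleftrightarrow>
  (\<forall>x\<in>E.pr Z Z'. \<forall>h\<in>El M Z. \<eta> Z' (Act M Z Z' (E.tm Z Z' x) h) = Act (resb N) Z Z' (E.tm Z Z' x) (\<eta> Z h))" (is "?l \<longleftrightarrow> ?r")
  if Z: "Z \<in> Obj E.TC" "Z' \<in> Obj E.TC" and l: "\<eta> Z \<in> lin_maps K (On M Z) (On N Z)" for Z Z'
 proof
  assume L: ?l
  show ?r
  proof (intro ballI)
   fix x h assume x: "x \<in> E.pr Z Z'" and h: "h \<in> El M Z"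
   show "\<eta> Z' (Act M Z Z' (E.tm Z Z' x) h) = Act (resb N) Z Z' (E.tm Z Z' x) (\<eta> Z h)"
    using L[rule_format, OF bq_closed[OF Z x] h] tM(2)[OF Z x h] rN(2)[OF Z x lin_closed[OF l h]] by simp
  qed
 next
  assume R: ?r
  show ?l
  proof (intro ballI)
   fix y h assume y: "y \<in> EB.pr Z Z'" and h: "h \<in> El M Z"
   obtain x where x: "x \<in> E.pr Z Z'" "y = bq Z Z' x" by (rule bq_cases[OF Z y])
   show "\<eta> Z' (Act (toB M) Z Z' (EB.tm Z Z' y) h) = Act N Z Z' (EB.tm Z Z' y) (\<eta> Z h)"
    unfolding x(2) tM(2)[OF Z x(1) h] rN(2)[OF Z x(1) lin_closed[OF l h], symmetric] by (rule R[rule_format, OF x(1) h])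
  qed
 qed
 then show ?thesis
  unfolding EB.tensor_mod_hom_iff[OF tM(1) N] E.tensor_mod_hom_iff[OF M rN(1)] toB_On resb_On Ball_def[of "Obj _"] EB_obj by blast
qed

lemma resb_hom:
 assumes A: "c_module K EB.TC A" and N: "c_module K EB.TC N" and h: "mod_hom K EB.TC A N \<eta>"
 shows "mod_hom K E.TC (resb A) (resb N) \<eta>"
proof (rule E.tensor_mod_homI[OF resb_c_module(1)[OF A] resb_c_module(1)[OF N]])
 fix Z assume Z: "Z \<in> Obj E.TC"
 then have Zb: "Z \<in> Obj EB.TC" by (simp add: EB_obj)
 show "\<eta> Z \<in> lin_maps K (On (resb A) Z) (On (resb N) Z)" using hom_lin[OF h Zb] by simp
 fix Z' x p assume Z': "Z' \<in> Obj E.TC" and x: "x \<in> E.pr Z Z'" and "p \<in> El (resb A) Z"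
 then have Zb': "Z' \<in> Obj EB.TC" and p: "p \<in> El A Z" by (simp_all add: EB_obj)
 show "\<eta> Z' (Act (resb A) Z Z' (E.tm Z Z' x) p) = Act (resb N) Z Z' (E.tm Z Z' x) (\<eta> Z p)"
  unfolding resb_c_module(2)[OF A Z Z' x p] resb_c_module(2)[OF N Z Z' x hom_closed[OF h Zb p]]
  by (rule hom_nat[OF h Zb Zb' EB.tm_closed[OF Zb Zb' bq_closed[OF Z Z' x]] p])
qed

lemma toB_map:
 assumes M: "c_module K E.TC M" "killed M" and N: "c_module K E.TC N" "killed N" and h: "mod_hom K E.TC M N \<eta>"
 shows "mod_hom K EB.TC (toB M) (toB N) \<eta>"
 unfolding toB_hom_iff[OF M toB_c_module(1)[OF N]]
proof (rule E.tensor_mod_homI[OF M(1) resb_c_module(1)[OF toB_c_module(1)[OF N]]])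
 fix Z assume Z: "Z \<in> Obj E.TC"
 show "\<eta> Z \<in> lin_maps K (On M Z) (On (resb (toB N)) Z)" using hom_lin[OF h Z] by simp
 fix Z' x p assume Z': "Z' \<in> Obj E.TC" and x: "x \<in> E.pr Z Z'" and p: "p \<in> El M Z"
 note hp = hom_closed[OF h Z p]
 show "\<eta> Z' (Act M Z Z' (E.tm Z Z' x) p) = Act (resb (toB N)) Z Z' (E.tm Z Z' x) (\<eta> Z p)"
  unfolding resb_c_module(2)[OF toB_c_module(1)[OF N] Z Z' x hp[folded toB_On]] toB_c_module(2)[OF N Z Z' x hp]
  by (rule hom_nat[OF h Z Z' E.tm_closed[OF Z Z' x] p])
qed

end

section \<open>Transport of exactness and homomorphisms into submodules\<close>

lemma lin_isos_D:
 assumes h: "h \<in> lin_isos K V W"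
 shows "h \<in> lin_maps K V W" "w \<in> carrier W ==> inv_into (carrier V) h w \<in> carrier V"
  "w \<in> carrier W ==> h (inv_into (carrier V) h w) = w" "v \<in> carrier V ==> inv_into (carrier V) h (h v) = v"
proof -
 have b: "bij_betw h (carrier V) (carrier W)" and l: "h \<in> lin_maps K V W" using h by (auto simp: lin_isos_def)
 show "h \<in> lin_maps K V W" by (rule l)
 have im: "h ` carrier V = carrier W" by (rule bij_betw_imp_surj_on[OF b])
 show "w \<in> carrier W ==> inv_into (carrier V) h w \<in> carrier V" by (rule inv_into_into) (simp add: im)
 show "w \<in> carrier W ==> h (inv_into (carrier V) h w) = w" by (rule f_inv_into_f) (simp add: im)
 show "v \<in> carrier V ==> inv_into (carrier V) h (h v) = v" by (rule inv_into_f_f[OF bij_betw_imp_inj_on[OF b]])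
qed

lemma lin_isos_inv:
 assumes h: "h \<in> lin_isos K V W" and V: "module K V" shows "inv_into (carrier V) h \<in> lin_isos K W V"
proof -
 note D = lin_isos_D[OF h] and l = lin_isos_D(1)[OF h] and m = mod_closed[OF V]
 have b: "bij_betw h (carrier V) (carrier W)" using h by (simp add: lin_isos_def)
 have "inv_into (carrier V) h \<in> lin_maps K W V"
 proof (rule lin_mapsI)
  fix x assume x: "x \<in> carrier W"
  then show "inv_into (carrier V) h x \<in> carrier V" by (rule D(2))
  show "inv_into (carrier V) h (x +[W] y) = inv_into (carrier V) h x +[V] inv_into (carrier V) h y" if y: "y \<in> carrier W" for y
   using D(4)[OF m(2)[OF D(2)[OF x] D(2)[OF y]]] lin_add[OF l D(2)[OF x] D(2)[OF y]] D(3)[OF x] D(3)[OF y] by simp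
  show "inv_into (carrier V) h (a *[W] x) = a *[V] inv_into (carrier V) h x" if a: "a \<in> carrier K" for a
   using D(4)[OF m(4)[OF a D(2)[OF x]]] lin_smult[OF l a D(2)[OF x]] D(3)[OF x] by simp
 qed
 then show ?thesis using bij_betw_inv_into[OF b] by (simp add: lin_isos_def)
qed

text \<open>Replaces the term \<open>W\<close> of an exact sequence by an isomorphic
  \<open>W'\<close>, once as the last, once as the middle and once as the first of three terms. The
  sequence produced by \<open>P\<close> contains the cohomology of \<open>Hom(P, B)\<close>, while
  \<open>H^n(B)\<close> is defined from a resolution over \<open>B^e\<close>.\<close>

lemma exact_transport:
 assumes h: "h \<in> lin_isos K W' W" and W': "module K W'" and W: "module K W" and g: "g \<in> lin_maps K V W"
 shows "exact_at U f V g W ==> exact_at U f V (\<lambda>x. inv_into (carrier W') h (g x)) W'"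
  and "exact_at V g W c U ==> exact_at V (\<lambda>x. inv_into (carrier W') h (g x)) W' (\<lambda>x. c (h x)) U"
  and "exact_at W c U f Y ==> exact_at W' (\<lambda>x. c (h x)) U f Y"
proof -
 note D = lin_isos_D[OF h]
 have z: "inv_into (carrier W') h w = 0[W'] \<longleftrightarrow> w = 0[W]" if "w \<in> carrier W" for w
  using D(3)[OF that] D(4)[OF mod_closed(1)[OF W']] lin_zero[OF D(1) W' W] by auto
 have im: "h ` carrier W' = carrier W" using h by (simp add: lin_isos_def bij_betw_def)
 show "exact_at U f V (\<lambda>x. inv_into (carrier W') h (g x)) W'" if "exact_at U f V g W"
  using that z lin_closed[OF g] unfolding exact_at_iff by auto
 show "exact_at V (\<lambda>x. inv_into (carrier W') h (g x)) W' (\<lambda>x. c (h x)) U" if "exact_at V g W c U"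
  unfolding exact_at_iff
 proof (intro equalityI subsetI)
  have e: "g ` carrier V = {w \<in> carrier W. c w = 0[U]}" using that by (simp add: exact_at_iff)
  {
   fix y assume "y \<in> (\<lambda>x. inv_into (carrier W') h (g x)) ` carrier V"
   then obtain x where x: "x \<in> carrier V" "y = inv_into (carrier W') h (g x)" by blast
   then show "y \<in> {x \<in> carrier W'. c (h x) = 0[U]}" using e D(2,3)[OF lin_closed[OF g x(1)]] by auto
  }
  fix y assume y: "y \<in> {x \<in> carrier W'. c (h x) = 0[U]}"
  then have "h y \<in> g ` carrier V" unfolding e using lin_closed[OF D(1), of y] by simp
  then obtain x where "x \<in> carrier V" "g x = h y" by (auto simp: image_iff)
  then show "y \<in> (\<lambda>x. inv_into (carrier W') h (g x)) ` carrier V" using y D(4)[of y] by (intro image_eqI[of _ _ x]) simp_all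
 qed
 show "exact_at W' (\<lambda>x. c (h x)) U f Y" if "exact_at W c U f Y"
  using that im unfolding exact_at_iff image_image[symmetric, of c h] by simp
qed

lemma submod_nat_trans:
 assumes S: "\<And>X. X \<in> Obj C ==> S X \<subseteq> El N X"
 shows "\<eta> \<in> nat_trans K C M (submod N S) \<longleftrightarrow> \<eta> \<in> nat_trans K C M N \<and> (\<forall>X\<in>Obj C. \<forall>x\<in>El M X. \<eta> X x \<in> S X)"
proof -
 have *: "(\<eta> X \<in> (El M X \<rightarrow>\<^sub>E S X)) = (\<eta> X \<in> (El M X \<rightarrow>\<^sub>E El N X) \<and> (\<forall>x\<in>El M X. \<eta> X x \<in> S X))"
  if "X \<in> Obj C" for X using S[OF that] by (auto simp: PiE_iff)
 have l: "(\<eta> X \<in> lin_maps K (On M X) ((On N X)\<lparr>carrier := S X\<rparr>)) = (\<eta> X \<in> lin_maps K (On M X) (On N X) \<and> (\<forall>x\<in>El M X. \<eta> X x \<in> S X))"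
  if "X \<in> Obj C" for X using S[OF that] by (auto simp: lin_maps_def)
 show ?thesis unfolding nat_trans_def submod_def
  by (auto simp: PiE_iff[of \<eta>] * l)
qed

lemma submod_Hom_Mod:
 "0[Hom_Mod K C M (submod N S)] = 0[Hom_Mod K C M N]"
 "\<eta> +[Hom_Mod K C M (submod N S)] \<theta> = \<eta> +[Hom_Mod K C M N] \<theta>"
 "a *[Hom_Mod K C M (submod N S)] \<eta> = a *[Hom_Mod K C M N] \<eta>"
 by (simp_all add: Hom_Mod_def submod_def)

section \<open>Two-sided quotients of projective bimodules\<close>

context ideal_kcat
begin

abbreviation biq where "biq M \<equiv> E.T.quotm M (bi_span M)"

abbreviation bip where "bip M Z x \<equiv> bi_span M Z +>[On M Z] x"

lemma biq_facts:
 assumes M: "c_module K E.TC M"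
 shows "c_module K E.TC (biq M)" "mod_hom K E.TC M (biq M) (bip M)" "killed (biq M)"
  and "\<And>Z u. Z \<in> Obj E.TC ==> u \<in> El (biq M) Z \<longleftrightarrow> (\<exists>x\<in>El M Z. u = bip M Z x)"
proof -
 note bs = bi_span_subfunctor[OF M]
 show "c_module K E.TC (biq M)" by (rule E.T.quotm_c_module[OF M bs])
 show "mod_hom K E.TC M (biq M) (bip M)" by (rule E.T.quotm_proj[OF M bs])
 show c: "u \<in> El (biq M) Z \<longleftrightarrow> (\<exists>x\<in>El M Z. u = bip M Z x)" if "Z \<in> Obj E.TC" for Z u
  using kmod.quot_carrier[OF on_kmod[OF M that]] by auto
 show "killed (biq M)"
  unfolding killed_def
 proof (intro ballI impI)
  fix Z Z' x u assume Z: "Z \<in> Obj E.TC" "Z' \<in> Obj E.TC" and x: "x \<in> E.pr Z Z'" "bi_ideal Z Z' x" and "u \<in> El (biq M) Z"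
  then obtain p where p: "p \<in> El M Z" "u = bip M Z p" using c by blast
  interpret V: kmod K "On M Z'" by (rule on_kmod[OF M Z(2)])
  show "Act (biq M) Z Z' (E.tm Z Z' x) u = 0[On (biq M) Z']"
   unfolding p(2) E.T.quotm_Act[OF M bs Z E.tm_closed[OF Z x(1)] p(1)]
   using V.coset_eq_self_iff[OF bi_span_submodule[OF M Z(2)] E.pure_act(2)[OF M Z x(1) p(1)]] bi_span_gen[where M = M, OF Z(1) x p(1)]
   by (simp add: V.quot_zero)
 qed
qed

text \<open>The universal property behind the adjunction between two-sided reduction and
  \<open>resb\<close>: a map into a restricted module kills every translate by a pure tensor with a
  component in \<open>I\<close>.\<close>

lemma biq_factor:
 assumes M: "c_module K E.TC M" and N: "c_module K EB.TC N" and g: "mod_hom K E.TC M (resb N) g"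
 obtains g' where "mod_hom K EB.TC (toB (biq M)) N g'" "\<And>Z x. Z \<in> Obj E.TC ==> x \<in> El M Z ==> g' Z (bip M Z x) = g Z x"
proof -
 note rN = resb_c_module(1)[OF N]
 have "g Z x = 0[On (resb N) Z]" if Z: "Z \<in> Obj E.TC" and x: "x \<in> bi_span M Z" for Z x
 proof -
  have "g Z x \<in> {0[On (resb N) Z]}"
  proof (rule bi_span_mapsto[OF M Z c_module.on_module[OF rN Z] hom_lin[OF g Z] zero_submodule[OF c_module.on_module[OF rN Z]] x])
   fix Z' y p assume Z': "Z' \<in> Obj E.TC" and y: "y \<in> E.pr Z' Z" "bi_ideal Z' Z y" and p: "p \<in> El M Z'"
   show "g Z (Act M Z' Z (E.tm Z' Z y) p) \<in> {0[On (resb N) Z]}"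
    unfolding hom_nat[OF g Z' Z E.tm_closed[OF Z' Z y(1)] p]
    using resb_killed[OF N, unfolded killed_def, rule_format, OF Z' Z y(1) hom_closed[OF g Z' p] y(2)] by (rule ssubst) (rule singletonI)
  qed
  then show ?thesis by (rule singletonD)
 qed
 from E.T.quotm_factor[OF M bi_span_subfunctor[OF M] rN g this]
 obtain g' where g': "mod_hom K E.TC (biq M) (resb N) g'" "\<forall>Z\<in>Obj E.TC. \<forall>x\<in>El M Z. g' Z (bip M Z x) = g Z x" by blast
 show thesis
  by (rule that[of g']) (use g' toB_hom_iff[OF biq_facts(1,3)[OF M] N] in auto)
qed

text \<open>As for \<open>fac_projective\<close>: \<open>resb\<close> preserves epimorphisms, so its
  left adjoint preserves projectives.\<close>

lemma biq_projective:
 fixes M :: "('k, 'o \<times> 'o, ('m \<times> 'm \<Rightarrow> 'k) set, 'v) cmod"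
 assumes pM: "projective K E.TC M"
 shows "projective K EB.TC (toB (biq M))"
proof -
 have M: "c_module K E.TC M" by (rule E.T.projective_c_module[OF pM])
 note bf = biq_facts[OF M]
 show ?thesis
 proof (rule EB.T.projectiveI[OF toB_c_module(1)[OF bf(1,3)]])
  fix A N :: "('k, 'o \<times> 'o, ('m set \<times> 'm set \<Rightarrow> 'k) set, ('o \<times> 'o, ('m set \<times> 'm set \<Rightarrow> 'k) set, 'v set) elt) cmod" and e
  assume A: "c_module K EB.TC A" and N: "c_module K EB.TC N" and e: "mod_hom K EB.TC A N e" "epi EB.TC A N e"
  note rA = resb_c_module(1)[OF A] and rN = resb_c_module(1)[OF N]
  have re: "epi E.TC (resb A) (resb N) e"
   by (rule epiI[OF resb_hom[OF A N e(1)]]) (use epiD[OF e(2)] EB_obj in auto)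
  show "lifts K EB.TC (toB (biq M)) A N e" unfolding lifts_def
  proof (intro allI impI)
   fix f assume "mod_hom K EB.TC (toB (biq M)) N f"
   then have "mod_hom K E.TC (biq M) (resb N) f" using toB_hom_iff[OF bf(1,3) N] by blast
   from hom_comp[OF bf(2) this] obtain g where g: "mod_hom K E.TC M (resb A) g"
    "\<And>Z x. Z \<in> Obj E.TC ==> x \<in> El M Z ==> e Z (g Z x) = f Z (bip M Z x)"
    by (rule liftsD[OF E.T.projective_lifts[OF pM rA rN resb_hom[OF A N e(1)] re]]) (rule that)
   obtain g' where g': "mod_hom K EB.TC (toB (biq M)) A g'" "\<And>Z x. Z \<in> Obj E.TC ==> x \<in> El M Z ==> g' Z (bip M Z x) = g Z x"
    by (rule biq_factor[OF M A g(1)]) (rule that)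
   have "e Z (g' Z u) = f Z u" if Z: "Z \<in> Obj EB.TC" and u: "u \<in> El (toB (biq M)) Z" for Z u
   proof -
    have Z': "Z \<in> Obj E.TC" using Z by (simp add: EB_obj)
    obtain x where x: "x \<in> El M Z" "u = bip M Z x" using u bf(4)[OF Z', of u] unfolding toB_On by blast
    show ?thesis unfolding x(2) g'(2)[OF Z' x(1)] by (rule g(2)[OF Z' x(1)])
   qed
   then show "\<exists>g. mod_hom K EB.TC (toB (biq M)) A g \<and> (\<forall>Z\<in>Obj EB.TC. \<forall>x\<in>El (toB (biq M)) Z. e Z (g Z x) = f Z x)"
    using g'(1) by blast
  qed
 qed
qed

abbreviation pq where "pq Z h \<equiv> q (fst Z) (snd Z) h"

lemma BB_act:
 assumes Z: "Z \<in> Obj E.TC" "Z' \<in> Obj E.TC" and x: "x \<in> E.pr Z Z'" and h: "h \<in> Mor C (fst Z) (snd Z)"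
 shows "Act (resb BB) Z Z' (E.tm Z Z' x) (pq Z h) = pq Z' (Act CC Z Z' (E.tm Z Z' x) h)"
proof -
 note o = E_objD[OF Z(1)] E_objD[OF Z(2)] and m = E_prD[OF x]
 have Zb: "Z \<in> Obj EB.TC" "Z' \<in> Obj EB.TC" using Z by (simp_all add: EB_obj)
 have hc: "h \<in> El CC Z" and hq: "pq Z h \<in> El BB Z" using h q_closed[OF o(1,2) h] by simp_all
 have hx: "Comp C (fst Z') (fst Z) (snd Z) h (fst x) \<in> Mor C (fst Z') (snd Z)" by (rule comp_closed[OF o(3,1,2) m(1) h])
 show ?thesis
  unfolding resb_c_module(2)[OF B.hom_bimod_c_module(1) Z x hq]
  unfolding B.hom_bimod_c_module(2)[OF Zb bq_closed[OF Z x] hq] hom_bimod_c_module(2)[OF Z x hc]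
  unfolding bq_def fst_conv snd_conv q_comp[OF o(3,1,2) m(1) h] q_comp[OF o(3,2,4) hx m(2)] ..
qed

lemma BB_carrier: "Z \<in> Obj E.TC ==> u \<in> El (resb BB) Z \<longleftrightarrow> (\<exists>h\<in>Mor C (fst Z) (snd Z). u = pq Z h)"
 using kmod.quot_carrier[OF hom_kmod[OF E_objD]] by (auto simp: B_simps(2))

lemma pq_hom: "mod_hom K E.TC CC (resb BB) pq"
proof (rule E.tensor_mod_homI[OF hom_bimod_c_module(1) resb_c_module(1)[OF B.hom_bimod_c_module(1)]])
 fix Z assume Z: "Z \<in> Obj E.TC"
 show "pq Z \<in> lin_maps K (On CC Z) (On (resb BB) Z)"
  using kmod.proj_lin[OF hom_kmod[OF E_objD[OF Z]] ideal_submodule[OF E_objD[OF Z]]] by (simp add: B_simps(2))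
 fix Z' x h assume "Z' \<in> Obj E.TC" "x \<in> E.pr Z Z'" "h \<in> El CC Z"
 then show "pq Z' (Act CC Z Z' (E.tm Z Z' x) h) = Act (resb BB) Z Z' (E.tm Z Z' x) (pq Z h)"
  by (intro BB_act[symmetric] Z) simp_all
qed

text \<open>The quotient of \<open>C\<close> by \<open>I\<close> formed over \<open>C^e\<close> and
  the restriction of \<open>B\<close> have the same spaces, but their actions are built differently.
  They agree on pure tensors, where naturality is tested.\<close>

lemma quotm_resb_hom:
 assumes Q: "c_module K E.TC Q" and e: "mod_hom K E.TC Q (E.T.quotm CC IZ) e"
 shows "mod_hom K E.TC Q (resb BB) e"
proof (rule E.tensor_mod_homI[OF Q resb_c_module(1)[OF B.hom_bimod_c_module(1)]])
 fix Z assume Z: "Z \<in> Obj E.TC"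
 show "e Z \<in> lin_maps K (On Q Z) (On (resb BB) Z)" using hom_lin[OF e Z] by (simp add: B_simps(2))
 fix Z' x u assume Z': "Z' \<in> Obj E.TC" and x: "x \<in> E.pr Z Z'" and u: "u \<in> El Q Z"
 have "e Z u \<in> El (resb BB) Z" using hom_closed[OF e Z u] by (simp add: B_simps(2))
 then obtain h where h: "h \<in> Mor C (fst Z) (snd Z)" "e Z u = pq Z h" using BB_carrier[OF Z] by blast
 have h': "h \<in> El CC Z" using h(1) by simp
 have "e Z' (Act Q Z Z' (E.tm Z Z' x) u) = Act (E.T.quotm CC IZ) Z Z' (E.tm Z Z' x) (IZ Z +>[On CC Z] h)"
  unfolding hom_nat[OF e Z Z' E.tm_closed[OF Z Z' x] u] h(2) by simp
 also have "\<dots> = pq Z' (Act CC Z Z' (E.tm Z Z' x) h)"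
  unfolding E.T.quotm_Act[OF hom_bimod_c_module(1) IZ_subfunctor Z Z' E.tm_closed[OF Z Z' x] h'] by simp
 finally show "e Z' (Act Q Z Z' (E.tm Z Z' x) u) = Act (resb BB) Z Z' (E.tm Z Z' x) (e Z u)"
  unfolding h(2) BB_act[OF Z Z' x h(1)] .
qed

text \<open>The complex of \<open>biq_resolution\<close>, read over \<open>B^e\<close>. Spaces and
  maps are unchanged, so exactness carries over verbatim and only naturality has to be
  reconsidered.\<close>

lemma B_resolution:
 fixes P :: "nat \<Rightarrow> ('k, 'o \<times> 'o, ('m \<times> 'm \<Rightarrow> 'k) set, 'v) cmod"
 assumes fK: "field K" and idem: "idempotent_ideal C I" and pI: "\<And>X. X \<in> Obj C ==> projective K C (ideal_at C I X)"
  and R: "resolution K E.TC CC P d \<epsilon>" and pr: "\<And>n. projective K E.TC (P n)"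
 obtains D e where "resolution K EB.TC BB (\<lambda>n. toB (biq (P n))) D e"
  "\<And>n Z x. Z \<in> Obj E.TC ==> x \<in> El (P (Suc n)) Z ==> D n Z (bip (P (Suc n)) Z x) = bip (P n) Z (d n Z x)"
proof -
 interpret P: resolution K E.TC CC P d \<epsilon> by fact
 obtain D e where De: "resolution K E.TC (E.T.quotm CC IZ) (\<lambda>n. biq (P n)) D e"
  "\<And>n Z x. Z \<in> Obj E.TC ==> x \<in> El (P (Suc n)) Z ==> D n Z (bip (P (Suc n)) Z x) = bip (P n) Z (d n Z x)"
  by (rule biq_resolution[OF fK idem pI R pr]) (assumption | rule that)+
 interpret Q: resolution K E.TC "E.T.quotm CC IZ" "\<lambda>n. biq (P n)" D e by (rule De(1))
 note bf = biq_facts[OF P.P]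
 have BQ: "On BB Z = On (E.T.quotm CC IZ) Z" for Z by (simp add: B_simps(2))
 have "resolution K EB.TC BB (\<lambda>n. toB (biq (P n))) D e"
 proof (rule EB.T.resolutionI)
  show "c_module K EB.TC BB" by (rule B.hom_bimod_c_module(1))
  show "c_module K EB.TC (toB (biq (P n)))" for n by (rule toB_c_module(1)[OF bf(1,3)])
  show "mod_hom K EB.TC (toB (biq (P (Suc n)))) (toB (biq (P n))) (D n)" for n by (rule toB_map[OF bf(1,3) bf(1,3) Q.d])
  show "mod_hom K EB.TC (toB (biq (P 0))) BB e"
   unfolding toB_hom_iff[OF bf(1,3) B.hom_bimod_c_module(1)] by (rule quotm_resb_hom[OF bf(1) Q.eps])
 qed (use Q.eps_onto Q.eps_d Q.d_d Q.exact0 Q.exact in "simp_all only: toB_On BQ EB_obj")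
 then show thesis by (rule that[OF _ De(2)])
qed

end

section \<open>The long exact sequence\<close>

context ideal_kcat
begin

lemma EB_Obj: "Obj EB.TC = Obj E.TC"
 using EB_obj by blast

text \<open>Precomposition with \<open>P n -> P n / (I P n + P n I)\<close> is bijective in each
  degree by \<open>biq_factor\<close> and commutes with the differentials by \<open>Dd\<close>. It
  holds for coefficients in any \<open>B^e\<close>-module.\<close>

lemma toB_complex_iso:
 assumes R: "resolution K E.TC F P d \<epsilon>" and N: "c_module K EB.TC N" and Q: "resolution K EB.TC G (\<lambda>n. toB (biq (P n))) D e"
  and Dd: "\<And>n Z x. Z \<in> Obj E.TC ==> x \<in> El (P (Suc n)) Z ==> D n Z (bip (P (Suc n)) Z x) = bip (P n) Z (d n Z x)"
 shows "H_map (E.T.hom_cx P (resb N)) (E.T.hom_d P d) n (\<lambda>\<phi>. nt_comp E.TC (P n) \<phi> (bip (P n))) \<in>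
  lin_isos K (H_mod (EB.T.hom_cx (\<lambda>n. toB (biq (P n))) N) (EB.T.hom_d (\<lambda>n. toB (biq (P n))) D) n)
   (H_mod (E.T.hom_cx P (resb N)) (E.T.hom_d P d) n)"
proof -
 interpret P: resolution K E.TC F P d \<epsilon> by fact
 let ?Q = "\<lambda>n. toB (biq (P n))"
 interpret Q: resolution K EB.TC G ?Q D e by fact
 note rN = resb_c_module(1)[OF N]
 have bf: "c_module K E.TC (biq (P n))" "mod_hom K E.TC (P n) (biq (P n)) (bip (P n))" "killed (biq (P n))" for n
  by (rule biq_facts[OF P.P])+
 have bc: "bip (P n) Z x \<in> El (biq (P n)) Z" if "Z \<in> Obj E.TC" "x \<in> El (P n) Z" for n Z x
  by (rule hom_closed[OF bf(2) that])
 let ?f = "\<lambda>n \<phi>. nt_comp E.TC (P n) \<phi> (bip (P n))"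
 have h: "mod_hom K E.TC (biq (P n)) (resb N) \<phi>" if "\<phi> \<in> nat_trans K EB.TC (?Q n) N" for \<phi> n
  using toB_hom_iff[OF bf(1,3) N] nat_trans_hom[OF that] by blast
 have fc: "?f n \<phi> \<in> nat_trans K E.TC (P n) (resb N)" if "\<phi> \<in> nat_trans K EB.TC (?Q n) N" for \<phi> n
  by (rule E.T.nt_comp_nat_trans[OF P.P bf(2) h[OF that]])
 interpret F: cochain_map K "EB.T.hom_cx ?Q N" "EB.T.hom_d ?Q D" "E.T.hom_cx P (resb N)" "E.T.hom_d P d" ?f
 proof (intro cochain_map.intro cochain_map_axioms.intro)
  show "cocomplex K (EB.T.hom_cx ?Q N) (EB.T.hom_d ?Q D)" by (rule EB.T.hom_cocomplex[where P = ?Q and d = D, OF Q.P Q.d Q.d_d N])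
  show "cocomplex K (E.T.hom_cx P (resb N)) (E.T.hom_d P d)" by (rule E.T.hom_cocomplex[where P = P and d = d, OF P.P P.d P.d_d rN])
  show "?f n \<in> lin_maps K (Hom_Mod K EB.TC (?Q n) N) (Hom_Mod K E.TC (P n) (resb N))" for n
  proof (rule lin_mapsI)
   fix x assume "x \<in> carrier (Hom_Mod K EB.TC (?Q n) N)"
   then show "?f n x \<in> carrier (Hom_Mod K E.TC (P n) (resb N))" unfolding E.T.Hom_Mod_simps EB.T.Hom_Mod_simps by (rule fc)
  next
   fix x y
   show "?f n (x +[Hom_Mod K EB.TC (?Q n) N] y) = ?f n x +[Hom_Mod K E.TC (P n) (resb N)] ?f n y"
    unfolding E.T.Hom_Mod_simps EB.T.Hom_Mod_simps E.T.nt_comp_ext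
    by (rule E.T.ext_hom_cong) (use bc in "simp add: ext_hom_apply EB_Obj del: E.T.quotm_On")
   fix a
   show "?f n (a *[Hom_Mod K EB.TC (?Q n) N] x) = a *[Hom_Mod K E.TC (P n) (resb N)] ?f n x"
    unfolding E.T.Hom_Mod_simps EB.T.Hom_Mod_simps E.T.nt_comp_ext
    by (rule E.T.ext_hom_cong) (use bc in "simp add: ext_hom_apply EB_Obj del: E.T.quotm_On")
  qed
  show "?f (Suc n) (nt_comp EB.TC (?Q (Suc n)) x (D n)) = nt_comp E.TC (P (Suc n)) (?f n x) (d n)" for n x
   unfolding E.T.nt_comp_ext EB.T.nt_comp_ext
   by (rule E.T.ext_hom_cong) (use bc in "simp add: ext_hom_apply EB_Obj Dd hom_closed[OF P.d] del: E.T.quotm_On")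
 qed
 show ?thesis
 proof (rule F.H_map_bij)
  fix n
  have "inj_on (?f n) (nat_trans K EB.TC (?Q n) N)"
  proof (rule inj_onI)
   fix x y assume x: "x \<in> nat_trans K EB.TC (?Q n) N" and y: "y \<in> nat_trans K EB.TC (?Q n) N" and eq: "?f n x = ?f n y"
   show "x = y"
   proof (rule nat_trans_eqI[OF x y])
    fix Z u assume Z: "Z \<in> Obj EB.TC" and u: "u \<in> El (?Q n) Z"
    have Z': "Z \<in> Obj E.TC" using Z by (simp add: EB_obj)
    obtain p where p: "p \<in> El (P n) Z" "u = bip (P n) Z p" using u biq_facts(4)[OF P.P Z'] unfolding toB_On by blast
    show "x Z u = y Z u"
     using fun_cong[OF fun_cong[OF eq], of Z p] unfolding E.T.nt_comp_apply[OF Z' p(1)] p(2) .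
   qed
  qed
  moreover have "\<exists>x\<in>nat_trans K EB.TC (?Q n) N. ?f n x = g" if g: "g \<in> nat_trans K E.TC (P n) (resb N)" for g
  proof -
   obtain g' where g': "mod_hom K EB.TC (?Q n) N g'" "\<And>Z x. Z \<in> Obj E.TC ==> x \<in> El (P n) Z ==> g' Z (bip (P n) Z x) = g Z x"
    by (rule biq_factor[OF P.P N nat_trans_hom[OF g]]) (rule that)
   have en: "ext_hom EB.TC (?Q n) g' \<in> nat_trans K EB.TC (?Q n) N" by (rule EB.T.ext_hom_nat_trans[OF Q.P g'(1)])
   have "?f n (ext_hom EB.TC (?Q n) g') = g"
    by (rule nat_trans_eqI[OF fc[OF en] g])
     (use bc in "simp add: E.T.nt_comp_apply ext_hom_apply EB_Obj g'(2) del: E.T.quotm_On")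
   then show ?thesis using en by blast
  qed
  ultimately show "bij_betw (?f n) (carrier (Hom_Mod K EB.TC (?Q n) N)) (carrier (Hom_Mod K E.TC (P n) (resb N)))"
   using fc unfolding bij_betw_def E.T.Hom_Mod_simps(1) EB.T.Hom_Mod_simps(1) by blast
 qed
qed

abbreviation "IB \<equiv> submod CC IZ"

lemma IB_c_module: "c_module K E.TC IB"
 by (rule E.T.submod_c_module[OF hom_bimod_c_module(1) IZ_subfunctor])

lemma IB_nat_trans: "\<eta> \<in> nat_trans K E.TC M IB \<longleftrightarrow> \<eta> \<in> nat_trans K E.TC M CC \<and> (\<forall>Z\<in>Obj E.TC. \<forall>x\<in>El M Z. \<eta> Z x \<in> IZ Z)"
 by (rule submod_nat_trans) (use I_carrier[OF E_objD] in auto)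

text \<open>Homomorphisms into \<open>I\<close> are those homomorphisms into \<open>C\<close> whose
  values lie in \<open>I\<close>, so the first map is the identity on elements, and its image is the
  kernel of composition with the projection \<open>pq\<close>.\<close>

lemma bimod_short_exact:
 assumes R: "resolution K E.TC F P d \<epsilon>" and pr: "\<And>n. projective K E.TC (P n)"
 shows "short_exact K (E.T.hom_cx P IB) (E.T.hom_d P d) (E.T.hom_cx P CC) (E.T.hom_d P d) (E.T.hom_cx P (resb BB)) (E.T.hom_d P d)
  (\<lambda>n \<phi>. \<phi>) (\<lambda>n. nt_comp E.TC (P n) pq)"
proof -
 interpret P: resolution K E.TC F P d \<epsilon> by fact
 note C = hom_bimod_c_module(1) and rB = resb_c_module(1)[OF B.hom_bimod_c_module(1)]
 show ?thesis
 proof (intro short_exact.intro cochain_map.intro cochain_map_axioms.intro short_exact_axioms.intro)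
  show "cocomplex K (E.T.hom_cx P IB) (E.T.hom_d P d)" by (rule E.T.hom_cocomplex[where P = P and d = d, OF P.P P.d P.d_d IB_c_module])
  show "cocomplex K (E.T.hom_cx P CC) (E.T.hom_d P d)" by (rule E.T.hom_cocomplex[where P = P and d = d, OF P.P P.d P.d_d C])
  then show "cocomplex K (E.T.hom_cx P CC) (E.T.hom_d P d)" .
  show "cocomplex K (E.T.hom_cx P (resb BB)) (E.T.hom_d P d)" by (rule E.T.hom_cocomplex[where P = P and d = d, OF P.P P.d P.d_d rB])
  show "(\<lambda>\<phi>. \<phi>) \<in> lin_maps K (Hom_Mod K E.TC (P n) IB) (Hom_Mod K E.TC (P n) CC)" for n
   by (rule lin_mapsI) (simp_all add: submod_Hom_Mod E.T.Hom_Mod_simps(1) IB_nat_trans)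
  show "nt_comp E.TC (P (Suc n)) x (d n) = nt_comp E.TC (P (Suc n)) x (d n)" for x n ..
  show "nt_comp E.TC (P n) pq \<in> lin_maps K (Hom_Mod K E.TC (P n) CC) (Hom_Mod K E.TC (P n) (resb BB))" for n
   by (rule E.T.postcomp_lin[OF P.P C rB pq_hom])
  show "nt_comp E.TC (P (Suc n)) pq (nt_comp E.TC (P (Suc n)) x (d n)) = nt_comp E.TC (P (Suc n)) (nt_comp E.TC (P n) pq x) (d n)" for x n
   unfolding E.T.nt_comp_ext by (rule E.T.ext_hom_cong) (simp add: ext_hom_apply hom_closed[OF P.d])
  show "x = 0[Hom_Mod K E.TC (P n) IB]" if "x = 0[Hom_Mod K E.TC (P n) CC]" for x n
   using that by (simp add: submod_Hom_Mod)
  show "\<exists>y\<in>carrier (Hom_Mod K E.TC (P n) CC). nt_comp E.TC (P n) pq y = z" if "z \<in> carrier (Hom_Mod K E.TC (P n) (resb BB))" for z n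
  proof -
   have z: "z \<in> nat_trans K E.TC (P n) (resb BB)" using that by (simp add: E.T.Hom_Mod_simps(1))
   \<comment> \<open>Surjectivity on the right is where projectivity of \<open>P n\<close>
     enters.\<close>
   have "epi E.TC CC (resb BB) pq" by (rule epiI[OF pq_hom]) (use BB_carrier in auto)
   then obtain y where y: "mod_hom K E.TC (P n) CC y" "\<And>Z x. Z \<in> Obj E.TC ==> x \<in> El (P n) Z ==> pq Z (y Z x) = z Z x"
    by (rule liftsD[OF E.T.projective_lifts[OF pr C rB pq_hom] nat_trans_hom[OF z]]) (rule that)
   have yn: "ext_hom E.TC (P n) y \<in> nat_trans K E.TC (P n) CC" by (rule E.T.ext_hom_nat_trans[OF P.P y(1)])
   have "nt_comp E.TC (P n) pq (ext_hom E.TC (P n) y) = z"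
    by (rule nat_trans_eqI[OF E.T.nt_comp_nat_trans[OF P.P nat_trans_hom[OF yn] pq_hom] z]) (simp add: E.T.nt_comp_apply ext_hom_apply y(2))
   then show ?thesis using yn by (auto simp: E.T.Hom_Mod_simps(1))
  qed
  have z: "nt_comp E.TC (P n) pq x = 0[Hom_Mod K E.TC (P n) (resb BB)] \<longleftrightarrow> x \<in> nat_trans K E.TC (P n) IB"
   if x: "x \<in> nat_trans K E.TC (P n) CC" for x n
  proof -
   have e: "pq Z (x Z p) = 0[On BB Z] \<longleftrightarrow> x Z p \<in> IZ Z" if Z: "Z \<in> Obj E.TC" and p: "p \<in> El (P n) Z" for Z p
    using q_zero_iff[OF E_objD[OF Z], of "x Z p"] hom_closed[OF nat_trans_hom[OF x] Z p] by simp
   have "nt_comp E.TC (P n) pq x = 0[Hom_Mod K E.TC (P n) (resb BB)] \<longleftrightarrow> (\<forall>Z\<in>Obj E.TC. \<forall>p\<in>El (P n) Z. pq Z (x Z p) = 0[On BB Z])"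
    unfolding E.T.Hom_Mod_simps(2) E.T.nt_comp_ext resb_On
   proof
    assume eq: "ext_hom E.TC (P n) (\<lambda>Z p. pq Z (x Z p)) = ext_hom E.TC (P n) (\<lambda>Z p. 0[On BB Z])"
    show "\<forall>Z\<in>Obj E.TC. \<forall>p\<in>El (P n) Z. pq Z (x Z p) = 0[On BB Z]"
    proof (intro ballI)
     fix Z p assume Z: "Z \<in> Obj E.TC" and p: "p \<in> El (P n) Z"
     show "pq Z (x Z p) = 0[On BB Z]" using fun_cong[OF fun_cong[OF eq], of Z p] unfolding ext_hom_apply[OF Z p] .
    qed
   next
    assume "\<forall>Z\<in>Obj E.TC. \<forall>p\<in>El (P n) Z. pq Z (x Z p) = 0[On BB Z]"
    then show "ext_hom E.TC (P n) (\<lambda>Z p. pq Z (x Z p)) = ext_hom E.TC (P n) (\<lambda>Z p. 0[On BB Z])"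
     by (intro E.T.ext_hom_cong) blast
   qed
   then show ?thesis using e x unfolding IB_nat_trans by blast
  qed
  show "nt_comp E.TC (P n) pq x = 0[Hom_Mod K E.TC (P n) (resb BB)]" if "x \<in> carrier (Hom_Mod K E.TC (P n) IB)" for x n
   using that z[of x n] by (simp add: E.T.Hom_Mod_simps(1) IB_nat_trans)
  show "\<exists>x\<in>carrier (Hom_Mod K E.TC (P n) IB). x = y"
   if "y \<in> carrier (Hom_Mod K E.TC (P n) CC)" "nt_comp E.TC (P n) pq y = 0[Hom_Mod K E.TC (P n) (resb BB)]" for y n
   using that z[of y n] by (simp add: E.T.Hom_Mod_simps(1))
 qed
qed

text \<open>The long exact sequence of \<open>bimod_short_exact\<close> with two adjustments:
  cohomology of \<open>Hom(P, B)\<close> is replaced by \<open>H^n(B)\<close>, and its first term,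
  degree-zero cohomology with values in \<open>I\<close>, by the space of homomorphisms from
  \<open>C\<close> to \<open>I\<close>.\<close>

lemma hochschild_sequence:
 assumes fK: "field K" and idem: "idempotent_ideal C I" and pI: "\<And>X. X \<in> Obj C ==> projective K C (ideal_at C I X)"
 obtains \<iota> \<alpha> \<beta> \<delta> where
  "\<iota> \<in> lin_maps K (Hom_Mod K E.TC CC IB) (Ext K E.TC 0 CC CC)"
  "\<And>n. \<alpha> n \<in> lin_maps K (Ext K E.TC (Suc n) CC IB) (Ext K E.TC (Suc n) CC CC)"
  "\<And>n. \<beta> n \<in> lin_maps K (Ext K E.TC n CC CC) (Ext K EB.TC n BB BB)"
  "\<And>n. \<delta> n \<in> lin_maps K (Ext K EB.TC n BB BB) (Ext K E.TC (Suc n) CC IB)"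
  "inj_on \<iota> (carrier (Hom_Mod K E.TC CC IB))"
  "exact_at (Hom_Mod K E.TC CC IB) \<iota> (Ext K E.TC 0 CC CC) (\<beta> 0) (Ext K EB.TC 0 BB BB)"
  "\<And>n. exact_at (Ext K E.TC n CC CC) (\<beta> n) (Ext K EB.TC n BB BB) (\<delta> n) (Ext K E.TC (Suc n) CC IB)"
  "\<And>n. exact_at (Ext K EB.TC n BB BB) (\<delta> n) (Ext K E.TC (Suc n) CC IB) (\<alpha> n) (Ext K E.TC (Suc n) CC CC)"
  "\<And>n. exact_at (Ext K E.TC (Suc n) CC IB) (\<alpha> n) (Ext K E.TC (Suc n) CC CC) (\<beta> (Suc n)) (Ext K EB.TC (Suc n) BB BB)"
proof -
 obtain P d \<epsilon> where P: "chosen_resolution K E.TC CC = (P, d, \<epsilon>)" by (metis prod_cases3)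
 obtain R dR \<epsilon>R where R: "chosen_resolution K EB.TC BB = (R, dR, \<epsilon>R)" by (metis prod_cases3)
 note Cm = hom_bimod_c_module(1) and Bm = B.hom_bimod_c_module(1)
 note PR = E.T.proj_resolution_resolution[OF Cm E.T.chosen_resolution[OF Cm P]]
  and RR = EB.T.proj_resolution_resolution[OF Bm EB.T.chosen_resolution[OF Bm R]]
 interpret P: resolution K E.TC CC P d \<epsilon> by (rule PR(1))
 interpret R: resolution K EB.TC BB R dR \<epsilon>R by (rule RR(1))
 let ?Q = "\<lambda>n. toB (biq (P n))"
 obtain D e where De: "resolution K EB.TC BB ?Q D e"
  "\<And>n Z x. Z \<in> Obj E.TC ==> x \<in> El (P (Suc n)) Z ==> D n Z (bip (P (Suc n)) Z x) = bip (P n) Z (d n Z x)"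
  by (rule B_resolution[OF fK idem pI PR]) (assumption | rule that)+
 have pQ: "projective K EB.TC (?Q n)" for n by (rule biq_projective[OF PR(2)])
 obtain \<tau> where \<tau>: "\<And>n. mod_hom K EB.TC (?Q n) (R n) (\<tau> n)"
  "\<And>X x. X \<in> Obj EB.TC ==> x \<in> El (?Q 0) X ==> \<epsilon>R X (\<tau> 0 X x) = e X x"
  "\<And>n X x. X \<in> Obj EB.TC ==> x \<in> El (?Q (Suc n)) X ==> dR n X (\<tau> (Suc n) X x) = \<tau> n X (D n X x)"
  by (rule EB.T.chain_lift_exists[OF De(1) pQ RR(1) hom_id]) (rule that)
 let ?A = "E.T.hom_cx P IB" and ?B = "E.T.hom_cx P CC" and ?C = "E.T.hom_cx P (resb BB)" and ?d = "E.T.hom_d P d"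
 let ?HQ = "\<lambda>n. H_mod (EB.T.hom_cx ?Q BB) (EB.T.hom_d ?Q D) n" and ?HB = "\<lambda>n. H_mod (EB.T.hom_cx R BB) (EB.T.hom_d R dR) n"
 have HB: "Ext K EB.TC n BB BB = ?HB n" for n by (simp add: Ext_def R EB.T.cohomology_H_mod)
 have HC: "Ext K E.TC n CC CC = H_mod ?B ?d n" "Ext K E.TC n CC IB = H_mod ?A ?d n" for n by (simp_all add: Ext_def P E.T.cohomology_H_mod)
 \<comment> \<open>From the chosen resolution \<open>R\<close> over \<open>B^e\<close> to the
   reduced resolution; \<open>h2\<close> then goes from the reduced resolution to
   \<open>Hom(P, B)\<close> over \<open>C^e\<close>.\<close>
 define h1 where "h1 n = H_map (EB.T.hom_cx ?Q BB) (EB.T.hom_d ?Q D) n (\<lambda>\<phi>. nt_comp EB.TC (?Q n) \<phi> (\<tau> n))" for n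
 have h1: "h1 n \<in> lin_isos K (?HB n) (?HQ n)" for n
  unfolding h1_def
  by (rule EB.T.projective_comparison[where Q = ?Q and dQ = D and \<epsilon>Q = e and P = R and dP = dR and \<epsilon>P = \<epsilon>R and \<tau> = \<tau>,
     OF Bm De(1) pQ RR(1) RR(2) \<tau>])
 define h2 where "h2 n = H_map ?C ?d n (\<lambda>\<phi>. nt_comp E.TC (P n) \<phi> (bip (P n)))" for n
 have h2: "h2 n \<in> lin_isos K (?HQ n) (H_mod ?C ?d n)" for n
  unfolding h2_def by (rule toB_complex_iso[OF PR(1) Bm De])
 define h where "h n = (\<lambda>x. h2 n (h1 n x))" for n
 have h: "h n \<in> lin_isos K (?HB n) (H_mod ?C ?d n)" for n unfolding h_def by (rule lin_isos_comp[OF h1 h2])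
 interpret S: short_exact K ?A ?d ?B ?d ?C ?d "\<lambda>n \<phi>. \<phi>" "\<lambda>n. nt_comp E.TC (P n) pq" by (rule bimod_short_exact[OF PR])
 interpret RX: cocomplex K "EB.T.hom_cx R BB" "EB.T.hom_d R dR" by (rule EB.T.hom_cocomplex[where P = R and d = dR, OF R.P R.d R.d_d Bm])
 let ?i = "\<lambda>\<eta>. nt_comp E.TC (P 0) \<eta> \<epsilon>"
 let ?\<iota> = "\<lambda>\<eta>. S.F.B.cls 0 (?i \<eta>)"
 note il = E.T.precomp_lin[OF P.P Cm Cm P.eps]
 have ec: "Z \<in> Obj E.TC ==> x \<in> El (P 0) Z ==> \<epsilon> Z x \<in> El CC Z" for Z x by (rule hom_closed[OF P.eps])
 have I0: "\<eta> \<in> carrier (Hom_Mod K E.TC CC CC)" if "\<eta> \<in> carrier (Hom_Mod K E.TC CC IB)" for \<eta>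
  using that by (simp add: E.T.Hom_Mod_simps(1) IB_nat_trans)
 \<comment> \<open>Left exactness of Hom: a map on \<open>P 0\<close> killed by the differential
   vanishes on the kernel of \<open>\<epsilon>\<close>, hence factors through
   \<open>C\<close>.\<close>
 have cA: "\<phi> \<in> cocyc ?A ?d 0 \<longleftrightarrow> \<phi> \<in> ?i ` carrier (Hom_Mod K E.TC CC IB)" for \<phi>
 proof
  assume "\<phi> \<in> ?i ` carrier (Hom_Mod K E.TC CC IB)"
  then obtain \<eta> where e: "\<eta> \<in> nat_trans K E.TC CC IB" "\<phi> = ?i \<eta>" by (auto simp: E.T.Hom_Mod_simps(1))
  note eh = nat_trans_hom[OF e(1)]
  have "?i \<eta> \<in> nat_trans K E.TC (P 0) IB" by (rule E.T.nt_comp_nat_trans[OF P.P P.eps eh])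
  moreover have "?i \<eta> Z (d 0 Z x) = 0[On IB Z]" if "Z \<in> Obj E.TC" "x \<in> El (P (Suc 0)) Z" for Z x
   using hom_zero[OF eh Cm IB_c_module that(1)] by (simp only: E.T.nt_comp_apply[OF that(1) hom_closed[OF P.d that]] P.eps_d[OF that])
  ultimately show "\<phi> \<in> cocyc ?A ?d 0" unfolding e(2) E.T.cocyc_iff[where P = P and d = d, OF P.P IB_c_module P.d] by blast
 next
  assume "\<phi> \<in> cocyc ?A ?d 0"
  then have p: "\<phi> \<in> nat_trans K E.TC (P 0) IB" "\<And>Z x. Z \<in> Obj E.TC ==> x \<in> El (P (Suc 0)) Z ==> \<phi> Z (d 0 Z x) = 0[On IB Z]"
   unfolding E.T.cocyc_iff[where P = P and d = d, OF P.P IB_c_module P.d] by blast+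
  have "epi E.TC (P 0) CC \<epsilon>" by (rule epiI[OF P.eps P.eps_onto])
  moreover have "\<phi> Z x = 0[On IB Z]" if "Z \<in> Obj E.TC" "x \<in> El (P 0) Z" "\<epsilon> Z x = 0[On CC Z]" for Z x
   using P.exact0[OF that] p(2)[OF that(1)] by blast
  ultimately obtain \<eta> where e: "mod_hom K E.TC CC IB \<eta>" "\<And>Z x. Z \<in> Obj E.TC ==> x \<in> El (P 0) Z ==> \<eta> Z (\<epsilon> Z x) = \<phi> Z x"
   by (rule E.T.hom_factor_epi[OF P.P Cm IB_c_module P.eps _ nat_trans_hom[OF p(1)]]) (assumption | rule that)+
  have en: "ext_hom E.TC CC \<eta> \<in> nat_trans K E.TC CC IB" by (rule E.T.ext_hom_nat_trans[OF Cm e(1)])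
  have "?i (ext_hom E.TC CC \<eta>) = \<phi>"
   by (rule nat_trans_eqI[OF E.T.nt_comp_nat_trans[OF P.P P.eps nat_trans_hom[OF en]] p(1)])
    (simp only: E.T.nt_comp_apply ext_hom_apply[OF _ ec] e(2))
  then show "\<phi> \<in> ?i ` carrier (Hom_Mod K E.TC CC IB)" using en unfolding E.T.Hom_Mod_simps(1) by blast
 qed
 have ic: "?i \<eta> \<in> cocyc ?A ?d 0" if "\<eta> \<in> carrier (Hom_Mod K E.TC CC IB)" for \<eta> using cA that by blast
 note iB = S.F.f_cocyc[OF ic]
 have \<iota>_lin: "?\<iota> \<in> lin_maps K (Hom_Mod K E.TC CC IB) (H_mod ?B ?d 0)"
 proof (rule lin_mapsI)
  fix x assume x: "x \<in> carrier (Hom_Mod K E.TC CC IB)"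
  show "?\<iota> x \<in> carrier (H_mod ?B ?d 0)" unfolding S.F.B.H_carrier using iB[OF x] by blast
  show "?\<iota> (x +[Hom_Mod K E.TC CC IB] y) = ?\<iota> x +[H_mod ?B ?d 0] ?\<iota> y" if y: "y \<in> carrier (Hom_Mod K E.TC CC IB)" for y
   unfolding submod_Hom_Mod lin_add[OF il I0[OF x] I0[OF y]] by (rule S.F.B.cls_add[OF iB[OF x] iB[OF y], symmetric])
  show "?\<iota> (a *[Hom_Mod K E.TC CC IB] x) = a *[H_mod ?B ?d 0] ?\<iota> x" if a: "a \<in> carrier K" for a
   unfolding submod_Hom_Mod lin_smult[OF il a I0[OF x]] by (rule S.F.B.cls_smult[OF a iB[OF x], symmetric])
 qed
 \<comment> \<open>The only coboundary in degree 0 is zero, so equal classes mean equal maps on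
   \<open>P 0\<close>, and \<open>\<epsilon>\<close> is an epimorphism.\<close>
 have \<iota>_inj: "inj_on ?\<iota> (carrier (Hom_Mod K E.TC CC IB))"
 proof (rule inj_onI)
  fix x y assume x: "x \<in> carrier (Hom_Mod K E.TC CC IB)" and y: "y \<in> carrier (Hom_Mod K E.TC CC IB)" and eq: "?\<iota> x = ?\<iota> y"
  interpret B0: kmod K "?B 0" by (rule S.F.B.kmod)
  have "?i x -[?B 0] ?i y \<in> cobd ?B ?d 0" using eq S.F.B.cls_eq_iff[OF iB[OF x] iB[OF y]] by blast
  then have "?i x -[?B 0] ?i y = 0[?B 0]" by (simp add: cobd_def)
  then have ee: "?i x = ?i y"
   using B0.minus_eq_zero_iff[OF S.F.B.cocyc_carrier[OF iB[OF x]] S.F.B.cocyc_carrier[OF iB[OF y]]] by blast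
  have xn: "x \<in> nat_trans K E.TC CC IB" and yn: "y \<in> nat_trans K E.TC CC IB" using x y by (simp_all add: E.T.Hom_Mod_simps(1))
  show "x = y"
  proof (rule nat_trans_eqI[OF xn yn])
   fix Z c assume Z: "Z \<in> Obj E.TC" and c: "c \<in> El CC Z"
   obtain p where p: "p \<in> El (P 0) Z" "\<epsilon> Z p = c" using P.eps_onto[OF Z c] by blast
   show "x Z c = y Z c" using fun_cong[OF fun_cong[OF ee], of Z p] unfolding E.T.nt_comp_apply[OF Z p(1)] p(2) .
  qed
 qed
 \<comment> \<open>The image of \<open>\<iota>\<close> is that of degree-zero cohomology with values
   in \<open>I\<close>. Exactness at \<open>H^0(C)\<close> is therefore the degree-zero case of
   \<open>exact_middle\<close>.\<close>
 have \<iota>_im: "?\<iota> ` carrier (Hom_Mod K E.TC CC IB) = S.F.f_star 0 ` carrier (H_mod ?A ?d 0)"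
 proof -
  have "S.F.f_star 0 ` carrier (H_mod ?A ?d 0) = (\<lambda>x. S.F.B.cls 0 x) ` cocyc ?A ?d 0"
   unfolding S.F.A.H_carrier image_image by (rule image_cong[OF refl S.F.H_map_cls])
  also have "cocyc ?A ?d 0 = ?i ` carrier (Hom_Mod K E.TC CC IB)" using cA by blast
  finally show ?thesis unfolding image_image by simp
 qed
 have ex0: "exact_at (Hom_Mod K E.TC CC IB) ?\<iota> (H_mod ?B ?d 0) (S.G.f_star 0) (H_mod ?C ?d 0)"
  using S.exact_middle[of 0] unfolding exact_at_iff \<iota>_im .
 note tr = exact_transport[OF h RX.H_module S.G.B.H_module S.G.H_map_lin]
 show thesis
 \<comment> \<open>\<open>\<alpha>\<close> is induced by the inclusion of \<open>I\<close>;
   \<open>\<beta>\<close> is the map induced by the projection followed by the inverse of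
   \<open>h\<close>; \<open>\<delta>\<close> is the connecting map after \<open>h\<close>. The index
   shift in \<open>\<alpha>\<close> leaves degree 0 to \<open>\<iota>\<close>.\<close>
 proof (rule that[of ?\<iota> "\<lambda>n. S.F.f_star (Suc n)" "\<lambda>n x. inv_into (carrier (?HB n)) (h n) (S.G.f_star n x)" "\<lambda>n x. S.conn n (h n x)"], unfold HB HC)
  show "?\<iota> \<in> lin_maps K (Hom_Mod K E.TC CC IB) (H_mod ?B ?d 0)" by (rule \<iota>_lin)
  show "S.F.f_star (Suc n) \<in> lin_maps K (H_mod ?A ?d (Suc n)) (H_mod ?B ?d (Suc n))" for n by (rule S.F.H_map_lin)
  show "(\<lambda>x. inv_into (carrier (?HB n)) (h n) (S.G.f_star n x)) \<in> lin_maps K (H_mod ?B ?d n) (?HB n)" for n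
   by (rule lin_comp[OF S.G.H_map_lin lin_isos_D(1)[OF lin_isos_inv[OF h RX.H_module]]])
  show "(\<lambda>x. S.conn n (h n x)) \<in> lin_maps K (?HB n) (H_mod ?A ?d (Suc n))" for n
   by (rule lin_comp[OF lin_isos_D(1)[OF h] S.conn_lin])
  show "inj_on ?\<iota> (carrier (Hom_Mod K E.TC CC IB))" by (rule \<iota>_inj)
  show "exact_at (Hom_Mod K E.TC CC IB) ?\<iota> (H_mod ?B ?d 0) (\<lambda>x. inv_into (carrier (?HB 0)) (h 0) (S.G.f_star 0 x)) (?HB 0)"
   by (rule tr(1)[OF ex0])
  show "exact_at (H_mod ?B ?d n) (\<lambda>x. inv_into (carrier (?HB n)) (h n) (S.G.f_star n x)) (?HB n) (\<lambda>x. S.conn n (h n x)) (H_mod ?A ?d (Suc n))" for n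
   by (rule tr(2)[OF S.exact_right])
  show "exact_at (?HB n) (\<lambda>x. S.conn n (h n x)) (H_mod ?A ?d (Suc n)) (S.F.f_star (Suc n)) (H_mod ?B ?d (Suc n))" for n
   by (rule tr(3)[OF S.exact_left])
  show "exact_at (H_mod ?A ?d (Suc n)) (S.F.f_star (Suc n)) (H_mod ?B ?d (Suc n)) (\<lambda>x. inv_into (carrier (?HB (Suc n))) (h (Suc n)) (S.G.f_star (Suc n) x)) (?HB (Suc n))" for n
   by (rule tr(1)[OF S.exact_middle])
 qed
qed

end

lemma ideal_bimod_eq: "ideal_bimod K C I = submod (hom_bimod K C) (\<lambda>Z. I (fst Z) (snd Z))"
 by (simp add: ideal_bimod_def case_prod_unfold)

theorem theorem4p7:
  fixes K :: "'k ring"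
    and C :: "('k, 'o, 'm) kcat"
    and I :: "'o \<Rightarrow> 'o \<Rightarrow> 'm set"
  assumes "field K"
    and "k_category K C"
    and "two_sided_ideal K C I"
    and "idempotent_ideal C I"
    and "\<forall>X\<in>Obj C. projective K C (ideal_at C I X)"
  shows "projection_homological_epi TYPE('v) TYPE('w) K C I \<and>
    (let E = (\<lambda>n. Ext K (env_cat K C) n (hom_bimod K C) (ideal_bimod K C I));
         E0 = Hom_Mod K (env_cat K C) (hom_bimod K C) (ideal_bimod K C I);
         HC = Hochschild_Mitchell K C;
         HB = Hochschild_Mitchell K (quot_cat C I)
     in \<exists>\<iota> \<alpha> \<beta> \<delta>.
          \<iota> \<in> lin_maps K E0 (HC 0) \<and>
          (\<forall>n. \<alpha> n \<in> lin_maps K (E (Suc n)) (HC (Suc n))) \<and>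
          (\<forall>n. \<beta> n \<in> lin_maps K (HC n) (HB n)) \<and>
          (\<forall>n. \<delta> n \<in> lin_maps K (HB n) (E (Suc n))) \<and>
          inj_on \<iota> (carrier E0) \<and>
          exact_at E0 \<iota> (HC 0) (\<beta> 0) (HB 0) \<and>
          (\<forall>n. exact_at (HC n) (\<beta> n) (HB n) (\<delta> n) (E (Suc n))) \<and>
          (\<forall>n. exact_at (HB n) (\<delta> n) (E (Suc n)) (\<alpha> n) (HC (Suc n))) \<and>
          (\<forall>n. exact_at (E (Suc n)) (\<alpha> n) (HC (Suc n)) (\<beta> (Suc n)) (HB (Suc n))))"
proof -
 interpret K: field K by fact
 have "cring K" ..
 with assms(2,3) interpret ideal_kcat K C I by (intro ideal_kcat.intro kcat.intro)
 have pI: "projective K C (ideal_at C I X)" if "X \<in> Obj C" for X using assms(5) that by blast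
 have env: "env_cat K C = E.TC" "env_cat K B = EB.TC" by (simp_all add: env_cat_def)
 have "projection_homological_epi TYPE('v) TYPE('w) K C I"
  unfolding projection_homological_epi_def strongly_idempotent_def
  by (intro allI impI) (rule ext_canonical_map_iso[OF assms(4) pI])
 moreover obtain \<iota> \<alpha> \<beta> \<delta> where "\<iota> \<in> lin_maps K (Hom_Mod K E.TC CC IB) (Ext K E.TC 0 CC CC)"
  "\<And>n. \<alpha> n \<in> lin_maps K (Ext K E.TC (Suc n) CC IB) (Ext K E.TC (Suc n) CC CC)"
  "\<And>n. \<beta> n \<in> lin_maps K (Ext K E.TC n CC CC) (Ext K EB.TC n BB BB)"
  "\<And>n. \<delta> n \<in> lin_maps K (Ext K EB.TC n BB BB) (Ext K E.TC (Suc n) CC IB)"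
  "inj_on \<iota> (carrier (Hom_Mod K E.TC CC IB))"
  "exact_at (Hom_Mod K E.TC CC IB) \<iota> (Ext K E.TC 0 CC CC) (\<beta> 0) (Ext K EB.TC 0 BB BB)"
  "\<And>n. exact_at (Ext K E.TC n CC CC) (\<beta> n) (Ext K EB.TC n BB BB) (\<delta> n) (Ext K E.TC (Suc n) CC IB)"
  "\<And>n. exact_at (Ext K EB.TC n BB BB) (\<delta> n) (Ext K E.TC (Suc n) CC IB) (\<alpha> n) (Ext K E.TC (Suc n) CC CC)"
  "\<And>n. exact_at (Ext K E.TC (Suc n) CC IB) (\<alpha> n) (Ext K E.TC (Suc n) CC CC) (\<beta> (Suc n)) (Ext K EB.TC (Suc n) BB BB)"
  by (rule hochschild_sequence[OF assms(1,4) pI]) (assumption | rule that)+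
 ultimately show ?thesis
  unfolding Let_def Hochschild_Mitchell_def env ideal_bimod_eq
  by (intro conjI exI[of _ \<iota>] exI[of _ \<alpha>] exI[of _ \<beta>] exI[of _ \<delta>] allI)
qed

end
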